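(* The following assignments define a functor $\mathsf{Dualn}:\mathrm{BAlg}\to\mathrm{ADA}_{\mathscr{J}}$ (valued in the underlying category of the 2-category $\mathrm{ADA}_{\mathscr{J}}$): each bifold algebra $(\mathscr{T},\mathscr{U},D)$ is sent to its dualization adjunction $$\mathsf{Dualn}(\mathscr{T},\mathscr{U},D)=(\mathscr{T}\text{-}\mathrm{Alg},\mathscr{U}\text{-}\mathrm{Alg},\mathrm{Hom}_{\mathscr{U}}(-,D)\dashv\mathrm{Hom}_{\mathscr{T}}(-,D)),$$ and each morphism $(M,g):(\mathscr{T}_1,\mathscr{U}_1,D_1)\to(\mathscr{T}_2,\mathscr{U}_2,D_2)$ in $\mathrm{BAlg}$ is sent to the 1-cell $$\mathsf{Dualn}(M,g)=(M_\ell^*,1,M_r^*,1,\phi^{(M,g)}),$$ where $\phi^{(M,g)}:M_r^*\,\mathrm{Hom}_{\mathscr{T}_1}(-,D_1)\Rightarrow\mathrm{Hom}_{\mathscr{T}_2}(-,D_2)\,(M_\ell^* )^{\mathrm{op}}$ is the $\mathscr{V}$-natural transformation whose component at $A\in\mathscr{T}_1\text{-}\mathrm{Alg}$ is the $\mathscr{U}_2$-homomorphism with components ($K\in\mathrm{ob}\,\mathscr{U}_2$) $$\mathscr{T}_1\text{-}\mathrm{Alg}(A,D_1(-,M_rK))\xrightarrow{M_\ell^*}\mathscr{T}_2\text{-}\mathrm{Alg}(AM_\ell,D_1(M_\ell-,M_rK))\xrightarrow{\mathscr{T}_2\text{-}\mathrm{Alg}(AM_\ell,\,g_{-,K})}\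mathscr{T}_2\text{-}\mathrm{Alg}(AM_\ell,D_2(-,K)).$$
   Context: Setting. $\mathscr{V}=(\mathscr{V},\otimes,I)$ is a symmetric monoidal closed category whose underlying ordinary category has finite limits; $\mathscr{V}$-categories may be large. $\mathscr{J}\hookrightarrow\mathscr{V}$ is a system of arities, i.e. a full sub-$\mathscr{V}$-category closed under $\otimes$ and containing $I$. $\mathscr{J}$-powers in a $\mathscr{V}$-category are powers (cotensors) by objects $J\in\mathscr{J}$. A $\mathscr{J}$-theory is a $\mathscr{V}$-category $\mathscr{T}$ with $\mathrm{ob}\,\mathscr{T}=\mathrm{ob}\,\mathscr{J}$, equipped with an identity-on-objects $\mathscr{V}$-functor $\mathscr{J}^{\mathrm{op}}\to\mathscr{T}$ that preserves $\mathscr{J}$-powers; morphisms of $\mathscr{J}$-theories are $\mathscr{V}$-functors commuting with these structure functors. A $\mathscr{T}$-algebra is a $\mathscr{V}$-functor $\mathscr{T}\to\mathscr{V}$ that preserves $\mathscr{J}$-powers; $\mathscr{T}\text{-}\mathrm{Alg}$ is the full subcategory of $[\mathscr{T},\mathscr{V}]$ on these, and $G^{\mathscr{T}}:\mathscr{T}\text{-}\mathrm{Alg}\to\mathscr{V}$ is evaluation at $I$. Throughout, $\mathscr{J}$ is amenable: for every $\mathscr{J}$-theory $\mathscr{T}$, $\mathscr{T}\text{-}\mathrm{Alg}$ exists as a $\mathscr{V}$-category and $G^{\mathscr{T}}$ has a left adjoint. For a morphism $M:\mathscr{T}\to\mathscr{U}$, $M^*:\mathscr{U}\text{-}\mathrm{Alg}\to\mathscr{T}\text{-}\mathrm{Alg}$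 is $M^*A=AM$ (so $G^{\mathscr{T}}M^*=G^{\mathscr{U}}$). Bifold algebras and dualization. A $(\mathscr{T},\mathscr{U})$-algebra is a $\mathscr{V}$-functor $D:\mathscr{T}\otimes\mathscr{U}\to\mathscr{V}$ that preserves $\mathscr{J}$-powers in each variable separately; a bifold algebra is a triple $(\mathscr{T},\mathscr{U},D)$ with $\mathscr{T},\mathscr{U}$ $\mathscr{J}$-theories and $D$ a $(\mathscr{T},\mathscr{U})$-algebra. $\mathrm{Hom}_{\mathscr{T}}(-,D):\mathscr{T}\text{-}\mathrm{Alg}^{\mathrm{op}}\to\mathscr{U}\text{-}\mathrm{Alg}$ is given by $(\mathrm{Hom}_{\mathscr{T}}(A,D))K=\mathscr{T}\text{-}\mathrm{Alg}(A,D(-,K))$ and $\mathrm{Hom}_{\mathscr{U}}(-,D):\mathscr{U}\text{-}\mathrm{Alg}\to\mathscr{T}\text{-}\mathrm{Alg}^{\mathrm{op}}$ by $(\mathrm{Hom}_{\mathscr{U}}(B,D))J=\mathscr{U}\text{-}\mathrm{Alg}(B,D(J,-))$. The dualization adjunction $\mathrm{Hom}_{\mathscr{U}}(-,D)\dashv\mathrm{Hom}_{\mathscr{T}}(-,D)$ is given by the canonical isomorphisms $\mathscr{T}\text{-}\mathrm{Alg}(A,\mathrm{Hom}_{\mathscr{U}}(B,D))\cong\mathscr{U}\text{-}\mathrm{Alg}(B,\mathrm{Hom}_{\mathscr{T}}(A,D))$ (both sides are canonically the end $\int_{J,K}\mathscr{V}(AJ\otimes BK,D(J,K))$). The category $\mathrm{BAlg}$.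 Objects are bifold algebras; a morphism $(M,g):(\mathscr{T}_1,\mathscr{U}_1,D_1)\to(\mathscr{T}_2,\mathscr{U}_2,D_2)$ consists of morphisms of $\mathscr{J}$-theories $M=(M_\ell:\mathscr{T}_2\to\mathscr{T}_1,\ M_r:\mathscr{U}_2\to\mathscr{U}_1)$ and a $\mathscr{V}$-natural transformation $g:M^*D_1:=D_1(M_\ell-,M_r?)\Rightarrow D_2$; composition is $(N,h)\cdot(M,g)=(MN,h\cdot N^*g)$. $\mathscr{J}$-algebraic $\mathscr{V}$-categories. In the pseudo-slice 2-category $\mathscr{V}\text{-}\mathrm{CAT}/\!/\mathscr{V}$, objects are pairs $(\mathscr{A},G)$ with $G:\mathscr{A}\to\mathscr{V}$ a $\mathscr{V}$-functor; 1-cells $(P,\gamma):(\mathscr{A},G)\to(\mathscr{B},H)$ consist of a $\mathscr{V}$-functor $P:\mathscr{A}\to\mathscr{B}$ and an invertible $\mathscr{V}$-natural $\gamma:HP\Rightarrow G$; 2-cells $\alpha:(P,\gamma)\Rightarrow(P',\gamma')$ are $\mathscr{V}$-natural $\alpha:P\Rightarrow P'$ with $\gamma'\cdot(H\alpha)=\gamma$. $(\mathscr{A},G)$ is $\mathscr{J}$-algebraic if it is equivalent in $\mathscr{V}\text{-}\mathrm{CAT}/\!/\mathscr{V}$ to $(\mathscr{T}\text{-}\mathrm{Alg},G^{\mathscr{T}})$ for some $\mathscr{J}$-theory $\mathscr{T}$. $\mathrm{ALGCAT}_{\mathscr{J}}$ is the full sub-2-category on the $\mathscr{J}$-algebraic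 objects. The 2-category $\mathrm{ADA}_{\mathscr{J}}$. Its objects are $\mathscr{J}$-algebraic dual adjunctions, i.e. triples $(\mathscr{A},\mathscr{B},\nabla\dashv\Delta)$ with $\mathscr{A},\mathscr{B}$ $\mathscr{J}$-algebraic $\mathscr{V}$-categories over $\mathscr{V}$ and $\nabla\dashv\Delta:\mathscr{A}^{\mathrm{op}}\to\mathscr{B}$ a $\mathscr{V}$-adjunction. A 1-cell $P=(P_\ell,\lambda^P,P_r,\rho^P,\phi^P):(\mathscr{A}_1,\mathscr{B}_1,\nabla_1\dashv\Delta_1)\to(\mathscr{A}_2,\mathscr{B}_2,\nabla_2\dashv\Delta_2)$ consists of 1-cells $(P_\ell,\lambda^P):\mathscr{A}_1\to\mathscr{A}_2$ and $(P_r,\rho^P):\mathscr{B}_1\to\mathscr{B}_2$ in $\mathrm{ALGCAT}_{\mathscr{J}}$ and a $\mathscr{V}$-natural transformation $\phi^P:P_r\Delta_1\Rightarrow\Delta_2P_\ell^{\mathrm{op}}$. A 2-cell $P\Rightarrow Q$ is a pair $(\gamma_\ell,\gamma_r)$ of 2-cells $\gamma_\ell:(Q_\ell,\lambda^Q)\Rightarrow(P_\ell,\lambda^P)$ and $\gamma_r:(P_r,\rho^P)\Rightarrow(Q_r,\rho^Q)$ in $\mathrm{ALGCAT}_{\mathscr{J}}$ with $(\Delta_2\gamma_\ell^{\mathrm{op}})\cdot\phi^P=\phi^Q\cdot(\gamma_r\Delta_1)$. Composition is componentwise and by pasting. *)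

theory Defs
  imports Main "HOL-Library.FuncSet"
begin

section \<open>Ordinary categories and finite limits\<close>

text \<open>Composition is written in applicative order: \<open>Cmp C g f\<close> is ``\<open>g\<close> after \<open>f\<close>''.\<close>

record ('o, 'm) cat =
  Ob :: "'o set"
  Arr :: "'m set"
  Dom :: "'m \<Rightarrow> 'o"
  Cod :: "'m \<Rightarrow> 'o"
  Idt :: "'o \<Rightarrow> 'm"
  Cmp :: "'m \<Rightarrow> 'm \<Rightarrow> 'm"

definition Homset :: "('o, 'm) cat \<Rightarrow> 'o \<Rightarrow> 'o \<Rightarrow> 'm set" where
  "Homset C a b = {f \<in> Arr C. Dom C f = a \<and> Cod C f = b}"

locale category =
  fixes C :: "('o, 'm) cat"
  assumes dom_ob: "f \<in> Arr C \<Longrightarrow> Dom C f \<in> Ob C"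
    and cod_ob: "f \<in> Arr C \<Longrightarrow> Cod C f \<in> Ob C"
    and idt_hom: "a \<in> Ob C \<Longrightarrow> Idt C a \<in> Homset C a a"
    and cmp_hom: "f \<in> Homset C a b \<Longrightarrow> g \<in> Homset C b c \<Longrightarrow> Cmp C g f \<in> Homset C a c"
    and cmp_idt: "f \<in> Homset C a b \<Longrightarrow> Cmp C f (Idt C a) = f"
    and idt_cmp: "f \<in> Homset C a b \<Longrightarrow> Cmp C (Idt C b) f = f"
    and cmp_assoc: "f \<in> Homset C a b \<Longrightarrow> g \<in> Homset C b c \<Longrightarrow> h \<in> Homset C c d \<Longrightarrow>
      Cmp C (Cmp C h g) f = Cmp C h (Cmp C g f)"

locale cat_functor = source: category C + target: category D
  for C :: "('o, 'm) cat" and D :: "('p, 'n) cat" +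
  fixes Fo :: "'o \<Rightarrow> 'p" and Fa :: "'m \<Rightarrow> 'n"
  assumes fun_ob: "a \<in> Ob C \<Longrightarrow> Fo a \<in> Ob D"
    and fun_hom: "f \<in> Homset C a b \<Longrightarrow> Fa f \<in> Homset D (Fo a) (Fo b)"
    and fun_idt: "a \<in> Ob C \<Longrightarrow> Fa (Idt C a) = Idt D (Fo a)"
    and fun_cmp: "f \<in> Homset C a b \<Longrightarrow> g \<in> Homset C b c \<Longrightarrow>
      Fa (Cmp C g f) = Cmp D (Fa g) (Fa f)"

definition is_cone ::
  "('k, 'l) cat \<Rightarrow> ('o, 'm) cat \<Rightarrow> ('k \<Rightarrow> 'o) \<Rightarrow> ('l \<Rightarrow> 'm) \<Rightarrow> 'o \<Rightarrow> ('k \<Rightarrow> 'm) \<Rightarrow> bool" where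
  "is_cone K C Fo Fa x p \<longleftrightarrow> x \<in> Ob C \<and> (\<forall>k\<in>Ob K. p k \<in> Homset C x (Fo k)) \<and>
     (\<forall>f\<in>Arr K. Cmp C (Fa f) (p (Dom K f)) = p (Cod K f))"

definition is_limit ::
  "('k, 'l) cat \<Rightarrow> ('o, 'm) cat \<Rightarrow> ('k \<Rightarrow> 'o) \<Rightarrow> ('l \<Rightarrow> 'm) \<Rightarrow> 'o \<Rightarrow> ('k \<Rightarrow> 'm) \<Rightarrow> bool" where
  "is_limit K C Fo Fa x p \<longleftrightarrow> is_cone K C Fo Fa x p \<and>
     (\<forall>y q. is_cone K C Fo Fa y q \<longrightarrow>
        (\<exists>!h. h \<in> Homset C y x \<and> (\<forall>k\<in>Ob K. Cmp C (p k) h = q k)))"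

text \<open>Every finite category is isomorphic to one whose objects and arrows are natural numbers,
  so it suffices to let the shapes range over those.\<close>

definition has_finite_limits :: "('o, 'm) cat \<Rightarrow> bool" where
  "has_finite_limits C \<longleftrightarrow>
     (\<forall>(K :: (nat, nat) cat) Fo Fa. finite (Ob K) \<longrightarrow> finite (Arr K) \<longrightarrow> cat_functor K C Fo Fa \<longrightarrow>
        (\<exists>x p. is_limit K C Fo Fa x p))"


section \<open>Symmetric monoidal closed categories\<close>

text \<open>The objects and arrows of the base of enrichment are all elements of the types
  \<open>'o\<close> and \<open>'m\<close>, each arrow having a domain and a codomain; composition and the
  tensor product of arrows are constrained only where they are meaningful.\<close>

record ('o, 'm) smc_data =
  vdom :: "'m \<Rightarrow> 'o"
  vcod :: "'m \<Rightarrow> 'o"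
  videntity :: "'o \<Rightarrow> 'm"
  vcompose :: "'m \<Rightarrow> 'm \<Rightarrow> 'm"
  vtensor :: "'o \<Rightarrow> 'o \<Rightarrow> 'o"
  vtensor_arr :: "'m \<Rightarrow> 'm \<Rightarrow> 'm"
  vunit :: "'o"
  vassoc :: "'o \<Rightarrow> 'o \<Rightarrow> 'o \<Rightarrow> 'm"
  vlunit :: "'o \<Rightarrow> 'm"
  vrunit :: "'o \<Rightarrow> 'm"
  vsym :: "'o \<Rightarrow> 'o \<Rightarrow> 'm"
  vihom :: "'o \<Rightarrow> 'o \<Rightarrow> 'o"
  veval :: "'o \<Rightarrow> 'o \<Rightarrow> 'm"

definition underlying :: "('o, 'm) smc_data \<Rightarrow> ('o, 'm) cat" where
  "underlying V = \<lparr>Ob = UNIV, Arr = UNIV, Dom = vdom V, Cod = vcod V,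
     Idt = videntity V, Cmp = vcompose V\<rparr>"

text \<open>Categories, functors and transformations enriched in \<open>V\<close>. All data are required
  to be extensional (equal to \<open>undefined\<close> outside the object sets), so that HOL equality is
  equality of enriched categories, functors and transformations.
  \<open>vcmp A a b c\<close> is the composition arrow from \<open>A(b,c) \<otimes> A(a,b)\<close> to \<open>A(a,c)\<close>.\<close>

record ('a, 'o, 'm) vcat =
  obs :: "'a set"
  vhom :: "'a \<Rightarrow> 'a \<Rightarrow> 'o"
  vid :: "'a \<Rightarrow> 'm"
  vcmp :: "'a \<Rightarrow> 'a \<Rightarrow> 'a \<Rightarrow> 'm"

record ('a, 'b, 'm) vfun =
  fob :: "'a \<Rightarrow> 'b"
  fhom :: "'a \<Rightarrow> 'a \<Rightarrow> 'm"

locale smcc =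
  fixes V :: "('o, 'm) smc_data"
begin

abbreviation hom :: "'o \<Rightarrow> 'o \<Rightarrow> 'm set" where
  "hom a b \<equiv> {f. vdom V f = a \<and> vcod V f = b}"
abbreviation idt :: "'o \<Rightarrow> 'm" where "idt \<equiv> videntity V"
abbreviation comp :: "'m \<Rightarrow> 'm \<Rightarrow> 'm" (infixr "\<cdot>" 55) where "g \<cdot> f \<equiv> vcompose V g f"
abbreviation tensor :: "'o \<Rightarrow> 'o \<Rightarrow> 'o" (infixr "\<otimes>" 70) where "a \<otimes> b \<equiv> vtensor V a b"
abbreviation tensor_arr :: "'m \<Rightarrow> 'm \<Rightarrow> 'm" (infixr "\<boxtimes>" 70) where
  "f \<boxtimes> g \<equiv> vtensor_arr V f g"
abbreviation unit_ob :: "'o" ("\<I>") where "\<I> \<equiv> vunit V"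
abbreviation asc :: "'o \<Rightarrow> 'o \<Rightarrow> 'o \<Rightarrow> 'm" where "asc \<equiv> vassoc V"
abbreviation lu :: "'o \<Rightarrow> 'm" where "lu \<equiv> vlunit V"
abbreviation ru :: "'o \<Rightarrow> 'm" where "ru \<equiv> vrunit V"
abbreviation sy :: "'o \<Rightarrow> 'o \<Rightarrow> 'm" where "sy \<equiv> vsym V"
abbreviation ih :: "'o \<Rightarrow> 'o \<Rightarrow> 'o" where "ih \<equiv> vihom V"
abbreviation ev :: "'o \<Rightarrow> 'o \<Rightarrow> 'm" where "ev \<equiv> veval V"

definition is_inverse :: "'m \<Rightarrow> 'm \<Rightarrow> bool" where
  "is_inverse f g \<longleftrightarrow> g \<in> hom (vcod V f) (vdom V f) \<and>
     g \<cdot> f = idt (vdom V f) \<and> f \<cdot> g = idt (vcod V f)"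

definition is_iso :: "'m \<Rightarrow> bool" where
  "is_iso f \<longleftrightarrow> (\<exists>g. is_inverse f g)"

definition vinv :: "'m \<Rightarrow> 'm" where
  "vinv f = (THE g. is_inverse f g)"

end

locale symmetric_monoidal_closed = smcc V + category "underlying V"
  for V :: "('o, 'm) smc_data" +
  assumes tensor_hom: "f \<in> hom a b \<Longrightarrow> g \<in> hom c d \<Longrightarrow> f \<boxtimes> g \<in> hom (a \<otimes> c) (b \<otimes> d)"
    and tensor_idt: "idt a \<boxtimes> idt b = idt (a \<otimes> b)"
    and tensor_comp: "f \<in> hom a b \<Longrightarrow> g \<in> hom b c \<Longrightarrow> f' \<in> hom a' b' \<Longrightarrow> g' \<in> hom b' c' \<Longrightarrow>
      (g \<cdot> f) \<boxtimes> (g' \<cdot> f') = (g \<boxtimes> g') \<cdot> (f \<boxtimes> f')"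
    and asc_hom: "asc a b c \<in> hom ((a \<otimes> b) \<otimes> c) (a \<otimes> (b \<otimes> c))"
    and asc_iso: "is_iso (asc a b c)"
    and asc_nat: "f \<in> hom a a' \<Longrightarrow> g \<in> hom b b' \<Longrightarrow> h \<in> hom c c' \<Longrightarrow>
      asc a' b' c' \<cdot> ((f \<boxtimes> g) \<boxtimes> h) = (f \<boxtimes> (g \<boxtimes> h)) \<cdot> asc a b c"
    and lu_hom: "lu a \<in> hom (\<I> \<otimes> a) a"
    and lu_iso: "is_iso (lu a)"
    and lu_nat: "f \<in> hom a b \<Longrightarrow> lu b \<cdot> (idt \<I> \<boxtimes> f) = f \<cdot> lu a"
    and ru_hom: "ru a \<in> hom (a \<otimes> \<I>) a"
    and ru_iso: "is_iso (ru a)"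
    and ru_nat: "f \<in> hom a b \<Longrightarrow> ru b \<cdot> (f \<boxtimes> idt \<I>) = f \<cdot> ru a"
    and pentagon: "asc a b (c \<otimes> d) \<cdot> asc (a \<otimes> b) c d =
      (idt a \<boxtimes> asc b c d) \<cdot> asc a (b \<otimes> c) d \<cdot> (asc a b c \<boxtimes> idt d)"
    and triangle: "(idt a \<boxtimes> lu b) \<cdot> asc a \<I> b = ru a \<boxtimes> idt b"
    and sy_hom: "sy a b \<in> hom (a \<otimes> b) (b \<otimes> a)"
    and sy_nat: "f \<in> hom a a' \<Longrightarrow> g \<in> hom b b' \<Longrightarrow>
      sy a' b' \<cdot> (f \<boxtimes> g) = (g \<boxtimes> f) \<cdot> sy a b"
    and sy_sy: "sy b a \<cdot> sy a b = idt (a \<otimes> b)"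
    and hexagon: "asc b c a \<cdot> sy a (b \<otimes> c) \<cdot> asc a b c =
      (idt b \<boxtimes> sy a c) \<cdot> asc b a c \<cdot> (sy a b \<boxtimes> idt c)"
    and ev_hom: "ev a b \<in> hom (ih a b \<otimes> a) b"
    and closed: "f \<in> hom (c \<otimes> a) b \<Longrightarrow> \<exists>!h. h \<in> hom c (ih a b) \<and> ev a b \<cdot> (h \<boxtimes> idt a) = f"


section \<open>Enriched categories\<close>

context smcc
begin

definition transp :: "'o \<Rightarrow> 'o \<Rightarrow> 'o \<Rightarrow> 'm \<Rightarrow> 'm" where
  "transp c a b f = (THE h. h \<in> hom c (ih a b) \<and> ev a b \<cdot> (h \<boxtimes> idt a) = f)"

definition untransp :: "'o \<Rightarrow> 'o \<Rightarrow> 'm \<Rightarrow> 'm" where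
  "untransp a b h = ev a b \<cdot> (h \<boxtimes> idt a)"

text \<open>The element of \<open>[a,b]\<close> corresponding to an arrow from \<open>a\<close> to \<open>b\<close>.\<close>

definition name :: "'o \<Rightarrow> 'o \<Rightarrow> 'm \<Rightarrow> 'm" where
  "name a b f = transp \<I> a b (f \<cdot> lu a)"

text \<open>The middle-four interchange from \<open>(a \<otimes> b) \<otimes> (c \<otimes> d)\<close> to \<open>(a \<otimes> c) \<otimes> (b \<otimes> d)\<close>.\<close>

definition middle :: "'o \<Rightarrow> 'o \<Rightarrow> 'o \<Rightarrow> 'o \<Rightarrow> 'm" where
  "middle a b c d = vinv (asc a c (b \<otimes> d)) \<cdot>
     (idt a \<boxtimes> (asc c b d \<cdot> (sy b c \<boxtimes> idt d) \<cdot> vinv (asc b c d))) \<cdot> asc a b (c \<otimes> d)"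

definition is_vcat :: "('a, 'o, 'm) vcat \<Rightarrow> bool" where
  "is_vcat A \<longleftrightarrow>
     vhom A \<in> obs A \<rightarrow>\<^sub>E obs A \<rightarrow>\<^sub>E UNIV \<and>
     vid A \<in> (\<Pi>\<^sub>E a\<in>obs A. hom \<I> (vhom A a a)) \<and>
     vcmp A \<in> (\<Pi>\<^sub>E a\<in>obs A. \<Pi>\<^sub>E b\<in>obs A. \<Pi>\<^sub>E c\<in>obs A.
       hom (vhom A b c \<otimes> vhom A a b) (vhom A a c)) \<and>
     (\<forall>a\<in>obs A. \<forall>b\<in>obs A. vcmp A a b b \<cdot> (vid A b \<boxtimes> idt (vhom A a b)) = lu (vhom A a b)) \<and>
     (\<forall>a\<in>obs A. \<forall>b\<in>obs A. vcmp A a a b \<cdot> (idt (vhom A a b) \<boxtimes> vid A a) = ru (vhom A a b)) \<and>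
     (\<forall>a\<in>obs A. \<forall>b\<in>obs A. \<forall>c\<in>obs A. \<forall>d\<in>obs A.
       vcmp A a b d \<cdot> (vcmp A b c d \<boxtimes> idt (vhom A a b)) =
       vcmp A a c d \<cdot> (idt (vhom A c d) \<boxtimes> vcmp A a b c) \<cdot>
         asc (vhom A c d) (vhom A b c) (vhom A a b))"

definition is_vfun ::
  "('a, 'o, 'm) vcat \<Rightarrow> ('b, 'o, 'm) vcat \<Rightarrow> ('a, 'b, 'm) vfun \<Rightarrow> bool" where
  "is_vfun A B F \<longleftrightarrow>
     fob F \<in> obs A \<rightarrow>\<^sub>E obs B \<and>
     fhom F \<in> (\<Pi>\<^sub>E a\<in>obs A. \<Pi>\<^sub>E b\<in>obs A. hom (vhom A a b) (vhom B (fob F a) (fob F b))) \<and>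
     (\<forall>a\<in>obs A. fhom F a a \<cdot> vid A a = vid B (fob F a)) \<and>
     (\<forall>a\<in>obs A. \<forall>b\<in>obs A. \<forall>c\<in>obs A.
       fhom F a c \<cdot> vcmp A a b c =
       vcmp B (fob F a) (fob F b) (fob F c) \<cdot> (fhom F b c \<boxtimes> fhom F a b))"

definition fid :: "('a, 'o, 'm) vcat \<Rightarrow> ('a, 'a, 'm) vfun" where
  "fid A = \<lparr>fob = (\<lambda>a\<in>obs A. a), fhom = (\<lambda>a\<in>obs A. \<lambda>b\<in>obs A. idt (vhom A a b))\<rparr>"

text \<open>\<open>fcomp A G F\<close> is \<open>G\<close> after \<open>F\<close>, for \<open>F\<close> with domain \<open>A\<close>.\<close>

definition fcomp ::
  "('a, 'o, 'm) vcat \<Rightarrow> ('b, 'c, 'm) vfun \<Rightarrow> ('a, 'b, 'm) vfun \<Rightarrow> ('a, 'c, 'm) vfun" where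
  "fcomp A G F = \<lparr>fob = (\<lambda>a\<in>obs A. fob G (fob F a)),
     fhom = (\<lambda>a\<in>obs A. \<lambda>b\<in>obs A. fhom G (fob F a) (fob F b) \<cdot> fhom F a b)\<rparr>"

definition vnat ::
  "('a, 'o, 'm) vcat \<Rightarrow> ('b, 'o, 'm) vcat \<Rightarrow> ('a, 'b, 'm) vfun \<Rightarrow> ('a, 'b, 'm) vfun \<Rightarrow>
   ('a \<Rightarrow> 'm) \<Rightarrow> bool" where
  "vnat A B F G \<alpha> \<longleftrightarrow>
     \<alpha> \<in> (\<Pi>\<^sub>E a\<in>obs A. hom \<I> (vhom B (fob F a) (fob G a))) \<and>
     (\<forall>a\<in>obs A. \<forall>b\<in>obs A.
       vcmp B (fob F a) (fob F b) (fob G b) \<cdot> (\<alpha> b \<boxtimes> fhom F a b) \<cdot> vinv (lu (vhom A a b)) =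
       vcmp B (fob F a) (fob G a) (fob G b) \<cdot> (fhom G a b \<boxtimes> \<alpha> a) \<cdot> vinv (ru (vhom A a b)))"

definition nid :: "('a, 'o, 'm) vcat \<Rightarrow> ('b, 'o, 'm) vcat \<Rightarrow> ('a, 'b, 'm) vfun \<Rightarrow> 'a \<Rightarrow> 'm" where
  "nid A B F = (\<lambda>a\<in>obs A. vid B (fob F a))"

text \<open>Vertical composition of \<open>\<alpha> : F \<Rightarrow> G\<close> and \<open>\<beta> : G \<Rightarrow> H\<close>.\<close>

definition ncomp ::
  "('a, 'o, 'm) vcat \<Rightarrow> ('b, 'o, 'm) vcat \<Rightarrow> ('a, 'b, 'm) vfun \<Rightarrow> ('a, 'b, 'm) vfun \<Rightarrow>
   ('a, 'b, 'm) vfun \<Rightarrow> ('a \<Rightarrow> 'm) \<Rightarrow> ('a \<Rightarrow> 'm) \<Rightarrow> 'a \<Rightarrow> 'm" where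
  "ncomp A B F G H \<beta> \<alpha> =
     (\<lambda>a\<in>obs A. vcmp B (fob F a) (fob G a) (fob H a) \<cdot> (\<beta> a \<boxtimes> \<alpha> a) \<cdot> vinv (lu \<I>))"

text \<open>Whiskerings: \<open>wleft A H F G \<alpha>\<close> is \<open>H\<alpha>\<close> for \<open>\<alpha> : F \<Rightarrow> G\<close>, and
  \<open>wright A \<alpha> F\<close> is \<open>\<alpha>F\<close>, where \<open>A\<close> is the domain of \<open>F\<close>.\<close>

definition wleft ::
  "('a, 'o, 'm) vcat \<Rightarrow> ('b, 'c, 'm) vfun \<Rightarrow> ('a, 'b, 'm) vfun \<Rightarrow> ('a, 'b, 'm) vfun \<Rightarrow>
   ('a \<Rightarrow> 'm) \<Rightarrow> 'a \<Rightarrow> 'm" where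
  "wleft A H F G \<alpha> = (\<lambda>a\<in>obs A. fhom H (fob F a) (fob G a) \<cdot> \<alpha> a)"

definition wright ::
  "('a, 'o, 'm) vcat \<Rightarrow> ('b \<Rightarrow> 'm) \<Rightarrow> ('a, 'b, 'm) vfun \<Rightarrow> 'a \<Rightarrow> 'm" where
  "wright A \<alpha> F = (\<lambda>a\<in>obs A. \<alpha> (fob F a))"

definition inverse_nats ::
  "('a, 'o, 'm) vcat \<Rightarrow> ('b, 'o, 'm) vcat \<Rightarrow> ('a, 'b, 'm) vfun \<Rightarrow> ('a, 'b, 'm) vfun \<Rightarrow>
   ('a \<Rightarrow> 'm) \<Rightarrow> ('a \<Rightarrow> 'm) \<Rightarrow> bool" where
  "inverse_nats A B F G \<alpha> \<beta> \<longleftrightarrow> vnat A B F G \<alpha> \<and> vnat A B G F \<beta> \<and>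
     ncomp A B F G F \<beta> \<alpha> = nid A B F \<and> ncomp A B G F G \<alpha> \<beta> = nid A B G"

definition vnat_iso ::
  "('a, 'o, 'm) vcat \<Rightarrow> ('b, 'o, 'm) vcat \<Rightarrow> ('a, 'b, 'm) vfun \<Rightarrow> ('a, 'b, 'm) vfun \<Rightarrow>
   ('a \<Rightarrow> 'm) \<Rightarrow> bool" where
  "vnat_iso A B F G \<alpha> \<longleftrightarrow> (\<exists>\<beta>. inverse_nats A B F G \<alpha> \<beta>)"

definition vop :: "('a, 'o, 'm) vcat \<Rightarrow> ('a, 'o, 'm) vcat" where
  "vop A = \<lparr>obs = obs A, vhom = (\<lambda>a\<in>obs A. \<lambda>b\<in>obs A. vhom A b a), vid = vid A,
     vcmp = (\<lambda>a\<in>obs A. \<lambda>b\<in>obs A. \<lambda>c\<in>obs A. vcmp A c b a \<cdot> sy (vhom A c b) (vhom A b a))\<rparr>"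

text \<open>The functor \<open>F\<^sup>o\<^sup>p\<close> between opposites, for \<open>F\<close> with domain \<open>A\<close>.\<close>

definition fop :: "('a, 'o, 'm) vcat \<Rightarrow> ('a, 'b, 'm) vfun \<Rightarrow> ('a, 'b, 'm) vfun" where
  "fop A F = \<lparr>fob = fob F, fhom = (\<lambda>a\<in>obs A. \<lambda>b\<in>obs A. fhom F b a)\<rparr>"

definition full_sub :: "('a, 'o, 'm) vcat \<Rightarrow> 'a set \<Rightarrow> ('a, 'o, 'm) vcat" where
  "full_sub A S = \<lparr>obs = S, vhom = (\<lambda>a\<in>S. \<lambda>b\<in>S. vhom A a b), vid = (\<lambda>a\<in>S. vid A a),
     vcmp = (\<lambda>a\<in>S. \<lambda>b\<in>S. \<lambda>c\<in>S. vcmp A a b c)\<rparr>"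

text \<open>The tensor product of enriched categories and of enriched functors.\<close>

definition vtimes ::
  "('a, 'o, 'm) vcat \<Rightarrow> ('b, 'o, 'm) vcat \<Rightarrow> ('a \<times> 'b, 'o, 'm) vcat" where
  "vtimes A B = \<lparr>obs = obs A \<times> obs B,
     vhom = (\<lambda>p\<in>obs A \<times> obs B. \<lambda>q\<in>obs A \<times> obs B.
       vhom A (fst p) (fst q) \<otimes> vhom B (snd p) (snd q)),
     vid = (\<lambda>p\<in>obs A \<times> obs B. (vid A (fst p) \<boxtimes> vid B (snd p)) \<cdot> vinv (lu \<I>)),
     vcmp = (\<lambda>p\<in>obs A \<times> obs B. \<lambda>q\<in>obs A \<times> obs B. \<lambda>r\<in>obs A \<times> obs B.
       (vcmp A (fst p) (fst q) (fst r) \<boxtimes> vcmp B (snd p) (snd q) (snd r)) \<cdot>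
       middle (vhom A (fst q) (fst r)) (vhom B (snd q) (snd r))
              (vhom A (fst p) (fst q)) (vhom B (snd p) (snd q)))\<rparr>"

definition ftimes ::
  "('a, 'o, 'm) vcat \<Rightarrow> ('b, 'o, 'm) vcat \<Rightarrow> ('a, 'c, 'm) vfun \<Rightarrow> ('b, 'd, 'm) vfun \<Rightarrow>
   ('a \<times> 'b, 'c \<times> 'd, 'm) vfun" where
  "ftimes A B F G = \<lparr>fob = (\<lambda>p\<in>obs A \<times> obs B. (fob F (fst p), fob G (snd p))),
     fhom = (\<lambda>p\<in>obs A \<times> obs B. \<lambda>q\<in>obs A \<times> obs B.
       fhom F (fst p) (fst q) \<boxtimes> fhom G (snd p) (snd q))\<rparr>"

text \<open>The partial functors \<open>D(a,-) : B \<rightarrow> C\<close> and \<open>D(-,b) : A \<rightarrow> C\<close> of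
  \<open>D : A \<otimes> B \<rightarrow> C\<close>.\<close>

definition fix_left ::
  "('a, 'o, 'm) vcat \<Rightarrow> ('b, 'o, 'm) vcat \<Rightarrow> ('a \<times> 'b, 'c, 'm) vfun \<Rightarrow> 'a \<Rightarrow> ('b, 'c, 'm) vfun" where
  "fix_left A B D a = \<lparr>fob = (\<lambda>b\<in>obs B. fob D (a, b)),
     fhom = (\<lambda>b\<in>obs B. \<lambda>b'\<in>obs B.
       fhom D (a, b) (a, b') \<cdot> (vid A a \<boxtimes> idt (vhom B b b')) \<cdot> vinv (lu (vhom B b b')))\<rparr>"

definition fix_right ::
  "('a, 'o, 'm) vcat \<Rightarrow> ('b, 'o, 'm) vcat \<Rightarrow> ('a \<times> 'b, 'c, 'm) vfun \<Rightarrow> 'b \<Rightarrow> ('a, 'c, 'm) vfun" where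
  "fix_right A B D b = \<lparr>fob = (\<lambda>a\<in>obs A. fob D (a, b)),
     fhom = (\<lambda>a\<in>obs A. \<lambda>a'\<in>obs A.
       fhom D (a, b) (a', b) \<cdot> (idt (vhom A a a') \<boxtimes> vid B b) \<cdot> vinv (ru (vhom A a a')))\<rparr>"

text \<open>The base as a category enriched in itself.\<close>

definition vself :: "('o, 'o, 'm) vcat" where
  "vself = \<lparr>obs = UNIV, vhom = ih, vid = (\<lambda>a. transp \<I> a a (lu a)),
     vcmp = (\<lambda>a b c. transp (ih b c \<otimes> ih a b) a c
       (ev b c \<cdot> (idt (ih b c) \<boxtimes> ev a b) \<cdot> asc (ih b c) (ih a b) a))\<rparr>"

text \<open>The representable functor \<open>A(a,-)\<close>.\<close>

definition rep :: "('a, 'o, 'm) vcat \<Rightarrow> 'a \<Rightarrow> ('a, 'o, 'm) vfun" where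
  "rep A a = \<lparr>fob = (\<lambda>b\<in>obs A. vhom A a b),
     fhom = (\<lambda>b\<in>obs A. \<lambda>c\<in>obs A.
       transp (vhom A b c) (vhom A a b) (vhom A a c) (vcmp A a b c))\<rparr>"

text \<open>The arrow \<open>A(a,f)\<close> from \<open>A(a,b)\<close> to \<open>A(a,c)\<close> induced by an element \<open>f\<close> of \<open>A(b,c)\<close>.\<close>

definition post :: "('a, 'o, 'm) vcat \<Rightarrow> 'a \<Rightarrow> 'a \<Rightarrow> 'a \<Rightarrow> 'm \<Rightarrow> 'm" where
  "post A a b c f = vcmp A a b c \<cdot> (f \<boxtimes> idt (vhom A a b)) \<cdot> vinv (lu (vhom A a b))"

text \<open>A power of \<open>a\<close> by \<open>x\<close>: an object \<open>p\<close> with a counit \<open>\<kappa>\<close> from \<open>x\<close> to \<open>A(p,a)\<close>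
  such that the induced arrows from \<open>A(b,p)\<close> to \<open>[x, A(b,a)]\<close> are invertible.\<close>

definition is_power :: "('a, 'o, 'm) vcat \<Rightarrow> 'o \<Rightarrow> 'a \<Rightarrow> 'a \<Rightarrow> 'm \<Rightarrow> bool" where
  "is_power A x a p \<kappa> \<longleftrightarrow> a \<in> obs A \<and> p \<in> obs A \<and> \<kappa> \<in> hom x (vhom A p a) \<and>
     (\<forall>b\<in>obs A. is_iso (transp (vhom A b p) x (vhom A b a)
        (vcmp A b p a \<cdot> (\<kappa> \<boxtimes> idt (vhom A b p)) \<cdot> sy (vhom A b p) x)))"

definition preserves_powers ::
  "'o set \<Rightarrow> ('a, 'o, 'm) vcat \<Rightarrow> ('b, 'o, 'm) vcat \<Rightarrow> ('a, 'b, 'm) vfun \<Rightarrow> bool" where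
  "preserves_powers S A B F \<longleftrightarrow>
     (\<forall>x\<in>S. \<forall>a p \<kappa>. is_power A x a p \<kappa> \<longrightarrow>
        is_power B x (fob F a) (fob F p) (fhom F p a \<cdot> \<kappa>))"

text \<open>An adjunction \<open>F \<stileturn> G : C \<rightarrow> B\<close>, given by isomorphisms \<open>\<theta> b c\<close> from \<open>C(Fb,c)\<close>
  to \<open>B(b,Gc)\<close>. The two last conditions are (transposed) naturality in \<open>c\<close> and in \<open>b\<close>.\<close>

definition is_vadj ::
  "('b, 'o, 'm) vcat \<Rightarrow> ('c, 'o, 'm) vcat \<Rightarrow> ('b, 'c, 'm) vfun \<Rightarrow> ('c, 'b, 'm) vfun \<Rightarrow>
   ('b \<Rightarrow> 'c \<Rightarrow> 'm) \<Rightarrow> bool" where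
  "is_vadj B C F G \<theta> \<longleftrightarrow> is_vfun B C F \<and> is_vfun C B G \<and>
     \<theta> \<in> (\<Pi>\<^sub>E b\<in>obs B. \<Pi>\<^sub>E c\<in>obs C. hom (vhom C (fob F b) c) (vhom B b (fob G c))) \<and>
     (\<forall>b\<in>obs B. \<forall>c\<in>obs C. is_iso (\<theta> b c)) \<and>
     (\<forall>b\<in>obs B. \<forall>c\<in>obs C. \<forall>c'\<in>obs C.
       \<theta> b c' \<cdot> vcmp C (fob F b) c c' =
       vcmp B b (fob G c) (fob G c') \<cdot> (fhom G c c' \<boxtimes> \<theta> b c)) \<and>
     (\<forall>b\<in>obs B. \<forall>b'\<in>obs B. \<forall>c\<in>obs C.
       \<theta> b' c \<cdot> vcmp C (fob F b') (fob F b) c \<cdot> (idt (vhom C (fob F b) c) \<boxtimes> fhom F b' b) =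
       vcmp B b' b (fob G c) \<cdot> (\<theta> b c \<boxtimes> idt (vhom B b' b)))"

text \<open>The hom-object \<open>[T,V](A,B)\<close> is the end over \<open>j\<close> of \<open>[Aj,Bj]\<close>: a universal family
  \<open>\<pi> j\<close> of arrows from \<open>e\<close> to \<open>[Aj,Bj]\<close> that is (extraordinarily) natural in \<open>j\<close>.
  For \<open>x = \<I>\<close> the condition \<open>hom_wedge\<close> is, up to unit isomorphisms, \<open>vnat\<close>.\<close>

definition hom_wedge ::
  "('a, 'o, 'm) vcat \<Rightarrow> ('a, 'o, 'm) vfun \<Rightarrow> ('a, 'o, 'm) vfun \<Rightarrow> 'o \<Rightarrow> ('a \<Rightarrow> 'm) \<Rightarrow> bool" where
  "hom_wedge T A B x \<pi> \<longleftrightarrow> (\<forall>j\<in>obs T. \<pi> j \<in> hom x (ih (fob A j) (fob B j))) \<and>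
     (\<forall>j\<in>obs T. \<forall>k\<in>obs T.
       vcmp vself (fob A j) (fob A k) (fob B k) \<cdot> (\<pi> k \<boxtimes> fhom A j k) =
       vcmp vself (fob A j) (fob B j) (fob B k) \<cdot> (fhom B j k \<boxtimes> \<pi> j) \<cdot> sy x (vhom T j k))"

definition is_hom_end ::
  "('a, 'o, 'm) vcat \<Rightarrow> ('a, 'o, 'm) vfun \<Rightarrow> ('a, 'o, 'm) vfun \<Rightarrow> 'o \<Rightarrow> ('a \<Rightarrow> 'm) \<Rightarrow> bool" where
  "is_hom_end T A B e \<pi> \<longleftrightarrow> hom_wedge T A B e \<pi> \<and>
     (\<forall>x \<rho>. hom_wedge T A B x \<rho> \<longrightarrow>
        (\<exists>!h. h \<in> hom x e \<and> (\<forall>j\<in>obs T. \<pi> j \<cdot> h = \<rho> j)))"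

text \<open>A choice of these ends, for those pairs of functors for which they exist.\<close>

definition hom_end ::
  "('a, 'o, 'm) vcat \<Rightarrow> ('a, 'o, 'm) vfun \<Rightarrow> ('a, 'o, 'm) vfun \<Rightarrow> 'o \<times> ('a \<Rightarrow> 'm)" where
  "hom_end T A B = (SOME p. is_hom_end T A B (fst p) (snd p))"

definition nat_ob :: "('a, 'o, 'm) vcat \<Rightarrow> ('a, 'o, 'm) vfun \<Rightarrow> ('a, 'o, 'm) vfun \<Rightarrow> 'o" where
  "nat_ob T A B = fst (hom_end T A B)"

definition proj ::
  "('a, 'o, 'm) vcat \<Rightarrow> ('a, 'o, 'm) vfun \<Rightarrow> ('a, 'o, 'm) vfun \<Rightarrow> 'a \<Rightarrow> 'm" where
  "proj T A B = snd (hom_end T A B)"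

text \<open>The arrow from \<open>x\<close> to \<open>[T,V](A,B)\<close> induced by a natural family \<open>\<rho>\<close>.\<close>

definition lift ::
  "('a, 'o, 'm) vcat \<Rightarrow> ('a, 'o, 'm) vfun \<Rightarrow> ('a, 'o, 'm) vfun \<Rightarrow> 'o \<Rightarrow> ('a \<Rightarrow> 'm) \<Rightarrow> 'm" where
  "lift T A B x \<rho> = (THE h. h \<in> hom x (nat_ob T A B) \<and> (\<forall>j\<in>obs T. proj T A B j \<cdot> h = \<rho> j))"

end


section \<open>Theories, algebras and bifold algebras\<close>

record ('o, 'm) theory_data =
  tcat :: "('o, 'o, 'm) vcat"
  tstr :: "('o, 'o, 'm) vfun"

type_synonym ('o, 'm) alg = "('o, 'o, 'm) vfun"

record ('o, 'm) bifold_data =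
  lth :: "('o, 'm) theory_data"
  rth :: "('o, 'm) theory_data"
  bif :: "('o \<times> 'o, 'o, 'm) vfun"

record ('o, 'm) bifold_mor =
  bsrc :: "('o, 'm) bifold_data"
  btgt :: "('o, 'm) bifold_data"
  bml :: "('o, 'o, 'm) vfun"
  bmr :: "('o, 'o, 'm) vfun"
  bnat :: "'o \<times> 'o \<Rightarrow> 'm"

text \<open>An object \<open>(A, G)\<close> of the pseudo-slice over \<open>V\<close>, and a 1-cell \<open>(P, \<gamma>)\<close>.\<close>

type_synonym ('a, 'o, 'm) over = "('a, 'o, 'm) vcat \<times> ('a, 'o, 'm) vfun"
type_synonym ('a, 'b, 'm) over_cell = "('a, 'b, 'm) vfun \<times> ('a \<Rightarrow> 'm)"

text \<open>Dual adjunctions \<open>\<nabla> \<stileturn> \<Delta> : \<A>\<^sup>o\<^sup>p \<rightarrow> \<B>\<close>; the field \<open>dadj\<close> holds the isomorphisms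
  from \<open>\<A>(a, \<nabla>b)\<close> to \<open>\<B>(b, \<Delta>a)\<close>.\<close>

record ('a, 'b, 'o, 'm) dual_adj =
  dleft :: "('a, 'o, 'm) over"
  dright :: "('b, 'o, 'm) over"
  dnabla :: "('b, 'a, 'm) vfun"
  ddelta :: "('a, 'b, 'm) vfun"
  dadj :: "'b \<Rightarrow> 'a \<Rightarrow> 'm"

record ('a, 'b, 'o, 'm) dual_cell =
  csrc :: "('a, 'b, 'o, 'm) dual_adj"
  ctgt :: "('a, 'b, 'o, 'm) dual_adj"
  cleft :: "('a, 'a, 'm) over_cell"
  cright :: "('b, 'b, 'm) over_cell"
  cphi :: "'a \<Rightarrow> 'm"

context smcc
begin

definition is_over :: "('a, 'o, 'm) over \<Rightarrow> bool" where
  "is_over X \<longleftrightarrow> is_vcat (fst X) \<and> is_vfun (fst X) vself (snd X)"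

definition over_1cell ::
  "('a, 'o, 'm) over \<Rightarrow> ('b, 'o, 'm) over \<Rightarrow> ('a, 'b, 'm) over_cell \<Rightarrow> bool" where
  "over_1cell X Y P \<longleftrightarrow> is_vfun (fst X) (fst Y) (fst P) \<and>
     vnat_iso (fst X) vself (fcomp (fst X) (snd Y) (fst P)) (snd X) (snd P)"

definition over_id :: "('a, 'o, 'm) over \<Rightarrow> ('a, 'a, 'm) over_cell" where
  "over_id X = (fid (fst X), nid (fst X) vself (snd X))"

text \<open>The composite of \<open>P : X \<rightarrow> Y\<close> and \<open>Q : Y \<rightarrow> Z\<close>; its second component is
  \<open>\<gamma> \<cdot> (\<delta>P)\<close> for \<open>P = (P,\<gamma>)\<close> and \<open>Q = (Q,\<delta>)\<close>.\<close>

definition over_comp ::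
  "('a, 'o, 'm) over \<Rightarrow> ('b, 'o, 'm) over \<Rightarrow> ('c, 'o, 'm) over \<Rightarrow>
   ('b, 'c, 'm) over_cell \<Rightarrow> ('a, 'b, 'm) over_cell \<Rightarrow> ('a, 'c, 'm) over_cell" where
  "over_comp X Y Z Q P =
     (fcomp (fst X) (fst Q) (fst P),
      ncomp (fst X) vself
        (fcomp (fst X) (snd Z) (fcomp (fst X) (fst Q) (fst P)))
        (fcomp (fst X) (snd Y) (fst P))
        (snd X)
        (snd P) (wright (fst X) (snd Q) (fst P)))"

definition over_2cell ::
  "('a, 'o, 'm) over \<Rightarrow> ('b, 'o, 'm) over \<Rightarrow> ('a, 'b, 'm) over_cell \<Rightarrow> ('a, 'b, 'm) over_cell \<Rightarrow>
   ('a \<Rightarrow> 'm) \<Rightarrow> bool" where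
  "over_2cell X Y P P' \<alpha> \<longleftrightarrow> vnat (fst X) (fst Y) (fst P) (fst P') \<alpha> \<and>
     ncomp (fst X) vself
       (fcomp (fst X) (snd Y) (fst P)) (fcomp (fst X) (snd Y) (fst P')) (snd X)
       (snd P') (wleft (fst X) (snd Y) (fst P) (fst P') \<alpha>) = snd P"

definition over_iso_1cells ::
  "('a, 'o, 'm) over \<Rightarrow> ('b, 'o, 'm) over \<Rightarrow> ('a, 'b, 'm) over_cell \<Rightarrow> ('a, 'b, 'm) over_cell \<Rightarrow>
   bool" where
  "over_iso_1cells X Y P P' \<longleftrightarrow> (\<exists>\<alpha> \<beta>. over_2cell X Y P P' \<alpha> \<and> over_2cell X Y P' P \<beta> \<and>
     inverse_nats (fst X) (fst Y) (fst P) (fst P') \<alpha> \<beta>)"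

definition over_equivalent :: "('a, 'o, 'm) over \<Rightarrow> ('b, 'o, 'm) over \<Rightarrow> bool" where
  "over_equivalent X Y \<longleftrightarrow>
     (\<exists>P Q. over_1cell X Y P \<and> over_1cell Y X Q \<and>
        over_iso_1cells X X (over_id X) (over_comp X Y X Q P) \<and>
        over_iso_1cells Y Y (over_comp Y X Y P Q) (over_id Y))"

end

locale arity_system = symmetric_monoidal_closed V for V :: "('o, 'm) smc_data" +
  fixes \<J> :: "'o set"
  assumes unit_arity: "\<I> \<in> \<J>"
    and tensor_arity: "j \<in> \<J> \<Longrightarrow> k \<in> \<J> \<Longrightarrow> j \<otimes> k \<in> \<J>"
begin

definition arity_cat :: "('o, 'o, 'm) vcat" where
  "arity_cat = full_sub vself \<J>"

definition is_theory :: "('o, 'm) theory_data \<Rightarrow> bool" where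
  "is_theory T \<longleftrightarrow> is_vcat (tcat T) \<and> obs (tcat T) = \<J> \<and>
     is_vfun (vop arity_cat) (tcat T) (tstr T) \<and> (\<forall>j\<in>\<J>. fob (tstr T) j = j) \<and>
     preserves_powers \<J> (vop arity_cat) (tcat T) (tstr T)"

definition theory_mor ::
  "('o, 'm) theory_data \<Rightarrow> ('o, 'm) theory_data \<Rightarrow> ('o, 'o, 'm) vfun \<Rightarrow> bool" where
  "theory_mor T U M \<longleftrightarrow> is_vfun (tcat T) (tcat U) M \<and>
     fcomp (vop arity_cat) M (tstr T) = tstr U"

definition is_algebra :: "('o, 'm) theory_data \<Rightarrow> ('o, 'm) alg \<Rightarrow> bool" where
  "is_algebra T A \<longleftrightarrow> is_vfun (tcat T) vself A \<and> preserves_powers \<J> (tcat T) vself A"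

definition Alg :: "('o, 'm) theory_data \<Rightarrow> (('o, 'm) alg, 'o, 'm) vcat" where
  "Alg T = \<lparr>obs = {A. is_algebra T A},
     vhom = (\<lambda>A\<in>{A. is_algebra T A}. \<lambda>B\<in>{A. is_algebra T A}. nat_ob (tcat T) A B),
     vid = (\<lambda>A\<in>{A. is_algebra T A}. lift (tcat T) A A \<I> (\<lambda>j. vid vself (fob A j))),
     vcmp = (\<lambda>A\<in>{A. is_algebra T A}. \<lambda>B\<in>{A. is_algebra T A}. \<lambda>C\<in>{A. is_algebra T A}.
       lift (tcat T) A C (nat_ob (tcat T) B C \<otimes> nat_ob (tcat T) A B)
         (\<lambda>j. vcmp vself (fob A j) (fob B j) (fob C j) \<cdot>
              (proj (tcat T) B C j \<boxtimes> proj (tcat T) A B j)))\<rparr>"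

definition eval_unit :: "('o, 'm) theory_data \<Rightarrow> (('o, 'm) alg, 'o, 'm) vfun" where
  "eval_unit T = \<lparr>fob = (\<lambda>A\<in>obs (Alg T). fob A \<I>),
     fhom = (\<lambda>A\<in>obs (Alg T). \<lambda>B\<in>obs (Alg T). proj (tcat T) A B \<I>)\<rparr>"

definition Alg_over :: "('o, 'm) theory_data \<Rightarrow> (('o, 'm) alg, 'o, 'm) over" where
  "Alg_over T = (Alg T, eval_unit T)"

definition amenable :: bool where
  "amenable \<longleftrightarrow> (\<forall>T. is_theory T \<longrightarrow>
     (\<forall>A B. is_algebra T A \<longrightarrow> is_algebra T B \<longrightarrow> (\<exists>e \<pi>. is_hom_end (tcat T) A B e \<pi>)) \<and>
     (\<exists>F \<theta>. is_vadj vself (Alg T) F (eval_unit T) \<theta>))"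

text \<open>The functor \<open>M\<^sup>*\<close> from \<open>U\<close>-algebras to \<open>T\<close>-algebras, for \<open>M : T \<rightarrow> U\<close>.\<close>

definition restr ::
  "('o, 'm) theory_data \<Rightarrow> ('o, 'm) theory_data \<Rightarrow> ('o, 'o, 'm) vfun \<Rightarrow>
   (('o, 'm) alg, ('o, 'm) alg, 'm) vfun" where
  "restr T U M = \<lparr>fob = (\<lambda>A\<in>obs (Alg U). fcomp (tcat T) A M),
     fhom = (\<lambda>A\<in>obs (Alg U). \<lambda>B\<in>obs (Alg U).
       lift (tcat T) (fcomp (tcat T) A M) (fcomp (tcat T) B M) (vhom (Alg U) A B)
         (\<lambda>j. proj (tcat U) A B (fob M j)))\<rparr>"

abbreviation at_left :: "('o, 'm) bifold_data \<Rightarrow> 'o \<Rightarrow> ('o, 'm) alg" where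
  "at_left X j \<equiv> fix_left (tcat (lth X)) (tcat (rth X)) (bif X) j"

abbreviation at_right :: "('o, 'm) bifold_data \<Rightarrow> 'o \<Rightarrow> ('o, 'm) alg" where
  "at_right X k \<equiv> fix_right (tcat (lth X)) (tcat (rth X)) (bif X) k"

definition is_bifold :: "('o, 'm) bifold_data \<Rightarrow> bool" where
  "is_bifold X \<longleftrightarrow> is_theory (lth X) \<and> is_theory (rth X) \<and>
     is_vfun (vtimes (tcat (lth X)) (tcat (rth X))) vself (bif X) \<and>
     (\<forall>j\<in>\<J>. preserves_powers \<J> (tcat (rth X)) vself (at_left X j)) \<and>
     (\<forall>k\<in>\<J>. preserves_powers \<J> (tcat (lth X)) vself (at_right X k))"


section \<open>The category of bifold algebras\<close>

abbreviation bcat :: "('o, 'm) bifold_data \<Rightarrow> ('o \<times> 'o, 'o, 'm) vcat" where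
  "bcat X \<equiv> vtimes (tcat (lth X)) (tcat (rth X))"

text \<open>For \<open>M = (M\<^sub>l, M\<^sub>r)\<close> with domains the theories of \<open>Y\<close>, the composite \<open>D(M\<^sub>l-, M\<^sub>r?)\<close>.\<close>

definition bpair ::
  "('o, 'm) bifold_data \<Rightarrow> ('o, 'o, 'm) vfun \<Rightarrow> ('o, 'o, 'm) vfun \<Rightarrow>
   ('o \<times> 'o, 'o \<times> 'o, 'm) vfun" where
  "bpair Y Ml Mr = ftimes (tcat (lth Y)) (tcat (rth Y)) Ml Mr"

definition brestr ::
  "('o, 'm) bifold_data \<Rightarrow> ('o, 'o, 'm) vfun \<Rightarrow> ('o, 'o, 'm) vfun \<Rightarrow>
   ('o \<times> 'o, 'o, 'm) vfun \<Rightarrow> ('o \<times> 'o, 'o, 'm) vfun" where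
  "brestr Y Ml Mr D = fcomp (bcat Y) D (bpair Y Ml Mr)"

definition is_bifold_mor :: "('o, 'm) bifold_mor \<Rightarrow> bool" where
  "is_bifold_mor f \<longleftrightarrow> is_bifold (bsrc f) \<and> is_bifold (btgt f) \<and>
     theory_mor (lth (btgt f)) (lth (bsrc f)) (bml f) \<and>
     theory_mor (rth (btgt f)) (rth (bsrc f)) (bmr f) \<and>
     vnat (bcat (btgt f)) vself (brestr (btgt f) (bml f) (bmr f) (bif (bsrc f)))
       (bif (btgt f)) (bnat f)"

definition bifold_id :: "('o, 'm) bifold_data \<Rightarrow> ('o, 'm) bifold_mor" where
  "bifold_id X = \<lparr>bsrc = X, btgt = X, bml = fid (tcat (lth X)), bmr = fid (tcat (rth X)),
     bnat = nid (bcat X) vself (bif X)\<rparr>"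

text \<open>\<open>(N,h) \<cdot> (M,g) = (MN, h \<cdot> N\<^sup>*g)\<close>, where \<open>N\<^sup>*g\<close> is the transformation from
  \<open>N\<^sup>*M\<^sup>*D\<^sub>1\<close> to \<open>N\<^sup>*D\<^sub>2\<close>.\<close>

definition bifold_comp ::
  "('o, 'm) bifold_mor \<Rightarrow> ('o, 'm) bifold_mor \<Rightarrow> ('o, 'm) bifold_mor" where
  "bifold_comp n m = \<lparr>bsrc = bsrc m, btgt = btgt n,
     bml = fcomp (tcat (lth (btgt n))) (bml m) (bml n),
     bmr = fcomp (tcat (rth (btgt n))) (bmr m) (bmr n),
     bnat = ncomp (bcat (btgt n)) vself
       (brestr (btgt n) (bml n) (bmr n) (brestr (btgt m) (bml m) (bmr m) (bif (bsrc m))))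
       (brestr (btgt n) (bml n) (bmr n) (bif (btgt m)))
       (bif (btgt n))
       (bnat n)
       (wright (bcat (btgt n)) (bnat m) (bpair (btgt n) (bml n) (bmr n)))\<rparr>"

definition BAlg :: "(('o, 'm) bifold_data, ('o, 'm) bifold_mor) cat" where
  "BAlg = \<lparr>Ob = {X. is_bifold X}, Arr = {f. is_bifold_mor f}, Dom = bsrc, Cod = btgt,
     Idt = bifold_id, Cmp = bifold_comp\<rparr>"


section \<open>Algebraic dual adjunctions\<close>

definition algebraic :: "('a, 'o, 'm) over \<Rightarrow> bool" where
  "algebraic X \<longleftrightarrow> is_over X \<and> (\<exists>T. is_theory T \<and> over_equivalent X (Alg_over T))"

definition is_dual_adj :: "('a, 'b, 'o, 'm) dual_adj \<Rightarrow> bool" where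
  "is_dual_adj X \<longleftrightarrow> algebraic (dleft X) \<and> algebraic (dright X) \<and>
     is_vadj (fst (dright X)) (vop (fst (dleft X))) (dnabla X) (ddelta X) (dadj X)"

definition is_dual_cell :: "('a, 'b, 'o, 'm) dual_cell \<Rightarrow> bool" where
  "is_dual_cell P \<longleftrightarrow> is_dual_adj (csrc P) \<and> is_dual_adj (ctgt P) \<and>
     over_1cell (dleft (csrc P)) (dleft (ctgt P)) (cleft P) \<and>
     over_1cell (dright (csrc P)) (dright (ctgt P)) (cright P) \<and>
     vnat (vop (fst (dleft (csrc P)))) (fst (dright (ctgt P)))
       (fcomp (vop (fst (dleft (csrc P)))) (fst (cright P)) (ddelta (csrc P)))
       (fcomp (vop (fst (dleft (csrc P)))) (ddelta (ctgt P))
          (fop (fst (dleft (csrc P))) (fst (cleft P))))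
       (cphi P)"

definition dual_id :: "('a, 'b, 'o, 'm) dual_adj \<Rightarrow> ('a, 'b, 'o, 'm) dual_cell" where
  "dual_id X = \<lparr>csrc = X, ctgt = X, cleft = over_id (dleft X), cright = over_id (dright X),
     cphi = nid (vop (fst (dleft X))) (fst (dright X)) (ddelta X)\<rparr>"

text \<open>The transformation of the composite \<open>QP\<close> is the pasting
  \<open>(\<phi>\<^sup>Q P\<^sub>l\<^sup>o\<^sup>p) \<cdot> (Q\<^sub>r \<phi>\<^sup>P)\<close> from \<open>Q\<^sub>r P\<^sub>r \<Delta>\<^sub>1\<close> via \<open>Q\<^sub>r \<Delta>\<^sub>2 P\<^sub>l\<^sup>o\<^sup>p\<close> to
  \<open>\<Delta>\<^sub>3 Q\<^sub>l\<^sup>o\<^sup>p P\<^sub>l\<^sup>o\<^sup>p\<close>.\<close>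

definition dual_comp ::
  "('a, 'b, 'o, 'm) dual_cell \<Rightarrow> ('a, 'b, 'o, 'm) dual_cell \<Rightarrow> ('a, 'b, 'o, 'm) dual_cell" where
  "dual_comp Q P =
     (let A1 = fst (dleft (csrc P)); A2 = fst (dleft (csrc Q));
          Plop = fop A1 (fst (cleft P)); Qlop = fop A2 (fst (cleft Q));
          Pr = fst (cright P); Qr = fst (cright Q);
          D1 = ddelta (csrc P); D2 = ddelta (csrc Q); D3 = ddelta (ctgt Q)
      in \<lparr>csrc = csrc P, ctgt = ctgt Q,
          cleft = over_comp (dleft (csrc P)) (dleft (csrc Q)) (dleft (ctgt Q)) (cleft Q) (cleft P),
          cright = over_comp (dright (csrc P)) (dright (csrc Q)) (dright (ctgt Q))
            (cright Q) (cright P),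
          cphi = ncomp (vop A1) (fst (dright (ctgt Q)))
            (fcomp (vop A1) Qr (fcomp (vop A1) Pr D1))
            (fcomp (vop A1) Qr (fcomp (vop A1) D2 Plop))
            (fcomp (vop A1) D3 (fcomp (vop A1) Qlop Plop))
            (wright (vop A1) (cphi Q) Plop)
            (wleft (vop A1) Qr (fcomp (vop A1) Pr D1) (fcomp (vop A1) D2 Plop) (cphi P))\<rparr>)"

text \<open>The underlying category of the 2-category of algebraic dual adjunctions (its 1-cells;
  the 2-cells play no role here). Sizes are expressed by types: the enriched categories involved
  have objects in arbitrary types \<open>'a\<close> and \<open>'b\<close>.\<close>

definition ADA :: "(('a, 'b, 'o, 'm) dual_adj, ('a, 'b, 'o, 'm) dual_cell) cat" where
  "ADA = \<lparr>Ob = {X. is_dual_adj X}, Arr = {P. is_dual_cell P}, Dom = csrc, Cod = ctgt,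
     Idt = dual_id, Cmp = dual_comp\<rparr>"


section \<open>Dualization\<close>

text \<open>The transposes \<open>k \<mapsto> D(-,k)\<close> and \<open>j \<mapsto> D(j,-)\<close> of a bifold algebra.\<close>

definition curry_right :: "('o, 'm) bifold_data \<Rightarrow> ('o, ('o, 'm) alg, 'm) vfun" where
  "curry_right X = \<lparr>fob = (\<lambda>k\<in>\<J>. at_right X k),
     fhom = (\<lambda>k\<in>\<J>. \<lambda>k'\<in>\<J>. lift (tcat (lth X)) (at_right X k) (at_right X k')
       (vhom (tcat (rth X)) k k') (\<lambda>j. fhom (at_left X j) k k'))\<rparr>"

definition curry_left :: "('o, 'm) bifold_data \<Rightarrow> ('o, ('o, 'm) alg, 'm) vfun" where
  "curry_left X = \<lparr>fob = (\<lambda>j\<in>\<J>. at_left X j),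
     fhom = (\<lambda>j\<in>\<J>. \<lambda>j'\<in>\<J>. lift (tcat (rth X)) (at_left X j) (at_left X j')
       (vhom (tcat (lth X)) j j') (\<lambda>k. fhom (at_right X k) j j'))\<rparr>"

text \<open>For \<open>E : U \<rightarrow> T-Alg\<close>, the algebras \<open>T-Alg(A, E-)\<close> and the functor
  \<open>A \<mapsto> T-Alg(A, E-)\<close> from \<open>(T-Alg)\<^sup>o\<^sup>p\<close> to \<open>U-Alg\<close>.\<close>

definition dual_alg ::
  "('o, 'm) theory_data \<Rightarrow> ('o, 'm) theory_data \<Rightarrow> ('o, ('o, 'm) alg, 'm) vfun \<Rightarrow>
   ('o, 'm) alg \<Rightarrow> ('o, 'm) alg" where
  "dual_alg T U E A = fcomp (tcat U) (rep (Alg T) A) E"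

definition dual_fun ::
  "('o, 'm) theory_data \<Rightarrow> ('o, 'm) theory_data \<Rightarrow> ('o, ('o, 'm) alg, 'm) vfun \<Rightarrow>
   (('o, 'm) alg, ('o, 'm) alg, 'm) vfun" where
  "dual_fun T U E = \<lparr>fob = (\<lambda>A\<in>obs (Alg T). dual_alg T U E A),
     fhom = (\<lambda>A\<in>obs (Alg T). \<lambda>A'\<in>obs (Alg T).
       lift (tcat U) (dual_alg T U E A) (dual_alg T U E A') (vhom (Alg T) A' A)
         (\<lambda>k. fhom (rep (vop (Alg T)) (fob E k)) A A'))\<rparr>"

text \<open>\<open>Hom\<^sub>T(-,D) : (T-Alg)\<^sup>o\<^sup>p \<rightarrow> U-Alg\<close> and \<open>Hom\<^sub>U(-,D) : U-Alg \<rightarrow> (T-Alg)\<^sup>o\<^sup>p\<close>.\<close>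

definition Hom_left ::
  "('o, 'm) bifold_data \<Rightarrow> (('o, 'm) alg, ('o, 'm) alg, 'm) vfun" where
  "Hom_left X = dual_fun (lth X) (rth X) (curry_right X)"

definition Hom_right ::
  "('o, 'm) bifold_data \<Rightarrow> (('o, 'm) alg, ('o, 'm) alg, 'm) vfun" where
  "Hom_right X = fop (Alg (rth X)) (dual_fun (rth X) (lth X) (curry_left X))"

text \<open>The canonical arrows from \<open>T-Alg(A, Hom\<^sub>U(B,D))\<close> and from \<open>U-Alg(B, Hom\<^sub>T(A,D))\<close>
  to \<open>[Aj \<otimes> Bk, D(j,k)]\<close>, which exhibit both objects as the end of the latter over \<open>j\<close> and
  \<open>k\<close>. The comparison between the two is the dualization isomorphism.\<close>

definition can_left ::
  "('o, 'm) bifold_data \<Rightarrow> ('o, 'm) alg \<Rightarrow> ('o, 'm) alg \<Rightarrow> 'o \<Rightarrow> 'o \<Rightarrow> 'm" where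
  "can_left X B A j k =
     (let H = fob (Hom_right X) B; e = vhom (Alg (lth X)) A H;
          Aj = fob A j; Bk = fob B k; d = fob (bif X) (j, k)
      in transp e (Aj \<otimes> Bk) d
           (untransp Bk d (proj (tcat (rth X)) B (at_left X j) k) \<cdot>
            (untransp Aj (fob H j) (proj (tcat (lth X)) A H j) \<boxtimes> idt Bk) \<cdot>
            vinv (asc e Aj Bk)))"

definition can_right ::
  "('o, 'm) bifold_data \<Rightarrow> ('o, 'm) alg \<Rightarrow> ('o, 'm) alg \<Rightarrow> 'o \<Rightarrow> 'o \<Rightarrow> 'm" where
  "can_right X B A j k =
     (let H = fob (Hom_left X) A; e = vhom (Alg (rth X)) B H;
          Aj = fob A j; Bk = fob B k; d = fob (bif X) (j, k)
      in transp e (Aj \<otimes> Bk) d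
           (untransp Aj d (proj (tcat (lth X)) A (at_right X k) j) \<cdot>
            (untransp Bk (fob H k) (proj (tcat (rth X)) B H k) \<boxtimes> idt Aj) \<cdot>
            vinv (asc e Bk Aj) \<cdot> (idt e \<boxtimes> sy Aj Bk)))"

definition dual_iso :: "('o, 'm) bifold_data \<Rightarrow> ('o, 'm) alg \<Rightarrow> ('o, 'm) alg \<Rightarrow> 'm" where
  "dual_iso X = (\<lambda>B\<in>obs (Alg (rth X)). \<lambda>A\<in>obs (Alg (lth X)).
     THE h. h \<in> hom (vhom (Alg (lth X)) A (fob (Hom_right X) B))
                    (vhom (Alg (rth X)) B (fob (Hom_left X) A)) \<and>
       (\<forall>j\<in>\<J>. \<forall>k\<in>\<J>. can_right X B A j k \<cdot> h = can_left X B A j k))"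

definition Dualn_ob ::
  "('o, 'm) bifold_data \<Rightarrow> (('o, 'm) alg, ('o, 'm) alg, 'o, 'm) dual_adj" where
  "Dualn_ob X = \<lparr>dleft = Alg_over (lth X), dright = Alg_over (rth X),
     dnabla = Hom_right X, ddelta = Hom_left X, dadj = dual_iso X\<rparr>"

text \<open>The functors \<open>M\<^sub>l\<^sup>*\<close> and \<open>M\<^sub>r\<^sup>*\<close>, and the element of
  \<open>T\<^sub>2-Alg(D\<^sub>1(M\<^sub>l-, M\<^sub>r k), D\<^sub>2(-, k))\<close> with components \<open>g\<^sub>(\<^sub>j\<^sub>,\<^sub>k\<^sub>)\<close>.\<close>

definition restr_l :: "('o, 'm) bifold_mor \<Rightarrow> (('o, 'm) alg, ('o, 'm) alg, 'm) vfun" where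
  "restr_l m = restr (lth (btgt m)) (lth (bsrc m)) (bml m)"

definition restr_r :: "('o, 'm) bifold_mor \<Rightarrow> (('o, 'm) alg, ('o, 'm) alg, 'm) vfun" where
  "restr_r m = restr (rth (btgt m)) (rth (bsrc m)) (bmr m)"

definition bnat_at :: "('o, 'm) bifold_mor \<Rightarrow> 'o \<Rightarrow> 'm" where
  "bnat_at m k = lift (tcat (lth (btgt m)))
     (fob (restr_l m) (at_right (bsrc m) (fob (bmr m) k))) (at_right (btgt m) k) \<I>
     (\<lambda>j. bnat m (j, k))"

text \<open>The composite
  \<open>T\<^sub>1-Alg(A, D\<^sub>1(-,M\<^sub>r k)) \<rightarrow> T\<^sub>2-Alg(A M\<^sub>l, D\<^sub>1(M\<^sub>l-,M\<^sub>r k)) \<rightarrow> T\<^sub>2-Alg(A M\<^sub>l, D\<^sub>2(-,k))\<close>.\<close>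

definition phi_comp :: "('o, 'm) bifold_mor \<Rightarrow> ('o, 'm) alg \<Rightarrow> 'o \<Rightarrow> 'm" where
  "phi_comp m A k =
     (let D1k = at_right (bsrc m) (fob (bmr m) k)
      in post (Alg (lth (btgt m))) (fob (restr_l m) A) (fob (restr_l m) D1k) (at_right (btgt m) k)
           (bnat_at m k) \<cdot>
         fhom (restr_l m) A D1k)"

text \<open>The components of an enriched transformation are elements of hom-objects, so the
  homomorphism with components \<open>phi_comp m A k\<close> is given as an element of
  \<open>U\<^sub>2-Alg(M\<^sub>r\<^sup>* Hom\<^sub>T\<^sub>1(A,D\<^sub>1), Hom\<^sub>T\<^sub>2(A M\<^sub>l,D\<^sub>2))\<close>.\<close>

definition phi :: "('o, 'm) bifold_mor \<Rightarrow> ('o, 'm) alg \<Rightarrow> 'm" where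
  "phi m = (\<lambda>A\<in>obs (Alg (lth (bsrc m))).
     (let S = fob (restr_r m) (fob (Hom_left (bsrc m)) A);
          R = fob (Hom_left (btgt m)) (fob (restr_l m) A)
      in lift (tcat (rth (btgt m))) S R \<I> (\<lambda>k. name (fob S k) (fob R k) (phi_comp m A k))))"

definition Dualn_arr ::
  "('o, 'm) bifold_mor \<Rightarrow> (('o, 'm) alg, ('o, 'm) alg, 'o, 'm) dual_cell" where
  "Dualn_arr m = \<lparr>csrc = Dualn_ob (bsrc m), ctgt = Dualn_ob (btgt m),
     cleft = (restr_l m, nid (Alg (lth (bsrc m))) vself (eval_unit (lth (bsrc m)))),
     cright = (restr_r m, nid (Alg (rth (bsrc m))) vself (eval_unit (rth (bsrc m)))),
     cphi = phi m\<rparr>"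

end

end

theory Submission
  imports Defs
begin

text \<open>All diagrams are chased with generalized elements. An element of an object \<open>a\<close> is an arrow
  into \<open>a\<close> from the tensor product of a context, i.e. of a list of named variables, and two elements
  are paired by shuffling their contexts. The coherence of the shuffles makes every structural
  isomorphism act on elements by rearranging a tuple, \<open>[a,b]\<close> becomes a type of functions with
  application \<open>ev\<close> and extensionality, and arrows are determined by their action on elements. Hence
  each equation between composites of arrows turns into an equation between linear terms,
  and the enriched statements are proved as they would be over sets.

  In this language the dualization isomorphism sends a family \<open>\<alpha>\<^sub>j : A\<^sub>j \<rightarrow> U-Alg(B, D(j,-))\<close> to the
  family \<open>\<beta>\<^sub>k : B\<^sub>k \<rightarrow> T-Alg(A, D(-,k))\<close> with \<open>(\<beta>\<^sub>k y)\<^sub>j t = (\<alpha>\<^sub>j t)\<^sub>k y\<close>, and \<open>\<phi>\<close> is determined by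
  \<open>(\<phi>\<^sub>A \<beta>)\<^sub>j t = g\<^sub>(\<^sub>j\<^sub>,\<^sub>k\<^sub>) (\<beta>\<^sub>j t)\<close>; naturality and functoriality are read off from these formulas.
  Morphisms of theories are the identity on objects and preserve the canonical powers \<open>x \<otimes> a\<close>, hence
  all powers by arities, so that restriction preserves algebras; \<open>T-Alg(A, D(-,k))\<close> preserves
  powers in \<open>k\<close> because these are computed pointwise.\<close>

section \<open>Coherence\<close>

text \<open>Named variables make the calculus strict. If an element were an arrow out of an
  arbitrary object, \<open>x \<odot> y\<close> and \<open>y \<odot> x\<close> would have different
  domains and the symmetry could not turn one into the other by an equation; over contexts merged by
  names it does. There are no diagonals, so a pairing of elements with a common variable has no
  meaning.

  One restriction shapes many proofs: an element of \<open>a \<otimes> b\<close> need not be a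
  pairing and an element of \<open>\<I>\<close> need not be \<open>one\<close>, while evaluation,
  composition and lifting are computed on pairings and on \<open>one\<close>. Hence the various
  forms of extensionality, in which an arrow is tested on tuples of the shape of its domain, and the
  separate treatment of wedges and functors whose domain involves a tensor product or the unit.

  Since enriched functors and transformations are extensional data, the functor laws are equalities,
  not isomorphisms. They hold because composition of functors is strictly associative and morphisms
  of theories fix every object, in particular \<open>\<I>\<close>, so that restriction commutes
  strictly with evaluation.\<close>

context symmetric_monoidal_closed
begin

section \<open>Typing and inverses in the base\<close>

lemma vdom_comp [simp]: "vdom V g = vcod V f \<Longrightarrow> vdom V (g \<cdot> f) = vdom V f"
  and vcod_comp [simp]: "vdom V g = vcod V f \<Longrightarrow> vcod V (g \<cdot> f) = vcod V g"
  using cmp_hom[of f "vdom V f" "vcod V f" g "vcod V g"] by (simp_all add: Homset_def underlying_def)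

lemma vdom_idt [simp]: "vdom V (idt a) = a" and vcod_idt [simp]: "vcod V (idt a) = a"
  using idt_hom[of a] by (simp_all add: Homset_def underlying_def)

lemma comp_idt [simp]: "vdom V f = a \<Longrightarrow> f \<cdot> idt a = f"
  using cmp_idt[of f a "vcod V f"] by (simp add: Homset_def underlying_def)

lemma idt_comp [simp]: "vcod V f = a \<Longrightarrow> idt a \<cdot> f = f"
  using idt_cmp[of f "vdom V f" a] by (simp add: Homset_def underlying_def)

lemma comp_assoc [simp]:
  "vdom V g = vcod V f \<Longrightarrow> vdom V h = vcod V g \<Longrightarrow> (h \<cdot> g) \<cdot> f = h \<cdot> g \<cdot> f"
  using cmp_assoc[of f "vdom V f" "vcod V f" g "vcod V g" h "vcod V h"]
  by (simp add: Homset_def underlying_def)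

lemma vdom_tensor [simp]: "vdom V (f \<boxtimes> g) = vdom V f \<otimes> vdom V g"
  and vcod_tensor [simp]: "vcod V (f \<boxtimes> g) = vcod V f \<otimes> vcod V g"
  using tensor_hom[of f "vdom V f" "vcod V f" g "vdom V g" "vcod V g"] by simp_all

declare tensor_idt [simp]

lemma tensor_comp': "vdom V g = vcod V f \<Longrightarrow> vdom V g' = vcod V f' \<Longrightarrow>
    (g \<cdot> f) \<boxtimes> (g' \<cdot> f') = (g \<boxtimes> g') \<cdot> (f \<boxtimes> f')"
  by (rule tensor_comp[of f "vdom V f" "vcod V f" g "vcod V g"
        f' "vdom V f'" "vcod V f'" g' "vcod V g'"]) simp_all

lemma idt_tensor_comp [simp]:
  "vdom V g = vcod V f \<Longrightarrow> idt a \<boxtimes> (g \<cdot> f) = (idt a \<boxtimes> g) \<cdot> (idt a \<boxtimes> f)"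
  using tensor_comp'[of "idt a" "idt a" g f] by simp

lemma tensor_comp_idt [simp]:
  "vdom V g = vcod V f \<Longrightarrow> (g \<cdot> f) \<boxtimes> idt a = (g \<boxtimes> idt a) \<cdot> (f \<boxtimes> idt a)"
  using tensor_comp'[of g f "idt a" "idt a"] by simp

lemma vdom_asc [simp]: "vdom V (asc a b c) = (a \<otimes> b) \<otimes> c"
  and vcod_asc [simp]: "vcod V (asc a b c) = a \<otimes> b \<otimes> c"
  using asc_hom[of a b c] by simp_all

lemma vdom_lu [simp]: "vdom V (lu a) = \<I> \<otimes> a" and vcod_lu [simp]: "vcod V (lu a) = a"
  using lu_hom[of a] by simp_all

lemma vdom_ru [simp]: "vdom V (ru a) = a \<otimes> \<I>" and vcod_ru [simp]: "vcod V (ru a) = a"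
  using ru_hom[of a] by simp_all

lemma vdom_sy [simp]: "vdom V (sy a b) = a \<otimes> b" and vcod_sy [simp]: "vcod V (sy a b) = b \<otimes> a"
  using sy_hom[of a b] by simp_all

lemma vdom_ev [simp]: "vdom V (ev a b) = ih a b \<otimes> a" and vcod_ev [simp]: "vcod V (ev a b) = b"
  using ev_hom[of a b] by simp_all

lemma is_inverseI:
  assumes "vdom V f = a" "vcod V f = b" "vdom V g = b" "vcod V g = a"
    and "g \<cdot> f = idt a" "f \<cdot> g = idt b"
  shows "is_inverse f g"
  using assms by (simp add: is_inverse_def)

lemma is_inverse_unique:
  assumes "is_inverse f g" and "is_inverse f h"
  shows "g = h"
proof -
  have "g = g \<cdot> f \<cdot> h" using assms by (auto simp: is_inverse_def)
  also have "\<dots> = (g \<cdot> f) \<cdot> h" using assms by (subst comp_assoc) (auto simp: is_inverse_def)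
  also have "\<dots> = h" using assms by (auto simp: is_inverse_def)
  finally show ?thesis .
qed

lemma vinv_eq: "is_inverse f g \<Longrightarrow> vinv f = g"
  unfolding vinv_def by (blast intro: is_inverse_unique)

lemma is_inverse_vinv: "is_iso f \<Longrightarrow> is_inverse f (vinv f)"
  unfolding is_iso_def using vinv_eq by blast

lemma
  assumes "is_iso f"
  shows vdom_vinv [simp]: "vdom V (vinv f) = vcod V f"
    and vcod_vinv [simp]: "vcod V (vinv f) = vdom V f"
    and vinv_comp [simp]: "vinv f \<cdot> f = idt (vdom V f)"
    and comp_vinv [simp]: "f \<cdot> vinv f = idt (vcod V f)"
  using is_inverse_vinv[OF assms] by (simp_all add: is_inverse_def)

lemma vinv_comp_comp [simp]:
  assumes "is_iso f" "vcod V g = vdom V f" shows "vinv f \<cdot> f \<cdot> g = g"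
  using comp_assoc[of f g "vinv f"] assms by simp

lemma comp_vinv_comp [simp]:
  assumes "is_iso f" "vcod V g = vcod V f" shows "f \<cdot> vinv f \<cdot> g = g"
  using comp_assoc[of "vinv f" g f] assms by simp

declare asc_iso [simp] lu_iso [simp] ru_iso [simp] sy_sy [simp]

lemma sy_iso [simp]: "is_iso (sy a b)"
  unfolding is_iso_def by (rule exI[of _ "sy b a"]) (rule is_inverseI, auto)

lemma sy_sy_comp [simp]: "vcod V f = a \<otimes> b \<Longrightarrow> sy b a \<cdot> sy a b \<cdot> f = f"
  using comp_assoc[of "sy a b" f "sy b a"] by simp

lemma is_iso_comp:
  assumes "is_iso f" "is_iso g" "vdom V g = vcod V f"
  shows "is_iso (g \<cdot> f)"
  unfolding is_iso_def
  by (rule exI[of _ "vinv f \<cdot> vinv g"], rule is_inverseI[of _ "vdom V f" "vcod V g"])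
    (use assms in simp_all)

lemma is_iso_tensor:
  assumes "is_iso f" "is_iso g"
  shows "is_iso (f \<boxtimes> g)"
  unfolding is_iso_def
  by (rule exI[of _ "vinv f \<boxtimes> vinv g"],
      rule is_inverseI[of _ "vdom V f \<otimes> vdom V g" "vcod V f \<otimes> vcod V g"])
    (use assms in \<open>simp_all add: tensor_comp'[symmetric]\<close>)

lemma is_iso_idt [simp]: "is_iso (idt a)"
  unfolding is_iso_def by (rule exI[of _ "idt a"]) (rule is_inverseI, auto)

lemma is_iso_vinv [simp]: "is_iso f \<Longrightarrow> is_iso (vinv f)"
  unfolding is_iso_def[of "vinv f"]
  by (rule exI[of _ f], rule is_inverseI[of _ "vcod V f" "vdom V f"]) simp_all

lemma iso_cancel_right:
  assumes "is_iso h" "f \<cdot> h = g \<cdot> h" "vdom V f = vcod V h" "vdom V g = vcod V h"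
  shows "f = g"
proof -
  have "(f \<cdot> h) \<cdot> vinv h = (g \<cdot> h) \<cdot> vinv h" using assms by simp
  then show ?thesis using assms(1,3,4) by simp
qed

lemma iso_cancel_left:
  assumes "is_iso h" "h \<cdot> f = h \<cdot> g" "vdom V h = vcod V f" "vdom V h = vcod V g"
  shows "f = g"
proof -
  have "vinv h \<cdot> h \<cdot> f = vinv h \<cdot> h \<cdot> g" using assms by simp
  then show ?thesis using assms(1,3,4) by (metis vinv_comp_comp)
qed

lemma asc_nat': "asc (vcod V f) (vcod V g) (vcod V h) \<cdot> ((f \<boxtimes> g) \<boxtimes> h) =
    (f \<boxtimes> (g \<boxtimes> h)) \<cdot> asc (vdom V f) (vdom V g) (vdom V h)"
  by (rule asc_nat) simp_all

lemma sy_nat': "sy (vcod V f) (vcod V g) \<cdot> (f \<boxtimes> g) = (g \<boxtimes> f) \<cdot> sy (vdom V f) (vdom V g)"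
  by (rule sy_nat) simp_all

lemma vinv_asc_nat: "vinv (asc (vcod V f) (vcod V g) (vcod V h)) \<cdot> (f \<boxtimes> (g \<boxtimes> h)) =
    ((f \<boxtimes> g) \<boxtimes> h) \<cdot> vinv (asc (vdom V f) (vdom V g) (vdom V h))"
proof (rule iso_cancel_left[of "asc (vcod V f) (vcod V g) (vcod V h)"])
  have "asc (vcod V f) (vcod V g) (vcod V h) \<cdot> ((f \<boxtimes> g) \<boxtimes> h) \<cdot>
      vinv (asc (vdom V f) (vdom V g) (vdom V h)) = f \<boxtimes> (g \<boxtimes> h)"
    by (subst comp_assoc[symmetric]) (simp_all add: asc_nat')
  then show "asc (vcod V f) (vcod V g) (vcod V h) \<cdot>
      vinv (asc (vcod V f) (vcod V g) (vcod V h)) \<cdot> (f \<boxtimes> (g \<boxtimes> h)) =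
      asc (vcod V f) (vcod V g) (vcod V h) \<cdot> ((f \<boxtimes> g) \<boxtimes> h) \<cdot>
        vinv (asc (vdom V f) (vdom V g) (vdom V h))" by simp
qed simp_all

section \<open>Coherence of the unit isomorphisms\<close>

lemma unit_tensor_faithful:
  assumes "idt \<I> \<boxtimes> f = idt \<I> \<boxtimes> g" "vdom V f = vdom V g" "vcod V f = vcod V g"
  shows "f = g"
proof -
  have "f \<cdot> lu (vdom V f) = g \<cdot> lu (vdom V g)"
    using lu_nat[of f "vdom V f" "vcod V f"] lu_nat[of g "vdom V g" "vcod V g"] assms by simp
  then show ?thesis using assms by (auto intro: iso_cancel_right[of "lu (vdom V f)"])
qed

lemma tensor_unit_faithful:
  assumes "f \<boxtimes> idt \<I> = g \<boxtimes> idt \<I>" "vdom V f = vdom V g" "vcod V f = vcod V g"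
  shows "f = g"
proof -
  have "f \<cdot> ru (vdom V f) = g \<cdot> ru (vdom V g)"
    using ru_nat[of f "vdom V f" "vcod V f"] ru_nat[of g "vdom V g" "vcod V g"] assms by simp
  then show ?thesis using assms by (auto intro: iso_cancel_right[of "ru (vdom V f)"])
qed

text \<open>Kelly's argument: after tensoring with \<open>\<I>\<close>, which loses nothing by
  naturality of \<open>lu\<close>, the pentagon at \<open>\<I>, \<I>, a, b\<close> and two triangles
  apply. The invertible \<open>?k\<close> completes the diagram to that pentagon and is cancelled at
  the end.\<close>

lemma lu_tensor: "lu (a \<otimes> b) \<cdot> asc \<I> a b = lu a \<boxtimes> idt b"
proof (rule unit_tensor_faithful)
  let ?k = "asc \<I> (\<I> \<otimes> a) b \<cdot> (asc \<I> \<I> a \<boxtimes> idt b)"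
  have "(idt \<I> \<boxtimes> lu (a \<otimes> b)) \<cdot> (idt \<I> \<boxtimes> asc \<I> a b) \<cdot> ?k =
      (idt \<I> \<boxtimes> lu (a \<otimes> b)) \<cdot> asc \<I> \<I> (a \<otimes> b) \<cdot> asc (\<I> \<otimes> \<I>) a b"
    by (simp add: pentagon)
  also have "\<dots> = ((idt \<I> \<boxtimes> lu (a \<otimes> b)) \<cdot> asc \<I> \<I> (a \<otimes> b)) \<cdot> asc (\<I> \<otimes> \<I>) a b" by simp
  also have "\<dots> = (ru \<I> \<boxtimes> (idt a \<boxtimes> idt b)) \<cdot> asc (\<I> \<otimes> \<I>) a b"
    by (simp only: triangle tensor_idt)
  also have "\<dots> = asc \<I> a b \<cdot> ((ru \<I> \<boxtimes> idt a) \<boxtimes> idt b)"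
    using asc_nat'[of "ru \<I>" "idt a" "idt b"] by (simp del: tensor_idt)
  also have "\<dots> = (asc \<I> a b \<cdot> ((idt \<I> \<boxtimes> lu a) \<boxtimes> idt b)) \<cdot> (asc \<I> \<I> a \<boxtimes> idt b)"
    by (simp add: triangle[symmetric])
  also have "\<dots> = (idt \<I> \<boxtimes> (lu a \<boxtimes> idt b)) \<cdot> ?k"
    using asc_nat'[of "idt \<I>" "lu a" "idt b"] by simp
  finally have *: "(idt \<I> \<boxtimes> (lu (a \<otimes> b) \<cdot> asc \<I> a b)) \<cdot> ?k = (idt \<I> \<boxtimes> (lu a \<boxtimes> idt b)) \<cdot> ?k"
    by simp
  show "idt \<I> \<boxtimes> (lu (a \<otimes> b) \<cdot> asc \<I> a b) = idt \<I> \<boxtimes> (lu a \<boxtimes> idt b)"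
    by (rule iso_cancel_right[of ?k, OF _ *]) (simp_all add: is_iso_comp is_iso_tensor)
qed simp_all

text \<open>The hexagon that carries \<open>a\<close> past \<open>\<I> \<otimes> \<I>\<close>,
  followed by the left unit of the target, compares \<open>ru a \<boxtimes> idt \<I>\<close> with
  \<open>(lu a \<cdot> sy a \<I>) \<boxtimes> idt \<I>\<close>, both followed by the invertible
  \<open>sy a \<I>\<close>, which cancels.\<close>

lemma lu_sy: "lu a \<cdot> sy a \<I> = ru a"
proof (rule tensor_unit_faithful)
  let ?c = "\<I>"
  have 1: "lu (?c \<otimes> a) \<cdot> asc \<I> ?c a \<cdot> sy a (\<I> \<otimes> ?c) \<cdot> asc a \<I> ?c = sy a ?c \<cdot> (ru a \<boxtimes> idt ?c)"
  proof -
    have "lu (?c \<otimes> a) \<cdot> asc \<I> ?c a \<cdot> sy a (\<I> \<otimes> ?c) \<cdot> asc a \<I> ?c =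
        (lu (?c \<otimes> a) \<cdot> asc \<I> ?c a) \<cdot> sy a (\<I> \<otimes> ?c) \<cdot> asc a \<I> ?c" by simp
    also have "\<dots> = ((lu ?c \<boxtimes> idt a) \<cdot> sy a (\<I> \<otimes> ?c)) \<cdot> asc a \<I> ?c"
      by (simp only: lu_tensor) simp
    also have "\<dots> = (sy a ?c \<cdot> (idt a \<boxtimes> lu ?c)) \<cdot> asc a \<I> ?c"
      using sy_nat'[of "idt a" "lu ?c"] by simp
    also have "\<dots> = sy a ?c \<cdot> (ru a \<boxtimes> idt ?c)" by (simp add: triangle)
    finally show ?thesis .
  qed
  have 2: "lu (?c \<otimes> a) \<cdot> (idt \<I> \<boxtimes> sy a ?c) \<cdot> asc \<I> a ?c \<cdot> (sy a \<I> \<boxtimes> idt ?c) =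
      sy a ?c \<cdot> ((lu a \<cdot> sy a \<I>) \<boxtimes> idt ?c)"
  proof -
    have "lu (?c \<otimes> a) \<cdot> (idt \<I> \<boxtimes> sy a ?c) \<cdot> asc \<I> a ?c \<cdot> (sy a \<I> \<boxtimes> idt ?c) =
        (lu (?c \<otimes> a) \<cdot> (idt \<I> \<boxtimes> sy a ?c)) \<cdot> asc \<I> a ?c \<cdot> (sy a \<I> \<boxtimes> idt ?c)" by simp
    also have "\<dots> = (sy a ?c \<cdot> lu (a \<otimes> ?c)) \<cdot> asc \<I> a ?c \<cdot> (sy a \<I> \<boxtimes> idt ?c)"
      using lu_nat[of "sy a ?c" "a \<otimes> ?c" "?c \<otimes> a"] by simp
    also have "\<dots> = sy a ?c \<cdot> (lu (a \<otimes> ?c) \<cdot> asc \<I> a ?c) \<cdot> (sy a \<I> \<boxtimes> idt ?c)" by simp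
    also have "\<dots> = sy a ?c \<cdot> ((lu a \<cdot> sy a \<I>) \<boxtimes> idt ?c)" by (simp add: lu_tensor)
    finally show ?thesis .
  qed
  have "sy a ?c \<cdot> ((lu a \<cdot> sy a \<I>) \<boxtimes> idt ?c) = sy a ?c \<cdot> (ru a \<boxtimes> idt ?c)"
    using 1 2 hexagon[of \<I> ?c a] by metis
  then show "(lu a \<cdot> sy a \<I>) \<boxtimes> idt \<I> = ru a \<boxtimes> idt \<I>"
    by (rule iso_cancel_left[rotated]) simp_all
qed simp_all

lemma ru_sy: "ru a \<cdot> sy \<I> a = lu a"
  by (simp add: lu_sy[symmetric])

text \<open>Naturality of \<open>lu\<close> at the arrow \<open>lu \<I>\<close> identifies
  \<open>lu (\<I> \<otimes> \<I>)\<close> with \<open>idt \<I> \<boxtimes> lu \<I>\<close>; then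
  \<open>lu_tensor\<close> and the triangle compare both units.\<close>

lemma lu_unit: "lu \<I> = ru \<I>"
proof (rule tensor_unit_faithful)
  have "lu \<I> \<cdot> lu (\<I> \<otimes> \<I>) = lu \<I> \<cdot> (idt \<I> \<boxtimes> lu \<I>)"
    using lu_nat[of "lu \<I>" "\<I> \<otimes> \<I>" \<I>] by simp
  then have "lu (\<I> \<otimes> \<I>) = idt \<I> \<boxtimes> lu \<I>" by (rule iso_cancel_left[rotated]) simp_all
  then show "lu \<I> \<boxtimes> idt \<I> = ru \<I> \<boxtimes> idt \<I>" using lu_tensor[of \<I> \<I>] triangle[of \<I> \<I>] by simp
qed simp_all

text \<open>The mirror image of \<open>lu_tensor\<close>, transported along the symmetry by the
  hexagon instead of repeating the pentagon argument.\<close>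

lemma ru_tensor: "(idt a \<boxtimes> ru b) \<cdot> asc a b \<I> = ru (a \<otimes> b)"
proof -
  have hx: "asc a b \<I> \<cdot> sy \<I> (a \<otimes> b) \<cdot> asc \<I> a b =
      (idt a \<boxtimes> sy \<I> b) \<cdot> asc a \<I> b \<cdot> (sy \<I> a \<boxtimes> idt b)" by (rule hexagon)
  have "(idt a \<boxtimes> ru b) \<cdot> asc a b \<I> \<cdot> sy \<I> (a \<otimes> b) \<cdot> asc \<I> a b =
      ((idt a \<boxtimes> ru b) \<cdot> (idt a \<boxtimes> sy \<I> b)) \<cdot> asc a \<I> b \<cdot> (sy \<I> a \<boxtimes> idt b)"
    by (simp add: hx)
  also have "\<dots> = (idt a \<boxtimes> lu b) \<cdot> asc a \<I> b \<cdot> (sy \<I> a \<boxtimes> idt b)"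
    by (subst idt_tensor_comp[symmetric]) (simp_all add: ru_sy)
  also have "\<dots> = ((idt a \<boxtimes> lu b) \<cdot> asc a \<I> b) \<cdot> (sy \<I> a \<boxtimes> idt b)" by simp
  also have "\<dots> = lu a \<boxtimes> idt b"
    by (simp only: triangle) (simp add: tensor_comp_idt[symmetric] ru_sy del: tensor_comp_idt)
  also have "\<dots> = ru (a \<otimes> b) \<cdot> sy \<I> (a \<otimes> b) \<cdot> asc \<I> a b"
    by (simp add: ru_sy lu_sy lu_tensor[symmetric] flip: lu_sy)
  finally have "((idt a \<boxtimes> ru b) \<cdot> asc a b \<I>) \<cdot> (sy \<I> (a \<otimes> b) \<cdot> asc \<I> a b) =
      ru (a \<otimes> b) \<cdot> sy \<I> (a \<otimes> b) \<cdot> asc \<I> a b" by simp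
  then show ?thesis by (rule iso_cancel_right[rotated]) (simp_all add: is_iso_comp)
qed

section \<open>Moving one factor through a tensor product\<close>

lemma left_pentagon:
  "asc (r \<otimes> s) t u \<cdot> (vinv (asc r s t) \<boxtimes> idt u) \<cdot> vinv (asc r (s \<otimes> t) u) =
   vinv (asc r s (t \<otimes> u)) \<cdot> (idt r \<boxtimes> asc s t u)"
proof -
  have "vinv (asc r s (t \<otimes> u)) \<cdot> (asc r s (t \<otimes> u) \<cdot> asc (r \<otimes> s) t u) \<cdot>
      (vinv (asc r s t) \<boxtimes> idt u) \<cdot> vinv (asc r (s \<otimes> t) u) =
    vinv (asc r s (t \<otimes> u)) \<cdot> (idt r \<boxtimes> asc s t u) \<cdot> asc r (s \<otimes> t) u \<cdot>
      ((asc r s t \<boxtimes> idt u) \<cdot> (vinv (asc r s t) \<boxtimes> idt u)) \<cdot> vinv (asc r (s \<otimes> t) u)"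
    by (simp add: pentagon)
  then show ?thesis
    by (simp add: tensor_comp_idt[symmetric] del: tensor_comp_idt)
qed

text \<open>The step of a shuffle in which the leading variable, of type \<open>r\<close>, comes
  from the second context: it has to pass the whole first context \<open>s\<close>.\<close>

definition swap_left :: "'o \<Rightarrow> 'o \<Rightarrow> 'o \<Rightarrow> 'm" where
  "swap_left r s t = asc s r t \<cdot> (sy r s \<boxtimes> idt t) \<cdot> vinv (asc r s t)"

lemma vdom_swap_left [simp]: "vdom V (swap_left r s t) = r \<otimes> s \<otimes> t"
  and vcod_swap_left [simp]: "vcod V (swap_left r s t) = s \<otimes> r \<otimes> t"
  by (simp_all add: swap_left_def)

lemma is_iso_swap_left [simp]: "is_iso (swap_left r s t)"
  by (simp add: swap_left_def is_iso_comp is_iso_tensor)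

lemma swap_left_nat:
  "swap_left r (vcod V f) (vcod V g) \<cdot> (idt r \<boxtimes> (f \<boxtimes> g)) =
   (f \<boxtimes> (idt r \<boxtimes> g)) \<cdot> swap_left r (vdom V f) (vdom V g)"
proof -
  let ?s = "vdom V f" and ?s' = "vcod V f" and ?t = "vdom V g" and ?t' = "vcod V g"
  have "swap_left r ?s' ?t' \<cdot> (idt r \<boxtimes> (f \<boxtimes> g)) =
      asc ?s' r ?t' \<cdot> (sy r ?s' \<boxtimes> idt ?t') \<cdot> ((idt r \<boxtimes> f) \<boxtimes> g) \<cdot> vinv (asc r ?s ?t)"
    using vinv_asc_nat[of "idt r" f g] by (simp add: swap_left_def)
  also have "\<dots> = asc ?s' r ?t' \<cdot> ((sy r ?s' \<cdot> (idt r \<boxtimes> f)) \<boxtimes> (idt ?t' \<cdot> g)) \<cdot> vinv (asc r ?s ?t)"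
    by (subst tensor_comp') simp_all
  also have "sy r ?s' \<cdot> (idt r \<boxtimes> f) = (f \<boxtimes> idt r) \<cdot> sy r ?s"
    using sy_nat'[of "idt r" f] by simp
  also have "asc ?s' r ?t' \<cdot> (((f \<boxtimes> idt r) \<cdot> sy r ?s) \<boxtimes> (idt ?t' \<cdot> g)) \<cdot> vinv (asc r ?s ?t) =
     asc ?s' r ?t' \<cdot> (((f \<boxtimes> idt r) \<cdot> sy r ?s) \<boxtimes> (g \<cdot> idt ?t)) \<cdot> vinv (asc r ?s ?t)" by simp
  also have "\<dots> = (asc ?s' r ?t' \<cdot> ((f \<boxtimes> idt r) \<boxtimes> g)) \<cdot> (sy r ?s \<boxtimes> idt ?t) \<cdot> vinv (asc r ?s ?t)"
    by (subst tensor_comp') simp_all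
  also have "\<dots> = (f \<boxtimes> (idt r \<boxtimes> g)) \<cdot> swap_left r ?s ?t"
    using asc_nat'[of f "idt r" g] by (simp add: swap_left_def)
  finally show ?thesis .
qed

text \<open>Reassociation after a leading factor \<open>r\<close> has been inserted into the middle
  one of three factors. Together with \<open>left_pentagon\<close> (first factor) and
  \<open>asc_swap_left'\<close> (last factor) this provides the diagram for each inductive case of
  \<open>shuffle_assoc\<close>.\<close>

lemma asc_swap_left:
  "asc s (r \<otimes> t) u \<cdot> (swap_left r s t \<boxtimes> idt u) \<cdot> vinv (asc r (s \<otimes> t) u) =
   (idt s \<boxtimes> vinv (asc r t u)) \<cdot> swap_left r s (t \<otimes> u) \<cdot> (idt r \<boxtimes> asc s t u)"
proof -
  have 1: "(vinv (asc r s t) \<boxtimes> idt u) \<cdot> vinv (asc r (s \<otimes> t) u) =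
      vinv (asc (r \<otimes> s) t u) \<cdot> vinv (asc r s (t \<otimes> u)) \<cdot> (idt r \<boxtimes> asc s t u)"
    by (subst left_pentagon[symmetric]) simp
  have 2: "((sy r s \<boxtimes> idt t) \<boxtimes> idt u) \<cdot> vinv (asc (r \<otimes> s) t u) \<cdot> h =
      vinv (asc (s \<otimes> r) t u) \<cdot> (sy r s \<boxtimes> idt (t \<otimes> u)) \<cdot> h" if "vcod V h = (r \<otimes> s) \<otimes> (t \<otimes> u)" for h
    using vinv_asc_nat[of "sy r s" "idt t" "idt u"] that
    by (simp add: comp_assoc[symmetric] del: comp_assoc)
  have "(idt s \<boxtimes> asc r t u) \<cdot> asc s (r \<otimes> t) u \<cdot> (asc s r t \<boxtimes> idt u) =
      asc s r (t \<otimes> u) \<cdot> asc (s \<otimes> r) t u"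
    by (simp add: pentagon)
  then have "(idt s \<boxtimes> vinv (asc r t u)) \<cdot> ((idt s \<boxtimes> asc r t u) \<cdot> asc s (r \<otimes> t) u \<cdot> (asc s r t \<boxtimes> idt u)) =
      (idt s \<boxtimes> vinv (asc r t u)) \<cdot> asc s r (t \<otimes> u) \<cdot> asc (s \<otimes> r) t u" by simp
  then have "((idt s \<boxtimes> vinv (asc r t u)) \<cdot> (idt s \<boxtimes> asc r t u)) \<cdot> asc s (r \<otimes> t) u \<cdot> (asc s r t \<boxtimes> idt u) =
      (idt s \<boxtimes> vinv (asc r t u)) \<cdot> asc s r (t \<otimes> u) \<cdot> asc (s \<otimes> r) t u" by simp
  then have 3: "asc s (r \<otimes> t) u \<cdot> (asc s r t \<boxtimes> idt u) =
      (idt s \<boxtimes> vinv (asc r t u)) \<cdot> asc s r (t \<otimes> u) \<cdot> asc (s \<otimes> r) t u"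
    by (simp add: idt_tensor_comp[symmetric] del: idt_tensor_comp)
  have 4: "asc s (r \<otimes> t) u \<cdot> (asc s r t \<boxtimes> idt u) \<cdot> h =
      (idt s \<boxtimes> vinv (asc r t u)) \<cdot> asc s r (t \<otimes> u) \<cdot> asc (s \<otimes> r) t u \<cdot> h"
    if "vcod V h = ((s \<otimes> r) \<otimes> t) \<otimes> u" for h
    using arg_cong[OF 3, of "\<lambda>k. k \<cdot> h"] that by simp
  show ?thesis by (simp add: swap_left_def 1 2 4)
qed

lemma asc_swap_left':
  "asc s t (r \<otimes> u) \<cdot> swap_left r (s \<otimes> t) u =
   (idt s \<boxtimes> swap_left r t u) \<cdot> swap_left r s (t \<otimes> u) \<cdot> (idt r \<boxtimes> asc s t u)"
proof -
  \<comment> \<open>The hexagon solved for \<open>sy r (s \<otimes> t)\<close>: to pass a product is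
    to pass its factors in turn.\<close>
  have "vinv (asc s t r) \<cdot> (asc s t r \<cdot> sy r (s \<otimes> t) \<cdot> asc r s t) \<cdot> vinv (asc r s t) =
      vinv (asc s t r) \<cdot> ((idt s \<boxtimes> sy r t) \<cdot> asc s r t \<cdot> (sy r s \<boxtimes> idt t)) \<cdot> vinv (asc r s t)"
    by (simp only: hexagon)
  then have h: "sy r (s \<otimes> t) = vinv (asc s t r) \<cdot> (idt s \<boxtimes> sy r t) \<cdot> swap_left r s t"
    by (simp add: swap_left_def)
  have "asc s t (r \<otimes> u) \<cdot> asc (s \<otimes> t) r u \<cdot> (vinv (asc s t r) \<boxtimes> idt u) =
      (asc s t (r \<otimes> u) \<cdot> asc (s \<otimes> t) r u) \<cdot> (vinv (asc s t r) \<boxtimes> idt u)" by simp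
  also have "\<dots> = (idt s \<boxtimes> asc t r u) \<cdot> asc s (t \<otimes> r) u \<cdot>
      ((asc s t r \<boxtimes> idt u) \<cdot> (vinv (asc s t r) \<boxtimes> idt u))"
    by (simp only: pentagon) simp
  also have "\<dots> = (idt s \<boxtimes> asc t r u) \<cdot> asc s (t \<otimes> r) u"
    by (simp add: tensor_comp_idt[symmetric] del: tensor_comp_idt)
  finally have p: "asc s t (r \<otimes> u) \<cdot> asc (s \<otimes> t) r u \<cdot> (vinv (asc s t r) \<boxtimes> idt u) =
      (idt s \<boxtimes> asc t r u) \<cdot> asc s (t \<otimes> r) u" .
  have p': "asc s t (r \<otimes> u) \<cdot> asc (s \<otimes> t) r u \<cdot> (vinv (asc s t r) \<boxtimes> idt u) \<cdot> h =
      (idt s \<boxtimes> asc t r u) \<cdot> asc s (t \<otimes> r) u \<cdot> h" if "vcod V h = (s \<otimes> t \<otimes> r) \<otimes> u" for h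
    using arg_cong[OF p, of "\<lambda>k. k \<cdot> h"] that by simp
  have n: "asc s (t \<otimes> r) u \<cdot> ((idt s \<boxtimes> sy r t) \<boxtimes> idt u) \<cdot> h =
      (idt s \<boxtimes> (sy r t \<boxtimes> idt u)) \<cdot> asc s (r \<otimes> t) u \<cdot> h" if "vcod V h = (s \<otimes> r \<otimes> t) \<otimes> u" for h
    using arg_cong[OF asc_nat'[of "idt s" "sy r t" "idt u"], of "\<lambda>k. k \<cdot> h"] that by simp
  have "asc s t (r \<otimes> u) \<cdot> swap_left r (s \<otimes> t) u =
      (idt s \<boxtimes> asc t r u) \<cdot> (idt s \<boxtimes> (sy r t \<boxtimes> idt u)) \<cdot>
      asc s (r \<otimes> t) u \<cdot> (swap_left r s t \<boxtimes> idt u) \<cdot> vinv (asc r (s \<otimes> t) u)"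
    by (simp add: swap_left_def[of r "s \<otimes> t" u] h p' n)
  also have "\<dots> = (idt s \<boxtimes> swap_left r t u) \<cdot> swap_left r s (t \<otimes> u) \<cdot> (idt r \<boxtimes> asc s t u)"
    by (simp only: asc_swap_left) (simp add: swap_left_def[of r t u])
  finally show ?thesis .
qed

text \<open>The hexagon once more, in the form that moves a whole context past another one. It says
  that \<open>?X \<cdot> ?R\<close> is an identity, and \<open>?Y\<close> is inverse to
  \<open>?R\<close>; hence \<open>?X = ?Y\<close>.\<close>

lemma sy_tensor: "sy (r \<otimes> s) t \<cdot> vinv (asc r s t) = swap_left r t s \<cdot> (idt r \<boxtimes> sy s t)"
proof (rule iso_cancel_left[of "vinv (asc t r s)"])
  let ?R = "(idt r \<boxtimes> sy t s) \<cdot> asc r t s \<cdot> (sy t r \<boxtimes> idt s)"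
  let ?Y = "(sy r t \<boxtimes> idt s) \<cdot> vinv (asc r t s) \<cdot> (idt r \<boxtimes> sy s t)"
  let ?X = "vinv (asc t r s) \<cdot> sy (r \<otimes> s) t \<cdot> vinv (asc r s t)"
  have a: "(sy t r \<boxtimes> idt s) \<cdot> (sy r t \<boxtimes> idt s) \<cdot> h = h" if "vcod V h = (r \<otimes> t) \<otimes> s" for h
    using arg_cong[OF tensor_comp_idt[of "sy t r" "sy r t" s, symmetric], of "\<lambda>k. k \<cdot> h"] that
    by (simp del: tensor_comp_idt)
  have b: "(idt r \<boxtimes> sy t s) \<cdot> (idt r \<boxtimes> sy s t) = idt (r \<otimes> s \<otimes> t)"
    using idt_tensor_comp[of "sy t s" "sy s t" r] by simp
  have "?X = ?X \<cdot> ?R \<cdot> ?Y" by (simp add: a b)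
  also have "\<dots> = (?X \<cdot> ?R) \<cdot> ?Y" by simp
  also have "?X \<cdot> ?R = idt ((t \<otimes> r) \<otimes> s)" by (simp add: hexagon[symmetric])
  also have "idt ((t \<otimes> r) \<otimes> s) \<cdot> ?Y = ?Y" by simp
  finally have "?X = ?Y" .
  then show "vinv (asc t r s) \<cdot> sy (r \<otimes> s) t \<cdot> vinv (asc r s t) =
    vinv (asc t r s) \<cdot> swap_left r t s \<cdot> (idt r \<boxtimes> sy s t)" by (simp add: swap_left_def)
qed simp_all

text \<open>A context is a list of named variables with their types. Merging two contexts by increasing
  names is associative, and commutative for contexts without common names; this makes the
  coherence of the shuffles below an induction with one diagram for each choice of the
  smallest variable.\<close>

primrec tens :: "(nat \<times> 'o) list \<Rightarrow> 'o" where
  "tens [] = \<I>"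
| "tens (x # S) = snd x \<otimes> tens S"

fun merge_ctx :: "(nat \<times> 'o) list \<Rightarrow> (nat \<times> 'o) list \<Rightarrow> (nat \<times> 'o) list" where
  "merge_ctx [] T = T"
| "merge_ctx (x # S) [] = x # S"
| "merge_ctx (x # S) (y # T) =
     (if fst x < fst y then x # merge_ctx S (y # T) else y # merge_ctx (x # S) T)"

text \<open>It points from the merged context to the two parts, because a pairing is formed by
  precomposition. On equal names the head of the second list goes first, as in
  \<open>merge_ctx\<close>; associativity survives this, and commutativity is claimed for disjoint
  names.\<close>

fun shuffle :: "(nat \<times> 'o) list \<Rightarrow> (nat \<times> 'o) list \<Rightarrow> 'm" where
  "shuffle [] T = vinv (lu (tens T))"
| "shuffle (x # S) [] = vinv (ru (tens (x # S)))"
| "shuffle (x # S) (y # T) =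
     (if fst x < fst y
      then vinv (asc (snd x) (tens S) (tens (y # T))) \<cdot> (idt (snd x) \<boxtimes> shuffle S (y # T))
      else swap_left (snd y) (tens (x # S)) (tens T) \<cdot> (idt (snd y) \<boxtimes> shuffle (x # S) T))"

lemma merge_ctx_Nil [simp]: "merge_ctx S [] = S"
  by (cases S) auto

lemma shuffle_Nil [simp]: "shuffle S [] = vinv (ru (tens S))"
  by (cases S) (auto simp: lu_unit)

lemma set_merge_ctx [simp]: "set (merge_ctx S T) = set S \<union> set T"
  by (induction S T rule: merge_ctx.induct) auto

lemma shuffle_typing: "vdom V (shuffle S T) = tens (merge_ctx S T) \<and>
    vcod V (shuffle S T) = tens S \<otimes> tens T \<and> is_iso (shuffle S T)"
  by (induction S T rule: shuffle.induct) (simp_all add: is_iso_comp is_iso_tensor)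

lemma vdom_shuffle [simp]: "vdom V (shuffle S T) = tens (merge_ctx S T)"
  and vcod_shuffle [simp]: "vcod V (shuffle S T) = tens S \<otimes> tens T"
  and is_iso_shuffle [simp]: "is_iso (shuffle S T)"
  using shuffle_typing by simp_all

lemma merge_ctx_commute:
  "fst ` set S \<inter> fst ` set T = {} \<Longrightarrow> merge_ctx S T = merge_ctx T S"
proof (induction S T rule: merge_ctx.induct)
  case (3 x S y T)
  then have "fst x \<noteq> fst y" by auto
  with 3 show ?case by (cases "fst x < fst y") auto
qed auto

lemma merge_ctx_assoc: "merge_ctx (merge_ctx S T) U = merge_ctx S (merge_ctx T U)"
proof (induction "length S + length T + length U" arbitrary: S T U rule: less_induct)
  case less
  show ?case
  proof (cases "S = [] \<or> T = [] \<or> U = []")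
    case False
    then obtain x S' y T' z U' where [simp]: "S = x # S'" "T = y # T'" "U = z # U'"
      by (meson list.exhaust)
    show ?thesis
      using less[of S' T U] less[of S T' U] less[of S T U']
      by (cases "fst x < fst y"; cases "fst y < fst z"; cases "fst x < fst z") auto
  qed auto
qed

lemma shuffle_commute:
  "fst ` set S \<inter> fst ` set T = {} \<Longrightarrow> sy (tens S) (tens T) \<cdot> shuffle S T = shuffle T S"
proof (induction S T rule: merge_ctx.induct)
  case (1 T)
  have "(ru (tens T) \<cdot> sy \<I> (tens T)) \<cdot> vinv (lu (tens T)) = idt (tens T)"
    by (simp only: ru_sy) simp
  then have "vinv (ru (tens T)) \<cdot> ru (tens T) \<cdot> sy \<I> (tens T) \<cdot> vinv (lu (tens T)) = vinv (ru (tens T))"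
    by simp
  then show ?case by simp
next
  case (2 x S)
  let ?s = "tens (x # S)"
  have "(lu ?s \<cdot> sy ?s \<I>) \<cdot> vinv (ru ?s) = idt ?s" by (simp only: lu_sy) simp
  then have "vinv (lu ?s) \<cdot> lu ?s \<cdot> sy ?s \<I> \<cdot> vinv (ru ?s) = vinv (lu ?s)" by simp
  then show ?case by simp
next
  case (3 x S y T)
  have step: "sy (r \<otimes> s) t \<cdot> vinv (asc r s t) \<cdot> (idt r \<boxtimes> g) =
      swap_left r t s \<cdot> (idt r \<boxtimes> (sy s t \<cdot> g))" if "vcod V g = s \<otimes> t" for r s t g
    using arg_cong[OF sy_tensor[of r s t], of "\<lambda>k. k \<cdot> (idt r \<boxtimes> g)"] that by simp
  from 3 have ne: "fst x \<noteq> fst y" by auto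
  show ?case
  proof (cases "fst x < fst y")
    case True
    with 3 show ?thesis by (simp add: step[simplified])
  next
    case False
    \<comment> \<open>\<open>step\<close> treats a leading variable of the first context. Here it
      belongs to the second one, so \<open>step\<close> is applied to the contexts in exchanged
      order and the outer symmetry is undone with \<open>sy_sy\<close>.\<close>
    with 3 have IH: "sy (tens (x # S)) (tens T) \<cdot> shuffle (x # S) T = shuffle T (x # S)" by auto
    have "sy (tens (y # T)) (tens (x # S)) \<cdot> shuffle (y # T) (x # S) =
        swap_left (snd y) (tens (x # S)) (tens T) \<cdot>
          (idt (snd y) \<boxtimes> (sy (tens T) (tens (x # S)) \<cdot> shuffle T (x # S)))"
      using False ne step[of "shuffle T (x # S)" "tens T" "tens (x # S)" "snd y"]
      by (simp del: idt_tensor_comp)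
    also have "\<dots> = shuffle (x # S) (y # T)"
      using False by (simp add: IH[symmetric] del: idt_tensor_comp)
    finally have "sy (tens (x # S)) (tens (y # T)) \<cdot> sy (tens (y # T)) (tens (x # S)) \<cdot>
      shuffle (y # T) (x # S) = sy (tens (x # S)) (tens (y # T)) \<cdot> shuffle (x # S) (y # T)" by simp
    then show ?thesis using merge_ctx_commute[of "y # T" "x # S"] 3(3) 
      by (simp only: sy_sy_comp vcod_shuffle)
  qed
qed

lemma shuffle_assoc:
  "asc (tens S) (tens T) (tens U) \<cdot> (shuffle S T \<boxtimes> idt (tens U)) \<cdot> shuffle (merge_ctx S T) U =
   (idt (tens S) \<boxtimes> shuffle T U) \<cdot> shuffle S (merge_ctx T U)"
  (is "?A S T U")
proof (induction "length S + length T + length U" arbitrary: S T U rule: less_induct)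
  case less
  consider "S = []" | "T = []" | "U = []"
    | x S' y T' z U' where "S = x # S'" "T = y # T'" "U = z # U'"
    by (meson list.exhaust)
  then show ?case
  proof cases
    case 1
    let ?t = "tens T" and ?u = "tens U"
    have "(lu (?t \<otimes> ?u) \<cdot> asc \<I> ?t ?u) \<cdot> (vinv (lu ?t) \<boxtimes> idt ?u) = idt (?t \<otimes> ?u)"
      by (simp only: lu_tensor)
        (simp add: tensor_comp_idt[symmetric] del: tensor_comp_idt)
    then have a: "asc \<I> ?t ?u \<cdot> (vinv (lu ?t) \<boxtimes> idt ?u) = vinv (lu (?t \<otimes> ?u))"
      by - (rule iso_cancel_left[of "lu (?t \<otimes> ?u)"], simp_all)
    have "lu (?t \<otimes> ?u) \<cdot> (idt \<I> \<boxtimes> shuffle T U) = shuffle T U \<cdot> lu (tens (merge_ctx T U))"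
      by (rule lu_nat[of _ "tens (merge_ctx T U)"]) simp
    then have "vinv (lu (?t \<otimes> ?u)) \<cdot> (lu (?t \<otimes> ?u) \<cdot> (idt \<I> \<boxtimes> shuffle T U)) \<cdot> vinv (lu (tens (merge_ctx T U)))
       = vinv (lu (?t \<otimes> ?u)) \<cdot> (shuffle T U \<cdot> lu (tens (merge_ctx T U))) \<cdot> vinv (lu (tens (merge_ctx T U)))"
      by simp
    then have b: "(idt \<I> \<boxtimes> shuffle T U) \<cdot> vinv (lu (tens (merge_ctx T U))) = vinv (lu (?t \<otimes> ?u)) \<cdot> shuffle T U"
      by simp
    have "asc \<I> ?t ?u \<cdot> (vinv (lu ?t) \<boxtimes> idt ?u) \<cdot> shuffle T U = vinv (lu (?t \<otimes> ?u)) \<cdot> shuffle T U"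
      using arg_cong[OF a, of "\<lambda>k. k \<cdot> shuffle T U"] by simp
    with b 1 show ?thesis by simp
  next
    case 2
    let ?s = "tens S" and ?u = "tens U"
    have "(idt ?s \<boxtimes> lu ?u) \<cdot> asc ?s \<I> ?u \<cdot> (vinv (ru ?s) \<boxtimes> idt ?u) =
        ((idt ?s \<boxtimes> lu ?u) \<cdot> asc ?s \<I> ?u) \<cdot> (vinv (ru ?s) \<boxtimes> idt ?u)" by simp
    also have "\<dots> = idt (?s \<otimes> ?u)"
      by (simp only: triangle) (simp add: tensor_comp_idt[symmetric] del: tensor_comp_idt)
    also have "\<dots> = (idt ?s \<boxtimes> lu ?u) \<cdot> (idt ?s \<boxtimes> vinv (lu ?u))"
      by (simp add: idt_tensor_comp[symmetric] del: idt_tensor_comp)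
    finally have a: "asc ?s \<I> ?u \<cdot> (vinv (ru ?s) \<boxtimes> idt ?u) = idt ?s \<boxtimes> vinv (lu ?u)"
      by (rule iso_cancel_left[rotated]) (simp_all add: is_iso_tensor)
    show ?thesis
      using 2 arg_cong[OF a, of "\<lambda>k. k \<cdot> shuffle S U"] by simp
  next
    case 3
    let ?s = "tens S" and ?t = "tens T"
    have "((idt ?s \<boxtimes> ru ?t) \<cdot> asc ?s ?t \<I>) \<cdot> vinv (ru (?s \<otimes> ?t)) = idt (?s \<otimes> ?t)"
      by (simp only: ru_tensor) simp
    then have "(idt ?s \<boxtimes> ru ?t) \<cdot> asc ?s ?t \<I> \<cdot> vinv (ru (?s \<otimes> ?t)) = (idt ?s \<boxtimes> ru ?t) \<cdot> (idt ?s \<boxtimes> vinv (ru ?t))"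
      by (simp add: idt_tensor_comp[symmetric] del: idt_tensor_comp)
    then have a: "asc ?s ?t \<I> \<cdot> vinv (ru (?s \<otimes> ?t)) = idt ?s \<boxtimes> vinv (ru ?t)"
      by (rule iso_cancel_left[rotated]) (simp_all add: is_iso_tensor)
    have "ru (?s \<otimes> ?t) \<cdot> (shuffle S T \<boxtimes> idt \<I>) = shuffle S T \<cdot> ru (tens (merge_ctx S T))"
      by (rule ru_nat[of _ "tens (merge_ctx S T)"]) simp
    then have "vinv (ru (?s \<otimes> ?t)) \<cdot> (ru (?s \<otimes> ?t) \<cdot> (shuffle S T \<boxtimes> idt \<I>)) \<cdot> vinv (ru (tens (merge_ctx S T)))
       = vinv (ru (?s \<otimes> ?t)) \<cdot> (shuffle S T \<cdot> ru (tens (merge_ctx S T))) \<cdot> vinv (ru (tens (merge_ctx S T)))"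
      by simp
    then have b: "(shuffle S T \<boxtimes> idt \<I>) \<cdot> vinv (ru (tens (merge_ctx S T))) = vinv (ru (?s \<otimes> ?t)) \<cdot> shuffle S T"
      by simp
    show ?thesis using 3 b arg_cong[OF a, of "\<lambda>k. k \<cdot> shuffle S T"] by simp
  next
    case 4
    \<comment> \<open>The cases say which of the three heads leads the fully merged context; ties go
      to the later list, as in \<open>merge_ctx\<close>.\<close>
    consider "fst x < fst y" "fst x < fst z" | "\<not> fst x < fst y" "fst y < fst z"
      | "\<not> (fst x < fst y \<and> fst x < fst z)" "\<not> fst y < fst z" by linarith
    then show ?thesis
    proof cases
      case 1
      let ?x = "snd x" and ?s = "tens S'" and ?t = "tens T" and ?u = "tens U"
      have "\<exists>w W. merge_ctx T U = w # W \<and> fst x < fst w"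
        using 1 4 by (cases "fst y < fst z") simp_all
      then obtain w W where W: "merge_ctx T U = w # W" "fst x < fst w" by blast
      have IH: "asc ?s ?t ?u \<cdot> (shuffle S' T \<boxtimes> idt ?u) \<cdot> shuffle (merge_ctx S' T) U =
          (idt ?s \<boxtimes> shuffle T U) \<cdot> shuffle S' (merge_ctx T U)" using less[of S' T U] 4 by simp
      have L: "shuffle S T = vinv (asc ?x ?s ?t) \<cdot> (idt ?x \<boxtimes> shuffle S' T)"
        "merge_ctx S T = x # merge_ctx S' T"
        "shuffle (x # merge_ctx S' T) U =
          vinv (asc ?x (tens (merge_ctx S' T)) ?u) \<cdot> (idt ?x \<boxtimes> shuffle (merge_ctx S' T) U)"
        using 1 4 by auto
      have R: "shuffle S (merge_ctx T U) =
          vinv (asc ?x ?s (tens (merge_ctx T U))) \<cdot> (idt ?x \<boxtimes> shuffle S' (merge_ctx T U))"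
        using W 4 by auto
      \<comment> \<open>\<open>n\<close> and \<open>m\<close> push the recursive shuffles through
        the structural arrows by naturality, and \<open>p\<close> is the pentagon; what remains is
        the induction hypothesis tensored with \<open>?x\<close> on the left. The other two cases
        follow the same plan.\<close>
      have n: "((idt ?x \<boxtimes> shuffle S' T) \<boxtimes> idt ?u) \<cdot> vinv (asc ?x (tens (merge_ctx S' T)) ?u) \<cdot> h =
          vinv (asc ?x (?s \<otimes> ?t) ?u) \<cdot> (idt ?x \<boxtimes> (shuffle S' T \<boxtimes> idt ?u)) \<cdot> h"
        if "vcod V h = ?x \<otimes> tens (merge_ctx S' T) \<otimes> ?u" for h
        using arg_cong[OF vinv_asc_nat[of "idt ?x" "shuffle S' T" "idt ?u"], of "\<lambda>k. k \<cdot> h"] that by simp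
      have p: "asc (?x \<otimes> ?s) ?t ?u \<cdot> (vinv (asc ?x ?s ?t) \<boxtimes> idt ?u) \<cdot> vinv (asc ?x (?s \<otimes> ?t) ?u) \<cdot> h =
          vinv (asc ?x ?s (?t \<otimes> ?u)) \<cdot> (idt ?x \<boxtimes> asc ?s ?t ?u) \<cdot> h" if "vcod V h = ?x \<otimes> (?s \<otimes> ?t) \<otimes> ?u" for h
        using arg_cong[OF left_pentagon[of ?x ?s ?t ?u], of "\<lambda>k. k \<cdot> h"] that by simp
      have m: "(idt (?x \<otimes> ?s) \<boxtimes> shuffle T U) \<cdot> vinv (asc ?x ?s (tens (merge_ctx T U))) \<cdot> h =
          vinv (asc ?x ?s (?t \<otimes> ?u)) \<cdot> (idt ?x \<boxtimes> (idt ?s \<boxtimes> shuffle T U)) \<cdot> h"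
        if "vcod V h = ?x \<otimes> ?s \<otimes> tens (merge_ctx T U)" for h
        using arg_cong[OF vinv_asc_nat[of "idt ?x" "idt ?s" "shuffle T U"], of "\<lambda>k. k \<cdot> h"] that by simp
      have S: "tens S = ?x \<otimes> ?s" using 4 by simp
      have IH': "(idt ?x \<boxtimes> asc ?s ?t ?u) \<cdot> (idt ?x \<boxtimes> (shuffle S' T \<boxtimes> idt ?u)) \<cdot> (idt ?x \<boxtimes> shuffle (merge_ctx S' T) U)
         = (idt ?x \<boxtimes> (idt ?s \<boxtimes> shuffle T U)) \<cdot> (idt ?x \<boxtimes> shuffle S' (merge_ctx T U))"
        using arg_cong[OF IH, of "\<lambda>k. idt ?x \<boxtimes> k"] by (simp add: merge_ctx_assoc)
      show ?thesis unfolding L R S by (simp add: n p m IH' merge_ctx_assoc)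
    next
      case 2
      let ?y = "snd y" and ?s = "tens S" and ?t = "tens T'" and ?u = "tens U"
      have IH: "asc ?s ?t ?u \<cdot> (shuffle S T' \<boxtimes> idt ?u) \<cdot> shuffle (merge_ctx S T') U =
          (idt ?s \<boxtimes> shuffle T' U) \<cdot> shuffle S (merge_ctx T' U)" using less[of S T' U] 4 by simp
      have L: "shuffle S T = swap_left ?y ?s ?t \<cdot> (idt ?y \<boxtimes> shuffle S T')"
        "merge_ctx S T = y # merge_ctx S T'"
        "shuffle (y # merge_ctx S T') U =
          vinv (asc ?y (tens (merge_ctx S T')) ?u) \<cdot> (idt ?y \<boxtimes> shuffle (merge_ctx S T') U)"
        using 2 4 by auto
      have R: "shuffle T U = vinv (asc ?y ?t ?u) \<cdot> (idt ?y \<boxtimes> shuffle T' U)"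
        "merge_ctx T U = y # merge_ctx T' U"
        "shuffle S (y # merge_ctx T' U) =
          swap_left ?y ?s (tens (merge_ctx T' U)) \<cdot> (idt ?y \<boxtimes> shuffle S (merge_ctx T' U))"
        using 2 4 by auto
      have n: "((idt ?y \<boxtimes> shuffle S T') \<boxtimes> idt ?u) \<cdot> vinv (asc ?y (tens (merge_ctx S T')) ?u) \<cdot> h =
          vinv (asc ?y (?s \<otimes> ?t) ?u) \<cdot> (idt ?y \<boxtimes> (shuffle S T' \<boxtimes> idt ?u)) \<cdot> h"
        if "vcod V h = ?y \<otimes> tens (merge_ctx S T') \<otimes> ?u" for h
        using arg_cong[OF vinv_asc_nat[of "idt ?y" "shuffle S T'" "idt ?u"], of "\<lambda>k. k \<cdot> h"] that by simp
      have p: "asc ?s (?y \<otimes> ?t) ?u \<cdot> (swap_left ?y ?s ?t \<boxtimes> idt ?u) \<cdot> vinv (asc ?y (?s \<otimes> ?t) ?u) \<cdot> h =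
          (idt ?s \<boxtimes> vinv (asc ?y ?t ?u)) \<cdot> swap_left ?y ?s (?t \<otimes> ?u) \<cdot> (idt ?y \<boxtimes> asc ?s ?t ?u) \<cdot> h"
        if "vcod V h = ?y \<otimes> (?s \<otimes> ?t) \<otimes> ?u" for h
        using arg_cong[OF asc_swap_left[of ?s ?y ?t ?u], of "\<lambda>k. k \<cdot> h"] that by simp
      have m: "(idt ?s \<boxtimes> (idt ?y \<boxtimes> shuffle T' U)) \<cdot> swap_left ?y ?s (tens (merge_ctx T' U)) \<cdot> h =
          swap_left ?y ?s (?t \<otimes> ?u) \<cdot> (idt ?y \<boxtimes> (idt ?s \<boxtimes> shuffle T' U)) \<cdot> h"
        if "vcod V h = ?y \<otimes> ?s \<otimes> tens (merge_ctx T' U)" for h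
        using arg_cong[OF swap_left_nat[of ?y "idt ?s" "shuffle T' U"], of "\<lambda>k. k \<cdot> h"] that by simp
      have S: "tens T = ?y \<otimes> ?t" using 4 by simp
      have IH': "(idt ?y \<boxtimes> asc ?s ?t ?u) \<cdot> (idt ?y \<boxtimes> (shuffle S T' \<boxtimes> idt ?u)) \<cdot> (idt ?y \<boxtimes> shuffle (merge_ctx S T') U)
         = (idt ?y \<boxtimes> (idt ?s \<boxtimes> shuffle T' U)) \<cdot> (idt ?y \<boxtimes> shuffle S (merge_ctx T' U))"
        using arg_cong[OF IH, of "\<lambda>k. idt ?y \<boxtimes> k"] by (simp add: merge_ctx_assoc)
      show ?thesis unfolding L R S by (simp add: n p m IH' merge_ctx_assoc)
    next
      case 3
      let ?z = "snd z" and ?s = "tens S" and ?t = "tens T" and ?u = "tens U'"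
      have "\<exists>w W. merge_ctx S T = w # W \<and> \<not> fst w < fst z"
        using 3 4 by (cases "fst x < fst y") simp_all
      then obtain w W where W: "merge_ctx S T = w # W" "\<not> fst w < fst z" by blast
      have IH: "asc ?s ?t ?u \<cdot> (shuffle S T \<boxtimes> idt ?u) \<cdot> shuffle (merge_ctx S T) U' =
          (idt ?s \<boxtimes> shuffle T U') \<cdot> shuffle S (merge_ctx T U')" using less[of S T U'] 4 by simp
      have L: "shuffle (merge_ctx S T) U =
          swap_left ?z (tens (merge_ctx S T)) ?u \<cdot> (idt ?z \<boxtimes> shuffle (merge_ctx S T) U')"
        using W 4 by auto
      have R: "shuffle T U = swap_left ?z ?t ?u \<cdot> (idt ?z \<boxtimes> shuffle T U')"
        "merge_ctx T U = z # merge_ctx T U'"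
        "shuffle S (z # merge_ctx T U') =
          swap_left ?z ?s (tens (merge_ctx T U')) \<cdot> (idt ?z \<boxtimes> shuffle S (merge_ctx T U'))"
        using 3 4 by auto
      have n: "(shuffle S T \<boxtimes> (idt ?z \<boxtimes> idt ?u)) \<cdot> swap_left ?z (tens (merge_ctx S T)) ?u \<cdot> h =
          swap_left ?z (?s \<otimes> ?t) ?u \<cdot> (idt ?z \<boxtimes> (shuffle S T \<boxtimes> idt ?u)) \<cdot> h"
        if "vcod V h = ?z \<otimes> tens (merge_ctx S T) \<otimes> ?u" for h
        using arg_cong[OF swap_left_nat[of ?z "shuffle S T" "idt ?u"], of "\<lambda>k. k \<cdot> h"] that by simp
      have p: "asc ?s ?t (?z \<otimes> ?u) \<cdot> swap_left ?z (?s \<otimes> ?t) ?u \<cdot> h =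
          (idt ?s \<boxtimes> swap_left ?z ?t ?u) \<cdot> swap_left ?z ?s (?t \<otimes> ?u) \<cdot> (idt ?z \<boxtimes> asc ?s ?t ?u) \<cdot> h"
        if "vcod V h = ?z \<otimes> (?s \<otimes> ?t) \<otimes> ?u" for h
        using arg_cong[OF asc_swap_left'[of ?s ?t ?z ?u], of "\<lambda>k. k \<cdot> h"] that by simp
      have m: "(idt ?s \<boxtimes> (idt ?z \<boxtimes> shuffle T U')) \<cdot> swap_left ?z ?s (tens (merge_ctx T U')) \<cdot> h =
          swap_left ?z ?s (?t \<otimes> ?u) \<cdot> (idt ?z \<boxtimes> (idt ?s \<boxtimes> shuffle T U')) \<cdot> h"
        if "vcod V h = ?z \<otimes> ?s \<otimes> tens (merge_ctx T U')" for h
        using arg_cong[OF swap_left_nat[of ?z "idt ?s" "shuffle T U'"], of "\<lambda>k. k \<cdot> h"] that by simp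
      have S: "tens U = ?z \<otimes> ?u" using 4 by simp
      have IH': "(idt ?z \<boxtimes> asc ?s ?t ?u) \<cdot> (idt ?z \<boxtimes> (shuffle S T \<boxtimes> idt ?u)) \<cdot> (idt ?z \<boxtimes> shuffle (merge_ctx S T) U')
         = (idt ?z \<boxtimes> (idt ?s \<boxtimes> shuffle T U')) \<cdot> (idt ?z \<boxtimes> shuffle S (merge_ctx T U'))"
        using arg_cong[OF IH, of "\<lambda>k. idt ?z \<boxtimes> k"] by (simp add: merge_ctx_assoc)
      show ?thesis unfolding L R S
        by (simp add: n[simplified] p m IH' merge_ctx_assoc)
    qed
  qed
qed

end

section \<open>Generalized elements\<close>

type_synonym ('o, 'm) elem = "((nat \<times> 'o) list \<times> 'm) option"

context symmetric_monoidal_closed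
begin

text \<open>Generalized elements, in which \<open>None\<close> stands for a pairing of elements that share a
  variable. With it all laws hold without linearity side conditions.\<close>

definition El :: "'o \<Rightarrow> ('o, 'm) elem set" where
  "El a = {e. case e of None \<Rightarrow> True | Some (S, x) \<Rightarrow> vdom V x = tens S \<and> vcod V x = a}"

definition act :: "'m \<Rightarrow> ('o, 'm) elem \<Rightarrow> ('o, 'm) elem" (infixr "\<bullet>" 56) where
  "f \<bullet> e = (case e of None \<Rightarrow> None | Some (S, x) \<Rightarrow> Some (S, f \<cdot> x))"

definition pair :: "('o, 'm) elem \<Rightarrow> ('o, 'm) elem \<Rightarrow> ('o, 'm) elem" (infixr "\<odot>" 70) where
  "d \<odot> e = (case (d, e) of
     (Some (S, x), Some (T, y)) \<Rightarrow>
       if fst ` set S \<inter> fst ` set T = {}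
       then Some (merge_ctx S T, (x \<boxtimes> y) \<cdot> shuffle S T) else None
   | _ \<Rightarrow> None)"

definition one :: "('o, 'm) elem" where
  "one = Some ([], idt \<I>)"

text \<open>The arrow is \<open>ru a\<close> because a context with one variable has the value
  \<open>a \<otimes> \<I>\<close>.\<close>

definition var :: "nat \<Rightarrow> 'o \<Rightarrow> ('o, 'm) elem" where
  "var n a = Some ([(n, a)], ru a)"

abbreviation app :: "'o \<Rightarrow> 'o \<Rightarrow> ('o, 'm) elem \<Rightarrow> ('o, 'm) elem \<Rightarrow> ('o, 'm) elem" where
  "app a b h x \<equiv> ev a b \<bullet> (h \<odot> x)"

lemma El_None [simp]: "None \<in> El a"
  and El_Some [simp]: "Some (S, x) \<in> El a \<longleftrightarrow> vdom V x = tens S \<and> vcod V x = a"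
  by (simp_all add: El_def)

lemma act_None [simp]: "f \<bullet> None = None"
  and act_Some: "f \<bullet> Some (S, x) = Some (S, f \<cdot> x)"
  by (simp_all add: act_def)

lemma pair_None [simp]: "None \<odot> e = None" "e \<odot> None = None"
  by (auto simp: pair_def split: option.split)

lemma pair_Some: "Some (S, x) \<odot> Some (T, y) =
   (if fst ` set S \<inter> fst ` set T = {}
    then Some (merge_ctx S T, (x \<boxtimes> y) \<cdot> shuffle S T) else None)"
  by (simp add: pair_def)

lemma El_cases:
  assumes "e \<in> El a"
  obtains "e = None" | S x where "e = Some (S, x)" "vdom V x = tens S" "vcod V x = a"
  using assms by (cases e) auto

lemma act_El [simp]: "x \<in> El (vdom V f) \<Longrightarrow> vcod V f = b \<Longrightarrow> f \<bullet> x \<in> El b"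
  by (erule El_cases) (auto simp: act_Some)

lemma pair_El [simp]: "x \<in> El a \<Longrightarrow> y \<in> El b \<Longrightarrow> x \<odot> y \<in> El (a \<otimes> b)"
  by (erule El_cases; erule El_cases) (auto simp: pair_Some)

lemma one_El [simp]: "one \<in> El \<I>"
  by (simp add: one_def)

lemma var_El [simp]: "var n a \<in> El a"
  by (simp add: var_def)

lemma act_idt [simp]: "x \<in> El a \<Longrightarrow> idt a \<bullet> x = x"
  by (erule El_cases) (auto simp: act_Some)

lemma act_comp [simp]:
  "x \<in> El (vdom V f) \<Longrightarrow> vdom V g = vcod V f \<Longrightarrow> (g \<cdot> f) \<bullet> x = g \<bullet> f \<bullet> x"
  by (erule El_cases) (auto simp: act_Some)

lemma act_tensor [simp]:
  assumes "x \<in> El (vdom V f)" "y \<in> El (vdom V g)"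
  shows "(f \<boxtimes> g) \<bullet> (x \<odot> y) = (f \<bullet> x) \<odot> (g \<bullet> y)"
  using assms by (elim El_cases) (auto simp: act_Some pair_Some tensor_comp')

lemma vinv_act [simp]: "is_iso f \<Longrightarrow> x \<in> El (vdom V f) \<Longrightarrow> vinv f \<bullet> f \<bullet> x = x"
  and act_vinv [simp]: "is_iso f \<Longrightarrow> x \<in> El (vcod V f) \<Longrightarrow> f \<bullet> vinv f \<bullet> x = x"
  using act_comp[of x f "vinv f"] act_comp[of x "vinv f" f] by simp_all

lemma iso_actD:
  assumes "is_iso f" "f \<bullet> x = f \<bullet> y" "x \<in> El (vdom V f)" "y \<in> El (vdom V f)"
  shows "x = y"
  using assms by (metis vinv_act)

text \<open>Naturality reduces the claim to \<open>shuffle_commute\<close>. Both pairings live over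
  the same merged context, since merging disjoint contexts does not depend on their order, and they
  are \<open>None\<close> in the same cases.\<close>

lemma act_sy [simp]:
  assumes "x \<in> El a" "y \<in> El b"
  shows "sy a b \<bullet> (x \<odot> y) = y \<odot> x"
proof -
  have "sy a b \<cdot> (f \<boxtimes> g) \<cdot> shuffle S T = (g \<boxtimes> f) \<cdot> shuffle T S"
    if "fst ` set S \<inter> fst ` set T = {}"
      "vdom V f = tens S" "vcod V f = a" "vdom V g = tens T" "vcod V g = b" for f g S T
    using arg_cong[OF sy_nat'[of f g], of "\<lambda>k. k \<cdot> shuffle S T"] that
    by (simp add: shuffle_commute)
  then show ?thesis
    using assms
    by (elim El_cases) (auto simp: act_Some pair_Some merge_ctx_commute Int_commute)
qed

text \<open>Naturality of \<open>asc\<close> moves the three arrows outside and leaves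
  \<open>shuffle_assoc\<close>. Both sides are defined under the same condition, that the three
  contexts are pairwise disjoint.\<close>

lemma act_asc [simp]:
  assumes "x \<in> El a" "y \<in> El b" "z \<in> El c"
  shows "asc a b c \<bullet> ((x \<odot> y) \<odot> z) = x \<odot> y \<odot> z"
proof -
  have "asc a b c \<cdot> (((f \<boxtimes> g) \<cdot> shuffle S T) \<boxtimes> h) \<cdot> shuffle (merge_ctx S T) U =
      (f \<boxtimes> ((g \<boxtimes> h) \<cdot> shuffle T U)) \<cdot> shuffle S (merge_ctx T U)"
    if "vdom V f = tens S" "vcod V f = a" "vdom V g = tens T" "vcod V g = b"
      "vdom V h = tens U" "vcod V h = c" for f g h S T U
  proof -
    have "((f \<boxtimes> g) \<cdot> shuffle S T) \<boxtimes> h = ((f \<boxtimes> g) \<boxtimes> h) \<cdot> (shuffle S T \<boxtimes> idt (tens U))"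
      using that by (simp add: tensor_comp'[symmetric])
    moreover have "f \<boxtimes> ((g \<boxtimes> h) \<cdot> shuffle T U) = (f \<boxtimes> (g \<boxtimes> h)) \<cdot> (idt (tens S) \<boxtimes> shuffle T U)"
      using that by (simp add: tensor_comp'[symmetric])
    moreover have "asc a b c \<cdot> ((f \<boxtimes> g) \<boxtimes> h) \<cdot> k = (f \<boxtimes> (g \<boxtimes> h)) \<cdot> asc (tens S) (tens T) (tens U) \<cdot> k"
      if k: "vcod V k = (tens S \<otimes> tens T) \<otimes> tens U" for k
      using arg_cong[OF asc_nat'[of f g h], of "\<lambda>l. l \<cdot> k"] that k
        \<open>vdom V f = tens S\<close> \<open>vcod V f = a\<close> \<open>vdom V g = tens T\<close> \<open>vcod V g = b\<close>
        \<open>vdom V h = tens U\<close> \<open>vcod V h = c\<close> by simp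
    ultimately show ?thesis using that by (simp add: shuffle_assoc merge_ctx_assoc)
  qed
  then show ?thesis
    using assms
    by (elim El_cases) (auto simp: act_Some pair_Some merge_ctx_assoc Int_Un_distrib Int_Un_distrib2
        image_Un)
qed

lemma act_vinv_asc [simp]:
  assumes "x \<in> El a" "y \<in> El b" "z \<in> El c"
  shows "vinv (asc a b c) \<bullet> (x \<odot> y \<odot> z) = (x \<odot> y) \<odot> z"
  using act_asc[OF assms] assms by (metis vinv_act asc_iso pair_El vdom_asc)

lemma act_vinv_lu [simp]:
  assumes "x \<in> El a"
  shows "vinv (lu a) \<bullet> x = one \<odot> x"
proof -
  have "vinv (lu a) \<cdot> f = (idt \<I> \<boxtimes> f) \<cdot> vinv (lu (tens S))"
    if "vdom V f = tens S" "vcod V f = a" for f S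
  proof (rule iso_cancel_left[of "lu a"])
    have "(lu a \<cdot> (idt \<I> \<boxtimes> f)) \<cdot> vinv (lu (tens S)) = f"
      using lu_nat[of f "tens S" a] that by simp
    then show "lu a \<cdot> vinv (lu a) \<cdot> f = lu a \<cdot> (idt \<I> \<boxtimes> f) \<cdot> vinv (lu (tens S))"
      using that by simp
  qed (use that in simp_all)
  then show ?thesis
    using assms by (elim El_cases) (auto simp: act_Some pair_Some one_def)
qed

lemma act_vinv_ru [simp]:
  assumes "x \<in> El a"
  shows "vinv (ru a) \<bullet> x = x \<odot> one"
proof -
  have "vinv (ru a) \<cdot> f = (f \<boxtimes> idt \<I>) \<cdot> vinv (ru (tens S))"
    if "vdom V f = tens S" "vcod V f = a" for f S
  proof (rule iso_cancel_left[of "ru a"])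
    have "(ru a \<cdot> (f \<boxtimes> idt \<I>)) \<cdot> vinv (ru (tens S)) = f"
      using ru_nat[of f "tens S" a] that by simp
    then show "ru a \<cdot> vinv (ru a) \<cdot> f = ru a \<cdot> (f \<boxtimes> idt \<I>) \<cdot> vinv (ru (tens S))"
      using that by simp
  qed (use that in simp_all)
  then show ?thesis
    using assms by (elim El_cases) (auto simp: act_Some pair_Some one_def)
qed

lemma act_lu [simp]: "x \<in> El a \<Longrightarrow> lu a \<bullet> (one \<odot> x) = x"
  by (metis act_vinv act_vinv_lu lu_iso vcod_lu)

lemma act_ru [simp]: "x \<in> El a \<Longrightarrow> ru a \<bullet> (x \<odot> one) = x"
  by (metis act_vinv act_vinv_ru ru_iso vcod_ru)

text \<open>Invertible elements detect equality of arrows out of their object. The set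
  \<open>N\<close> bounds the names in use, so that pairings of elements with disjoint bounds are
  defined and again invertible.\<close>

definition fresh_iso :: "nat set \<Rightarrow> 'o \<Rightarrow> ('o, 'm) elem \<Rightarrow> bool" where
  "fresh_iso N a e \<longleftrightarrow> (\<exists>S x. e = Some (S, x) \<and> is_iso x \<and> fst ` set S \<subseteq> N \<and>
     vdom V x = tens S \<and> vcod V x = a)"

lemma fresh_iso_var: "n \<in> N \<Longrightarrow> fresh_iso N a (var n a)"
  by (simp add: fresh_iso_def var_def)

lemma fresh_iso_one: "fresh_iso N \<I> one"
  by (simp add: fresh_iso_def one_def)

lemma fresh_iso_pair:
  "fresh_iso N a x \<Longrightarrow> fresh_iso N' b y \<Longrightarrow> N \<inter> N' = {} \<Longrightarrow> fresh_iso (N \<union> N') (a \<otimes> b) (x \<odot> y)"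
  unfolding fresh_iso_def by (force simp: pair_Some is_iso_comp is_iso_tensor)

lemma eq_fresh_iso:
  assumes "f \<bullet> z = g \<bullet> z" "fresh_iso N a z" "vdom V f = a" "vdom V g = a"
  shows "f = g"
  using assms by (auto simp: fresh_iso_def act_Some intro: iso_cancel_right)

text \<open>A pairing of distinct variables is invertible, so that an arrow is determined by its action on
  pairings of arbitrary elements.\<close>

lemma act_eqI:
  assumes "\<And>x. x \<in> El a \<Longrightarrow> f \<bullet> x = g \<bullet> x" "vdom V f = a" "vdom V g = a"
  shows "f = g"
  by (rule eq_fresh_iso[OF _ fresh_iso_var[of 0 UNIV a]]) (use assms in auto)

lemma act_eqI_pair:
  assumes "\<And>x y. x \<in> El a \<Longrightarrow> y \<in> El b \<Longrightarrow> f \<bullet> (x \<odot> y) = g \<bullet> (x \<odot> y)"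
    and "vdom V f = a \<otimes> b" "vdom V g = a \<otimes> b"
  shows "f = g"
  by (rule eq_fresh_iso[OF _ fresh_iso_pair[OF fresh_iso_var[of 0 "{0}" a] fresh_iso_var[of 1 "{1}" b]]])
    (use assms in auto)

lemma act_eqI_pair_left:
  assumes "\<And>x y z. x \<in> El a \<Longrightarrow> y \<in> El b \<Longrightarrow> z \<in> El c \<Longrightarrow>
      f \<bullet> ((x \<odot> y) \<odot> z) = g \<bullet> ((x \<odot> y) \<odot> z)"
    and "vdom V f = (a \<otimes> b) \<otimes> c" "vdom V g = (a \<otimes> b) \<otimes> c"
  shows "f = g"
  by (rule eq_fresh_iso[OF _ fresh_iso_pair[OF
          fresh_iso_pair[OF fresh_iso_var[of 0 "{0}" a] fresh_iso_var[of 1 "{1}" b]]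
          fresh_iso_var[of 2 "{2}" c]]])
    (use assms in auto)

lemma act_eqI_pair_pair:
  assumes "\<And>x y z w. x \<in> El a \<Longrightarrow> y \<in> El b \<Longrightarrow> z \<in> El c \<Longrightarrow> w \<in> El d \<Longrightarrow>
      f \<bullet> ((x \<odot> y) \<odot> (z \<odot> w)) = g \<bullet> ((x \<odot> y) \<odot> (z \<odot> w))"
    and "vdom V f = (a \<otimes> b) \<otimes> (c \<otimes> d)" "vdom V g = (a \<otimes> b) \<otimes> (c \<otimes> d)"
  shows "f = g"
  by (rule eq_fresh_iso[OF _ fresh_iso_pair[OF
          fresh_iso_pair[OF fresh_iso_var[of 0 "{0}" a] fresh_iso_var[of 1 "{1}" b]]
          fresh_iso_pair[OF fresh_iso_var[of 2 "{2}" c] fresh_iso_var[of 3 "{3}" d]]]])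
    (use assms in auto)

lemma act_eqI_one:
  assumes "f \<bullet> one = g \<bullet> one" "vdom V f = \<I>" "vdom V g = \<I>"
  shows "f = g"
  by (rule eq_fresh_iso[OF assms(1) fresh_iso_one]) (use assms in auto)

lemma act_eqI_one_pair:
  assumes "\<And>x. x \<in> El a \<Longrightarrow> f \<bullet> (one \<odot> x) = g \<bullet> (one \<odot> x)"
    and "vdom V f = \<I> \<otimes> a" "vdom V g = \<I> \<otimes> a"
  shows "f = g"
  by (rule eq_fresh_iso[OF _ fresh_iso_pair[OF fresh_iso_one[of "{}"] fresh_iso_var[of 0 UNIV a]]])
    (use assms in auto)

lemma act_eqI_pair_one:
  assumes "\<And>x. x \<in> El a \<Longrightarrow> f \<bullet> (x \<odot> one) = g \<bullet> (x \<odot> one)"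
    and "vdom V f = a \<otimes> \<I>" "vdom V g = a \<otimes> \<I>"
  shows "f = g"
  by (rule eq_fresh_iso[OF _ fresh_iso_pair[OF fresh_iso_var[of 0 UNIV a] fresh_iso_one[of "{}"]]])
    (use assms in auto)

lemma is_inverse_actI:
  assumes "\<And>x. x \<in> El a \<Longrightarrow> g \<bullet> f \<bullet> x = x" "\<And>y. y \<in> El b \<Longrightarrow> f \<bullet> g \<bullet> y = y"
    and "vdom V f = a" "vcod V f = b" "vdom V g = b" "vcod V g = a"
  shows "is_inverse f g"
  by (rule is_inverseI[of f a b]; (rule act_eqI)?) (use assms in auto)

lemma is_iso_actI:
  assumes "\<And>x. x \<in> El a \<Longrightarrow> g \<bullet> f \<bullet> x = x" "\<And>y. y \<in> El b \<Longrightarrow> f \<bullet> g \<bullet> y = y"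
    and "vdom V f = a" "vcod V f = b" "vdom V g = b" "vcod V g = a"
  shows "is_iso f"
  using is_inverse_actI[OF assms] by (auto simp: is_iso_def)

lemma act_middle [simp]:
  assumes "x \<in> El a" "y \<in> El b" "z \<in> El c" "w \<in> El d"
  shows "middle a b c d \<bullet> ((x \<odot> y) \<odot> (z \<odot> w)) = (x \<odot> z) \<odot> (y \<odot> w)"
  using assms by (simp add: middle_def del: idt_tensor_comp tensor_comp_idt)

lemma vdom_middle [simp]: "vdom V (middle a b c d) = (a \<otimes> b) \<otimes> (c \<otimes> d)"
  and vcod_middle [simp]: "vcod V (middle a b c d) = (a \<otimes> c) \<otimes> (b \<otimes> d)"
  by (simp_all add: middle_def del: idt_tensor_comp tensor_comp_idt)

section \<open>Function objects: application and extensionality\<close>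

lemma transp_typing:
  assumes "vdom V f = c \<otimes> a" "vcod V f = b"
  shows "transp c a b f \<in> hom c (ih a b) \<and> ev a b \<cdot> (transp c a b f \<boxtimes> idt a) = f"
  unfolding transp_def by (rule theI'[OF closed]) (use assms in simp)

lemma vdom_transp [simp]: "vdom V f = c \<otimes> a \<Longrightarrow> vcod V f = b \<Longrightarrow> vdom V (transp c a b f) = c"
  and vcod_transp [simp]: "vdom V f = c \<otimes> a \<Longrightarrow> vcod V f = b \<Longrightarrow> vcod V (transp c a b f) = ih a b"
  using transp_typing[of f c a b] by simp_all

lemma app_transp [simp]:
  assumes "vdom V f = c \<otimes> a" "vcod V f = b" "z \<in> El c" "x \<in> El a"
  shows "app a b (transp c a b f \<bullet> z) x = f \<bullet> (z \<odot> x)"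
proof -
  have "f \<bullet> (z \<odot> x) = (ev a b \<cdot> (transp c a b f \<boxtimes> idt a)) \<bullet> (z \<odot> x)"
    using transp_typing[of f c a b] assms by simp
  also have "\<dots> = app a b (transp c a b f \<bullet> z) x"
    using assms by (subst act_comp) auto
  finally show ?thesis by simp
qed

text \<open>Applying both functions to one variable that is fresh for both contexts recovers their
  transposes up to an isomorphism, and by \<open>closed\<close> transposition is injective.\<close>

lemma ih_ext:
  assumes "h \<in> El (ih a b)" "h' \<in> El (ih a b)"
    and "\<And>x. x \<in> El a \<Longrightarrow> app a b h x = app a b h' x"
  shows "h = h'"
proof -
  \<comment> \<open>A name above all names in use, so that merging puts the new variable last; the
    summand \<open>{0}\<close> keeps the set nonempty.\<close>
  define n where "n = Suc (Max ((case h of None \<Rightarrow> {} | Some (S, x) \<Rightarrow> fst ` set S) \<union>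
    (case h' of None \<Rightarrow> {} | Some (S, x) \<Rightarrow> fst ` set S) \<union> {0}))"
  have n: "k < n" if "k \<in> (case h of None \<Rightarrow> {} | Some (S, x) \<Rightarrow> fst ` set S) \<union>
    (case h' of None \<Rightarrow> {} | Some (S, x) \<Rightarrow> fst ` set S)" for k
    unfolding n_def less_Suc_eq_le
    by (rule Max_ge) (use that in \<open>auto split: option.splits\<close>)
  have merge: "merge_ctx S [(n, a)] = S @ [(n, a)]" if "\<And>k. k \<in> fst ` set S \<Longrightarrow> k < n" for S
    using that by (induction S) auto
  have *: "ev a b \<bullet> (Some (S, x) \<odot> var n a) =
      Some (S @ [(n, a)], ev a b \<cdot> (x \<boxtimes> ru a) \<cdot> shuffle S [(n, a)])"
    if "\<And>k. k \<in> fst ` set S \<Longrightarrow> k < n" for S x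
    using that merge[OF that] by (force simp: var_def pair_Some act_Some)
  have eq: "app a b h (var n a) = app a b h' (var n a)" by (rule assms) simp
  from assms(1) show ?thesis
  proof (cases rule: El_cases)
    case 1
    with assms(2) eq n show ?thesis by (cases rule: El_cases) (auto simp: *)
  next
    case (2 S x)
    note h = this
    from assms(2) show ?thesis
    proof (cases rule: El_cases)
      case 1
      with h eq n show ?thesis by (auto simp: *)
    next
      case (2 S' x')
      then have [simp]: "S' = S" and
        e: "ev a b \<cdot> (x \<boxtimes> ru a) \<cdot> shuffle S [(n, a)] = ev a b \<cdot> (x' \<boxtimes> ru a) \<cdot> shuffle S [(n, a)]"
        using eq h n by (auto simp: *)
      \<comment> \<open>\<open>ru a\<close> and the shuffle form an invertible arrow; cancelling it
        leaves the untransposed arrows.\<close>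
      let ?k = "(idt (tens S) \<boxtimes> ru a) \<cdot> shuffle S [(n, a)]"
      have k: "ev a b \<cdot> (y \<boxtimes> ru a) \<cdot> shuffle S [(n, a)] = (ev a b \<cdot> (y \<boxtimes> idt a)) \<cdot> ?k"
        if "vdom V y = tens S" "vcod V y = ih a b" for y
      proof -
        have "y \<boxtimes> ru a = (y \<boxtimes> idt a) \<cdot> (idt (tens S) \<boxtimes> ru a)"
          using that tensor_comp'[of y "idt (tens S)" "idt a" "ru a"] by simp
        then show ?thesis using that by simp
      qed
      have "(ev a b \<cdot> (x \<boxtimes> idt a)) \<cdot> ?k = (ev a b \<cdot> (x' \<boxtimes> idt a)) \<cdot> ?k"
        using e h 2 k[of x] k[of x'] by simp
      then have "ev a b \<cdot> (x \<boxtimes> idt a) = ev a b \<cdot> (x' \<boxtimes> idt a)"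
        by (rule iso_cancel_right[rotated]) (use h 2 in \<open>simp_all add: is_iso_comp is_iso_tensor\<close>)
      moreover have "\<exists>!h. h \<in> hom (tens S) (ih a b) \<and> ev a b \<cdot> (h \<boxtimes> idt a) = ev a b \<cdot> (x \<boxtimes> idt a)"
        by (rule closed) (use h in simp)
      ultimately have "x = x'" using h 2 by auto
      with h 2 show ?thesis by simp
    qed
  qed
qed

lemma vdom_untransp [simp]: "vdom V h = c \<Longrightarrow> vcod V h = ih a b \<Longrightarrow> vdom V (untransp a b h) = c \<otimes> a"
  and vcod_untransp [simp]: "vcod V h = ih a b \<Longrightarrow> vcod V (untransp a b h) = b"
  by (simp_all add: untransp_def)

lemma act_untransp [simp]:
  assumes "vcod V h = ih a b" "z \<in> El (vdom V h)" "x \<in> El a"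
  shows "untransp a b h \<bullet> (z \<odot> x) = app a b (h \<bullet> z) x"
  using assms by (simp add: untransp_def)

lemma vdom_name [simp]: "vdom V f = a \<Longrightarrow> vcod V f = b \<Longrightarrow> vdom V (name a b f) = \<I>"
  and vcod_name [simp]: "vdom V f = a \<Longrightarrow> vcod V f = b \<Longrightarrow> vcod V (name a b f) = ih a b"
  by (simp_all add: name_def)

lemma app_name [simp]:
  assumes "vdom V f = a" "vcod V f = b" "x \<in> El a"
  shows "app a b (name a b f \<bullet> one) x = f \<bullet> x"
  using assms by (simp add: name_def)

lemma vself_simps [simp]: "obs vself = UNIV" "vhom vself = ih"
  by (simp_all add: vself_def)

lemma vdom_vid_vself [simp]: "vdom V (vid vself a) = \<I>"
  and vcod_vid_vself [simp]: "vcod V (vid vself a) = ih a a"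
  and vdom_vcmp_vself [simp]: "vdom V (vcmp vself a b c) = ih b c \<otimes> ih a b"
  and vcod_vcmp_vself [simp]: "vcod V (vcmp vself a b c) = ih a c"
  by (simp_all add: vself_def)

lemma app_vid_vself [simp]: "x \<in> El a \<Longrightarrow> app a a (vid vself a \<bullet> one) x = x"
  by (simp add: vself_def)

lemma app_vcmp_vself [simp]:
  "g \<in> El (ih b c) \<Longrightarrow> f \<in> El (ih a b) \<Longrightarrow> x \<in> El a \<Longrightarrow>
   app a c (vcmp vself a b c \<bullet> (g \<odot> f)) x = app b c g (app a b f x)"
  by (simp add: vself_def)

section \<open>Enriched categories, functors and transformations\<close>

abbreviation ide :: "('a, 'o, 'm) vcat \<Rightarrow> 'a \<Rightarrow> ('o, 'm) elem" where
  "ide A a \<equiv> vid A a \<bullet> one"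

abbreviation cmp :: "('a, 'o, 'm) vcat \<Rightarrow> 'a \<Rightarrow> 'a \<Rightarrow> 'a \<Rightarrow>
    ('o, 'm) elem \<Rightarrow> ('o, 'm) elem \<Rightarrow> ('o, 'm) elem" where
  "cmp A a b c g f \<equiv> vcmp A a b c \<bullet> (g \<odot> f)"

text \<open>Each axiom of \<open>is_vcat\<close> is an equation of arrows. Tested on tuples of the
  shape of its domain, with \<open>one\<close> for a unit factor, it becomes an axiom of ordinary
  categories for elements.\<close>

lemma is_vcatI:
  assumes "vhom A \<in> obs A \<rightarrow>\<^sub>E obs A \<rightarrow>\<^sub>E UNIV"
    and "vid A \<in> (\<Pi>\<^sub>E a\<in>obs A. hom \<I> (vhom A a a))"
    and "vcmp A \<in> (\<Pi>\<^sub>E a\<in>obs A. \<Pi>\<^sub>E b\<in>obs A. \<Pi>\<^sub>E c\<in>obs A.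
       hom (vhom A b c \<otimes> vhom A a b) (vhom A a c))"
    and "\<And>a b f. a \<in> obs A \<Longrightarrow> b \<in> obs A \<Longrightarrow> f \<in> El (vhom A a b) \<Longrightarrow> cmp A a b b (ide A b) f = f"
    and "\<And>a b f. a \<in> obs A \<Longrightarrow> b \<in> obs A \<Longrightarrow> f \<in> El (vhom A a b) \<Longrightarrow> cmp A a a b f (ide A a) = f"
    and "\<And>a b c d f g h. a \<in> obs A \<Longrightarrow> b \<in> obs A \<Longrightarrow> c \<in> obs A \<Longrightarrow> d \<in> obs A \<Longrightarrow>
       f \<in> El (vhom A a b) \<Longrightarrow> g \<in> El (vhom A b c) \<Longrightarrow> h \<in> El (vhom A c d) \<Longrightarrow>
       cmp A a b d (cmp A b c d h g) f = cmp A a c d h (cmp A a b c g f)"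
  shows "is_vcat A"
proof -
  have [simp]: "vdom V (vid A a) = \<I>" "vcod V (vid A a) = vhom A a a" if "a \<in> obs A" for a
    using assms(2) that by (auto simp: PiE_iff)
  have [simp]: "vdom V (vcmp A a b c) = vhom A b c \<otimes> vhom A a b"
    "vcod V (vcmp A a b c) = vhom A a c" if "a \<in> obs A" "b \<in> obs A" "c \<in> obs A" for a b c
    using assms(3) that by (auto simp: PiE_iff)
  show ?thesis
    unfolding is_vcat_def
  proof (intro conjI ballI)
    fix a b assume ab: "a \<in> obs A" "b \<in> obs A"
    show "vcmp A a b b \<cdot> (vid A b \<boxtimes> idt (vhom A a b)) = lu (vhom A a b)"
      by (rule act_eqI_one_pair[of "vhom A a b"]) (use ab assms in simp_all)
    show "vcmp A a a b \<cdot> (idt (vhom A a b) \<boxtimes> vid A a) = ru (vhom A a b)"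
      by (rule act_eqI_pair_one[of "vhom A a b"]) (use ab assms in simp_all)
  next
    fix a b c d assume "a \<in> obs A" "b \<in> obs A" "c \<in> obs A" "d \<in> obs A"
    then show "vcmp A a b d \<cdot> (vcmp A b c d \<boxtimes> idt (vhom A a b)) =
       vcmp A a c d \<cdot> (idt (vhom A c d) \<boxtimes> vcmp A a b c) \<cdot>
         asc (vhom A c d) (vhom A b c) (vhom A a b)"
      by (intro act_eqI_pair_left[of "vhom A c d" "vhom A b c" "vhom A a b"])
        (use assms(6) in simp_all)
  qed (use assms in auto)
qed

context
  fixes A :: "('a, 'o, 'm) vcat"
  assumes A: "is_vcat A"
begin

lemma
  assumes "a \<in> obs A"
  shows vdom_vid [simp]: "vdom V (vid A a) = \<I>"
    and vcod_vid [simp]: "vcod V (vid A a) = vhom A a a"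
  using A assms by (auto simp: is_vcat_def PiE_iff)

lemma
  assumes "a \<in> obs A" "b \<in> obs A" "c \<in> obs A"
  shows vdom_vcmp [simp]: "vdom V (vcmp A a b c) = vhom A b c \<otimes> vhom A a b"
    and vcod_vcmp [simp]: "vcod V (vcmp A a b c) = vhom A a c"
  using A assms by (auto simp: is_vcat_def PiE_iff)

lemma cmp_ide_left [simp]:
  assumes "a \<in> obs A" "b \<in> obs A" "f \<in> El (vhom A a b)"
  shows "cmp A a b b (ide A b) f = f"
proof -
  have "(vcmp A a b b \<cdot> (vid A b \<boxtimes> idt (vhom A a b))) \<bullet> (one \<odot> f) = lu (vhom A a b) \<bullet> (one \<odot> f)"
    using A assms by (simp add: is_vcat_def)
  then show ?thesis using assms by simp
qed

lemma cmp_ide_right [simp]: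
  assumes "a \<in> obs A" "b \<in> obs A" "f \<in> El (vhom A a b)"
  shows "cmp A a a b f (ide A a) = f"
proof -
  have "(vcmp A a a b \<cdot> (idt (vhom A a b) \<boxtimes> vid A a)) \<bullet> (f \<odot> one) = ru (vhom A a b) \<bullet> (f \<odot> one)"
    using A assms by (simp add: is_vcat_def)
  then show ?thesis using assms by simp
qed

lemma cmp_cmp [simp]:
  assumes "a \<in> obs A" "b \<in> obs A" "c \<in> obs A" "d \<in> obs A"
    and "f \<in> El (vhom A a b)" "g \<in> El (vhom A b c)" "h \<in> El (vhom A c d)"
  shows "cmp A a b d (cmp A b c d h g) f = cmp A a c d h (cmp A a b c g f)"
proof -
  have "(vcmp A a b d \<cdot> (vcmp A b c d \<boxtimes> idt (vhom A a b))) \<bullet> ((h \<odot> g) \<odot> f) =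
     (vcmp A a c d \<cdot> (idt (vhom A c d) \<boxtimes> vcmp A a b c) \<cdot>
         asc (vhom A c d) (vhom A b c) (vhom A a b)) \<bullet> ((h \<odot> g) \<odot> f)"
    using A assms by (simp only: is_vcat_def)
  then show ?thesis using assms by simp
qed

end

lemma is_vcat_vself [simp]: "is_vcat vself"
proof (rule is_vcatI)
  fix a b c d f g h
  assume "f \<in> El (vhom vself a b)"
  then show "cmp vself a b b (ide vself b) f = f" "cmp vself a a b f (ide vself a) = f"
    by (auto intro: ih_ext[of _ a b])
  assume "f \<in> El (vhom vself a b)" "g \<in> El (vhom vself b c)" "h \<in> El (vhom vself c d)"
  then show "cmp vself a b d (cmp vself b c d h g) f = cmp vself a c d h (cmp vself a b c g f)"
    by (auto intro: ih_ext[of _ a d])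
qed auto

lemma is_vfunI:
  assumes A: "is_vcat A" and B: "is_vcat B"
    and F: "fob F \<in> obs A \<rightarrow>\<^sub>E obs B"
      "fhom F \<in> (\<Pi>\<^sub>E a\<in>obs A. \<Pi>\<^sub>E b\<in>obs A. hom (vhom A a b) (vhom B (fob F a) (fob F b)))"
    and "\<And>a. a \<in> obs A \<Longrightarrow> fhom F a a \<bullet> ide A a = ide B (fob F a)"
    and "\<And>a b c f g. a \<in> obs A \<Longrightarrow> b \<in> obs A \<Longrightarrow> c \<in> obs A \<Longrightarrow>
       f \<in> El (vhom A a b) \<Longrightarrow> g \<in> El (vhom A b c) \<Longrightarrow>
       fhom F a c \<bullet> cmp A a b c g f =
       cmp B (fob F a) (fob F b) (fob F c) (fhom F b c \<bullet> g) (fhom F a b \<bullet> f)"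
  shows "is_vfun A B F"
proof -
  have [simp]: "fob F a \<in> obs B" if "a \<in> obs A" for a
    using F(1) that by auto
  have [simp]: "vdom V (fhom F a b) = vhom A a b" "vcod V (fhom F a b) = vhom B (fob F a) (fob F b)"
    if "a \<in> obs A" "b \<in> obs A" for a b
    using F(2) that by (auto simp: PiE_iff)
  note [simp] = A B
  show ?thesis
    unfolding is_vfun_def
  proof (intro conjI ballI)
    fix a assume "a \<in> obs A"
    then show "fhom F a a \<cdot> vid A a = vid B (fob F a)"
      by (intro act_eqI_one) (use assms(5) in simp_all)
  next
    fix a b c assume "a \<in> obs A" "b \<in> obs A" "c \<in> obs A"
    then show "fhom F a c \<cdot> vcmp A a b c =
       vcmp B (fob F a) (fob F b) (fob F c) \<cdot> (fhom F b c \<boxtimes> fhom F a b)"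
      by (intro act_eqI_pair[of "vhom A b c" "vhom A a b"]) (use assms(6) in simp_all)
  qed (use F in auto)
qed

context
  fixes A :: "('a, 'o, 'm) vcat" and B :: "('b, 'o, 'm) vcat" and F :: "('a, 'b, 'm) vfun"
  assumes F: "is_vfun A B F"
begin

lemma fob_in: "a \<in> obs A \<Longrightarrow> fob F a \<in> obs B"
  using F by (auto simp: is_vfun_def)

lemma fob_undef: "a \<notin> obs A \<Longrightarrow> fob F a = undefined"
  using F by (auto simp: is_vfun_def)

lemma fhom_undef: "a \<notin> obs A \<or> b \<notin> obs A \<Longrightarrow> fhom F a b = (if a \<in> obs A then undefined else undefined b)"
  using F by (force simp: is_vfun_def PiE_iff extensional_def)

lemma
  assumes "a \<in> obs A" "b \<in> obs A"
  shows vdom_fhom: "vdom V (fhom F a b) = vhom A a b"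
    and vcod_fhom: "vcod V (fhom F a b) = vhom B (fob F a) (fob F b)"
  using F assms by (auto simp: is_vfun_def PiE_iff)

lemma fhom_ide:
  assumes "a \<in> obs A" "is_vcat A"
  shows "fhom F a a \<bullet> ide A a = ide B (fob F a)"
proof -
  have "(fhom F a a \<cdot> vid A a) \<bullet> one = ide B (fob F a)" using F assms by (simp add: is_vfun_def)
  then show ?thesis using assms by (simp add: vdom_fhom)
qed

lemma fhom_cmp:
  assumes "a \<in> obs A" "b \<in> obs A" "c \<in> obs A" "is_vcat A" "is_vcat B"
    and "f \<in> El (vhom A a b)" "g \<in> El (vhom A b c)"
  shows "fhom F a c \<bullet> cmp A a b c g f =
       cmp B (fob F a) (fob F b) (fob F c) (fhom F b c \<bullet> g) (fhom F a b \<bullet> f)"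
proof -
  have "(fhom F a c \<cdot> vcmp A a b c) \<bullet> (g \<odot> f) =
    (vcmp B (fob F a) (fob F b) (fob F c) \<cdot> (fhom F b c \<boxtimes> fhom F a b)) \<bullet> (g \<odot> f)"
    using F assms by (simp only: is_vfun_def)
  then show ?thesis using assms by (simp add: vdom_fhom vcod_fhom fob_in)
qed

lemmas vfun_simps = fob_in vdom_fhom vcod_fhom fhom_ide fhom_cmp

end

text \<open>Outside the object set both functors are \<open>undefined\<close>, and inside it their
  arrows are determined by elements. The codomains may differ, as a functor does not record its
  codomain.\<close>

lemma vfun_eqI:
  assumes "is_vfun A B F" "is_vfun A B' G"
    and "\<And>a. a \<in> obs A \<Longrightarrow> fob F a = fob G a"
    and "\<And>a b f. a \<in> obs A \<Longrightarrow> b \<in> obs A \<Longrightarrow> f \<in> El (vhom A a b) \<Longrightarrow> fhom F a b \<bullet> f = fhom G a b \<bullet> f"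
  shows "F = G"
proof (rule vfun.equality)
  show "fob F = fob G"
  proof
    fix a
    show "fob F a = fob G a"
      by (cases "a \<in> obs A")
        (simp_all add: assms(3) fob_undef[OF assms(1)] fob_undef[OF assms(2)])
  qed
  show "fhom F = fhom G"
  proof (intro ext)
    fix a b
    show "fhom F a b = fhom G a b"
    proof (cases "a \<in> obs A \<and> b \<in> obs A")
      case True
      then show ?thesis
        using assms(4)[of a b] vdom_fhom[OF assms(1), of a b] vdom_fhom[OF assms(2), of a b]
        by (auto intro: act_eqI[of "vhom A a b"])
    next
      case False
      then show ?thesis using fhom_undef[OF assms(1)] fhom_undef[OF assms(2)] by auto
    qed
  qed
qed simp

lemma vnatI:
  assumes A: "is_vcat A" and B: "is_vcat B" and F: "is_vfun A B F" and G: "is_vfun A B G"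
    and \<alpha>: "\<alpha> \<in> (\<Pi>\<^sub>E a\<in>obs A. hom \<I> (vhom B (fob F a) (fob G a)))"
    and "\<And>a b f. a \<in> obs A \<Longrightarrow> b \<in> obs A \<Longrightarrow> f \<in> El (vhom A a b) \<Longrightarrow>
      cmp B (fob F a) (fob F b) (fob G b) (\<alpha> b \<bullet> one) (fhom F a b \<bullet> f) =
      cmp B (fob F a) (fob G a) (fob G b) (fhom G a b \<bullet> f) (\<alpha> a \<bullet> one)"
  shows "vnat A B F G \<alpha>"
proof -
  have [simp]: "vdom V (\<alpha> a) = \<I>" "vcod V (\<alpha> a) = vhom B (fob F a) (fob G a)" if "a \<in> obs A" for a
    using \<alpha> that by (auto simp: PiE_iff)
  note [simp] = A B vfun_simps[OF F] vfun_simps[OF G]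
  show ?thesis
    unfolding vnat_def
  proof (intro conjI ballI)
    fix a b assume "a \<in> obs A" "b \<in> obs A"
    then show "vcmp B (fob F a) (fob F b) (fob G b) \<cdot> (\<alpha> b \<boxtimes> fhom F a b) \<cdot> vinv (lu (vhom A a b)) =
       vcmp B (fob F a) (fob G a) (fob G b) \<cdot> (fhom G a b \<boxtimes> \<alpha> a) \<cdot> vinv (ru (vhom A a b))"
      by (intro act_eqI[of "vhom A a b"]) (use assms(6) in simp_all)
  qed (use \<alpha> in auto)
qed

context
  fixes A :: "('a, 'o, 'm) vcat" and B :: "('b, 'o, 'm) vcat" and F G \<alpha>
  assumes \<alpha>: "vnat A B F G \<alpha>"
begin

lemma
  assumes "a \<in> obs A"
  shows vdom_vnat: "vdom V (\<alpha> a) = \<I>"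
    and vcod_vnat: "vcod V (\<alpha> a) = vhom B (fob F a) (fob G a)"
  using \<alpha> assms by (auto simp: vnat_def PiE_iff)

lemma vnat_undef: "a \<notin> obs A \<Longrightarrow> \<alpha> a = undefined"
  using \<alpha> by (auto simp: vnat_def)

lemma vnat_cmp:
  assumes "a \<in> obs A" "b \<in> obs A" "f \<in> El (vhom A a b)"
    and "is_vcat A" "is_vcat B" "is_vfun A B F" "is_vfun A B G"
  shows "cmp B (fob F a) (fob F b) (fob G b) (\<alpha> b \<bullet> one) (fhom F a b \<bullet> f) =
      cmp B (fob F a) (fob G a) (fob G b) (fhom G a b \<bullet> f) (\<alpha> a \<bullet> one)"
proof -
  have "(vcmp B (fob F a) (fob F b) (fob G b) \<cdot> (\<alpha> b \<boxtimes> fhom F a b) \<cdot> vinv (lu (vhom A a b))) \<bullet> f =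
       (vcmp B (fob F a) (fob G a) (fob G b) \<cdot> (fhom G a b \<boxtimes> \<alpha> a) \<cdot> vinv (ru (vhom A a b))) \<bullet> f"
    using \<alpha> assms by (simp only: vnat_def)
  then show ?thesis using assms by (simp add: vfun_simps[of A B] vdom_vnat vcod_vnat)
qed

lemmas vnat_simps = vdom_vnat vcod_vnat vnat_cmp

end

text \<open>A component has domain \<open>\<I>\<close> and is therefore determined by its value at
  \<open>one\<close>.\<close>

lemma vnat_eqI:
  assumes "vnat A B F G \<alpha>" "vnat A B' F' G' \<beta>"
    and "\<And>a. a \<in> obs A \<Longrightarrow> \<alpha> a \<bullet> one = \<beta> a \<bullet> one"
  shows "\<alpha> = \<beta>"
proof
  fix a
  show "\<alpha> a = \<beta> a"
    by (cases "a \<in> obs A")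
      (auto intro!: act_eqI_one simp: assms vdom_vnat[OF assms(1)] vdom_vnat[OF assms(2)]
        vnat_undef[OF assms(1)] vnat_undef[OF assms(2)])
qed

section \<open>The 2-category of enriched categories\<close>

lemma fid_simps [simp]:
  "a \<in> obs A \<Longrightarrow> fob (fid A) a = a"
  "a \<in> obs A \<Longrightarrow> b \<in> obs A \<Longrightarrow> fhom (fid A) a b = idt (vhom A a b)"
  by (simp_all add: fid_def)

lemma fcomp_simps [simp]:
  "a \<in> obs A \<Longrightarrow> fob (fcomp A G F) a = fob G (fob F a)"
  "a \<in> obs A \<Longrightarrow> b \<in> obs A \<Longrightarrow> fhom (fcomp A G F) a b = fhom G (fob F a) (fob F b) \<cdot> fhom F a b"
  by (simp_all add: fcomp_def)

lemma is_vfun_fid: "is_vcat A \<Longrightarrow> is_vfun A A (fid A)"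
  by (rule is_vfunI) (auto simp: fid_def)

lemma is_vfun_fcomp:
  assumes "is_vfun A B F" "is_vfun B C G" "is_vcat A" "is_vcat B" "is_vcat C"
  shows "is_vfun A C (fcomp A G F)"
proof -
  note [simp] = assms(3-5) vfun_simps[OF assms(1)] vfun_simps[OF assms(2)]
  show ?thesis
    by (rule is_vfunI) (auto simp: fcomp_def)
qed

lemma fcomp_assoc:
  assumes "is_vfun A B F" "is_vfun B C G" "is_vfun C D H"
    and "is_vcat A" "is_vcat B" "is_vcat C" "is_vcat D"
  shows "fcomp A (fcomp B H G) F = fcomp A H (fcomp A G F)"
proof -
  note [simp] = vfun_simps[OF assms(1)] vfun_simps[OF assms(2)] vfun_simps[OF assms(3)]
  show ?thesis
    by (rule vfun_eqI[OF is_vfun_fcomp[OF assms(1) is_vfun_fcomp[OF assms(2,3,5,6,7)] assms(4,5,7)]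
          is_vfun_fcomp[OF is_vfun_fcomp[OF assms(1,2,4,5,6)] assms(3,4,6,7)]]) simp_all
qed

lemma fcomp_fid_left:
  assumes "is_vfun A B F" "is_vcat A" "is_vcat B"
  shows "fcomp A (fid B) F = F"
proof -
  note [simp] = vfun_simps[OF assms(1)]
  show ?thesis
    by (rule vfun_eqI[OF is_vfun_fcomp[OF assms(1) is_vfun_fid[OF assms(3)] assms(2,3,3)] assms(1)]) simp_all
qed

lemma fcomp_fid_right:
  assumes "is_vfun A B F" "is_vcat A" "is_vcat B"
  shows "fcomp A F (fid A) = F"
proof -
  note [simp] = vfun_simps[OF assms(1)]
  show ?thesis
    by (rule vfun_eqI[OF is_vfun_fcomp[OF is_vfun_fid[OF assms(2)] assms(1,2,2,3)] assms(1)]) simp_all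
qed

lemma nid_simps [simp]: "a \<in> obs A \<Longrightarrow> nid A B F a = vid B (fob F a)"
  by (simp add: nid_def)

lemma vnat_nid:
  assumes "is_vfun A B F" "is_vcat A" "is_vcat B"
  shows "vnat A B F F (nid A B F)"
proof -
  note [simp] = assms(2,3) vfun_simps[OF assms(1)]
  show ?thesis by (rule vnatI) (auto simp: nid_def assms)
qed

lemma ncomp_one:
  assumes "vnat A B F G \<alpha>" "vnat A B G' H \<beta>" "a \<in> obs A" "fob G' a = fob G a"
    and "is_vfun A B F" "is_vfun A B G" "is_vfun A B H" "is_vcat A" "is_vcat B"
  shows "ncomp A B F G H \<beta> \<alpha> a \<bullet> one = cmp B (fob F a) (fob G a) (fob H a) (\<beta> a \<bullet> one) (\<alpha> a \<bullet> one)"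
  using assms by (simp add: ncomp_def vdom_vnat[OF assms(1)] vcod_vnat[OF assms(1)]
    vdom_vnat[OF assms(2)] vcod_vnat[OF assms(2)] fob_in)

lemma vnat_ncomp:
  assumes "vnat A B F G \<alpha>" "vnat A B G H \<beta>"
    and "is_vfun A B F" "is_vfun A B G" "is_vfun A B H" "is_vcat A" "is_vcat B"
  shows "vnat A B F H (ncomp A B F G H \<beta> \<alpha>)"
proof (rule vnatI)
  note [simp] = assms vfun_simps[OF assms(3)] vfun_simps[OF assms(4)] vfun_simps[OF assms(5)]
    vdom_vnat[OF assms(1)] vcod_vnat[OF assms(1)] vdom_vnat[OF assms(2)] vcod_vnat[OF assms(2)]
  show "ncomp A B F G H \<beta> \<alpha> \<in> (\<Pi>\<^sub>E a\<in>obs A. hom \<I> (vhom B (fob F a) (fob H a)))"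
    by (auto simp: ncomp_def)
  fix a b f assume ab: "a \<in> obs A" "b \<in> obs A" "f \<in> El (vhom A a b)"
  let ?F = "fob F" and ?G = "fob G" and ?H = "fob H"
  \<comment> \<open>The naturality square of \<open>\<beta>\<close>, precomposed with
    \<open>\<alpha> a\<close>; after reassociation the square of \<open>\<alpha>\<close> fits onto
    it.\<close>
  have "cmp B (?F a) (?G a) (?H b) (cmp B (?G a) (?G b) (?H b) (\<beta> b \<bullet> one) (fhom G a b \<bullet> f)) (\<alpha> a \<bullet> one) =
    cmp B (?F a) (?G a) (?H b) (cmp B (?G a) (?H a) (?H b) (fhom H a b \<bullet> f) (\<beta> a \<bullet> one)) (\<alpha> a \<bullet> one)"
    using ab by (simp only: vnat_cmp[OF assms(2)] assms)
  then have "cmp B (?F a) (?G b) (?H b) (\<beta> b \<bullet> one) (cmp B (?F a) (?G a) (?G b) (fhom G a b \<bullet> f) (\<alpha> a \<bullet> one)) =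
    cmp B (?F a) (?H a) (?H b) (fhom H a b \<bullet> f) (cmp B (?F a) (?G a) (?H a) (\<beta> a \<bullet> one) (\<alpha> a \<bullet> one))"
    using ab by simp
  then show "cmp B (?F a) (?F b) (?H b) (ncomp A B F G H \<beta> \<alpha> b \<bullet> one) (fhom F a b \<bullet> f) =
    cmp B (?F a) (?H a) (?H b) (fhom H a b \<bullet> f) (ncomp A B F G H \<beta> \<alpha> a \<bullet> one)"
    using ab by (simp add: ncomp_one[OF assms(1,2)] vnat_cmp[OF assms(1)])
qed (use assms in simp_all)

lemma ncomp_nid_left:
  assumes "vnat A B F G \<alpha>" "is_vfun A B F" "is_vfun A B G" "is_vcat A" "is_vcat B"
  shows "ncomp A B F G G (nid A B G) \<alpha> = \<alpha>"
  by (rule vnat_eqI[OF vnat_ncomp[OF assms(1) vnat_nid] assms(1)])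
    (use assms in \<open>simp_all add: ncomp_one[OF assms(1) vnat_nid] vfun_simps[of A B] vnat_simps[OF assms(1)]\<close>)

lemma wright_simps [simp]: "a \<in> obs A \<Longrightarrow> wright A \<alpha> F a = \<alpha> (fob F a)"
  by (simp add: wright_def)

lemma wleft_simps [simp]: "a \<in> obs A \<Longrightarrow> wleft A H F G \<alpha> a = fhom H (fob F a) (fob G a) \<cdot> \<alpha> a"
  by (simp add: wleft_def)

lemma vnat_wright:
  assumes "vnat B C G H \<alpha>" "is_vfun A B F" "is_vfun B C G" "is_vfun B C H"
    and "is_vcat A" "is_vcat B" "is_vcat C"
  shows "vnat A C (fcomp A G F) (fcomp A H F) (wright A \<alpha> F)"
proof -
  note [simp] = assms vfun_simps[OF assms(2)] vfun_simps[OF assms(3)] vfun_simps[OF assms(4)]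
    vnat_simps[OF assms(1)]
  show ?thesis
    by (rule vnatI[OF assms(5,7) is_vfun_fcomp[OF assms(2,3,5,6,7)] is_vfun_fcomp[OF assms(2,4,5,6,7)]])
      (auto simp: wright_def)
qed

lemma vnat_wleft:
  assumes "vnat A B F G \<alpha>" "is_vfun A B F" "is_vfun A B G" "is_vfun B C H"
    and "is_vcat A" "is_vcat B" "is_vcat C"
  shows "vnat A C (fcomp A H F) (fcomp A H G) (wleft A H F G \<alpha>)"
proof -
  note [simp] = assms vfun_simps[OF assms(2)] vfun_simps[OF assms(3)] vfun_simps[OF assms(4)]
    vdom_vnat[OF assms(1)] vcod_vnat[OF assms(1)]
  show ?thesis
  proof (rule vnatI[OF assms(5,7) is_vfun_fcomp[OF assms(2,4,5,6,7)] is_vfun_fcomp[OF assms(3,4,5,6,7)]])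
    fix a b f assume ab: "a \<in> obs A" "b \<in> obs A" "f \<in> El (vhom A a b)"
    have "fhom H (fob F a) (fob G b) \<bullet> cmp B (fob F a) (fob F b) (fob G b) (\<alpha> b \<bullet> one) (fhom F a b \<bullet> f) =
      fhom H (fob F a) (fob G b) \<bullet> cmp B (fob F a) (fob G a) (fob G b) (fhom G a b \<bullet> f) (\<alpha> a \<bullet> one)"
      using ab by (simp only: vnat_cmp[OF assms(1)] assms)
    then show "cmp C (fob (fcomp A H F) a) (fob (fcomp A H F) b) (fob (fcomp A H G) b)
      (wleft A H F G \<alpha> b \<bullet> one) (fhom (fcomp A H F) a b \<bullet> f) =
      cmp C (fob (fcomp A H F) a) (fob (fcomp A H G) a) (fob (fcomp A H G) b)
      (fhom (fcomp A H G) a b \<bullet> f) (wleft A H F G \<alpha> a \<bullet> one)"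
      using ab by simp
  qed (auto simp: wleft_def)
qed

section \<open>Opposites\<close>

lemma vop_simps [simp]:
  "obs (vop A) = obs A"
  "vid (vop A) = vid A"
  "a \<in> obs A \<Longrightarrow> b \<in> obs A \<Longrightarrow> vhom (vop A) a b = vhom A b a"
  by (simp_all add: vop_def)

lemma vcmp_vop [simp]:
  assumes "is_vcat A" "a \<in> obs A" "b \<in> obs A" "c \<in> obs A"
    and "f \<in> El (vhom A b a)" "g \<in> El (vhom A c b)"
  shows "cmp (vop A) a b c g f = cmp A c b a f g"
  using assms by (simp add: vop_def)

lemma is_vcat_vop [simp]:
  assumes A: "is_vcat A"
  shows "is_vcat (vop A)"
proof (rule is_vcatI)
  note [simp] = A
  show "vhom (vop A) \<in> obs (vop A) \<rightarrow>\<^sub>E obs (vop A) \<rightarrow>\<^sub>E UNIV"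
    by (auto simp: vop_def)
  show "vid (vop A) \<in> (\<Pi>\<^sub>E a\<in>obs (vop A). hom \<I> (vhom (vop A) a a))"
  proof -
    have "vid A \<in> (\<Pi>\<^sub>E a\<in>obs A. hom \<I> (vhom A a a))"
      using A unfolding is_vcat_def by blast
    moreover have "(\<Pi>\<^sub>E a\<in>obs (vop A). hom \<I> (vhom (vop A) a a)) = (\<Pi>\<^sub>E a\<in>obs A. hom \<I> (vhom A a a))"
      by (auto simp: PiE_iff)
    ultimately show ?thesis by simp
  qed
  show "vcmp (vop A) \<in> (\<Pi>\<^sub>E a\<in>obs (vop A). \<Pi>\<^sub>E b\<in>obs (vop A). \<Pi>\<^sub>E c\<in>obs (vop A).
       hom (vhom (vop A) b c \<otimes> vhom (vop A) a b) (vhom (vop A) a c))"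
    by (auto simp: vop_def)
qed (simp_all add: A)

lemma fop_simps [simp]:
  "fob (fop A F) = fob F"
  "a \<in> obs A \<Longrightarrow> b \<in> obs A \<Longrightarrow> fhom (fop A F) a b = fhom F b a"
  by (simp_all add: fop_def)

lemma is_vfun_fop:
  assumes F: "is_vfun A B F" and A: "is_vcat A" and B: "is_vcat B"
  shows "is_vfun (vop A) (vop B) (fop A F)"
proof (rule is_vfunI)
  note [simp] = A B vfun_simps[OF F]
  show "fob (fop A F) \<in> obs (vop A) \<rightarrow>\<^sub>E obs (vop B)"
    using F by (simp add: is_vfun_def)
  show "fhom (fop A F) \<in> (\<Pi>\<^sub>E a\<in>obs (vop A). \<Pi>\<^sub>E b\<in>obs (vop A).
      hom (vhom (vop A) a b) (vhom (vop B) (fob (fop A F) a) (fob (fop A F) b)))"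
    by (auto simp: fop_def)
qed (use A B in \<open>simp_all add: vfun_simps[OF F]\<close>)

text \<open>Not an instance of \<open>is_vfun_fop\<close>, which would produce a functor out of
  \<open>vop (vop A)\<close>. It is the form needed for \<open>Hom_right\<close>, whose target is an
  opposite.\<close>

lemma is_vfun_fop':
  assumes F: "is_vfun (vop A) B F" and A: "is_vcat A" and B: "is_vcat B"
  shows "is_vfun A (vop B) (fop A F)"
proof (rule is_vfunI)
  note [simp] = A B vfun_simps[OF F, simplified]
  show "fob (fop A F) \<in> obs A \<rightarrow>\<^sub>E obs (vop B)"
    using F by (simp add: is_vfun_def)
  show "fhom (fop A F) \<in> (\<Pi>\<^sub>E a\<in>obs A. \<Pi>\<^sub>E b\<in>obs A.
      hom (vhom A a b) (vhom (vop B) (fob (fop A F) a) (fob (fop A F) b)))"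
    by (auto simp: fop_def)
  fix a assume "a \<in> obs A"
  then show "fhom (fop A F) a a \<bullet> ide A a = ide (vop B) (fob (fop A F) a)"
    using fhom_ide[OF F, of a] by simp
next
  note [simp] = A B vfun_simps[OF F, simplified]
  fix a b c f g
  assume *: "a \<in> obs A" "b \<in> obs A" "c \<in> obs A" "f \<in> El (vhom A a b)" "g \<in> El (vhom A b c)"
  then show "fhom (fop A F) a c \<bullet> cmp A a b c g f =
    cmp (vop B) (fob (fop A F) a) (fob (fop A F) b) (fob (fop A F) c)
      (fhom (fop A F) b c \<bullet> g) (fhom (fop A F) a b \<bullet> f)"
    using fhom_cmp[OF F, of c b a g f] by simp
qed (use A B in simp_all)

lemma fop_fcomp:
  assumes "is_vfun A B F"
  shows "fop A (fcomp A G F) = fcomp (vop A) (fop B G) (fop A F)"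
  using fob_in[OF assms] by (auto simp: fop_def fcomp_def restrict_def fun_eq_iff)

lemma fop_fid: "fop A (fid A) = fid (vop A)"
  by (auto simp: fop_def fid_def restrict_def fun_eq_iff)

section \<open>Invertible transformations\<close>

lemma inverse_natsI:
  assumes "vnat A B F G \<alpha>" "vnat A B G F \<beta>"
    and "is_vfun A B F" "is_vfun A B G" "is_vcat A" "is_vcat B"
    and "\<And>a. a \<in> obs A \<Longrightarrow> cmp B (fob F a) (fob G a) (fob F a) (\<beta> a \<bullet> one) (\<alpha> a \<bullet> one) = ide B (fob F a)"
    and "\<And>a. a \<in> obs A \<Longrightarrow> cmp B (fob G a) (fob F a) (fob G a) (\<alpha> a \<bullet> one) (\<beta> a \<bullet> one) = ide B (fob G a)"
  shows "inverse_nats A B F G \<alpha> \<beta>"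
  unfolding inverse_nats_def
proof (intro conjI)
  show "ncomp A B F G F \<beta> \<alpha> = nid A B F"
    by (rule vnat_eqI[OF vnat_ncomp[OF assms(1,2,3,4,3,5,6)] vnat_nid[OF assms(3,5,6)]])
      (simp add: ncomp_one[OF assms(1,2)] assms)
  show "ncomp A B G F G \<alpha> \<beta> = nid A B G"
    by (rule vnat_eqI[OF vnat_ncomp[OF assms(2,1,4,3,4,5,6)] vnat_nid[OF assms(4,5,6)]])
      (simp add: ncomp_one[OF assms(2,1)] assms)
qed (use assms in simp_all)

lemma inverse_natsD:
  assumes "inverse_nats A B F G \<alpha> \<beta>"
    and "is_vfun A B F" "is_vfun A B G" "is_vcat A" "is_vcat B" "a \<in> obs A"
  shows "cmp B (fob F a) (fob G a) (fob F a) (\<beta> a \<bullet> one) (\<alpha> a \<bullet> one) = ide B (fob F a)"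
proof -
  have n: "vnat A B F G \<alpha>" "vnat A B G F \<beta>" using assms(1) by (auto simp: inverse_nats_def)
  have "ncomp A B F G F \<beta> \<alpha> a \<bullet> one = nid A B F a \<bullet> one" using assms(1) by (simp add: inverse_nats_def)
  then show ?thesis using assms by (simp add: ncomp_one[OF n])
qed

lemma inverse_nats_sym: "inverse_nats A B F G \<alpha> \<beta> \<Longrightarrow> inverse_nats A B G F \<beta> \<alpha>"
  by (simp add: inverse_nats_def)

lemma inverse_nats_nid:
  assumes "is_vfun A B F" "is_vcat A" "is_vcat B"
  shows "inverse_nats A B F F (nid A B F) (nid A B F)"
  by (rule inverse_natsI) (use assms in \<open>simp_all add: vnat_nid vfun_simps[OF assms(1)]\<close>)

lemma vnat_iso_nid:
  assumes "is_vfun A B F" "is_vcat A" "is_vcat B"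
  shows "vnat_iso A B F F (nid A B F)"
  using inverse_nats_nid[OF assms] by (auto simp: vnat_iso_def)

lemma vnat_isoD: "vnat_iso A B F G \<alpha> \<Longrightarrow> vnat A B F G \<alpha>"
  by (auto simp: vnat_iso_def inverse_nats_def)

lemma vnat_iso_ncomp:
  assumes "vnat_iso A B F G \<alpha>" "vnat_iso A B G H \<beta>"
    and "is_vfun A B F" "is_vfun A B G" "is_vfun A B H" "is_vcat A" "is_vcat B"
  shows "vnat_iso A B F H (ncomp A B F G H \<beta> \<alpha>)"
proof -
  obtain \<alpha>' \<beta>' where inv: "inverse_nats A B F G \<alpha> \<alpha>'" "inverse_nats A B G H \<beta> \<beta>'"
    using assms(1,2) by (auto simp: vnat_iso_def)
  then have n: "vnat A B F G \<alpha>" "vnat A B G F \<alpha>'" "vnat A B G H \<beta>" "vnat A B H G \<beta>'"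
    by (auto simp: inverse_nats_def)
  note [simp] = assms(3-7) vfun_simps[OF assms(3)] vfun_simps[OF assms(4)] vfun_simps[OF assms(5)]
    vdom_vnat[OF n(1)] vdom_vnat[OF n(2)] vdom_vnat[OF n(3)] vdom_vnat[OF n(4)]
    vcod_vnat[OF n(1)] vcod_vnat[OF n(2)] vcod_vnat[OF n(3)] vcod_vnat[OF n(4)]
  \<comment> \<open>Cancels mutually inverse components in the interior of a composite, where the
    right-nested normal form of \<open>cmp_cmp\<close> hides them.\<close>
  have c: "cmp B x y z h (cmp B x z y k f) = f"
    if "cmp B z y z h k = ide B z" "x \<in> obs B" "y \<in> obs B" "z \<in> obs B"
      "h \<in> El (vhom B y z)" "k \<in> El (vhom B z y)" "f \<in> El (vhom B x z)" for x y z h k f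
    using that cmp_cmp[of B x z y z f k h] by simp
  have "inverse_nats A B F H (ncomp A B F G H \<beta> \<alpha>) (ncomp A B H G F \<alpha>' \<beta>')"
  proof (rule inverse_natsI)
    show "vnat A B F H (ncomp A B F G H \<beta> \<alpha>)" "vnat A B H F (ncomp A B H G F \<alpha>' \<beta>')"
      using n by (auto intro: vnat_ncomp[of A B F G] vnat_ncomp[of A B H G])
    fix a assume a: "a \<in> obs A"
    show "cmp B (fob F a) (fob H a) (fob F a) (ncomp A B H G F \<alpha>' \<beta>' a \<bullet> one)
        (ncomp A B F G H \<beta> \<alpha> a \<bullet> one) = ide B (fob F a)"
      using a inverse_natsD[OF inv(1)] inverse_natsD[OF inv(2)]
      by (simp add: ncomp_one[OF n(1,3)] ncomp_one[OF n(4,2)] c[of "fob G a" "fob H a"])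
    show "cmp B (fob H a) (fob F a) (fob H a) (ncomp A B F G H \<beta> \<alpha> a \<bullet> one)
        (ncomp A B H G F \<alpha>' \<beta>' a \<bullet> one) = ide B (fob H a)"
      using a inverse_natsD[OF inverse_nats_sym[OF inv(1)]] inverse_natsD[OF inverse_nats_sym[OF inv(2)]]
      by (simp add: ncomp_one[OF n(1,3)] ncomp_one[OF n(4,2)] c[of "fob G a" "fob F a"])
  qed simp_all
  then show ?thesis by (auto simp: vnat_iso_def)
qed

lemma vnat_iso_wright:
  assumes "vnat_iso B C G H \<alpha>" "is_vfun A B F" "is_vfun B C G" "is_vfun B C H"
    and "is_vcat A" "is_vcat B" "is_vcat C"
  shows "vnat_iso A C (fcomp A G F) (fcomp A H F) (wright A \<alpha> F)"
proof -
  obtain \<beta> where inv: "inverse_nats B C G H \<alpha> \<beta>"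
    using assms(1) by (auto simp: vnat_iso_def)
  then have n: "vnat B C G H \<alpha>" "vnat B C H G \<beta>" by (auto simp: inverse_nats_def)
  have "inverse_nats A C (fcomp A G F) (fcomp A H F) (wright A \<alpha> F) (wright A \<beta> F)"
    using vnat_wright[OF n(1) assms(2,3,4,5,6,7)] vnat_wright[OF n(2) assms(2,4,3,5,6,7)]
      is_vfun_fcomp[OF assms(2,3,5,6,7)] is_vfun_fcomp[OF assms(2,4,5,6,7)] assms(5,7)
  proof (rule inverse_natsI)
    fix a assume a: "a \<in> obs A"
    show "cmp C (fob (fcomp A G F) a) (fob (fcomp A H F) a) (fob (fcomp A G F) a)
        (wright A \<beta> F a \<bullet> one) (wright A \<alpha> F a \<bullet> one) = ide C (fob (fcomp A G F) a)"
      using a inverse_natsD[OF inv assms(3,4,6,7) fob_in[OF assms(2) a]] by simp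
    show "cmp C (fob (fcomp A H F) a) (fob (fcomp A G F) a) (fob (fcomp A H F) a)
        (wright A \<alpha> F a \<bullet> one) (wright A \<beta> F a \<bullet> one) = ide C (fob (fcomp A H F) a)"
      using a inverse_natsD[OF inverse_nats_sym[OF inv] assms(4,3,6,7) fob_in[OF assms(2) a]] by simp
  qed
  then show ?thesis by (auto simp: vnat_iso_def)
qed

section \<open>The pseudo-slice over the base\<close>

lemma over_1cell_id: "is_over X \<Longrightarrow> over_1cell X X (over_id X)"
  by (auto simp: is_over_def over_1cell_def over_id_def is_vfun_fid fcomp_fid_right vnat_iso_nid)

lemma over_1cell_comp:
  assumes X: "is_over X" and Y: "is_over Y" and Z: "is_over Z"
    and P: "over_1cell X Y P" and Q: "over_1cell Y Z Q"
  shows "over_1cell X Z (over_comp X Y Z Q P)"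
proof -
  have v: "is_vcat (fst X)" "is_vcat (fst Y)" "is_vcat (fst Z)"
    and g: "is_vfun (fst X) vself (snd X)" "is_vfun (fst Y) vself (snd Y)" "is_vfun (fst Z) vself (snd Z)"
    and f: "is_vfun (fst X) (fst Y) (fst P)" "is_vfun (fst Y) (fst Z) (fst Q)"
    and n: "vnat_iso (fst X) vself (fcomp (fst X) (snd Y) (fst P)) (snd X) (snd P)"
      "vnat_iso (fst Y) vself (fcomp (fst Y) (snd Z) (fst Q)) (snd Y) (snd Q)"
    using assms by (auto simp: is_over_def over_1cell_def)
  have "vnat_iso (fst X) vself (fcomp (fst X) (snd Z) (fcomp (fst X) (fst Q) (fst P)))
      (fcomp (fst X) (snd Y) (fst P)) (wright (fst X) (snd Q) (fst P))"
    using vnat_iso_wright[OF n(2) f(1) is_vfun_fcomp[OF f(2) g(3) v(2,3)] g(2) v(1,2)]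
      fcomp_assoc[OF f g(3) v] by simp
  then have "vnat_iso (fst X) vself (fcomp (fst X) (snd Z) (fcomp (fst X) (fst Q) (fst P))) (snd X)
      (snd (over_comp X Y Z Q P))"
    unfolding over_comp_def snd_conv
    using n(1)
    by (rule vnat_iso_ncomp)
      (simp_all add: g v is_vfun_fcomp[OF f v] is_vfun_fcomp[OF f(1) g(2)]
        is_vfun_fcomp[OF is_vfun_fcomp[OF f v] g(3)])
  then show ?thesis
    by (simp add: over_1cell_def over_comp_def is_vfun_fcomp[OF f v])
qed

lemma over_comp_one:
  assumes X: "is_over X" and Y: "is_over Y" and Z: "is_over Z"
    and P: "over_1cell X Y P" and Q: "over_1cell Y Z Q" and a: "a \<in> obs (fst X)"
  shows "snd (over_comp X Y Z Q P) a \<bullet> one =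
    cmp vself (fob (snd Z) (fob (fst Q) (fob (fst P) a))) (fob (snd Y) (fob (fst P) a)) (fob (snd X) a)
      (snd P a \<bullet> one) (snd Q (fob (fst P) a) \<bullet> one)"
proof -
  have f: "is_vfun (fst X) (fst Y) (fst P)" "is_vfun (fst Y) (fst Z) (fst Q)"
    and n: "vnat (fst X) vself (fcomp (fst X) (snd Y) (fst P)) (snd X) (snd P)"
      "vnat (fst Y) vself (fcomp (fst Y) (snd Z) (fst Q)) (snd Y) (snd Q)"
    using assms by (auto simp: is_over_def over_1cell_def vnat_isoD)
  show ?thesis
    using a fob_in[OF f(1) a]
    by (simp add: over_comp_def ncomp_def vdom_vnat[OF n(1)] vdom_vnat[OF n(2)]
        vcod_vnat[OF n(1)] vcod_vnat[OF n(2)])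
qed

lemma over_1cell_eqI:
  assumes "over_1cell X Y P" "over_1cell X Y Q" "fst P = fst Q"
    and "\<And>a. a \<in> obs (fst X) \<Longrightarrow> snd P a \<bullet> one = snd Q a \<bullet> one"
  shows "P = Q"
proof (rule prod_eqI)
  show "snd P = snd Q"
    using assms by (intro vnat_eqI[of "fst X" vself]) (auto simp: over_1cell_def intro: vnat_isoD)
qed (use assms in simp)

text \<open>Strict, although the slice is a pseudo-slice: functors compose strictly, and the
  components of the invertible parts are the same threefold composite in the base.\<close>

lemma over_comp_assoc:
  assumes X: "is_over X" and Y: "is_over Y" and Z: "is_over Z" and W: "is_over W"
    and P: "over_1cell X Y P" and Q: "over_1cell Y Z Q" and R: "over_1cell Z W R"
  shows "over_comp X Y W (over_comp Y Z W R Q) P = over_comp X Z W R (over_comp X Y Z Q P)"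
proof -
  have v: "is_vcat (fst X)" "is_vcat (fst Y)" "is_vcat (fst Z)" "is_vcat (fst W)"
    and f: "is_vfun (fst X) (fst Y) (fst P)" "is_vfun (fst Y) (fst Z) (fst Q)"
      "is_vfun (fst Z) (fst W) (fst R)"
    and n: "vnat (fst X) vself (fcomp (fst X) (snd Y) (fst P)) (snd X) (snd P)"
      "vnat (fst Y) vself (fcomp (fst Y) (snd Z) (fst Q)) (snd Y) (snd Q)"
      "vnat (fst Z) vself (fcomp (fst Z) (snd W) (fst R)) (snd Z) (snd R)"
    using assms by (auto simp: is_over_def over_1cell_def vnat_isoD)
  have [simp]: "fst (over_comp X Y Z Q P) = fcomp (fst X) (fst Q) (fst P)" for X Y Z :: "('x, 'o, 'm) over" and Q P
    by (simp add: over_comp_def)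
  show ?thesis
  proof (rule over_1cell_eqI)
    show "over_1cell X W (over_comp X Y W (over_comp Y Z W R Q) P)"
      by (rule over_1cell_comp[OF X Y W P over_1cell_comp[OF Y Z W Q R]])
    show "over_1cell X W (over_comp X Z W R (over_comp X Y Z Q P))"
      by (rule over_1cell_comp[OF X Z W over_1cell_comp[OF X Y Z P Q] R])
    show "fst (over_comp X Y W (over_comp Y Z W R Q) P) = fst (over_comp X Z W R (over_comp X Y Z Q P))"
      by (simp add: over_comp_def fcomp_assoc[OF f v])
    fix a assume a: "a \<in> obs (fst X)"
    note a' = fob_in[OF f(1) a] fob_in[OF f(2) fob_in[OF f(1) a]]
    show "snd (over_comp X Y W (over_comp Y Z W R Q) P) a \<bullet> one =
        snd (over_comp X Z W R (over_comp X Y Z Q P)) a \<bullet> one"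
      unfolding over_comp_one[OF X Y W P over_1cell_comp[OF Y Z W Q R] a]
        over_comp_one[OF X Z W over_1cell_comp[OF X Y Z P Q] R a]
        over_comp_one[OF Y Z W Q R a'(1)] over_comp_one[OF X Y Z P Q a]
      using a a'
      by (simp add: over_comp_def vdom_vnat[OF n(1)] vdom_vnat[OF n(2)] vdom_vnat[OF n(3)]
          vcod_vnat[OF n(1)] vcod_vnat[OF n(2)] vcod_vnat[OF n(3)])
  qed
qed

lemma over_comp_id_left:
  assumes X: "is_over X" and Y: "is_over Y" and P: "over_1cell X Y P"
  shows "over_comp X Y Y (over_id Y) P = P"
proof (rule over_1cell_eqI[OF over_1cell_comp[OF X Y Y P over_1cell_id[OF Y]] P])
  have v: "is_vcat (fst X)" "is_vcat (fst Y)"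
    and f: "is_vfun (fst X) (fst Y) (fst P)"
    and n: "vnat (fst X) vself (fcomp (fst X) (snd Y) (fst P)) (snd X) (snd P)"
    using assms by (auto simp: is_over_def over_1cell_def vnat_isoD)
  show "fst (over_comp X Y Y (over_id Y) P) = fst P"
    by (simp add: over_comp_def over_id_def fcomp_fid_left[OF f v])
  fix a assume a: "a \<in> obs (fst X)"
  show "snd (over_comp X Y Y (over_id Y) P) a \<bullet> one = snd P a \<bullet> one"
    unfolding over_comp_one[OF X Y Y P over_1cell_id[OF Y] a]
    using a fob_in[OF f a] by (simp add: over_id_def vdom_vnat[OF n] vcod_vnat[OF n])
qed

lemma over_comp_id_right:
  assumes X: "is_over X" and Y: "is_over Y" and P: "over_1cell X Y P"
  shows "over_comp X X Y P (over_id X) = P"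
proof (rule over_1cell_eqI[OF over_1cell_comp[OF X X Y over_1cell_id[OF X] P] P])
  have v: "is_vcat (fst X)" "is_vcat (fst Y)"
    and f: "is_vfun (fst X) (fst Y) (fst P)"
    and n: "vnat (fst X) vself (fcomp (fst X) (snd Y) (fst P)) (snd X) (snd P)"
    using assms by (auto simp: is_over_def over_1cell_def vnat_isoD)
  show "fst (over_comp X X Y P (over_id X)) = fst P"
    by (simp add: over_comp_def over_id_def fcomp_fid_right[OF f v])
  fix a assume a: "a \<in> obs (fst X)"
  show "snd (over_comp X X Y P (over_id X)) a \<bullet> one = snd P a \<bullet> one"
    unfolding over_comp_one[OF X X Y over_1cell_id[OF X] P a]
    using a fob_in[OF f a] by (simp add: over_id_def vdom_vnat[OF n] vcod_vnat[OF n])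
qed

text \<open>Identity 1-cells with identity 2-cells. Since \<open>over_comp\<close> has strict units,
  the composites to be compared are identities. This is what makes \<open>Alg_over T\<close>
  algebraic.\<close>

lemma over_equivalent_refl:
  assumes X: "is_over X"
  shows "over_equivalent X X"
proof -
  have v: "is_vcat (fst X)" and g: "is_vfun (fst X) vself (snd X)"
    using assms by (auto simp: is_over_def)
  have "over_2cell X X (over_id X) (over_id X) (nid (fst X) (fst X) (fid (fst X)))"
    unfolding over_2cell_def
  proof
    let ?n = "nid (fst X) (fst X) (fid (fst X))"
    have n: "vnat (fst X) (fst X) (fid (fst X)) (fid (fst X)) ?n"
      by (rule vnat_nid[OF is_vfun_fid[OF v] v v])
    then show "vnat (fst X) (fst X) (fst (over_id X)) (fst (over_id X)) ?n" by (simp add: over_id_def)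
    have w: "vnat (fst X) vself (snd X) (snd X) (wleft (fst X) (snd X) (fid (fst X)) (fid (fst X)) ?n)"
      using vnat_wleft[OF n is_vfun_fid[OF v] is_vfun_fid[OF v] g v v]
      by (simp add: fcomp_fid_right[OF g v])
    show "ncomp (fst X) vself (fcomp (fst X) (snd X) (fst (over_id X)))
        (fcomp (fst X) (snd X) (fst (over_id X))) (snd X) (snd (over_id X))
        (wleft (fst X) (snd X) (fst (over_id X)) (fst (over_id X)) ?n) = snd (over_id X)"
      unfolding over_id_def fst_conv snd_conv
      by (simp add: fcomp_fid_right[OF g v] ncomp_nid_left[OF w g g v])
        (rule vnat_eqI[OF w vnat_nid[OF g v]], simp_all add: v vfun_simps[OF g])
  qed
  then have "over_iso_1cells X X (over_id X) (over_id X)"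
    unfolding over_iso_1cells_def
    by (intro exI[of _ "nid (fst X) (fst X) (fid (fst X))"])
      (simp add: over_id_def inverse_nats_nid is_vfun_fid v)
  then show ?thesis
    unfolding over_equivalent_def
    using over_1cell_id[OF X] over_comp_id_left[OF X X over_1cell_id[OF X]]
    by (intro exI[of _ "over_id X"]) simp
qed

end

section \<open>The category of algebraic dual adjunctions\<close>

context arity_system
begin

lemma is_dual_adjD:
  assumes "is_dual_adj X"
  shows "is_over (dleft X)" "is_over (dright X)" "is_vcat (fst (dleft X))" "is_vcat (fst (dright X))"
    "is_vfun (vop (fst (dleft X))) (fst (dright X)) (ddelta X)"
  using assms by (auto simp: is_dual_adj_def algebraic_def is_over_def is_vadj_def)

context
  fixes P :: "('a, 'b, 'o, 'm) dual_cell"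
  assumes P: "is_dual_cell P"
begin

lemma is_dual_cell_adj: "is_dual_adj (csrc P)" "is_dual_adj (ctgt P)"
  using P by (auto simp: is_dual_cell_def)

lemmas src_adj = is_dual_adjD[OF is_dual_cell_adj(1)]
lemmas tgt_adj = is_dual_adjD[OF is_dual_cell_adj(2)]

lemma is_dual_cell_over:
  "over_1cell (dleft (csrc P)) (dleft (ctgt P)) (cleft P)"
  "over_1cell (dright (csrc P)) (dright (ctgt P)) (cright P)"
  using P by (auto simp: is_dual_cell_def)

lemma is_vfun_cell:
  "is_vfun (fst (dleft (csrc P))) (fst (dleft (ctgt P))) (fst (cleft P))"
  "is_vfun (fst (dright (csrc P))) (fst (dright (ctgt P))) (fst (cright P))"
  "is_vfun (vop (fst (dleft (csrc P)))) (vop (fst (dleft (ctgt P))))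
     (fop (fst (dleft (csrc P))) (fst (cleft P)))"
  using is_dual_cell_over src_adj tgt_adj by (auto simp: over_1cell_def intro: is_vfun_fop)

lemma is_vfun_cphi:
  "is_vfun (vop (fst (dleft (csrc P)))) (fst (dright (ctgt P)))
       (fcomp (vop (fst (dleft (csrc P)))) (fst (cright P)) (ddelta (csrc P)))"
  "is_vfun (vop (fst (dleft (csrc P)))) (fst (dright (ctgt P)))
       (fcomp (vop (fst (dleft (csrc P)))) (ddelta (ctgt P))
          (fop (fst (dleft (csrc P))) (fst (cleft P))))"
  using is_vfun_fcomp[OF src_adj(5) is_vfun_cell(2)] is_vfun_fcomp[OF is_vfun_cell(3) tgt_adj(5)]
    src_adj tgt_adj by auto

lemma vnat_cphi:
  "vnat (vop (fst (dleft (csrc P)))) (fst (dright (ctgt P)))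
       (fcomp (vop (fst (dleft (csrc P)))) (fst (cright P)) (ddelta (csrc P)))
       (fcomp (vop (fst (dleft (csrc P)))) (ddelta (ctgt P))
          (fop (fst (dleft (csrc P))) (fst (cleft P))))
       (cphi P)"
  using P by (auto simp: is_dual_cell_def)

end

lemma is_dual_cell_id:
  assumes X: "is_dual_adj X"
  shows "is_dual_cell (dual_id X)"
proof -
  note x = is_dual_adjD[OF X]
  show ?thesis
    using X x by (simp add: is_dual_cell_def dual_id_def over_1cell_id)
      (simp add: over_id_def fop_fid fcomp_fid_left[OF x(5)] fcomp_fid_right[OF x(5)] vnat_nid)
qed

context
  fixes P Q :: "('a, 'b, 'o, 'm) dual_cell"
  assumes P: "is_dual_cell P" and Q: "is_dual_cell Q" and QP: "csrc Q = ctgt P"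
begin

lemma dual_comp_simps:
  "csrc (dual_comp Q P) = csrc P" "ctgt (dual_comp Q P) = ctgt Q"
  "cleft (dual_comp Q P) = over_comp (dleft (csrc P)) (dleft (csrc Q)) (dleft (ctgt Q)) (cleft Q) (cleft P)"
  "cright (dual_comp Q P) = over_comp (dright (csrc P)) (dright (csrc Q)) (dright (ctgt Q)) (cright Q) (cright P)"
  by (simp_all add: dual_comp_def Let_def)

lemma is_dual_cell_comp: "is_dual_cell (dual_comp Q P)"
proof -
  note p = src_adj[OF P] tgt_adj[OF P] is_vfun_cell[OF P] is_vfun_cphi[OF P]
  note q = src_adj[OF Q, unfolded QP] tgt_adj[OF Q] is_vfun_cell[OF Q, unfolded QP]
    is_vfun_cphi[OF Q, unfolded QP]
  let ?A = "vop (fst (dleft (csrc P)))" and ?C = "fst (dright (ctgt Q))"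
  let ?Pl = "fop (fst (dleft (csrc P))) (fst (cleft P))"
  let ?Ql = "fop (fst (dleft (ctgt P))) (fst (cleft Q))"
  let ?D1 = "ddelta (csrc P)" and ?D2 = "ddelta (ctgt P)" and ?D3 = "ddelta (ctgt Q)"
  let ?Pr = "fst (cright P)" and ?Qr = "fst (cright Q)"
  have vc: "is_vcat ?A" "is_vcat (vop (fst (dleft (ctgt P))))" "is_vcat (vop (fst (dleft (ctgt Q))))"
    using p q by simp_all
  note v = vc p(3,4,8,9) q(3,4,8,9)
  \<comment> \<open>\<open>dual_comp\<close> and \<open>is_dual_cell\<close> bracket the composite
    functors differently; \<open>a1\<close> to \<open>a4\<close> are the strict equations that
    identify the two forms.\<close>
  have a1: "fcomp ?A (fcomp (fst (dright (csrc P))) ?Qr ?Pr) ?D1 = fcomp ?A ?Qr (fcomp ?A ?Pr ?D1)"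
    by (rule fcomp_assoc[OF p(5,12) q(12)]) (use v in auto)
  have a2: "fcomp ?A (fcomp (vop (fst (dleft (ctgt P)))) ?Qr ?D2) ?Pl = fcomp ?A ?Qr (fcomp ?A ?D2 ?Pl)"
    by (rule fcomp_assoc[OF p(13,10) q(12)]) (use v in auto)
  have a3: "fcomp ?A (fcomp (vop (fst (dleft (ctgt P)))) ?D3 ?Ql) ?Pl = fcomp ?A ?D3 (fcomp ?A ?Ql ?Pl)"
    by (rule fcomp_assoc[OF p(13) q(13,10)]) (use v in auto)
  have a4: "fop (fst (dleft (csrc P))) (fcomp (fst (dleft (csrc P))) (fst (cleft Q)) (fst (cleft P))) = fcomp ?A ?Ql ?Pl"
    by (rule fop_fcomp[OF p(11)])
  have n1: "vnat ?A ?C (fcomp ?A ?Qr (fcomp ?A ?Pr ?D1)) (fcomp ?A ?Qr (fcomp ?A ?D2 ?Pl))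
      (wleft ?A ?Qr (fcomp ?A ?Pr ?D1) (fcomp ?A ?D2 ?Pl) (cphi P))"
    by (rule vnat_wleft[OF vnat_cphi[OF P] p(14,15) q(12)]) (use v in auto)
  have n2: "vnat ?A ?C (fcomp ?A ?Qr (fcomp ?A ?D2 ?Pl)) (fcomp ?A ?D3 (fcomp ?A ?Ql ?Pl))
      (wright ?A (cphi Q) ?Pl)"
    using vnat_wright[OF vnat_cphi[OF Q, unfolded QP] p(13) q(14,15)] v a2 a3 by auto
  have f: "is_vfun ?A ?C (fcomp ?A ?Qr (fcomp ?A ?Pr ?D1))" "is_vfun ?A ?C (fcomp ?A ?Qr (fcomp ?A ?D2 ?Pl))"
    "is_vfun ?A ?C (fcomp ?A ?D3 (fcomp ?A ?Ql ?Pl))"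
    using is_vfun_fcomp[OF p(14) q(12)] is_vfun_fcomp[OF p(15) q(12)]
      is_vfun_fcomp[OF is_vfun_fcomp[OF p(13) q(13)] q(10)] v by auto
  have "vnat ?A ?C (fcomp ?A ?Qr (fcomp ?A ?Pr ?D1)) (fcomp ?A ?D3 (fcomp ?A ?Ql ?Pl)) (cphi (dual_comp Q P))"
    using vnat_ncomp[OF n1 n2 f] v by (simp add: dual_comp_def Let_def QP)
  then show ?thesis
    using over_1cell_comp[OF p(1,6) q(6) is_dual_cell_over(1)[OF P] is_dual_cell_over(1)[OF Q, unfolded QP]]
      over_1cell_comp[OF p(2,7) q(7) is_dual_cell_over(2)[OF P] is_dual_cell_over(2)[OF Q, unfolded QP]]
      is_dual_cell_adj[OF P] is_dual_cell_adj[OF Q]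
    by (simp add: is_dual_cell_def dual_comp_simps QP) (simp add: over_comp_def a1 a4)
qed

text \<open>The pasting evaluated at one object. With it the axioms of \<open>ADA\<close> become
  equations between composites in the right-hand category of the target.\<close>

lemma cphi_dual_comp:
  assumes a: "a \<in> obs (fst (dleft (csrc P)))"
  shows "cphi (dual_comp Q P) a \<bullet> one =
    cmp (fst (dright (ctgt Q))) (fob (fst (cright Q)) (fob (fst (cright P)) (fob (ddelta (csrc P)) a)))
      (fob (fst (cright Q)) (fob (ddelta (ctgt P)) (fob (fst (cleft P)) a)))
      (fob (ddelta (ctgt Q)) (fob (fst (cleft Q)) (fob (fst (cleft P)) a)))
      (cphi Q (fob (fst (cleft P)) a) \<bullet> one)
      (fhom (fst (cright Q)) (fob (fst (cright P)) (fob (ddelta (csrc P)) a))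
        (fob (ddelta (ctgt P)) (fob (fst (cleft P)) a)) \<bullet> cphi P a \<bullet> one)"
proof -
  note p = src_adj[OF P] tgt_adj[OF P] is_vfun_cell[OF P] is_vfun_cphi[OF P]
  note q = src_adj[OF Q, unfolded QP] tgt_adj[OF Q] is_vfun_cell[OF Q, unfolded QP]
    is_vfun_cphi[OF Q, unfolded QP]
  have a': "fob (fst (cleft P)) a \<in> obs (fst (dleft (ctgt P)))" by (rule fob_in[OF p(11) a])
  have o: "fob (ddelta (csrc P)) a \<in> obs (fst (dright (csrc P)))"
    "fob (ddelta (ctgt P)) (fob (fst (cleft P)) a) \<in> obs (fst (dright (ctgt P)))"
    "fob (ddelta (ctgt Q)) (fob (fst (cleft Q)) (fob (fst (cleft P)) a)) \<in> obs (fst (dright (ctgt Q)))"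
    using fob_in[OF p(5)] fob_in[OF p(10)] fob_in[OF q(10)] fob_in[OF q(11) a'] a a' by auto
  note o' = fob_in[OF p(12) o(1)] fob_in[OF q(12) o(2)] fob_in[OF q(12) fob_in[OF p(12) o(1)]]
  show ?thesis
    using a a' o o' p q
    by (simp add: dual_comp_def Let_def QP ncomp_def vdom_vnat[OF vnat_cphi[OF P]]
        vcod_vnat[OF vnat_cphi[OF P]] vdom_vnat[OF vnat_cphi[OF Q, unfolded QP]]
        vcod_vnat[OF vnat_cphi[OF Q, unfolded QP]] vdom_fhom[OF q(12)] vcod_fhom[OF q(12)])
qed

end

lemma dual_cell_eqI:
  assumes "is_dual_cell P" "is_dual_cell Q" "csrc P = csrc Q" "ctgt P = ctgt Q"
    and "cleft P = cleft Q" "cright P = cright Q"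
    and "\<And>a. a \<in> obs (fst (dleft (csrc P))) \<Longrightarrow> cphi P a \<bullet> one = cphi Q a \<bullet> one"
  shows "P = Q"
proof (rule dual_cell.equality)
  show "cphi P = cphi Q"
    by (rule vnat_eqI[OF vnat_cphi[OF assms(1)] vnat_cphi[OF assms(2), folded assms(3)]]) (use assms(7) in simp)
qed (use assms in simp_all)

lemma dual_id_simps:
  "csrc (dual_id X) = X" "ctgt (dual_id X) = X"
  "cleft (dual_id X) = over_id (dleft X)" "cright (dual_id X) = over_id (dright X)"
  "cphi (dual_id X) = nid (vop (fst (dleft X))) (fst (dright X)) (ddelta X)"
  by (simp_all add: dual_id_def)

lemma over_id_simps: "fst (over_id X) = fid (fst X)" "snd (over_id X) = nid (fst X) vself (snd X)"
  by (simp_all add: over_id_def)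

lemma dual_comp_id_right:
  assumes f: "is_dual_cell f"
  shows "dual_comp f (dual_id (csrc f)) = f"
proof -
  note p = src_adj[OF f] tgt_adj[OF f] is_vfun_cell[OF f] is_vfun_cphi[OF f]
  note o = is_dual_cell_over[OF f]
  have id: "is_dual_cell (dual_id (csrc f))" "csrc f = ctgt (dual_id (csrc f))"
    using is_dual_cell_id is_dual_cell_adj[OF f] by (auto simp: dual_id_simps)
  note c = dual_comp_simps[OF id(1) f id(2)]
  show ?thesis
  proof (rule dual_cell_eqI[OF is_dual_cell_comp[OF id(1) f id(2)] f])
    fix x assume "x \<in> obs (fst (dleft (csrc (dual_comp f (dual_id (csrc f))))))"
    then have x: "x \<in> obs (fst (dleft (csrc f)))" by (simp add: c dual_id_simps)
    then have x': "x \<in> obs (fst (dleft (csrc (dual_id (csrc f)))))" by (simp add: dual_id_simps)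
    have d: "fob (ddelta (csrc f)) x \<in> obs (fst (dright (csrc f)))"
      "fob (ddelta (ctgt f)) (fob (fst (cleft f)) x) \<in> obs (fst (dright (ctgt f)))"
      using fob_in[OF p(5)] fob_in[OF p(10)] fob_in[OF p(11)] x by auto
    show "cphi (dual_comp f (dual_id (csrc f))) x \<bullet> one = cphi f x \<bullet> one"
      unfolding cphi_dual_comp[OF id(1) f id(2) x']
      using x d p fob_in[OF p(12) d(1)]
      by (simp add: dual_id_simps over_id_simps fhom_ide[OF p(12)] vdom_vnat[OF vnat_cphi[OF f]]
          vcod_vnat[OF vnat_cphi[OF f]])
  qed (simp_all add: c dual_id_simps over_comp_id_right[OF p(1,6) o(1)] over_comp_id_right[OF p(2,7) o(2)])
qed

lemma dual_comp_id_left: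
  assumes f: "is_dual_cell f"
  shows "dual_comp (dual_id (ctgt f)) f = f"
proof -
  note p = src_adj[OF f] tgt_adj[OF f] is_vfun_cell[OF f] is_vfun_cphi[OF f]
  note o = is_dual_cell_over[OF f]
  have id: "is_dual_cell (dual_id (ctgt f))" "csrc (dual_id (ctgt f)) = ctgt f"
    using is_dual_cell_id is_dual_cell_adj[OF f] by (auto simp: dual_id_simps)
  note c = dual_comp_simps[OF f id]
  show ?thesis
  proof (rule dual_cell_eqI[OF is_dual_cell_comp[OF f id] f])
    fix x assume "x \<in> obs (fst (dleft (csrc (dual_comp (dual_id (ctgt f)) f))))"
    then have x: "x \<in> obs (fst (dleft (csrc f)))" by (simp add: c dual_id_simps)
    note x' = fob_in[OF p(11) x]
    have d: "fob (ddelta (csrc f)) x \<in> obs (fst (dright (csrc f)))"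
      "fob (ddelta (ctgt f)) (fob (fst (cleft f)) x) \<in> obs (fst (dright (ctgt f)))"
      using fob_in[OF p(5)] fob_in[OF p(10)] fob_in[OF p(11)] x by auto
    show "cphi (dual_comp (dual_id (ctgt f)) f) x \<bullet> one = cphi f x \<bullet> one"
      unfolding cphi_dual_comp[OF f id x]
      using x x' d p fob_in[OF p(12) d(1)]
      by (simp add: dual_id_simps over_id_simps vdom_vnat[OF vnat_cphi[OF f]]
          vcod_vnat[OF vnat_cphi[OF f]])
  qed (simp_all add: c dual_id_simps over_comp_id_left[OF p(1,6) o(1)] over_comp_id_left[OF p(2,7) o(2)])
qed

text \<open>On components both sides consist of the same three factors. They agree by functoriality
  of the right-hand leg of \<open>h\<close>, which is applied to a composite on one side and to its
  factors on the other.\<close>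

lemma dual_comp_assoc:
  assumes f: "is_dual_cell f" and g: "is_dual_cell g" and h: "is_dual_cell h"
    and gf: "csrc g = ctgt f" and hg: "csrc h = ctgt g"
  shows "dual_comp (dual_comp h g) f = dual_comp h (dual_comp g f)"
proof -
  note c1 = dual_comp_simps[OF f g gf] and c2 = dual_comp_simps[OF g h hg]
  have i1: "is_dual_cell (dual_comp g f)" "csrc h = ctgt (dual_comp g f)"
    using is_dual_cell_comp[OF f g gf] hg by (simp_all add: c1)
  have i2: "is_dual_cell (dual_comp h g)" "csrc (dual_comp h g) = ctgt f"
    using is_dual_cell_comp[OF g h hg] gf by (simp_all add: c2)
  note c3 = dual_comp_simps[OF i1(1) h i1(2)] and c4 = dual_comp_simps[OF f i2]
  note p = src_adj[OF f] tgt_adj[OF f] is_vfun_cell[OF f] is_vfun_cphi[OF f]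
  note q = src_adj[OF g, unfolded gf] tgt_adj[OF g] is_vfun_cell[OF g, unfolded gf]
    is_vfun_cphi[OF g, unfolded gf]
  note r = src_adj[OF h, unfolded hg] tgt_adj[OF h] is_vfun_cell[OF h, unfolded hg]
    is_vfun_cphi[OF h, unfolded hg]
  show ?thesis
  proof (rule dual_cell_eqI[OF is_dual_cell_comp[OF f i2] is_dual_cell_comp[OF i1(1) h i1(2)]])
    fix x assume "x \<in> obs (fst (dleft (csrc (dual_comp (dual_comp h g) f))))"
    then have x: "x \<in> obs (fst (dleft (csrc f)))" by (simp add: c4)
    then have x': "x \<in> obs (fst (dleft (csrc (dual_comp g f))))" by (simp add: c1)
    note y = fob_in[OF p(11) x]
    then have y': "fob (fst (cleft f)) x \<in> obs (fst (dleft (csrc g)))" by (simp add: gf)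
    note z = fob_in[OF q(11) y]
    note w = fob_in[OF r(11) z]
    have d: "fob (ddelta (csrc f)) x \<in> obs (fst (dright (csrc f)))"
      "fob (ddelta (ctgt f)) (fob (fst (cleft f)) x) \<in> obs (fst (dright (ctgt f)))"
      "fob (ddelta (ctgt g)) (fob (fst (cleft g)) (fob (fst (cleft f)) x)) \<in> obs (fst (dright (ctgt g)))"
      "fob (ddelta (ctgt h)) (fob (fst (cleft h)) (fob (fst (cleft g)) (fob (fst (cleft f)) x))) \<in> obs (fst (dright (ctgt h)))"
      using fob_in[OF p(5)] fob_in[OF p(10)] fob_in[OF q(10)] fob_in[OF r(10)] x y z w by auto
    note e = fob_in[OF p(12) d(1)] fob_in[OF q(12) fob_in[OF p(12) d(1)]]
      fob_in[OF r(12) fob_in[OF q(12) fob_in[OF p(12) d(1)]]]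
      fob_in[OF q(12) d(2)] fob_in[OF r(12) fob_in[OF q(12) d(2)]] fob_in[OF r(12) d(3)]
    note [simp] = vdom_vnat[OF vnat_cphi[OF f]] vcod_vnat[OF vnat_cphi[OF f]]
      vdom_vnat[OF vnat_cphi[OF g], unfolded gf] vcod_vnat[OF vnat_cphi[OF g], unfolded gf]
      vdom_vnat[OF vnat_cphi[OF h], unfolded hg] vcod_vnat[OF vnat_cphi[OF h], unfolded hg]
      vdom_fhom[OF q(12)] vcod_fhom[OF q(12)] vdom_fhom[OF r(12)] vcod_fhom[OF r(12)]
    show "cphi (dual_comp (dual_comp h g) f) x \<bullet> one = cphi (dual_comp h (dual_comp g f)) x \<bullet> one"
      unfolding cphi_dual_comp[OF i1(1) h i1(2) x'] cphi_dual_comp[OF f i2 x] c1 c2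
        cphi_dual_comp[OF f g gf x] cphi_dual_comp[OF g h hg y']
      using x y z w d e p(3,4,8,9) q(3,4,8,9) r(3,4,8,9)
      by (simp add: over_comp_def gf hg fhom_cmp[OF r(12)])
  next
    show "cleft (dual_comp (dual_comp h g) f) = cleft (dual_comp h (dual_comp g f))"
      using over_comp_assoc[OF p(1,6) q(6) r(6) is_dual_cell_over(1)[OF f]
          is_dual_cell_over(1)[OF g, unfolded gf] is_dual_cell_over(1)[OF h, unfolded hg]]
      by (simp add: c1 c2 c3 c4 gf hg)
    show "cright (dual_comp (dual_comp h g) f) = cright (dual_comp h (dual_comp g f))"
      using over_comp_assoc[OF p(2,7) q(7) r(7) is_dual_cell_over(2)[OF f]
          is_dual_cell_over(2)[OF g, unfolded gf] is_dual_cell_over(2)[OF h, unfolded hg]]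
      by (simp add: c1 c2 c3 c4 gf hg)
  qed (simp_all add: c1 c2 c3 c4)
qed

lemma category_ADA: "category (ADA :: (('a, 'b, 'o, 'm) dual_adj, ('a, 'b, 'o, 'm) dual_cell) cat)"
  by unfold_locales
    (auto simp: ADA_def Homset_def is_dual_cell_adj is_dual_cell_id is_dual_cell_comp
      dual_comp_simps dual_id_simps dual_comp_id_left dual_comp_id_right dual_comp_assoc)

section \<open>Tensor products of enriched categories\<close>

lemma obs_vtimes [simp]: "obs (vtimes A B) = obs A \<times> obs B"
  by (simp add: vtimes_def)

lemma vhom_vtimes [simp]:
  "a \<in> obs A \<Longrightarrow> a' \<in> obs A \<Longrightarrow> b \<in> obs B \<Longrightarrow> b' \<in> obs B \<Longrightarrow>
   vhom (vtimes A B) (a, b) (a', b') = vhom A a a' \<otimes> vhom B b b'"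
  by (simp add: vtimes_def)

lemma
  assumes "is_vcat A" "is_vcat B" "a \<in> obs A" "b \<in> obs B"
  shows vdom_vid_vtimes [simp]: "vdom V (vid (vtimes A B) (a, b)) = \<I>"
    and vcod_vid_vtimes [simp]: "vcod V (vid (vtimes A B) (a, b)) = vhom A a a \<otimes> vhom B b b"
    and ide_vtimes [simp]: "ide (vtimes A B) (a, b) = ide A a \<odot> ide B b"
  using assms by (simp_all add: vtimes_def)

lemma
  assumes "is_vcat A" "is_vcat B" "a \<in> obs A" "a' \<in> obs A" "a'' \<in> obs A"
    "b \<in> obs B" "b' \<in> obs B" "b'' \<in> obs B"
  shows vdom_vcmp_vtimes [simp]: "vdom V (vcmp (vtimes A B) (a, b) (a', b') (a'', b'')) =
      (vhom A a' a'' \<otimes> vhom B b' b'') \<otimes> (vhom A a a' \<otimes> vhom B b b')"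
    and vcod_vcmp_vtimes [simp]: "vcod V (vcmp (vtimes A B) (a, b) (a', b') (a'', b'')) =
      vhom A a a'' \<otimes> vhom B b b''"
    and cmp_vtimes [simp]: "g \<in> El (vhom A a' a'') \<Longrightarrow> k \<in> El (vhom B b' b'') \<Longrightarrow>
      f \<in> El (vhom A a a') \<Longrightarrow> h \<in> El (vhom B b b') \<Longrightarrow>
      cmp (vtimes A B) (a, b) (a', b') (a'', b'') (g \<odot> k) (f \<odot> h) = cmp A a a' a'' g f \<odot> cmp B b b' b'' k h"
  using assms by (simp_all add: vtimes_def)

lemma is_vcat_vtimes [simp]:
  assumes A: "is_vcat A" and B: "is_vcat B"
  shows "is_vcat (vtimes A B)"
  unfolding is_vcat_def
proof (intro conjI ballI)
  note [simp] = A B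
  show "vhom (vtimes A B) \<in> obs (vtimes A B) \<rightarrow>\<^sub>E obs (vtimes A B) \<rightarrow>\<^sub>E UNIV"
    by (simp add: vtimes_def)
  show "vid (vtimes A B) \<in> (\<Pi>\<^sub>E p\<in>obs (vtimes A B). hom \<I> (vhom (vtimes A B) p p))"
    by (auto simp: vtimes_def)
  show "vcmp (vtimes A B) \<in> (\<Pi>\<^sub>E p\<in>obs (vtimes A B). \<Pi>\<^sub>E q\<in>obs (vtimes A B). \<Pi>\<^sub>E r\<in>obs (vtimes A B).
       hom (vhom (vtimes A B) q r \<otimes> vhom (vtimes A B) p q) (vhom (vtimes A B) p r))"
    by (auto simp: vtimes_def split: if_splits)
next
  note [simp] = A B
  fix p q assume "p \<in> obs (vtimes A B)" "q \<in> obs (vtimes A B)"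
  then obtain a b a' b' where [simp]: "p = (a, b)" "q = (a', b')"
    and *: "a \<in> obs A" "a' \<in> obs A" "b \<in> obs B" "b' \<in> obs B" by auto
  \<comment> \<open>The unit law has domain
    \<open>\<I> \<otimes> (A(a,a') \<otimes> B(b,b'))\<close>. Composing with the inverse of
    \<open>lu\<close> removes the unit, so that testing on pairings is enough; \<open>lu\<close> is
    put back afterwards.\<close>
  have "vcmp (vtimes A B) p q q \<cdot> (vid (vtimes A B) q \<boxtimes> idt (vhom (vtimes A B) p q)) \<cdot> vinv (lu (vhom (vtimes A B) p q)) =
      idt (vhom (vtimes A B) p q)"
    by (rule act_eqI_pair[of "vhom A a a'" "vhom B b b'"]) (use * in simp_all)
  then have "(vcmp (vtimes A B) p q q \<cdot> (vid (vtimes A B) q \<boxtimes> idt (vhom (vtimes A B) p q)) \<cdot> vinv (lu (vhom (vtimes A B) p q)))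
     \<cdot> lu (vhom (vtimes A B) p q) = lu (vhom (vtimes A B) p q)"
    by simp
  then show "vcmp (vtimes A B) p q q \<cdot> (vid (vtimes A B) q \<boxtimes> idt (vhom (vtimes A B) p q)) = lu (vhom (vtimes A B) p q)"
    using * by simp
  have "vcmp (vtimes A B) p p q \<cdot> (idt (vhom (vtimes A B) p q) \<boxtimes> vid (vtimes A B) p) \<cdot> vinv (ru (vhom (vtimes A B) p q)) =
      idt (vhom (vtimes A B) p q)"
    by (rule act_eqI_pair[of "vhom A a a'" "vhom B b b'"]) (use * in simp_all)
  then have "(vcmp (vtimes A B) p p q \<cdot> (idt (vhom (vtimes A B) p q) \<boxtimes> vid (vtimes A B) p) \<cdot> vinv (ru (vhom (vtimes A B) p q)))
     \<cdot> ru (vhom (vtimes A B) p q) = ru (vhom (vtimes A B) p q)"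
    by simp
  then show "vcmp (vtimes A B) p p q \<cdot> (idt (vhom (vtimes A B) p q) \<boxtimes> vid (vtimes A B) p) = ru (vhom (vtimes A B) p q)"
    using * by simp
next
  note [simp] = A B
  fix p q r s assume "p \<in> obs (vtimes A B)" "q \<in> obs (vtimes A B)" "r \<in> obs (vtimes A B)" "s \<in> obs (vtimes A B)"
  then obtain a b a' b' a'' b'' c d where [simp]: "p = (a, b)" "q = (a', b')" "r = (a'', b'')" "s = (c, d)"
    and *: "a \<in> obs A" "a' \<in> obs A" "b \<in> obs B" "b' \<in> obs B" "a'' \<in> obs A" "b'' \<in> obs B"
      "c \<in> obs A" "d \<in> obs B" by auto
  show "vcmp (vtimes A B) p q s \<cdot> (vcmp (vtimes A B) q r s \<boxtimes> idt (vhom (vtimes A B) p q)) =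
       vcmp (vtimes A B) p r s \<cdot> (idt (vhom (vtimes A B) r s) \<boxtimes> vcmp (vtimes A B) p q r) \<cdot>
         asc (vhom (vtimes A B) r s) (vhom (vtimes A B) q r) (vhom (vtimes A B) p q)"
  \<comment> \<open>Three morphisms of a tensor product have six components, so the arrows are
    compared at a pairing of six distinct variables.\<close>
  proof (rule eq_fresh_iso[OF _ fresh_iso_pair[OF fresh_iso_pair[OF
          fresh_iso_pair[OF fresh_iso_var[of 0 "{0}"] fresh_iso_var[of 1 "{1}"]]
          fresh_iso_pair[OF fresh_iso_var[of 2 "{2}"] fresh_iso_var[of 3 "{3}"]]]
          fresh_iso_pair[OF fresh_iso_var[of 4 "{4}"] fresh_iso_var[of 5 "{5}"]]]])
    show "vdom V (vcmp (vtimes A B) p q s \<cdot> (vcmp (vtimes A B) q r s \<boxtimes> idt (vhom (vtimes A B) p q))) =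
      ((vhom A a'' c \<otimes> vhom B b'' d) \<otimes> (vhom A a' a'' \<otimes> vhom B b' b'')) \<otimes> (vhom A a a' \<otimes> vhom B b b')"
      using * by simp
  qed (use * in simp_all)
qed

lemma fob_ftimes [simp]: "a \<in> obs A \<Longrightarrow> b \<in> obs B \<Longrightarrow> fob (ftimes A B F G) (a, b) = (fob F a, fob G b)"
  and fhom_ftimes [simp]: "a \<in> obs A \<Longrightarrow> b \<in> obs B \<Longrightarrow> a' \<in> obs A \<Longrightarrow> b' \<in> obs B \<Longrightarrow>
    fhom (ftimes A B F G) (a, b) (a', b') = fhom F a a' \<boxtimes> fhom G b b'"
  by (simp_all add: ftimes_def)

text \<open>\<open>is_vfunI\<close> would ask for functoriality at every element of
  \<open>A(a,a') \<otimes> B(b,b')\<close>, and such an element need not be a pairing. Arrows out of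
  the tensor product are nevertheless determined by pairings.\<close>

lemma vtimes_vfunI:
  assumes A: "is_vcat A" and B: "is_vcat B" and C: "is_vcat C"
    and F: "fob F \<in> obs A \<times> obs B \<rightarrow>\<^sub>E obs C"
      "fhom F \<in> (\<Pi>\<^sub>E p\<in>obs A \<times> obs B. \<Pi>\<^sub>E q\<in>obs A \<times> obs B.
        hom (vhom A (fst p) (fst q) \<otimes> vhom B (snd p) (snd q)) (vhom C (fob F p) (fob F q)))"
    and i: "\<And>a b. a \<in> obs A \<Longrightarrow> b \<in> obs B \<Longrightarrow>
      fhom F (a, b) (a, b) \<bullet> (ide A a \<odot> ide B b) = ide C (fob F (a, b))"
    and c: "\<And>a b a' b' a'' b'' f g h k. a \<in> obs A \<Longrightarrow> a' \<in> obs A \<Longrightarrow> a'' \<in> obs A \<Longrightarrow>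
       b \<in> obs B \<Longrightarrow> b' \<in> obs B \<Longrightarrow> b'' \<in> obs B \<Longrightarrow>
       f \<in> El (vhom A a a') \<Longrightarrow> h \<in> El (vhom B b b') \<Longrightarrow>
       g \<in> El (vhom A a' a'') \<Longrightarrow> k \<in> El (vhom B b' b'') \<Longrightarrow>
       fhom F (a, b) (a'', b'') \<bullet> (cmp A a a' a'' g f \<odot> cmp B b b' b'' k h) =
       cmp C (fob F (a, b)) (fob F (a', b')) (fob F (a'', b''))
         (fhom F (a', b') (a'', b'') \<bullet> (g \<odot> k)) (fhom F (a, b) (a', b') \<bullet> (f \<odot> h))"
  shows "is_vfun (vtimes A B) C F"
proof -
  have F1: "fob F (a, b) \<in> obs C" if "a \<in> obs A" "b \<in> obs B" for a b
    using F(1) that by auto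
  have F2: "vdom V (fhom F (a, b) (a', b')) = vhom A a a' \<otimes> vhom B b b'"
    "vcod V (fhom F (a, b) (a', b')) = vhom C (fob F (a, b)) (fob F (a', b'))"
    if "a \<in> obs A" "b \<in> obs B" "a' \<in> obs A" "b' \<in> obs B" for a b a' b'
    using F(2) that by (auto simp: PiE_iff)
  note [simp] = A B C F1 F2
  show ?thesis
    unfolding is_vfun_def
  proof (intro conjI ballI)
    show "fob F \<in> obs (vtimes A B) \<rightarrow>\<^sub>E obs C" using F(1) by simp
    show "fhom F \<in> (\<Pi>\<^sub>E p\<in>obs (vtimes A B). \<Pi>\<^sub>E q\<in>obs (vtimes A B).
        hom (vhom (vtimes A B) p q) (vhom C (fob F p) (fob F q)))"
      using F(2) by (auto simp: PiE_iff)
    fix p assume "p \<in> obs (vtimes A B)"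
    then show "fhom F p p \<cdot> vid (vtimes A B) p = vid C (fob F p)"
      by (intro act_eqI_one) (auto simp: i)
  next
    fix p q r assume "p \<in> obs (vtimes A B)" "q \<in> obs (vtimes A B)" "r \<in> obs (vtimes A B)"
    then obtain a b a' b' a'' b'' where [simp]: "p = (a, b)" "q = (a', b')" "r = (a'', b'')"
      and *: "a \<in> obs A" "a' \<in> obs A" "b \<in> obs B" "b' \<in> obs B" "a'' \<in> obs A" "b'' \<in> obs B" by auto
    show "fhom F p r \<cdot> vcmp (vtimes A B) p q r =
       vcmp C (fob F p) (fob F q) (fob F r) \<cdot> (fhom F q r \<boxtimes> fhom F p q)"
      by (rule act_eqI_pair_pair[of "vhom A a' a''" "vhom B b' b''" "vhom A a a'" "vhom B b b'"])
        (use * c in simp_all)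
  qed
qed

lemma is_vfun_ftimes:
  assumes "is_vfun A C F" "is_vfun B D G" "is_vcat A" "is_vcat B" "is_vcat C" "is_vcat D"
  shows "is_vfun (vtimes A B) (vtimes C D) (ftimes A B F G)"
proof -
  note [simp] = assms vfun_simps[OF assms(1)] vfun_simps[OF assms(2)]
  show ?thesis
    by (rule vtimes_vfunI) (auto simp: ftimes_def split: if_splits)
qed

lemma fcomp_ftimes:
  assumes "is_vfun A A' F" "is_vfun A' A'' F'" "is_vfun B B' G" "is_vfun B' B'' G'"
    and "is_vcat A" "is_vcat A'" "is_vcat A''" "is_vcat B" "is_vcat B'" "is_vcat B''"
  shows "ftimes A B (fcomp A F' F) (fcomp B G' G) = fcomp (vtimes A B) (ftimes A' B' F' G') (ftimes A B F G)"
proof -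
  note [simp] = assms vfun_simps[OF assms(1)] vfun_simps[OF assms(2)] vfun_simps[OF assms(3)] vfun_simps[OF assms(4)]
  show ?thesis
    by (auto simp: ftimes_def fcomp_def vtimes_def fun_eq_iff restrict_def tensor_comp')
qed

lemma ftimes_fid: "is_vcat A \<Longrightarrow> is_vcat B \<Longrightarrow> ftimes A B (fid A) (fid B) = fid (vtimes A B)"
  by (auto simp: ftimes_def fid_def vtimes_def fun_eq_iff restrict_def)

context
  fixes A :: "('a, 'o, 'm) vcat" and B :: "('b, 'o, 'm) vcat" and C :: "('c, 'o, 'm) vcat" and D
  assumes A: "is_vcat A" and B: "is_vcat B" and C: "is_vcat C" and D: "is_vfun (vtimes A B) C D"
begin

lemma fob_bifun: "a \<in> obs A \<Longrightarrow> b \<in> obs B \<Longrightarrow> fob D (a, b) \<in> obs C"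
  using fob_in[OF D, of "(a, b)"] by simp

lemma
  assumes "a \<in> obs A" "b \<in> obs B" "a' \<in> obs A" "b' \<in> obs B"
  shows vdom_bifun: "vdom V (fhom D (a, b) (a', b')) = vhom A a a' \<otimes> vhom B b b'"
    and vcod_bifun: "vcod V (fhom D (a, b) (a', b')) = vhom C (fob D (a, b)) (fob D (a', b'))"
  using vdom_fhom[OF D, of "(a, b)" "(a', b')"] vcod_fhom[OF D, of "(a, b)" "(a', b')"] assms by simp_all

lemma bifun_ide: "a \<in> obs A \<Longrightarrow> b \<in> obs B \<Longrightarrow>
    fhom D (a, b) (a, b) \<bullet> (ide A a \<odot> ide B b) = ide C (fob D (a, b))"
  using fhom_ide[OF D, of "(a, b)"] by (simp add: A B)

text \<open>Oriented against \<open>fhom_cmp\<close>: two successive actions of \<open>D\<close> are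
  merged into one, which brings both sides of an interchange law to the same form.\<close>

lemma bifun_cmp:
  assumes "a \<in> obs A" "a' \<in> obs A" "a'' \<in> obs A" "b \<in> obs B" "b' \<in> obs B" "b'' \<in> obs B"
    and "f \<in> El (vhom A a a')" "h \<in> El (vhom B b b')" "g \<in> El (vhom A a' a'')" "k \<in> El (vhom B b' b'')"
  shows "cmp C (fob D (a, b)) (fob D (a', b')) (fob D (a'', b''))
         (fhom D (a', b') (a'', b'') \<bullet> (g \<odot> k)) (fhom D (a, b) (a', b') \<bullet> (f \<odot> h)) =
      fhom D (a, b) (a'', b'') \<bullet> (cmp A a a' a'' g f \<odot> cmp B b b' b'' k h)"
  using fhom_cmp[OF D, of "(a, b)" "(a', b')" "(a'', b'')" "f \<odot> h" "g \<odot> k"] assms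
  by (simp add: A B C)

lemmas bifun_simps = fob_bifun vdom_bifun vcod_bifun bifun_ide bifun_cmp

lemma fob_fix_left [simp]: "b \<in> obs B \<Longrightarrow> fob (fix_left A B D a) b = fob D (a, b)"
  and fob_fix_right [simp]: "a \<in> obs A \<Longrightarrow> fob (fix_right A B D b) a = fob D (a, b)"
  by (simp_all add: fix_left_def fix_right_def)

lemma fhom_fix_left [simp]:
  assumes "a \<in> obs A" "b \<in> obs B" "b' \<in> obs B" "g \<in> El (vhom B b b')"
  shows "fhom (fix_left A B D a) b b' \<bullet> g = fhom D (a, b) (a, b') \<bullet> (ide A a \<odot> g)"
  using assms by (simp add: fix_left_def bifun_simps A B C)

lemma fhom_fix_right [simp]:
  assumes "b \<in> obs B" "a \<in> obs A" "a' \<in> obs A" "f \<in> El (vhom A a a')"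
  shows "fhom (fix_right A B D b) a a' \<bullet> f = fhom D (a, b) (a', b) \<bullet> (f \<odot> ide B b)"
  using assms by (simp add: fix_right_def bifun_simps A B C)

lemma is_vfun_fix_left:
  assumes a: "a \<in> obs A"
  shows "is_vfun B C (fix_left A B D a)"
proof (rule is_vfunI[OF B C])
  note [simp] = A B C bifun_simps a
  show "fob (fix_left A B D a) \<in> obs B \<rightarrow>\<^sub>E obs C" by (simp add: fix_left_def)
  show "fhom (fix_left A B D a) \<in> (\<Pi>\<^sub>E b\<in>obs B. \<Pi>\<^sub>E b'\<in>obs B.
      hom (vhom B b b') (vhom C (fob (fix_left A B D a) b) (fob (fix_left A B D a) b')))"
    by (simp add: fix_left_def)
qed (simp_all add: A B C bifun_simps a)

lemma is_vfun_fix_right: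
  assumes b: "b \<in> obs B"
  shows "is_vfun A C (fix_right A B D b)"
proof (rule is_vfunI[OF A C])
  note [simp] = A B C bifun_simps b
  show "fob (fix_right A B D b) \<in> obs A \<rightarrow>\<^sub>E obs C" by (simp add: fix_right_def)
  show "fhom (fix_right A B D b) \<in> (\<Pi>\<^sub>E a\<in>obs A. \<Pi>\<^sub>E a'\<in>obs A.
      hom (vhom A a a') (vhom C (fob (fix_right A B D b) a) (fob (fix_right A B D b) a')))"
    by (simp add: fix_right_def)
qed (simp_all add: A B C bifun_simps b)

end

section \<open>Powers\<close>

text \<open>Flipping the arguments of a function with two arguments requires exchanging the last two
  of three factors, the first being the function itself.\<close>

definition exch :: "'o \<Rightarrow> 'o \<Rightarrow> 'o \<Rightarrow> 'm" where
  "exch a b c = vinv (asc a c b) \<cdot> (idt a \<boxtimes> sy b c) \<cdot> asc a b c"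

lemma vdom_exch [simp]: "vdom V (exch a b c) = (a \<otimes> b) \<otimes> c"
  and vcod_exch [simp]: "vcod V (exch a b c) = (a \<otimes> c) \<otimes> b"
  by (simp_all add: exch_def)

lemma act_exch [simp]:
  "x \<in> El a \<Longrightarrow> y \<in> El b \<Longrightarrow> z \<in> El c \<Longrightarrow> exch a b c \<bullet> ((x \<odot> y) \<odot> z) = (x \<odot> z) \<odot> y"
  by (simp add: exch_def)

definition power_map :: "('a, 'o, 'm) vcat \<Rightarrow> 'o \<Rightarrow> 'a \<Rightarrow> 'a \<Rightarrow> 'm \<Rightarrow> 'a \<Rightarrow> 'm" where
  "power_map A x a p \<kappa> b = transp (vhom A b p) x (vhom A b a)
     (vcmp A b p a \<cdot> (\<kappa> \<boxtimes> idt (vhom A b p)) \<cdot> sy (vhom A b p) x)"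

lemma is_power_iff: "is_power A x a p \<kappa> \<longleftrightarrow> a \<in> obs A \<and> p \<in> obs A \<and> \<kappa> \<in> hom x (vhom A p a) \<and>
     (\<forall>b\<in>obs A. is_iso (power_map A x a p \<kappa> b))"
  by (simp add: is_power_def power_map_def)

lemma
  assumes "is_vcat A" "a \<in> obs A" "p \<in> obs A" "b \<in> obs A" "\<kappa> \<in> hom x (vhom A p a)"
  shows vdom_power_map [simp]: "vdom V (power_map A x a p \<kappa> b) = vhom A b p"
    and vcod_power_map [simp]: "vcod V (power_map A x a p \<kappa> b) = ih x (vhom A b a)"
    and app_power_map [simp]: "f \<in> El (vhom A b p) \<Longrightarrow> \<xi> \<in> El x \<Longrightarrow>
      app x (vhom A b a) (power_map A x a p \<kappa> b \<bullet> f) \<xi> = cmp A b p a (\<kappa> \<bullet> \<xi>) f"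
  using assms by (simp_all add: power_map_def)

text \<open>Up to the isomorphism of \<open>[\<I>,p]\<close> with \<open>p\<close> this is the
  comparison map of a power in the base at the test object \<open>\<I>\<close>.\<close>

definition self_power_map :: "'o \<Rightarrow> 'o \<Rightarrow> 'o \<Rightarrow> 'm \<Rightarrow> 'm" where
  "self_power_map x a p \<kappa> = transp p x a (untransp p a \<kappa> \<cdot> sy p x)"

lemma
  assumes "\<kappa> \<in> hom x (ih p a)"
  shows vdom_self_power_map [simp]: "vdom V (self_power_map x a p \<kappa>) = p"
    and vcod_self_power_map [simp]: "vcod V (self_power_map x a p \<kappa>) = ih x a"
    and app_self_power_map [simp]: "t \<in> El p \<Longrightarrow> \<xi> \<in> El x \<Longrightarrow>
      app x a (self_power_map x a p \<kappa> \<bullet> t) \<xi> = app p a (\<kappa> \<bullet> \<xi>) t"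
  using assms by (simp_all add: self_power_map_def)

text \<open>By closedness a power in the base is determined by its generalized elements, so the
  universal property need not be tested against all objects.\<close>

lemma is_power_vself:
  "is_power vself x a p \<kappa> \<longleftrightarrow> \<kappa> \<in> hom x (ih p a) \<and> is_iso (self_power_map x a p \<kappa>)"
proof (cases "\<kappa> \<in> hom x (ih p a)")
  case False
  then show ?thesis by (auto simp: is_power_iff)
next
  case True
  define \<sigma> where "\<sigma> = self_power_map x a p \<kappa>"
  define \<Phi> where "\<Phi> = power_map vself x a p \<kappa>"
  have s [simp]: "vdom V \<sigma> = p" "vcod V \<sigma> = ih x a" "vdom V \<kappa> = x" "vcod V \<kappa> = ih p a"
    using True by (simp_all add: \<sigma>_def)
  have s_app [simp]: "app x a (\<sigma> \<bullet> t) \<xi> = app p a (\<kappa> \<bullet> \<xi>) t" if "t \<in> El p" "\<xi> \<in> El x" for t \<xi>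
    using True that by (simp add: \<sigma>_def)
  have F [simp]: "vdom V (\<Phi> b) = ih b p" "vcod V (\<Phi> b) = ih x (ih b a)" for b
    using True vdom_power_map[of vself a p b \<kappa> x] vcod_power_map[of vself a p b \<kappa> x] by (simp_all add: \<Phi>_def)
  have F_app [simp]: "app x (ih b a) (\<Phi> b \<bullet> f) \<xi> = cmp vself b p a (\<kappa> \<bullet> \<xi>) f"
    if "f \<in> El (ih b p)" "\<xi> \<in> El x" for b f \<xi>
    using True that app_power_map[of vself a p b \<kappa> x] by (simp add: \<Phi>_def)
  have "is_iso (\<Phi> b)" if i: "is_iso \<sigma>" for b
  proof -
    \<comment> \<open>\<open>?w\<close> sends \<open>(g, z)\<close> to the function
      \<open>\<xi> \<mapsto> g \<xi> z\<close> in \<open>[x,a]\<close>. Hence \<open>?inv\<close>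
      sends \<open>g\<close> to the function whose value at \<open>z\<close> is the preimage of that
      one under \<open>\<sigma>\<close>.\<close>
    let ?w = "transp (ih x (ih b a) \<otimes> b) x a (ev b a \<cdot> (ev x (ih b a) \<boxtimes> idt b) \<cdot> exch (ih x (ih b a)) b x)"
    let ?inv = "transp (ih x (ih b a)) b p (vinv \<sigma> \<cdot> ?w)"
    have w: "vdom V ?w = ih x (ih b a) \<otimes> b" "vcod V ?w = ih x a" by simp_all
    show ?thesis
    proof (rule is_iso_actI)
      fix f assume f: "f \<in> El (vdom V (\<Phi> b))"
      show "?inv \<bullet> \<Phi> b \<bullet> f = f"
      proof (rule ih_ext[of _ b p])
        fix z assume z: "z \<in> El b"
        have "?w \<bullet> ((\<Phi> b \<bullet> f) \<odot> z) = \<sigma> \<bullet> app b p f z"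
          by (rule ih_ext[of _ x a]) (use f z in simp_all)
        then show "app b p (?inv \<bullet> \<Phi> b \<bullet> f) z = app b p f z" using f z i by simp
      qed (use f i in simp_all)
    next
      fix g assume g: "g \<in> El (vcod V (\<Phi> b))"
      show "\<Phi> b \<bullet> ?inv \<bullet> g = g"
      proof (rule ih_ext[of _ x "ih b a"])
        fix \<xi> assume \<xi>: "\<xi> \<in> El x"
        show "app x (ih b a) (\<Phi> b \<bullet> ?inv \<bullet> g) \<xi> = app x (ih b a) g \<xi>"
        proof (rule ih_ext[of _ b a])
          fix z assume z: "z \<in> El b"
          have "app p a (\<kappa> \<bullet> \<xi>) (vinv \<sigma> \<bullet> ?w \<bullet> (g \<odot> z)) = app x a (\<sigma> \<bullet> vinv \<sigma> \<bullet> ?w \<bullet> (g \<odot> z)) \<xi>"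
            using g \<xi> z i by (subst s_app) simp_all
          also have "\<dots> = app b a (app x (ih b a) g \<xi>) z" using g \<xi> z i by simp
          finally show "app b a (app x (ih b a) (\<Phi> b \<bullet> ?inv \<bullet> g) \<xi>) z = app b a (app x (ih b a) g \<xi>) z"
            using g \<xi> z i by simp
        qed (use g \<xi> i in simp_all)
      qed (use g i in simp_all)
    qed (use i in simp_all)
  qed
  moreover have "is_iso \<sigma>" if i: "\<And>b. is_iso (\<Phi> b)"
  proof -
    \<comment> \<open>Yoneda at \<open>b = [x,a]\<close>: the element \<open>?g\<close>, evaluation
      \<open>\<xi> \<mapsto> (h \<mapsto> h \<xi>)\<close>, is the image under
      \<open>\<Phi> ?b\<close> of an element \<open>?f\<close> of \<open>[[x,a],p]\<close>, whose
      underlying arrow \<open>?h\<close> is a section of \<open>\<sigma>\<close>.\<close>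
    let ?b = "ih x a"
    let ?g = "transp \<I> x (ih ?b a) (transp (\<I> \<otimes> x) ?b a (ev x a \<cdot> sy x ?b \<cdot> (lu x \<boxtimes> idt ?b)))"
    have g: "vdom V ?g = \<I>" "vcod V ?g = ih x (ih ?b a)" by simp_all
    let ?f = "vinv (\<Phi> ?b) \<cdot> ?g"
    have f: "vdom V ?f = \<I>" "vcod V ?f = ih ?b p" using i by simp_all
    let ?h = "untransp ?b p ?f \<cdot> vinv (lu ?b)"
    have fe: "?f \<bullet> one \<in> El (ih ?b p)" using i by simp
    have sh: "\<sigma> \<bullet> ?h \<bullet> h = h" if h: "h \<in> El ?b" for h
    proof (rule ih_ext[of _ x a])
      fix \<xi> assume \<xi>: "\<xi> \<in> El x"
      have "app x (ih ?b a) (\<Phi> ?b \<bullet> ?f \<bullet> one) \<xi> = app x (ih ?b a) (?g \<bullet> one) \<xi>" using i by simp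
      then have "cmp vself ?b p a (\<kappa> \<bullet> \<xi>) (?f \<bullet> one) = app x (ih ?b a) (?g \<bullet> one) \<xi>"
        using fe \<xi> by (simp only: F_app)
      then have "app ?b a (cmp vself ?b p a (\<kappa> \<bullet> \<xi>) (?f \<bullet> one)) h = app ?b a (app x (ih ?b a) (?g \<bullet> one) \<xi>) h"
        by simp
      then show "app x a (\<sigma> \<bullet> ?h \<bullet> h) \<xi> = app x a h \<xi>" using h \<xi> i by simp
    qed (use h i in simp_all)
    show ?thesis
    proof (rule is_iso_actI[of p ?h])
      fix t assume t: "t \<in> El p"
      \<comment> \<open>That \<open>?h \<cdot> \<sigma>\<close> is the identity follows from
        injectivity of \<open>\<Phi> p\<close>, applied to the elements of \<open>[p,p]\<close> that
        name the two arrows.\<close>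
      let ?e = "name p p (?h \<cdot> \<sigma>) \<bullet> one"
      have e: "?e \<in> El (ih p p)" using i by simp
      have e_app: "app p p ?e t = ?h \<bullet> \<sigma> \<bullet> t" if "t \<in> El p" for t using that i by simp
      have "\<Phi> p \<bullet> ?e = \<Phi> p \<bullet> ide vself p"
      proof (rule ih_ext[of _ x "ih p a"])
        fix \<xi> assume \<xi>: "\<xi> \<in> El x"
        show "app x (ih p a) (\<Phi> p \<bullet> ?e) \<xi> = app x (ih p a) (\<Phi> p \<bullet> ide vself p) \<xi>"
        proof (rule ih_ext[of _ p a])
          fix t assume t: "t \<in> El p"
          have "app p a (\<kappa> \<bullet> \<xi>) (?h \<bullet> \<sigma> \<bullet> t) = app x a (\<sigma> \<bullet> ?h \<bullet> \<sigma> \<bullet> t) \<xi>"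
            using t \<xi> i by (subst s_app) simp_all
          also have "\<dots> = app p a (\<kappa> \<bullet> \<xi>) t" using t \<xi> by (subst sh) simp_all
          finally show "app p a (app x (ih p a) (\<Phi> p \<bullet> ?e) \<xi>) t = app p a (app x (ih p a) (\<Phi> p \<bullet> ide vself p) \<xi>) t"
            using t \<xi> e by (simp add: e_app)
        qed (use \<xi> e in simp_all)
      qed (use e in simp_all)
      then have "?e = ide vself p" by (rule iso_actD[OF i]) (use e in simp_all)
      then show "?h \<bullet> \<sigma> \<bullet> t = t" using e_app[OF t] t by simp
    next
      fix h assume "h \<in> El (ih x a)"
      then show "\<sigma> \<bullet> ?h \<bullet> h = h" by (rule sh)
    qed (use i in simp_all)
  qed
  ultimately show ?thesis using True by (auto simp: is_power_iff \<sigma>_def \<Phi>_def)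
qed

text \<open>Surjectivity of the comparison map, applied to the element of \<open>[x, A(b,a)]\<close>
  named by \<open>\<mu>\<close>; \<open>power_unique\<close> is its injectivity.\<close>

lemma power_factor:
  assumes A: "is_vcat A" and p: "is_power A x a p \<kappa>" and b: "b \<in> obs A"
    and m: "\<mu> \<in> hom x (vhom A b a)"
  obtains u where "u \<in> hom \<I> (vhom A b p)"
    "\<And>\<xi>. \<xi> \<in> El x \<Longrightarrow> cmp A b p a (\<kappa> \<bullet> \<xi>) (u \<bullet> one) = \<mu> \<bullet> \<xi>"
proof
  have *: "a \<in> obs A" "p \<in> obs A" "\<kappa> \<in> hom x (vhom A p a)" "is_iso (power_map A x a p \<kappa> b)"
    using p b by (auto simp: is_power_iff)
  note s = vdom_power_map[OF A *(1,2) b *(3)] vcod_power_map[OF A *(1,2) b *(3)]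
    app_power_map[OF A *(1,2) b *(3)]
  let ?u = "vinv (power_map A x a p \<kappa> b) \<cdot> name x (vhom A b a) \<mu>"
  show "?u \<in> hom \<I> (vhom A b p)" using s m * by simp
  fix \<xi> assume \<xi>: "\<xi> \<in> El x"
  have "cmp A b p a (\<kappa> \<bullet> \<xi>) (?u \<bullet> one) = app x (vhom A b a) (power_map A x a p \<kappa> b \<bullet> ?u \<bullet> one) \<xi>"
    using s m * \<xi> by (subst s(3)) simp_all
  also have "\<dots> = \<mu> \<bullet> \<xi>" using s(1,2) m * \<xi> by simp
  finally show "cmp A b p a (\<kappa> \<bullet> \<xi>) (?u \<bullet> one) = \<mu> \<bullet> \<xi>" .
qed

lemma power_unique:
  assumes A: "is_vcat A" and p: "is_power A x a p \<kappa>" and b: "b \<in> obs A"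
    and fg: "f \<in> El (vhom A b p)" "g \<in> El (vhom A b p)"
    and eq: "\<And>\<xi>. \<xi> \<in> El x \<Longrightarrow> cmp A b p a (\<kappa> \<bullet> \<xi>) f = cmp A b p a (\<kappa> \<bullet> \<xi>) g"
  shows "f = g"
proof -
  have *: "a \<in> obs A" "p \<in> obs A" "\<kappa> \<in> hom x (vhom A p a)" "is_iso (power_map A x a p \<kappa> b)"
    using p b by (auto simp: is_power_iff)
  note s = vdom_power_map[OF A *(1,2) b *(3)] vcod_power_map[OF A *(1,2) b *(3)]
    app_power_map[OF A *(1,2) b *(3)]
  have "power_map A x a p \<kappa> b \<bullet> f = power_map A x a p \<kappa> b \<bullet> g"
    by (rule ih_ext[of _ x "vhom A b a"]) (use s fg eq in simp_all)
  then show ?thesis by (rule iso_actD[OF *(4)]) (use s fg in simp_all)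
qed

text \<open>Two powers of \<open>a\<close> by \<open>x\<close> are related by
  \<open>u : p \<rightarrow> p0\<close> and \<open>v : p0 \<rightarrow> p\<close> compatible with
  the counits, and \<open>F\<close> carries these over. The comparison map of \<open>F p\<close> is
  inverted by that of \<open>F p0\<close> followed by \<open>F v\<close>; this uses the one equation
  that \<open>v\<close> after \<open>u\<close> is the identity of \<open>p\<close>. Hence
  preservation need be checked for one power of each object by each exponent.\<close>

lemma is_power_transfer:
  assumes A: "is_vcat A" and B: "is_vcat B" and F: "is_vfun A B F"
    and p0: "is_power A x a p0 \<kappa>0" and p: "is_power A x a p \<kappa>"
    and Fp0: "is_power B x (fob F a) (fob F p0) (fhom F p0 a \<cdot> \<kappa>0)"
  shows "is_power B x (fob F a) (fob F p) (fhom F p a \<cdot> \<kappa>)"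
proof -
  have o: "a \<in> obs A" "p \<in> obs A" "p0 \<in> obs A"
    and k: "vdom V \<kappa> = x" "vcod V \<kappa> = vhom A p a" "vdom V \<kappa>0 = x" "vcod V \<kappa>0 = vhom A p0 a"
    using p p0 by (auto simp: is_power_iff)
  obtain u where u: "u \<in> hom \<I> (vhom A p p0)"
    and ku: "\<And>\<xi>. \<xi> \<in> El x \<Longrightarrow> cmp A p p0 a (\<kappa>0 \<bullet> \<xi>) (u \<bullet> one) = \<kappa> \<bullet> \<xi>"
    by (rule power_factor[OF A p0 o(2), where \<mu> = \<kappa>]) (use k in auto)
  obtain v where v: "v \<in> hom \<I> (vhom A p0 p)"
    and kv: "\<And>\<xi>. \<xi> \<in> El x \<Longrightarrow> cmp A p0 p a (\<kappa> \<bullet> \<xi>) (v \<bullet> one) = \<kappa>0 \<bullet> \<xi>"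
    by (rule power_factor[OF A p o(3), where \<mu> = \<kappa>0]) (use k in auto)
  note [simp] = A B vfun_simps[OF F] o k
  have ty [simp]: "vdom V u = \<I>" "vcod V u = vhom A p p0" "vdom V v = \<I>" "vcod V v = vhom A p0 p"
    using u v by auto
  have vu: "cmp A p p0 p (v \<bullet> one) (u \<bullet> one) = ide A p"
  proof (rule power_unique[OF A p o(2)])
    fix \<xi> assume \<xi>: "\<xi> \<in> El x"
    have "cmp A p p a (\<kappa> \<bullet> \<xi>) (cmp A p p0 p (v \<bullet> one) (u \<bullet> one)) =
      cmp A p p0 a (cmp A p0 p a (\<kappa> \<bullet> \<xi>) (v \<bullet> one)) (u \<bullet> one)"
      using \<xi> by (subst cmp_cmp[OF A]) simp_all
    also have "\<dots> = cmp A p p a (\<kappa> \<bullet> \<xi>) (ide A p)" using \<xi> by (simp only: kv ku) simp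
    finally show "cmp A p p a (\<kappa> \<bullet> \<xi>) (cmp A p p0 p (v \<bullet> one) (u \<bullet> one)) = cmp A p p a (\<kappa> \<bullet> \<xi>) (ide A p)" .
  qed simp_all
  let ?F = "fob F" and ?u = "fhom F p p0 \<bullet> u \<bullet> one" and ?v = "fhom F p0 p \<bullet> v \<bullet> one"
  have Fku: "cmp B (?F p) (?F p0) (?F a) (fhom F p0 a \<bullet> \<kappa>0 \<bullet> \<xi>) ?u = fhom F p a \<bullet> \<kappa> \<bullet> \<xi>" if "\<xi> \<in> El x" for \<xi>
    using fhom_cmp[OF F, of p p0 a "u \<bullet> one" "\<kappa>0 \<bullet> \<xi>"] that by (simp del: fhom_cmp add: ku)
  have Fkv: "cmp B (?F p0) (?F p) (?F a) (fhom F p a \<bullet> \<kappa> \<bullet> \<xi>) ?v = fhom F p0 a \<bullet> \<kappa>0 \<bullet> \<xi>" if "\<xi> \<in> El x" for \<xi>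
    using fhom_cmp[OF F, of p0 p a "v \<bullet> one" "\<kappa> \<bullet> \<xi>"] that by (simp del: fhom_cmp add: kv)
  have Fvu: "cmp B (?F p) (?F p0) (?F p) ?v ?u = ide B (?F p)"
    using fhom_cmp[OF F, of p p0 p "u \<bullet> one" "v \<bullet> one"] by (simp del: fhom_cmp add: vu)
  have "is_iso (power_map B x (?F a) (?F p) (fhom F p a \<cdot> \<kappa>) b)" if b: "b \<in> obs B" for b
  proof -
    let ?\<Phi> = "power_map B x (?F a) (?F p) (fhom F p a \<cdot> \<kappa>) b"
    let ?Q = "power_map B x (?F a) (?F p0) (fhom F p0 a \<cdot> \<kappa>0) b"
    have i: "is_iso ?Q" using Fp0 b by (simp add: is_power_iff)
    let ?inv = "post B b (?F p0) (?F p) (fhom F p0 p \<cdot> v) \<cdot> vinv ?Q"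
    note [simp] = b i
    show ?thesis
    proof (rule is_iso_actI[of "vhom B b (?F p)" ?inv _ "ih x (vhom B b (?F a))"])
      fix f assume f [simp]: "f \<in> El (vhom B b (?F p))"
      have "?\<Phi> \<bullet> f = ?Q \<bullet> cmp B b (?F p) (?F p0) ?u f"
      proof (rule ih_ext[of _ x "vhom B b (?F a)"])
        fix \<xi> assume \<xi>: "\<xi> \<in> El x"
        have "cmp B b (?F p) (?F a) (cmp B (?F p) (?F p0) (?F a) (fhom F p0 a \<bullet> \<kappa>0 \<bullet> \<xi>) ?u) f =
          cmp B b (?F p0) (?F a) (fhom F p0 a \<bullet> \<kappa>0 \<bullet> \<xi>) (cmp B b (?F p) (?F p0) ?u f)"
          using \<xi> by (subst cmp_cmp[OF B]) simp_all
        then show "app x (vhom B b (?F a)) (?\<Phi> \<bullet> f) \<xi> = app x (vhom B b (?F a)) (?Q \<bullet> cmp B b (?F p) (?F p0) ?u f) \<xi>"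
          using \<xi> by (simp add: Fku)
      qed simp_all
      then have "?inv \<bullet> ?\<Phi> \<bullet> f = cmp B b (?F p0) (?F p) ?v (cmp B b (?F p) (?F p0) ?u f)"
        by (simp add: post_def)
      also have "\<dots> = cmp B b (?F p) (?F p) (cmp B (?F p) (?F p0) (?F p) ?v ?u) f"
        by (subst cmp_cmp[OF B]) simp_all
      finally show "?inv \<bullet> ?\<Phi> \<bullet> f = f" by (simp add: Fvu)
    next
      fix g assume g [simp]: "g \<in> El (ih x (vhom B b (?F a)))"
      show "?\<Phi> \<bullet> ?inv \<bullet> g = g"
      proof (rule ih_ext[of _ x "vhom B b (?F a)"])
        fix \<xi> assume \<xi>: "\<xi> \<in> El x"
        have "app x (vhom B b (?F a)) (?\<Phi> \<bullet> ?inv \<bullet> g) \<xi> =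
          cmp B b (?F p) (?F a) (fhom F p a \<bullet> \<kappa> \<bullet> \<xi>) (cmp B b (?F p0) (?F p) ?v (vinv ?Q \<bullet> g))"
          using \<xi> by (simp add: post_def)
        also have "\<dots> = cmp B b (?F p0) (?F a) (cmp B (?F p0) (?F p) (?F a) (fhom F p a \<bullet> \<kappa> \<bullet> \<xi>) ?v) (vinv ?Q \<bullet> g)"
          using \<xi> by (subst cmp_cmp[OF B]) simp_all
        also have "\<dots> = app x (vhom B b (?F a)) (?Q \<bullet> vinv ?Q \<bullet> g) \<xi>"
          using \<xi> by (subst app_power_map[OF B]) (simp_all add: Fkv)
        also have "\<dots> = app x (vhom B b (?F a)) g \<xi>" by simp
        finally show "app x (vhom B b (?F a)) (?\<Phi> \<bullet> ?inv \<bullet> g) \<xi> = app x (vhom B b (?F a)) g \<xi>" .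
      qed (simp_all add: post_def)
    qed (simp_all add: post_def)
  qed
  then show ?thesis by (simp add: is_power_iff)
qed

lemma preserves_powersI:
  assumes "is_vcat A" "is_vcat B" "is_vfun A B F"
    and "\<And>x a. x \<in> S \<Longrightarrow> a \<in> obs A \<Longrightarrow> is_power A x a (p0 x a) (\<kappa>0 x a)"
    and "\<And>x a. x \<in> S \<Longrightarrow> a \<in> obs A \<Longrightarrow>
      is_power B x (fob F a) (fob F (p0 x a)) (fhom F (p0 x a) a \<cdot> \<kappa>0 x a)"
  shows "preserves_powers S A B F"
  unfolding preserves_powers_def
proof (intro ballI allI impI)
  fix x a p \<kappa> assume x: "x \<in> S" and p: "is_power A x a p \<kappa>"
  then have a: "a \<in> obs A" by (simp add: is_power_iff)
  show "is_power B x (fob F a) (fob F p) (fhom F p a \<cdot> \<kappa>)"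
    by (rule is_power_transfer[OF assms(1-3) assms(4)[OF x a] p assms(5)[OF x a]])
qed

lemma preserves_powersD:
  "preserves_powers S A B F \<Longrightarrow> x \<in> S \<Longrightarrow> is_power A x a p \<kappa> \<Longrightarrow>
   is_power B x (fob F a) (fob F p) (fhom F p a \<cdot> \<kappa>)"
  by (simp add: preserves_powers_def)

section \<open>Functions on a tensor product\<close>

lemma act_ih_pair_eqI:
  assumes "\<And>z x y. z \<in> El d \<Longrightarrow> x \<in> El a \<Longrightarrow> y \<in> El b \<Longrightarrow>
      app (a \<otimes> b) c (f \<bullet> z) (x \<odot> y) = app (a \<otimes> b) c (g \<bullet> z) (x \<odot> y)"
    and "f \<in> hom d (ih (a \<otimes> b) c)" "g \<in> hom d (ih (a \<otimes> b) c)"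
  shows "f = g"
proof -
  have eq: "ev (a \<otimes> b) c \<cdot> (g \<boxtimes> idt (a \<otimes> b)) = ev (a \<otimes> b) c \<cdot> (f \<boxtimes> idt (a \<otimes> b))"
    by (rule eq_fresh_iso[OF _ fresh_iso_pair[OF fresh_iso_var[of 2 "{2}" d]
          fresh_iso_pair[OF fresh_iso_var[of 0 "{0}" a] fresh_iso_var[of 1 "{1}" b]]]])
      (use assms in auto)
  have c: "\<exists>!h. h \<in> hom d (ih (a \<otimes> b) c) \<and>
      ev (a \<otimes> b) c \<cdot> (h \<boxtimes> idt (a \<otimes> b)) = ev (a \<otimes> b) c \<cdot> (f \<boxtimes> idt (a \<otimes> b))"
    by (rule closed) (use assms(2) in simp)
  show ?thesis
    by (rule trans[OF the1_equality[OF c, symmetric] the1_equality[OF c]]) (use assms(2,3) eq in auto)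
qed

text \<open>\<open>ih_ext\<close> would require agreement on all elements of
  \<open>a \<otimes> b\<close>. Currying turns agreement on pairings into two applications of
  \<open>ih_ext\<close>; currying is injective since \<open>unc\<close> is a left inverse, which is
  an equation of arrows and so can be tested on variables.\<close>

lemma ih_ext_pair:
  assumes h: "h \<in> El (ih (a \<otimes> b) c)" and h': "h' \<in> El (ih (a \<otimes> b) c)"
    and eq: "\<And>x y. x \<in> El a \<Longrightarrow> y \<in> El b \<Longrightarrow> app (a \<otimes> b) c h (x \<odot> y) = app (a \<otimes> b) c h' (x \<odot> y)"
  shows "h = h'"
proof -
  let ?i = "ih (a \<otimes> b) c"
  define cur where "cur = transp ?i a (ih b c) (transp (?i \<otimes> a) b c (ev (a \<otimes> b) c \<cdot> asc ?i a b))"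
  define unc where "unc = transp (ih a (ih b c)) (a \<otimes> b) c
    (ev b c \<cdot> (ev a (ih b c) \<boxtimes> idt b) \<cdot> vinv (asc (ih a (ih b c)) a b))"
  have ty [simp]: "vdom V cur = ?i" "vcod V cur = ih a (ih b c)" "vdom V unc = ih a (ih b c)" "vcod V unc = ?i"
    by (simp_all add: cur_def unc_def)
  have cur: "app b c (app a (ih b c) (cur \<bullet> k) x) y = app (a \<otimes> b) c k (x \<odot> y)"
    if "k \<in> El ?i" "x \<in> El a" "y \<in> El b" for k x y
    using that by (simp add: cur_def)
  have unc: "app (a \<otimes> b) c (unc \<bullet> k) (x \<odot> y) = app b c (app a (ih b c) k x) y"
    if "k \<in> El (ih a (ih b c))" "x \<in> El a" "y \<in> El b" for k x y
    using that by (simp add: unc_def)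
  have "unc \<cdot> cur = idt ?i"
    by (rule act_ih_pair_eqI[of ?i a b c]) (simp_all add: cur unc)
  then have u: "unc \<bullet> cur \<bullet> k = k" if "k \<in> El ?i" for k
    using that by (simp flip: act_comp)
  have "cur \<bullet> h = cur \<bullet> h'"
  proof (rule ih_ext[of _ a "ih b c"])
    fix x assume x: "x \<in> El a"
    show "app a (ih b c) (cur \<bullet> h) x = app a (ih b c) (cur \<bullet> h') x"
      by (rule ih_ext[of _ b c]) (use h h' eq x in \<open>simp_all add: cur\<close>)
  qed (use h h' in simp_all)
  then have "unc \<bullet> cur \<bullet> h = unc \<bullet> cur \<bullet> h'" by simp
  then show ?thesis by (simp only: u[OF h] u[OF h'])
qed

section \<open>Ends\<close>

lemma hom_wedgeI:
  assumes T: "is_vcat T" and A: "is_vfun T vself A" and B: "is_vfun T vself B"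
    and p: "\<And>j. j \<in> obs T \<Longrightarrow> \<pi> j \<in> hom x (ih (fob A j) (fob B j))"
    and "\<And>j k z f t. j \<in> obs T \<Longrightarrow> k \<in> obs T \<Longrightarrow> z \<in> El x \<Longrightarrow> f \<in> El (vhom T j k) \<Longrightarrow> t \<in> El (fob A j) \<Longrightarrow>
      app (fob A k) (fob B k) (\<pi> k \<bullet> z) (app (fob A j) (fob A k) (fhom A j k \<bullet> f) t) =
      app (fob B j) (fob B k) (fhom B j k \<bullet> f) (app (fob A j) (fob B j) (\<pi> j \<bullet> z) t)"
  shows "hom_wedge T A B x \<pi>"
  unfolding hom_wedge_def
proof (intro conjI ballI)
  note [simp] = T vfun_simps[OF A] vfun_simps[OF B]
  have [simp]: "vdom V (\<pi> j) = x" "vcod V (\<pi> j) = ih (fob A j) (fob B j)" if "j \<in> obs T" for j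
    using p that by auto
  fix j k assume jk: "j \<in> obs T" "k \<in> obs T"
  show "vcmp vself (fob A j) (fob A k) (fob B k) \<cdot> (\<pi> k \<boxtimes> fhom A j k) =
       vcmp vself (fob A j) (fob B j) (fob B k) \<cdot> (fhom B j k \<boxtimes> \<pi> j) \<cdot> sy x (vhom T j k)"
  proof (rule act_eqI_pair[of x "vhom T j k"])
    fix z f assume zf: "z \<in> El x" "f \<in> El (vhom T j k)"
    show "(vcmp vself (fob A j) (fob A k) (fob B k) \<cdot> (\<pi> k \<boxtimes> fhom A j k)) \<bullet> (z \<odot> f) =
       (vcmp vself (fob A j) (fob B j) (fob B k) \<cdot> (fhom B j k \<boxtimes> \<pi> j) \<cdot> sy x (vhom T j k)) \<bullet> (z \<odot> f)"
      by (rule ih_ext[of _ "fob A j" "fob B k"]) (use jk zf assms(5) in simp_all)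
  qed (use jk in simp_all)
qed (use p in auto)

lemma hom_wedgeD:
  assumes w: "hom_wedge T A B x \<pi>"
    and T: "is_vcat T" and A: "is_vfun T vself A" and B: "is_vfun T vself B"
    and jk: "j \<in> obs T" "k \<in> obs T" and e: "z \<in> El x" "f \<in> El (vhom T j k)" "t \<in> El (fob A j)"
  shows "app (fob A k) (fob B k) (\<pi> k \<bullet> z) (app (fob A j) (fob A k) (fhom A j k \<bullet> f) t) =
      app (fob B j) (fob B k) (fhom B j k \<bullet> f) (app (fob A j) (fob B j) (\<pi> j \<bullet> z) t)"
proof -
  note [simp] = T vfun_simps[OF A] vfun_simps[OF B]
  have [simp]: "vdom V (\<pi> j) = x" "vcod V (\<pi> j) = ih (fob A j) (fob B j)" if "j \<in> obs T" for j
    using w that by (auto simp: hom_wedge_def)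
  have "(vcmp vself (fob A j) (fob A k) (fob B k) \<cdot> (\<pi> k \<boxtimes> fhom A j k)) \<bullet> (z \<odot> f) =
       (vcmp vself (fob A j) (fob B j) (fob B k) \<cdot> (fhom B j k \<boxtimes> \<pi> j) \<cdot> sy x (vhom T j k)) \<bullet> (z \<odot> f)"
    using w jk by (simp only: hom_wedge_def)
  then have "app (fob A j) (fob B k) (cmp vself (fob A j) (fob A k) (fob B k) (\<pi> k \<bullet> z) (fhom A j k \<bullet> f)) t =
    app (fob A j) (fob B k) (cmp vself (fob A j) (fob B j) (fob B k) (fhom B j k \<bullet> f) (\<pi> j \<bullet> z)) t"
    using jk e by simp
  then show ?thesis using jk e by simp
qed

lemma full_sub_simps [simp]:
  "obs (full_sub A S) = S"
  "a \<in> S \<Longrightarrow> b \<in> S \<Longrightarrow> vhom (full_sub A S) a b = vhom A a b"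
  "a \<in> S \<Longrightarrow> vid (full_sub A S) a = vid A a"
  "a \<in> S \<Longrightarrow> b \<in> S \<Longrightarrow> c \<in> S \<Longrightarrow> vcmp (full_sub A S) a b c = vcmp A a b c"
  by (simp_all add: full_sub_def)

lemma is_vcat_full_sub:
  assumes A: "is_vcat A" and S: "S \<subseteq> obs A"
  shows "is_vcat (full_sub A S)"
proof (rule is_vcatI)
  have [simp]: "a \<in> obs A" if "a \<in> S" for a using S that by auto
  note [simp] = A
  show "vhom (full_sub A S) \<in> obs (full_sub A S) \<rightarrow>\<^sub>E obs (full_sub A S) \<rightarrow>\<^sub>E UNIV"
    by (auto simp: full_sub_def)
  show "vid (full_sub A S) \<in> (\<Pi>\<^sub>E a\<in>obs (full_sub A S). hom \<I> (vhom (full_sub A S) a a))"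
    by (auto simp: full_sub_def)
  show "vcmp (full_sub A S) \<in> (\<Pi>\<^sub>E a\<in>obs (full_sub A S). \<Pi>\<^sub>E b\<in>obs (full_sub A S). \<Pi>\<^sub>E c\<in>obs (full_sub A S).
       hom (vhom (full_sub A S) b c \<otimes> vhom (full_sub A S) a b) (vhom (full_sub A S) a c))"
    by (auto simp: full_sub_def)
qed (use A S in \<open>simp_all add: subset_iff\<close>)

end

locale amenable_arity_system = arity_system V \<J>
  for V :: "('o, 'm) smc_data" and \<J> :: "'o set" +
  assumes amenable: amenable
begin

section \<open>Theories\<close>

lemma arity_cat_simps [simp]:
  "obs arity_cat = \<J>"
  "a \<in> \<J> \<Longrightarrow> b \<in> \<J> \<Longrightarrow> vhom arity_cat a b = ih a b"
  "a \<in> \<J> \<Longrightarrow> vid arity_cat a = vid vself a"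
  "a \<in> \<J> \<Longrightarrow> b \<in> \<J> \<Longrightarrow> c \<in> \<J> \<Longrightarrow> vcmp arity_cat a b c = vcmp vself a b c"
  by (simp_all add: arity_cat_def)

lemma is_vcat_arity_cat [simp]: "is_vcat arity_cat"
  by (simp add: arity_cat_def is_vcat_full_sub)

text \<open>The unit of the adjunction between \<open>- \<otimes> a\<close> and
  \<open>[a,-]\<close>; it serves as the counit of the canonical power of \<open>a\<close> by
  \<open>x\<close> in the opposite of \<open>\<J>\<close>.\<close>

definition coev :: "'o \<Rightarrow> 'o \<Rightarrow> 'm" where
  "coev x a = transp x a (x \<otimes> a) (idt (x \<otimes> a))"

lemma vdom_coev [simp]: "vdom V (coev x a) = x"
  and vcod_coev [simp]: "vcod V (coev x a) = ih a (x \<otimes> a)"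
  and app_coev [simp]: "\<xi> \<in> El x \<Longrightarrow> t \<in> El a \<Longrightarrow> app a (x \<otimes> a) (coev x a \<bullet> \<xi>) t = \<xi> \<odot> t"
  by (simp_all add: coev_def)

text \<open>The comparison map is currying, from \<open>[x \<otimes> a, b]\<close> to
  \<open>[x, [a, b]]\<close>. Arities are closed under tensor products, so the power exists inside
  \<open>\<J>\<close>.\<close>

lemma is_power_arity_cat:
  assumes x: "x \<in> \<J>" and a: "a \<in> \<J>"
  shows "is_power (vop arity_cat) x a (x \<otimes> a) (coev x a)"
proof -
  note [simp] = x a tensor_arity
  have "is_iso (power_map (vop arity_cat) x a (x \<otimes> a) (coev x a) b)" if b: "b \<in> \<J>" for b
  proof -
    let ?\<Phi> = "power_map (vop arity_cat) x a (x \<otimes> a) (coev x a) b"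
    let ?inv = "transp (ih x (ih a b)) (x \<otimes> a) b
      (ev a b \<cdot> (ev x (ih a b) \<boxtimes> idt a) \<cdot> vinv (asc (ih x (ih a b)) x a))"
    note [simp] = b
    have P: "vdom V ?\<Phi> = ih (x \<otimes> a) b" "vcod V ?\<Phi> = ih x (ih a b)"
      by simp_all
    have P': "app a b (app x (ih a b) (?\<Phi> \<bullet> f) \<xi>) t = app (x \<otimes> a) b f (\<xi> \<odot> t)"
      if "f \<in> El (ih (x \<otimes> a) b)" "\<xi> \<in> El x" "t \<in> El a" for f \<xi> t
    proof -
      have "app x (ih a b) (?\<Phi> \<bullet> f) \<xi> = cmp arity_cat a (x \<otimes> a) b f (coev x a \<bullet> \<xi>)"
        using that app_power_map[of "vop arity_cat" a "x \<otimes> a" b "coev x a" x f \<xi>] by simp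
      then show ?thesis using that by simp
    qed
    show ?thesis
    proof (rule is_iso_actI[of "ih (x \<otimes> a) b" ?inv _ "ih x (ih a b)"])
      fix f assume f: "f \<in> El (ih (x \<otimes> a) b)"
      show "?inv \<bullet> ?\<Phi> \<bullet> f = f"
        by (rule ih_ext_pair[of _ x a b]) (use f in \<open>simp_all add: P'\<close>)
    next
      fix g assume g: "g \<in> El (ih x (ih a b))"
      show "?\<Phi> \<bullet> ?inv \<bullet> g = g"
      proof (rule ih_ext[of _ x "ih a b"])
        fix \<xi> assume \<xi>: "\<xi> \<in> El x"
        show "app x (ih a b) (?\<Phi> \<bullet> ?inv \<bullet> g) \<xi> = app x (ih a b) g \<xi>"
          by (rule ih_ext[of _ a b]) (use g \<xi> in \<open>simp_all add: P'\<close>)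
      qed (use g in simp_all)
    qed simp_all
  qed
  then show ?thesis by (simp add: is_power_iff)
qed

lemma theory_vcat [simp]: "is_theory T \<Longrightarrow> is_vcat (tcat T)"
  and theory_obs [simp]: "is_theory T \<Longrightarrow> obs (tcat T) = \<J>"
  and theory_powers: "is_theory T \<Longrightarrow> preserves_powers \<J> (vop arity_cat) (tcat T) (tstr T)"
  and theory_str: "is_theory T \<Longrightarrow> is_vfun (vop arity_cat) (tcat T) (tstr T)"
  and fob_tstr [simp]: "is_theory T \<Longrightarrow> j \<in> \<J> \<Longrightarrow> fob (tstr T) j = j"
  by (simp_all add: is_theory_def)

text \<open>The structure functor is the identity on objects and preserves the powers
  \<open>x \<otimes> a\<close>. So each theory has powers of all its objects by all arities, and
  preservation of powers can be checked on these.\<close>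

lemma is_power_theory:
  assumes T: "is_theory T" and x: "x \<in> \<J>" and a: "a \<in> \<J>"
  shows "is_power (tcat T) x a (x \<otimes> a) (fhom (tstr T) (x \<otimes> a) a \<cdot> coev x a)"
proof -
  from preserves_powersD[OF theory_powers[OF T] x is_power_arity_cat[OF x a]]
  have "is_power (tcat T) x (fob (tstr T) a) (fob (tstr T) (x \<otimes> a)) (fhom (tstr T) (x \<otimes> a) a \<cdot> coev x a)"
    .
  then show ?thesis using T x a by (simp add: tensor_arity)
qed

lemma preserves_powers_theoryI:
  assumes T: "is_theory T" and B: "is_vcat B" and F: "is_vfun (tcat T) B F"
    and "\<And>x a. x \<in> \<J> \<Longrightarrow> a \<in> \<J> \<Longrightarrow>
      is_power B x (fob F a) (fob F (x \<otimes> a)) (fhom F (x \<otimes> a) a \<cdot> fhom (tstr T) (x \<otimes> a) a \<cdot> coev x a)"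
  shows "preserves_powers \<J> (tcat T) B F"
  by (rule preserves_powersI[OF _ B F, where ?p0.0 = "\<lambda>x a. x \<otimes> a"
        and ?\<kappa>0.0 = "\<lambda>x a. fhom (tstr T) (x \<otimes> a) a \<cdot> coev x a"])
    (use assms is_power_theory in auto)

lemma theory_morD:
  assumes "theory_mor T U M"
  shows "is_vfun (tcat T) (tcat U) M" "fcomp (vop arity_cat) M (tstr T) = tstr U"
  using assms by (simp_all add: theory_mor_def)

lemma fob_theory_mor:
  assumes "is_theory T" "is_theory U" "theory_mor T U M" "j \<in> \<J>"
  shows "fob M j = j"
proof -
  have "fob (fcomp (vop arity_cat) M (tstr T)) j = fob (tstr U) j"
    using assms(3) by (simp add: theory_mor_def)
  then show ?thesis using assms by simp
qed

text \<open>\<open>M\<close> commutes with the structure functors and fixes objects, so it carries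
  the canonical power of \<open>T\<close>, with its counit, to that of \<open>U\<close>.\<close>

lemma theory_mor_preserves_powers:
  assumes T: "is_theory T" and U: "is_theory U" and M: "theory_mor T U M"
  shows "preserves_powers \<J> (tcat T) (tcat U) M"
proof (rule preserves_powers_theoryI[OF T theory_vcat[OF U] theory_morD(1)[OF M]])
  fix x a assume *: "x \<in> \<J>" "a \<in> \<J>"
  note [simp] = T U * fob_theory_mor[OF T U M] vfun_simps[OF theory_str[OF T]]
    vfun_simps[OF theory_morD(1)[OF M]] tensor_arity
  have "fhom (fcomp (vop arity_cat) M (tstr T)) (x \<otimes> a) a = fhom (tstr U) (x \<otimes> a) a"
    using M by (simp add: theory_mor_def)
  then have e: "fhom M (x \<otimes> a) a \<cdot> fhom (tstr T) (x \<otimes> a) a = fhom (tstr U) (x \<otimes> a) a" by simp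
  have "fhom M (x \<otimes> a) a \<cdot> fhom (tstr T) (x \<otimes> a) a \<cdot> coev x a = fhom (tstr U) (x \<otimes> a) a \<cdot> coev x a"
    using arg_cong[OF e, of "\<lambda>k. k \<cdot> coev x a"] by simp
  then show "is_power (tcat U) x (fob M a) (fob M (x \<otimes> a))
      (fhom M (x \<otimes> a) a \<cdot> fhom (tstr T) (x \<otimes> a) a \<cdot> coev x a)"
    using is_power_theory[OF U *] by simp
qed

lemma theory_mor_fid: "is_theory T \<Longrightarrow> theory_mor T T (fid (tcat T))"
  using fcomp_fid_left[OF theory_str[of T]] by (simp add: theory_mor_def is_vfun_fid)

lemma theory_mor_fcomp:
  assumes T: "is_theory T" "is_theory U" "is_theory W" and M: "theory_mor T U M" and N: "theory_mor U W N"
  shows "theory_mor T W (fcomp (tcat T) N M)"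
  using fcomp_assoc[OF theory_str[OF T(1)] theory_morD(1)[OF M] theory_morD(1)[OF N]]
    is_vfun_fcomp[OF theory_morD(1)[OF M] theory_morD(1)[OF N]] M N T
  by (simp add: theory_mor_def)

lemma algebra_vfun: "is_algebra T A \<Longrightarrow> is_vfun (tcat T) vself A"
  and algebra_powers: "is_algebra T A \<Longrightarrow> preserves_powers \<J> (tcat T) vself A"
  by (simp_all add: is_algebra_def)

lemma is_algebra_fcomp:
  assumes T: "is_theory T" "is_theory U" and M: "theory_mor T U M" and A: "is_algebra U A"
  shows "is_algebra T (fcomp (tcat T) A M)"
proof -
  note f = is_vfun_fcomp[OF theory_morD(1)[OF M] algebra_vfun[OF A]]
  show ?thesis
    unfolding is_algebra_def
  proof
    show "is_vfun (tcat T) vself (fcomp (tcat T) A M)" using f T by simp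
    show "preserves_powers \<J> (tcat T) vself (fcomp (tcat T) A M)"
      unfolding preserves_powers_def
    proof (intro ballI allI impI)
      fix x a p \<kappa> assume x: "x \<in> \<J>" and p: "is_power (tcat T) x a p \<kappa>"
      then have o: "a \<in> obs (tcat T)" "p \<in> obs (tcat T)" "\<kappa> \<in> hom x (vhom (tcat T) p a)" by (auto simp: is_power_iff)
      have "is_power (tcat U) x (fob M a) (fob M p) (fhom M p a \<cdot> \<kappa>)"
        by (rule preserves_powersD[OF theory_mor_preserves_powers[OF T M] x p])
      then have "is_power vself x (fob A (fob M a)) (fob A (fob M p))
          (fhom A (fob M p) (fob M a) \<cdot> fhom M p a \<cdot> \<kappa>)"
        by (rule preserves_powersD[OF algebra_powers[OF A] x])
      then show "is_power vself x (fob (fcomp (tcat T) A M) a) (fob (fcomp (tcat T) A M) p)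
          (fhom (fcomp (tcat T) A M) p a \<cdot> \<kappa>)"
        using o vfun_simps[OF theory_morD(1)[OF M]] vfun_simps[OF algebra_vfun[OF A]] by simp
    qed
  qed
qed

section \<open>Categories of algebras\<close>

lemma obs_Alg [simp]: "obs (Alg T) = {A. is_algebra T A}"
  by (simp add: Alg_def)

text \<open>Amenability provides some end, so the choice made by \<open>hom_end\<close> is
  one.\<close>

lemma hom_end_Alg:
  assumes "is_theory T" "is_algebra T A" "is_algebra T B"
  shows "is_hom_end (tcat T) A B (vhom (Alg T) A B) (proj (tcat T) A B)"
proof -
  have "\<exists>e \<pi>. is_hom_end (tcat T) A B e \<pi>"
    using amenable assms by (simp add: amenable_def)
  then have "\<exists>p. is_hom_end (tcat T) A B (fst p) (snd p)" by simp
  then have "is_hom_end (tcat T) A B (fst (hom_end (tcat T) A B)) (snd (hom_end (tcat T) A B))"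
    unfolding hom_end_def by (rule someI_ex)
  then show ?thesis using assms by (simp add: Alg_def nat_ob_def proj_def)
qed

lemma is_hom_endD:
  "is_hom_end T A B e \<pi> \<Longrightarrow> hom_wedge T A B x \<rho> \<Longrightarrow>
   \<exists>!h. h \<in> hom x e \<and> (\<forall>j\<in>obs T. \<pi> j \<cdot> h = \<rho> j)"
  unfolding is_hom_end_def by (elim conjE allE impE)

lemma hom_wedge_proj:
  assumes "is_theory T" "is_algebra T A" "is_algebra T B"
  shows "hom_wedge (tcat T) A B (vhom (Alg T) A B) (proj (tcat T) A B)"
  using hom_end_Alg[OF assms] by (simp add: is_hom_end_def)

lemma
  assumes "is_theory T" "is_algebra T A" "is_algebra T B" "j \<in> \<J>"
  shows vdom_proj [simp]: "vdom V (proj (tcat T) A B j) = vhom (Alg T) A B"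
    and vcod_proj [simp]: "vcod V (proj (tcat T) A B j) = ih (fob A j) (fob B j)"
  using hom_wedge_proj[OF assms(1-3)] assms(1,4) by (auto simp: hom_wedge_def)

abbreviation comp_at :: "('o, 'm) theory_data \<Rightarrow> ('o, 'm) alg \<Rightarrow> ('o, 'm) alg \<Rightarrow> 'o \<Rightarrow>
    ('o, 'm) elem \<Rightarrow> ('o, 'm) elem \<Rightarrow> ('o, 'm) elem" where
  "comp_at T A B j \<alpha> t \<equiv> app (fob A j) (fob B j) (proj (tcat T) A B j \<bullet> \<alpha>) t"

lemma comp_at_nat:
  assumes "is_theory T" "is_algebra T A" "is_algebra T B" "j \<in> \<J>" "k \<in> \<J>"
    and "\<alpha> \<in> El (vhom (Alg T) A B)" "f \<in> El (vhom (tcat T) j k)" "t \<in> El (fob A j)"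
  shows "comp_at T A B k \<alpha> (app (fob A j) (fob A k) (fhom A j k \<bullet> f) t) =
      app (fob B j) (fob B k) (fhom B j k \<bullet> f) (comp_at T A B j \<alpha> t)"
  by (rule hom_wedgeD[OF hom_wedge_proj]) (use assms algebra_vfun in auto)

text \<open>The projections of an end are jointly monic, and by \<open>ih_ext\<close> each of them
  is determined by application. So hom-objects between algebras may be treated as sets of natural
  families of functions.\<close>

lemma Alg_ext:
  assumes T: "is_theory T" and A: "is_algebra T A" and B: "is_algebra T B"
    and \<alpha>: "\<alpha> \<in> El (vhom (Alg T) A B)" and \<beta>: "\<beta> \<in> El (vhom (Alg T) A B)"
    and eq: "\<And>j t. j \<in> \<J> \<Longrightarrow> t \<in> El (fob A j) \<Longrightarrow> comp_at T A B j \<alpha> t = comp_at T A B j \<beta> t"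
  shows "\<alpha> = \<beta>"
proof -
  have p: "proj (tcat T) A B j \<bullet> \<alpha> = proj (tcat T) A B j \<bullet> \<beta>" if "j \<in> \<J>" for j
    by (rule ih_ext[of _ "fob A j" "fob B j"]) (use assms that in simp_all)
  show ?thesis
  proof (cases rule: El_cases[OF \<alpha>])
    case 1
    \<comment> \<open>One projection has to be available to compare contexts and definedness; the
      one at \<open>\<I>\<close> always is.\<close>
    with p[OF unit_arity] show ?thesis by (cases rule: El_cases[OF \<beta>]) (auto simp: act_Some)
  next
    case (2 S f)
    note f = this
    show ?thesis
    proof (cases rule: El_cases[OF \<beta>])
      case 1
      with f p[OF unit_arity] show ?thesis by (auto simp: act_Some)
    next
      case (2 S' g)
      have [simp]: "S' = S" using p[OF unit_arity] f 2 by (simp add: act_Some)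
      have fg: "proj (tcat T) A B j \<cdot> g = proj (tcat T) A B j \<cdot> f" if "j \<in> \<J>" for j
        using p[OF that] f 2 by (simp add: act_Some)
      \<comment> \<open>Both \<open>f\<close> and \<open>g\<close> mediate this wedge over the
        context \<open>tens S\<close>, so uniqueness identifies them.\<close>
      have "hom_wedge (tcat T) A B (tens S) (\<lambda>j. proj (tcat T) A B j \<cdot> f)"
      proof (rule hom_wedgeI)
        fix j k z h t assume "j \<in> obs (tcat T)" "k \<in> obs (tcat T)" "z \<in> El (tens S)"
          "h \<in> El (vhom (tcat T) j k)" "t \<in> El (fob A j)"
        then show "app (fob A k) (fob B k) ((proj (tcat T) A B k \<cdot> f) \<bullet> z) (app (fob A j) (fob A k) (fhom A j k \<bullet> h) t) =
          app (fob B j) (fob B k) (fhom B j k \<bullet> h) (app (fob A j) (fob B j) ((proj (tcat T) A B j \<cdot> f) \<bullet> z) t)"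
          using T A B f comp_at_nat[OF T A B, of j k "f \<bullet> z" h t] by simp
      qed (use T A B f in \<open>auto intro: algebra_vfun\<close>)
      from is_hom_endD[OF hom_end_Alg[OF T A B] this]
      have u: "\<exists>!h. h \<in> hom (tens S) (vhom (Alg T) A B) \<and>
          (\<forall>j\<in>obs (tcat T). proj (tcat T) A B j \<cdot> h = proj (tcat T) A B j \<cdot> f)"
        .
      have "f = g"
        by (rule trans[OF the1_equality[OF u, symmetric] the1_equality[OF u]])
          (use f 2 fg T in simp_all)
      with f 2 show ?thesis by simp
    qed
  qed
qed

context
  fixes T A B x \<rho>
  assumes T: "is_theory T" and A: "is_algebra T A" and B: "is_algebra T B"
    and w: "hom_wedge (tcat T) A B x \<rho>"
begin

lemma lift_typing: "lift (tcat T) A B x \<rho> \<in> hom x (vhom (Alg T) A B) \<and>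
    (\<forall>j\<in>\<J>. proj (tcat T) A B j \<cdot> lift (tcat T) A B x \<rho> = \<rho> j)"
proof -
  have "\<exists>!h. h \<in> hom x (vhom (Alg T) A B) \<and> (\<forall>j\<in>obs (tcat T). proj (tcat T) A B j \<cdot> h = \<rho> j)"
    by (rule is_hom_endD[OF hom_end_Alg[OF T A B] w])
  from theI'[OF this] T A B show ?thesis by (simp add: lift_def Alg_def)
qed

lemma vdom_lift: "vdom V (lift (tcat T) A B x \<rho>) = x"
  and vcod_lift: "vcod V (lift (tcat T) A B x \<rho>) = vhom (Alg T) A B"
  using lift_typing by simp_all

lemma proj_lift:
  assumes "j \<in> \<J>" "z \<in> El x"
  shows "proj (tcat T) A B j \<bullet> lift (tcat T) A B x \<rho> \<bullet> z = \<rho> j \<bullet> z"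
proof -
  have "(proj (tcat T) A B j \<cdot> lift (tcat T) A B x \<rho>) \<bullet> z = \<rho> j \<bullet> z"
    using lift_typing assms by simp
  then show ?thesis using assms T A B by (simp add: vdom_lift vcod_lift)
qed

lemmas lift_simps = vdom_lift vcod_lift proj_lift

end

context
  fixes T assumes T: "is_theory T"
begin

lemma hom_wedge_vid:
  assumes A: "is_algebra T A"
  shows "hom_wedge (tcat T) A A \<I> (\<lambda>j. vid vself (fob A j))"
  unfolding hom_wedge_def
proof (intro conjI ballI)
  note [simp] = T vfun_simps[OF algebra_vfun[OF A]]
  fix j k assume jk: "j \<in> obs (tcat T)" "k \<in> obs (tcat T)"
  then show "vcmp vself (fob A j) (fob A k) (fob A k) \<cdot> (vid vself (fob A k) \<boxtimes> fhom A j k) =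
       vcmp vself (fob A j) (fob A j) (fob A k) \<cdot> (fhom A j k \<boxtimes> vid vself (fob A j)) \<cdot> sy \<I> (vhom (tcat T) j k)"
    by (intro act_eqI_one_pair[of "vhom (tcat T) j k"]) simp_all
qed auto

lemma hom_wedge_vcmp:
  assumes A: "is_algebra T A" and B: "is_algebra T B" and C: "is_algebra T C"
  shows "hom_wedge (tcat T) A C (vhom (Alg T) B C \<otimes> vhom (Alg T) A B)
    (\<lambda>j. vcmp vself (fob A j) (fob B j) (fob C j) \<cdot> (proj (tcat T) B C j \<boxtimes> proj (tcat T) A B j))"
  \<comment> \<open>The definition is unfolded because \<open>hom_wedgeI\<close> quantifies over all
    elements of the domain, which is a tensor product here; composition can be computed on
    pairings.\<close>
  unfolding hom_wedge_def
proof (intro conjI ballI)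
  note [simp] = T A B C vfun_simps[OF algebra_vfun[OF A]] vfun_simps[OF algebra_vfun[OF B]]
    vfun_simps[OF algebra_vfun[OF C]]
  fix j k assume jk: "j \<in> obs (tcat T)" "k \<in> obs (tcat T)"
  let ?\<pi> = "\<lambda>j. vcmp vself (fob A j) (fob B j) (fob C j) \<cdot> (proj (tcat T) B C j \<boxtimes> proj (tcat T) A B j)"
  show "vcmp vself (fob A j) (fob A k) (fob C k) \<cdot> (?\<pi> k \<boxtimes> fhom A j k) =
     vcmp vself (fob A j) (fob C j) (fob C k) \<cdot> (fhom C j k \<boxtimes> ?\<pi> j) \<cdot>
       sy (vhom (Alg T) B C \<otimes> vhom (Alg T) A B) (vhom (tcat T) j k)"
  proof (rule act_eqI_pair_left[of "vhom (Alg T) B C" "vhom (Alg T) A B" "vhom (tcat T) j k"])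
    fix \<beta> \<alpha> f assume e: "\<beta> \<in> El (vhom (Alg T) B C)" "\<alpha> \<in> El (vhom (Alg T) A B)" "f \<in> El (vhom (tcat T) j k)"
    show "(vcmp vself (fob A j) (fob A k) (fob C k) \<cdot> (?\<pi> k \<boxtimes> fhom A j k)) \<bullet> ((\<beta> \<odot> \<alpha>) \<odot> f) =
     (vcmp vself (fob A j) (fob C j) (fob C k) \<cdot> (fhom C j k \<boxtimes> ?\<pi> j) \<cdot>
       sy (vhom (Alg T) B C \<otimes> vhom (Alg T) A B) (vhom (tcat T) j k)) \<bullet> ((\<beta> \<odot> \<alpha>) \<odot> f)"
      by (rule ih_ext[of _ "fob A j" "fob C k"])
        (use e jk in \<open>simp_all add: comp_at_nat[OF T A B] comp_at_nat[OF T B C] del: tensor_comp_idt idt_tensor_comp\<close>)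
  qed (use jk in simp_all)
qed (use T A B C in auto)

lemma
  assumes A: "is_algebra T A"
  shows vdom_vid_Alg: "vdom V (vid (Alg T) A) = \<I>"
    and vcod_vid_Alg: "vcod V (vid (Alg T) A) = vhom (Alg T) A A"
    and comp_at_ide: "j \<in> \<J> \<Longrightarrow> t \<in> El (fob A j) \<Longrightarrow> comp_at T A A j (ide (Alg T) A) t = t"
  using lift_simps[OF T A A hom_wedge_vid[OF A]] A by (simp_all add: Alg_def)

lemma
  assumes A: "is_algebra T A" and B: "is_algebra T B" and C: "is_algebra T C"
  shows vdom_vcmp_Alg: "vdom V (vcmp (Alg T) A B C) = vhom (Alg T) B C \<otimes> vhom (Alg T) A B"
    and vcod_vcmp_Alg: "vcod V (vcmp (Alg T) A B C) = vhom (Alg T) A C"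
    and comp_at_cmp: "j \<in> \<J> \<Longrightarrow> \<beta> \<in> El (vhom (Alg T) B C) \<Longrightarrow> \<alpha> \<in> El (vhom (Alg T) A B) \<Longrightarrow> t \<in> El (fob A j) \<Longrightarrow>
      comp_at T A C j (cmp (Alg T) A B C \<beta> \<alpha>) t = comp_at T B C j \<beta> (comp_at T A B j \<alpha> t)"
proof -
  have v: "vcmp (Alg T) A B C = lift (tcat T) A C (vhom (Alg T) B C \<otimes> vhom (Alg T) A B)
    (\<lambda>j. vcmp vself (fob A j) (fob B j) (fob C j) \<cdot> (proj (tcat T) B C j \<boxtimes> proj (tcat T) A B j))"
    using A B C by (simp add: Alg_def)
  note l = lift_simps[OF T A C hom_wedge_vcmp[OF A B C], folded v]
  show "vdom V (vcmp (Alg T) A B C) = vhom (Alg T) B C \<otimes> vhom (Alg T) A B"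
    "vcod V (vcmp (Alg T) A B C) = vhom (Alg T) A C"
    by (simp_all add: l)
  show "comp_at T A C j (cmp (Alg T) A B C \<beta> \<alpha>) t = comp_at T B C j \<beta> (comp_at T A B j \<alpha> t)"
    if "j \<in> \<J>" "\<beta> \<in> El (vhom (Alg T) B C)" "\<alpha> \<in> El (vhom (Alg T) A B)" "t \<in> El (fob A j)"
    using that T A B C by (simp add: l(3))
qed

text \<open>By \<open>Alg_ext\<close> the laws are tested on components, where they are laws of
  nested application.\<close>

lemma is_vcat_Alg: "is_vcat (Alg T)"
proof (rule is_vcatI)
  note [simp] = T vdom_vid_Alg vcod_vid_Alg vdom_vcmp_Alg vcod_vcmp_Alg comp_at_ide comp_at_cmp
  show "vhom (Alg T) \<in> obs (Alg T) \<rightarrow>\<^sub>E obs (Alg T) \<rightarrow>\<^sub>E UNIV"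
    by (auto simp: Alg_def)
  have "vid (Alg T) A = undefined" if "A \<notin> obs (Alg T)" for A
    using that by (simp add: Alg_def)
  then show "vid (Alg T) \<in> (\<Pi>\<^sub>E A\<in>obs (Alg T). hom \<I> (vhom (Alg T) A A))"
    by (auto simp: PiE_iff extensional_def)
  have "vcmp (Alg T) A = undefined" if "A \<notin> obs (Alg T)" for A
    using that by (simp add: Alg_def)
  moreover have "vcmp (Alg T) A B = undefined" if "A \<in> obs (Alg T)" "B \<notin> obs (Alg T)" for A B
    using that by (simp add: Alg_def)
  moreover have "vcmp (Alg T) A B C = undefined" if "A \<in> obs (Alg T)" "B \<in> obs (Alg T)" "C \<notin> obs (Alg T)" for A B C
    using that by (simp add: Alg_def)
  ultimately show "vcmp (Alg T) \<in> (\<Pi>\<^sub>E A\<in>obs (Alg T). \<Pi>\<^sub>E B\<in>obs (Alg T). \<Pi>\<^sub>E C\<in>obs (Alg T).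
       hom (vhom (Alg T) B C \<otimes> vhom (Alg T) A B) (vhom (Alg T) A C))"
    by (auto simp: PiE_iff extensional_def)
  fix A B f assume "A \<in> obs (Alg T)" "B \<in> obs (Alg T)" "f \<in> El (vhom (Alg T) A B)"
  then show "cmp (Alg T) A B B (ide (Alg T) B) f = f" "cmp (Alg T) A A B f (ide (Alg T) A) = f"
    by - (rule Alg_ext[OF T, of A B]; simp)+
next
  note [simp] = T vdom_vid_Alg vcod_vid_Alg vdom_vcmp_Alg vcod_vcmp_Alg comp_at_ide comp_at_cmp
  fix A B C D f g h
  assume "A \<in> obs (Alg T)" "B \<in> obs (Alg T)" "C \<in> obs (Alg T)" "D \<in> obs (Alg T)"
    "f \<in> El (vhom (Alg T) A B)" "g \<in> El (vhom (Alg T) B C)" "h \<in> El (vhom (Alg T) C D)"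
  then show "cmp (Alg T) A B D (cmp (Alg T) B C D h g) f = cmp (Alg T) A C D h (cmp (Alg T) A B C g f)"
    by - (rule Alg_ext[OF T, of A D], simp_all)
qed

lemma eval_unit_simps:
  "is_algebra T A \<Longrightarrow> fob (eval_unit T) A = fob A \<I>"
  "is_algebra T A \<Longrightarrow> is_algebra T B \<Longrightarrow> fhom (eval_unit T) A B = proj (tcat T) A B \<I>"
  by (simp_all add: eval_unit_def)

lemma is_vfun_eval_unit: "is_vfun (Alg T) vself (eval_unit T)"
proof (rule is_vfunI)
  note [simp] = T eval_unit_simps unit_arity is_vcat_Alg comp_at_ide comp_at_cmp
  show "fob (eval_unit T) \<in> obs (Alg T) \<rightarrow>\<^sub>E obs vself"
    by (auto simp: eval_unit_def)
  show "fhom (eval_unit T) \<in> (\<Pi>\<^sub>E A\<in>obs (Alg T). \<Pi>\<^sub>E B\<in>obs (Alg T).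
      hom (vhom (Alg T) A B) (vhom vself (fob (eval_unit T) A) (fob (eval_unit T) B)))"
    by (auto simp: eval_unit_def)
  fix A assume A: "A \<in> obs (Alg T)"
  then show "fhom (eval_unit T) A A \<bullet> ide (Alg T) A = ide vself (fob (eval_unit T) A)"
    by - (rule ih_ext[of _ "fob A \<I>" "fob A \<I>"], simp_all)
next
  note [simp] = T eval_unit_simps unit_arity is_vcat_Alg comp_at_ide comp_at_cmp
  fix A B C f g
  assume "A \<in> obs (Alg T)" "B \<in> obs (Alg T)" "C \<in> obs (Alg T)"
    "f \<in> El (vhom (Alg T) A B)" "g \<in> El (vhom (Alg T) B C)"
  then show "fhom (eval_unit T) A C \<bullet> cmp (Alg T) A B C g f =
    cmp vself (fob (eval_unit T) A) (fob (eval_unit T) B) (fob (eval_unit T) C)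
      (fhom (eval_unit T) B C \<bullet> g) (fhom (eval_unit T) A B \<bullet> f)"
    by - (rule ih_ext[of _ "fob A \<I>" "fob C \<I>"], simp_all)
qed (simp_all add: is_vcat_Alg)

lemma is_over_Alg: "is_over (Alg_over T)"
  by (simp add: is_over_def Alg_over_def is_vcat_Alg is_vfun_eval_unit)

lemma algebraic_Alg: "algebraic (Alg_over T)"
  using is_over_Alg over_equivalent_refl[OF is_over_Alg] T by (auto simp: algebraic_def)

end

section \<open>Restriction along morphisms of theories\<close>

context
  fixes T U M
  assumes T: "is_theory T" and U: "is_theory U" and M: "theory_mor T U M"
begin

lemma fob_restr: "is_algebra U A \<Longrightarrow> fob (restr T U M) A = fcomp (tcat T) A M"
  by (simp add: restr_def)

lemma hom_wedge_restr:
  assumes A: "is_algebra U A" and B: "is_algebra U B"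
  shows "hom_wedge (tcat T) (fcomp (tcat T) A M) (fcomp (tcat T) B M) (vhom (Alg U) A B)
    (\<lambda>j. proj (tcat U) A B (fob M j))"
proof (rule hom_wedgeI)
  note [simp] = T U A B fob_theory_mor[OF T U M] vfun_simps[OF theory_morD(1)[OF M]]
    vfun_simps[OF algebra_vfun[OF A]] vfun_simps[OF algebra_vfun[OF B]]
  fix j k z f t
  assume *: "j \<in> obs (tcat T)" "k \<in> obs (tcat T)" "z \<in> El (vhom (Alg U) A B)"
    "f \<in> El (vhom (tcat T) j k)" "t \<in> El (fob (fcomp (tcat T) A M) j)"
  then have f: "fhom M j k \<bullet> f \<in> El (vhom (tcat U) j k)" by simp
  show "app (fob (fcomp (tcat T) A M) k) (fob (fcomp (tcat T) B M) k) (proj (tcat U) A B (fob M k) \<bullet> z)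
     (app (fob (fcomp (tcat T) A M) j) (fob (fcomp (tcat T) A M) k) (fhom (fcomp (tcat T) A M) j k \<bullet> f) t) =
    app (fob (fcomp (tcat T) B M) j) (fob (fcomp (tcat T) B M) k) (fhom (fcomp (tcat T) B M) j k \<bullet> f)
     (app (fob (fcomp (tcat T) A M) j) (fob (fcomp (tcat T) B M) j) (proj (tcat U) A B (fob M j) \<bullet> z) t)"
    using * comp_at_nat[OF U A B _ _ _ f] by simp
qed (use T U A B fob_theory_mor[OF T U M] is_algebra_fcomp[OF T U M]
    in \<open>auto intro: algebra_vfun\<close>)

lemma
  assumes A: "is_algebra U A" and B: "is_algebra U B"
  shows vdom_restr: "vdom V (fhom (restr T U M) A B) = vhom (Alg U) A B"
    and vcod_restr: "vcod V (fhom (restr T U M) A B) = vhom (Alg T) (fcomp (tcat T) A M) (fcomp (tcat T) B M)"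
    and proj_restr: "j \<in> \<J> \<Longrightarrow> \<alpha> \<in> El (vhom (Alg U) A B) \<Longrightarrow>
      proj (tcat T) (fcomp (tcat T) A M) (fcomp (tcat T) B M) j \<bullet> fhom (restr T U M) A B \<bullet> \<alpha> =
      proj (tcat U) A B j \<bullet> \<alpha>"
  using lift_simps[OF T is_algebra_fcomp[OF T U M A] is_algebra_fcomp[OF T U M B] hom_wedge_restr[OF A B]]
    A B fob_theory_mor[OF T U M] by (simp_all add: restr_def)

lemma is_vfun_restr: "is_vfun (Alg U) (Alg T) (restr T U M)"
proof (rule is_vfunI)
  note [simp] = T U is_vcat_Alg fob_restr vdom_restr vcod_restr proj_restr is_algebra_fcomp[OF T U M]
    fob_theory_mor[OF T U M] comp_at_ide comp_at_cmp
  show "fob (restr T U M) \<in> obs (Alg U) \<rightarrow>\<^sub>E obs (Alg T)"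
    by (auto simp: restr_def)
  have "fhom (restr T U M) A = undefined" if "\<not> is_algebra U A" for A
    using that by (simp add: restr_def)
  moreover have "fhom (restr T U M) A B = undefined" if "is_algebra U A" "\<not> is_algebra U B" for A B
    using that by (simp add: restr_def)
  ultimately show "fhom (restr T U M) \<in> (\<Pi>\<^sub>E A\<in>obs (Alg U). \<Pi>\<^sub>E B\<in>obs (Alg U).
      hom (vhom (Alg U) A B) (vhom (Alg T) (fob (restr T U M) A) (fob (restr T U M) B)))"
    by (auto simp: PiE_iff extensional_def)
  fix A assume A: "A \<in> obs (Alg U)"
  then show "fhom (restr T U M) A A \<bullet> ide (Alg U) A = ide (Alg T) (fob (restr T U M) A)"
    using comp_at_ide[OF T is_algebra_fcomp[OF T U M], of A]
    by - (rule Alg_ext[OF T, of "fcomp (tcat T) A M" "fcomp (tcat T) A M"], simp_all)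
next
  note [simp] = T U is_vcat_Alg fob_restr vdom_restr vcod_restr proj_restr is_algebra_fcomp[OF T U M]
    fob_theory_mor[OF T U M] comp_at_ide comp_at_cmp
  fix A B C f g
  assume "A \<in> obs (Alg U)" "B \<in> obs (Alg U)" "C \<in> obs (Alg U)"
    "f \<in> El (vhom (Alg U) A B)" "g \<in> El (vhom (Alg U) B C)"
  then show "fhom (restr T U M) A C \<bullet> cmp (Alg U) A B C g f =
    cmp (Alg T) (fob (restr T U M) A) (fob (restr T U M) B) (fob (restr T U M) C)
      (fhom (restr T U M) B C \<bullet> g) (fhom (restr T U M) A B \<bullet> f)"
    using comp_at_cmp[OF T is_algebra_fcomp[OF T U M] is_algebra_fcomp[OF T U M] is_algebra_fcomp[OF T U M], of A B C]
    by - (rule Alg_ext[OF T, of "fcomp (tcat T) A M" "fcomp (tcat T) C M"], simp_all)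
qed (simp_all add: is_vcat_Alg T U)

text \<open>Strict because a morphism of theories fixes \<open>\<I>\<close>. This is why the
  invertible parts of the two legs of \<open>Dualn_arr\<close> can be identities.\<close>

lemma eval_unit_restr: "fcomp (Alg U) (eval_unit T) (restr T U M) = eval_unit U"
proof (rule vfun_eqI[OF is_vfun_fcomp[OF is_vfun_restr is_vfun_eval_unit] is_vfun_eval_unit])
  note [simp] = T U fob_restr vdom_restr vcod_restr proj_restr is_algebra_fcomp[OF T U M]
    fob_theory_mor[OF T U M] eval_unit_simps unit_arity
  show "fob (fcomp (Alg U) (eval_unit T) (restr T U M)) A = fob (eval_unit U) A" if "A \<in> obs (Alg U)" for A
    using that by simp
  show "fhom (fcomp (Alg U) (eval_unit T) (restr T U M)) A B \<bullet> f = fhom (eval_unit U) A B \<bullet> f"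
    if "A \<in> obs (Alg U)" "B \<in> obs (Alg U)" "f \<in> El (vhom (Alg U) A B)" for A B f
    using that by simp
qed (simp_all add: T U is_vcat_Alg)

end

lemma restr_fid:
  assumes T: "is_theory T"
  shows "restr T T (fid (tcat T)) = fid (Alg T)"
proof (rule vfun_eqI[OF is_vfun_restr[OF T T theory_mor_fid[OF T]] is_vfun_fid[OF is_vcat_Alg[OF T]]])
  note m = theory_mor_fid[OF T]
  have fid: "fcomp (tcat T) A (fid (tcat T)) = A" if "is_algebra T A" for A
    by (rule fcomp_fid_right[OF algebra_vfun[OF that]]) (simp_all add: T)
  note [simp] = T fob_restr[OF T T m] vdom_restr[OF T T m] vcod_restr[OF T T m]
  show "fob (restr T T (fid (tcat T))) A = fob (fid (Alg T)) A" if "A \<in> obs (Alg T)" for A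
    using that fid by simp
  fix A B f assume *: "A \<in> obs (Alg T)" "B \<in> obs (Alg T)" "f \<in> El (vhom (Alg T) A B)"
  then show "fhom (restr T T (fid (tcat T))) A B \<bullet> f = fhom (fid (Alg T)) A B \<bullet> f"
    using proj_restr[OF T T m, of A B] fid
    by - (rule Alg_ext[OF T, of A B], simp_all)
qed

text \<open>On objects this is associativity of \<open>fcomp\<close>; on hom-objects both sides have
  the same projections, since restriction leaves components unchanged.\<close>

lemma restr_fcomp:
  assumes T: "is_theory T" and U: "is_theory U" and W: "is_theory W"
    and M: "theory_mor T U M" and N: "theory_mor U W N"
  shows "restr T W (fcomp (tcat T) N M) = fcomp (Alg W) (restr T U M) (restr U W N)"
proof (rule vfun_eqI[OF is_vfun_restr[OF T W theory_mor_fcomp[OF T U W M N]]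
      is_vfun_fcomp[OF is_vfun_restr[OF U W N] is_vfun_restr[OF T U M]]])
  note m = theory_mor_fcomp[OF T U W M N]
  have a: "fcomp (tcat T) (fcomp (tcat U) A N) M = fcomp (tcat T) A (fcomp (tcat T) N M)" if "is_algebra W A" for A
    by (rule fcomp_assoc[OF theory_morD(1)[OF M] theory_morD(1)[OF N] algebra_vfun[OF that]]) (simp_all add: T U W)
  note [simp] = T U W fob_restr[OF T U M] vdom_restr[OF T U M] vcod_restr[OF T U M]
    fob_restr[OF U W N] vdom_restr[OF U W N] vcod_restr[OF U W N]
    fob_restr[OF T W m] vdom_restr[OF T W m] vcod_restr[OF T W m]
    is_algebra_fcomp[OF U W N] is_algebra_fcomp[OF T W m]
  show "fob (restr T W (fcomp (tcat T) N M)) A = fob (fcomp (Alg W) (restr T U M) (restr U W N)) A"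
    if "A \<in> obs (Alg W)" for A
    using that a by simp
  fix A B f assume *: "A \<in> obs (Alg W)" "B \<in> obs (Alg W)" "f \<in> El (vhom (Alg W) A B)"
  let ?A = "fcomp (tcat T) A (fcomp (tcat T) N M)" and ?B = "fcomp (tcat T) B (fcomp (tcat T) N M)"
  let ?e = "fhom (restr T W (fcomp (tcat T) N M)) A B \<bullet> f"
  let ?e' = "fhom (restr T U M) (fcomp (tcat U) A N) (fcomp (tcat U) B N) \<bullet> fhom (restr U W N) A B \<bullet> f"
  have e': "fhom (fcomp (Alg W) (restr T U M) (restr U W N)) A B \<bullet> f = ?e'"
    using * by simp
  have "?e = ?e'"
  proof (rule Alg_ext[OF T, of ?A ?B])
    show "?e' \<in> El (vhom (Alg T) ?A ?B)"
      using * a[of A] a[of B] by (simp del: fcomp_simps)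
    fix j t assume j: "j \<in> \<J>"
    have "proj (tcat T) ?A ?B j \<bullet> ?e = proj (tcat W) A B j \<bullet> f"
      using * j by (simp add: proj_restr[OF T W m] del: fcomp_simps)
    moreover have "proj (tcat T) ?A ?B j \<bullet> ?e' = proj (tcat W) A B j \<bullet> f"
      using * j proj_restr[OF T U M is_algebra_fcomp[OF U W N, of A] is_algebra_fcomp[OF U W N, of B] j]
      by (simp add: a proj_restr[OF U W N] del: fcomp_simps)
    ultimately show "comp_at T ?A ?B j ?e t = comp_at T ?A ?B j ?e' t" by (simp only:)
  qed (use * in simp_all)
  then show "fhom (restr T W (fcomp (tcat T) N M)) A B \<bullet> f =
      fhom (fcomp (Alg W) (restr T U M) (restr U W N)) A B \<bullet> f"
    by (simp only: e')
qed (simp_all add: is_vcat_Alg T U W)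

section \<open>Representable functors\<close>

lemma fob_rep [simp]: "b \<in> obs A \<Longrightarrow> fob (rep A a) b = vhom A a b"
  by (simp add: rep_def)

lemma
  assumes "is_vcat A" "a \<in> obs A" "b \<in> obs A" "c \<in> obs A"
  shows vdom_rep [simp]: "vdom V (fhom (rep A a) b c) = vhom A b c"
    and vcod_rep [simp]: "vcod V (fhom (rep A a) b c) = ih (vhom A a b) (vhom A a c)"
    and app_rep [simp]: "f \<in> El (vhom A b c) \<Longrightarrow> g \<in> El (vhom A a b) \<Longrightarrow>
      app (vhom A a b) (vhom A a c) (fhom (rep A a) b c \<bullet> f) g = cmp A a b c f g"
  using assms by (simp_all add: rep_def)

lemma is_vfun_rep:
  assumes A: "is_vcat A" and a: "a \<in> obs A"
  shows "is_vfun A vself (rep A a)"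
proof (rule is_vfunI)
  note [simp] = A a
  show "fob (rep A a) \<in> obs A \<rightarrow>\<^sub>E obs vself" by (simp add: rep_def)
  show "fhom (rep A a) \<in> (\<Pi>\<^sub>E b\<in>obs A. \<Pi>\<^sub>E c\<in>obs A.
      hom (vhom A b c) (vhom vself (fob (rep A a) b) (fob (rep A a) c)))"
    by (simp add: rep_def)
  fix b assume "b \<in> obs A"
  then show "fhom (rep A a) b b \<bullet> ide A b = ide vself (fob (rep A a) b)"
    by - (rule ih_ext[of _ "vhom A a b" "vhom A a b"], simp_all)
next
  note [simp] = A a
  fix b c d f g assume "b \<in> obs A" "c \<in> obs A" "d \<in> obs A" "f \<in> El (vhom A b c)" "g \<in> El (vhom A c d)"
  then show "fhom (rep A a) b d \<bullet> cmp A b c d g f =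
    cmp vself (fob (rep A a) b) (fob (rep A a) c) (fob (rep A a) d) (fhom (rep A a) c d \<bullet> g) (fhom (rep A a) b c \<bullet> f)"
    by - (rule ih_ext[of _ "vhom A a b" "vhom A a d"], simp_all)
qed (use A in simp_all)

section \<open>Pairs of transposed functors\<close>

text \<open>The two transposes \<open>E : U \<rightarrow> T-Alg\<close> and \<open>E' : T \<rightarrow> U-Alg\<close> of a bifold algebra. The notion is
  symmetric, so that every statement about one of them is also available for the other.\<close>

definition transposes :: "('o, 'm) theory_data \<Rightarrow> ('o, 'm) theory_data \<Rightarrow>
    ('o, ('o, 'm) alg, 'm) vfun \<Rightarrow> ('o, ('o, 'm) alg, 'm) vfun \<Rightarrow> bool" where
  "transposes T U E E' \<longleftrightarrow> is_theory T \<and> is_theory U \<and>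
     is_vfun (tcat U) (Alg T) E \<and> is_vfun (tcat T) (Alg U) E' \<and>
     (\<forall>j\<in>\<J>. \<forall>k\<in>\<J>. fob (fob E k) j = fob (fob E' j) k) \<and>
     (\<forall>j\<in>\<J>. \<forall>k\<in>\<J>. \<forall>k'\<in>\<J>. proj (tcat T) (fob E k) (fob E k') j \<cdot> fhom E k k' = fhom (fob E' j) k k') \<and>
     (\<forall>k\<in>\<J>. \<forall>j\<in>\<J>. \<forall>j'\<in>\<J>. proj (tcat U) (fob E' j) (fob E' j') k \<cdot> fhom E' j j' = fhom (fob E k) j j')"

lemma transposes_sym: "transposes T U E E' \<Longrightarrow> transposes U T E' E"
  unfolding transposes_def by metis

section \<open>Dual algebras\<close>

context
  fixes T U E E'
  assumes TU: "transposes T U E E'"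
begin

lemma transposes_theory: "is_theory T" "is_theory U"
  using TU by (simp_all only: transposes_def)

lemma transposes_vfun: "is_vfun (tcat U) (Alg T) E" "is_vfun (tcat T) (Alg U) E'"
  using TU by (simp_all only: transposes_def)

lemma transposes_algebra: "k \<in> \<J> \<Longrightarrow> is_algebra T (fob E k)" "j \<in> \<J> \<Longrightarrow> is_algebra U (fob E' j)"
  using fob_in[OF transposes_vfun(1), of k] fob_in[OF transposes_vfun(2), of j] transposes_theory by simp_all

lemma fob_transpose: "j \<in> \<J> \<Longrightarrow> k \<in> \<J> \<Longrightarrow> fob (fob E' j) k = fob (fob E k) j"
  using TU by (simp only: transposes_def)

lemma fhom_transpose_typing:
  assumes "k \<in> \<J>" "k' \<in> \<J>"
  shows "vdom V (fhom E k k') = vhom (tcat U) k k'" "vcod V (fhom E k k') = vhom (Alg T) (fob E k) (fob E k')"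
  using vdom_fhom[OF transposes_vfun(1), of k k'] vcod_fhom[OF transposes_vfun(1), of k k'] assms
    transposes_theory by simp_all

lemma proj_transpose:
  assumes "j \<in> \<J>" "k \<in> \<J>" "k' \<in> \<J>" "f \<in> El (vhom (tcat U) k k')"
  shows "proj (tcat T) (fob E k) (fob E k') j \<bullet> fhom E k k' \<bullet> f = fhom (fob E' j) k k' \<bullet> f"
proof -
  have "(proj (tcat T) (fob E k) (fob E k') j \<cdot> fhom E k k') \<bullet> f = fhom (fob E' j) k k' \<bullet> f"
    using TU assms(1-3) by (simp only: transposes_def)
  then show ?thesis
    using assms transposes_theory transposes_algebra by (simp add: fhom_transpose_typing)
qed

lemmas transposes_simps = transposes_theory transposes_algebra fob_transpose fhom_transpose_typing
  proj_transpose is_vcat_Alg[OF transposes_theory(1)] is_vcat_Alg[OF transposes_theory(2)]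

context
  fixes A
  assumes A: "is_algebra T A"
begin

lemma fob_dual_alg: "k \<in> \<J> \<Longrightarrow> fob (dual_alg T U E A) k = vhom (Alg T) A (fob E k)"
  using transposes_simps by (simp add: dual_alg_def)

lemma is_vfun_dual_alg: "is_vfun (tcat U) vself (dual_alg T U E A)"
  unfolding dual_alg_def
  by (rule is_vfun_fcomp[OF transposes_vfun(1) is_vfun_rep]) (simp_all add: transposes_simps A)

lemma
  assumes "k \<in> \<J>" "k' \<in> \<J>"
  shows vdom_dual_alg: "vdom V (fhom (dual_alg T U E A) k k') = vhom (tcat U) k k'"
    and vcod_dual_alg: "vcod V (fhom (dual_alg T U E A) k k') =
      ih (vhom (Alg T) A (fob E k)) (vhom (Alg T) A (fob E k'))"
    and app_dual_alg: "f \<in> El (vhom (tcat U) k k') \<Longrightarrow> \<beta> \<in> El (vhom (Alg T) A (fob E k)) \<Longrightarrow>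
      app (vhom (Alg T) A (fob E k)) (vhom (Alg T) A (fob E k')) (fhom (dual_alg T U E A) k k' \<bullet> f) \<beta> =
      cmp (Alg T) A (fob E k) (fob E k') (fhom E k k' \<bullet> f) \<beta>"
  using assms A by (simp_all add: dual_alg_def transposes_simps)

lemma comp_at_transpose_cmp:
  assumes "k \<in> \<J>" "k' \<in> \<J>" "j \<in> \<J>" "f \<in> El (vhom (tcat U) k k')" "\<beta> \<in> El (vhom (Alg T) A (fob E k))"
    "t \<in> El (fob A j)"
  shows "comp_at T A (fob E k') j (cmp (Alg T) A (fob E k) (fob E k') (fhom E k k' \<bullet> f) \<beta>) t =
    app (fob (fob E k) j) (fob (fob E k') j) (fhom (fob E' j) k k' \<bullet> f) (comp_at T A (fob E k) j \<beta> t)"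
  using assms A by (simp add: comp_at_cmp[OF transposes_theory(1)] transposes_simps)

text \<open>The comparison map of the dual algebra is postcomposition with the homomorphisms
  \<open>fhom E p a \<bullet> \<kappa> \<bullet> \<xi>\<close>, whose components at \<open>j\<close>
  are given by the \<open>U\<close>-algebra \<open>fob E' j\<close>. Hence it can be inverted
  componentwise, and the componentwise inverses lift to the end once they are natural in
  \<open>j\<close>.\<close>

lemma dual_alg_preserves_powers: "preserves_powers \<J> (tcat U) vself (dual_alg T U E A)"
  unfolding preserves_powers_def
proof (intro ballI allI impI)
  note [simp] = transposes_simps A fob_dual_alg vdom_dual_alg vcod_dual_alg app_dual_alg
    comp_at_transpose_cmp
  let ?H = "dual_alg T U E A"
  fix x a p \<kappa>
  assume x: "x \<in> \<J>" and pw: "is_power (tcat U) x a p \<kappa>"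
  then have o [simp]: "a \<in> \<J>" "p \<in> \<J>" "vdom V \<kappa> = x" "vcod V \<kappa> = vhom (tcat U) p a"
    by (auto simp: is_power_iff)
  define d where "d = (\<lambda>j k. fob (fob E k) j)"
  \<comment> \<open>The comparison map of the power at the component \<open>j\<close>. It is
    invertible because \<open>fob E' j\<close> is a \<open>U\<close>-algebra.\<close>
  define \<sigma> where "\<sigma> = (\<lambda>j. self_power_map x (d j a) (d j p) (fhom (fob E' j) p a \<cdot> \<kappa>))"
  have E' [simp]: "vdom V (fhom (fob E' j) p a) = vhom (tcat U) p a"
    "vcod V (fhom (fob E' j) p a) = ih (d j p) (d j a)" if "j \<in> \<J>" for j
    using that vdom_fhom[OF algebra_vfun[OF transposes_algebra(2)[OF that]], of p a]
      vcod_fhom[OF algebra_vfun[OF transposes_algebra(2)[OF that]], of p a] by (simp_all add: d_def)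
  have i [simp]: "is_iso (\<sigma> j)" if "j \<in> \<J>" for j
    using preserves_powersD[OF algebra_powers[OF transposes_algebra(2)[OF that]] x pw] that
    by (simp add: is_power_vself \<sigma>_def d_def)
  have s [simp]: "vdom V (\<sigma> j) = d j p" "vcod V (\<sigma> j) = ih x (d j a)" if "j \<in> \<J>" for j
    using that by (simp_all add: \<sigma>_def)
  have s_app [simp]: "app x (d j a) (\<sigma> j \<bullet> t) \<xi> = app (d j p) (d j a) (fhom (fob E' j) p a \<bullet> \<kappa> \<bullet> \<xi>) t"
    if "j \<in> \<J>" "t \<in> El (d j p)" "\<xi> \<in> El x" for j t \<xi>
    using that by (simp add: \<sigma>_def)
  let ?h = "ih x (vhom (Alg T) A (fob E a))"
  \<comment> \<open>\<open>w j\<close> sends \<open>(g, t)\<close> to the function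
    \<open>\<xi> \<mapsto> (g \<xi>)_j t\<close>; the inverse of \<open>\<sigma> j\<close> turns it
    into the component \<open>\<tau> j\<close> of the inverse under construction.\<close>
  define w where "w = (\<lambda>j. transp (?h \<otimes> fob A j) x (d j a)
    (untransp (fob A j) (d j a) (proj (tcat T) A (fob E a) j) \<cdot>
     (ev x (vhom (Alg T) A (fob E a)) \<boxtimes> idt (fob A j)) \<cdot> exch ?h (fob A j) x))"
  have w [simp]: "vdom V (w j) = ?h \<otimes> fob A j" "vcod V (w j) = ih x (d j a)" if "j \<in> \<J>" for j
    using that by (simp_all add: w_def d_def)
  have w_app [simp]: "app x (d j a) (w j \<bullet> (g \<odot> t)) \<xi> =
      comp_at T A (fob E a) j (app x (vhom (Alg T) A (fob E a)) g \<xi>) t"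
    if "j \<in> \<J>" "g \<in> El ?h" "t \<in> El (fob A j)" "\<xi> \<in> El x" for j g t \<xi>
    using that by (simp add: w_def d_def)
  define \<tau> where "\<tau> = (\<lambda>j. transp ?h (fob A j) (d j p) (vinv (\<sigma> j) \<cdot> w j))"
  have t [simp]: "vdom V (\<tau> j) = ?h" "vcod V (\<tau> j) = ih (fob A j) (d j p)" if "j \<in> \<J>" for j
    using that by (simp_all add: \<tau>_def)
  have t_app [simp]: "app (fob A j) (d j p) (\<tau> j \<bullet> g) t = vinv (\<sigma> j) \<bullet> w j \<bullet> (g \<odot> t)"
    if "j \<in> \<J>" "g \<in> El ?h" "t \<in> El (fob A j)" for j g t
    using that by (simp add: \<tau>_def)
  note Af = vdom_fhom[OF algebra_vfun[OF A]] vcod_fhom[OF algebra_vfun[OF A]]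
  note Ef = vdom_fhom[OF algebra_vfun[OF transposes_algebra(1)]] vcod_fhom[OF algebra_vfun[OF transposes_algebra(1)]]
  have wedge: "hom_wedge (tcat T) A (fob E p) ?h \<tau>"
  proof (rule hom_wedgeI)
    fix j k g f t
    assume *: "j \<in> obs (tcat T)" "k \<in> obs (tcat T)" "g \<in> El ?h" "f \<in> El (vhom (tcat T) j k)" "t \<in> El (fob A j)"
    then have jk [simp]: "j \<in> \<J>" "k \<in> \<J>" by simp_all
    let ?s = "vinv (\<sigma> j) \<bullet> w j \<bullet> (g \<odot> t)"
    let ?Aft = "app (fob A j) (fob A k) (fhom A j k \<bullet> f) t"
    let ?Efs = "app (d j p) (d k p) (fhom (fob E p) j k \<bullet> f) ?s"
    have se: "?s \<in> El (d j p)" using * by simp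
    have Aft: "?Aft \<in> El (fob A k)" using * Af by simp
    have Efs: "?Efs \<in> El (d k p)" using * se Ef by (simp add: d_def)
    \<comment> \<open>Naturality of \<open>\<tau>\<close> is checked after applying
      \<open>\<sigma> k\<close>, where it becomes naturality of the homomorphisms
      \<open>fhom E p a \<bullet> \<kappa> \<bullet> \<xi>\<close> and
      \<open>g \<xi>\<close>.\<close>
    have "w k \<bullet> (g \<odot> ?Aft) = \<sigma> k \<bullet> ?Efs"
    proof (rule ih_ext[of _ x "d k a"])
      fix \<xi> assume \<xi>: "\<xi> \<in> El x"
      have k\<xi>: "\<kappa> \<bullet> \<xi> \<in> El (vhom (tcat U) p a)" using \<xi> by simp
      have "app x (d k a) (\<sigma> k \<bullet> ?Efs) \<xi> = app (d k p) (d k a) (fhom (fob E' k) p a \<bullet> \<kappa> \<bullet> \<xi>) ?Efs"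
        using * Efs \<xi> by (subst s_app) simp_all
      also have "\<dots> = comp_at T (fob E p) (fob E a) k (fhom E p a \<bullet> \<kappa> \<bullet> \<xi>) ?Efs"
        using * k\<xi> by (simp add: d_def)
      also have "\<dots> = app (d j a) (d k a) (fhom (fob E a) j k \<bullet> f)
          (comp_at T (fob E p) (fob E a) j (fhom E p a \<bullet> \<kappa> \<bullet> \<xi>) ?s)"
        using * se k\<xi> comp_at_nat[of T "fob E p" "fob E a" j k "fhom E p a \<bullet> \<kappa> \<bullet> \<xi>" f ?s]
        by (simp add: d_def)
      also have "comp_at T (fob E p) (fob E a) j (fhom E p a \<bullet> \<kappa> \<bullet> \<xi>) ?s = app x (d j a) (\<sigma> j \<bullet> ?s) \<xi>"
        using * se \<xi> k\<xi> by (subst s_app) (simp_all add: d_def)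
      also have "\<dots> = comp_at T A (fob E a) j (app x (vhom (Alg T) A (fob E a)) g \<xi>) t"
        using * \<xi> by simp
      also have "app (d j a) (d k a) (fhom (fob E a) j k \<bullet> f) \<dots> = app x (d k a) (w k \<bullet> (g \<odot> ?Aft)) \<xi>"
        using * \<xi> Aft comp_at_nat[of T A "fob E a" j k "app x (vhom (Alg T) A (fob E a)) g \<xi>" f t]
        by (subst w_app) (simp_all add: d_def)
      finally show "app x (d k a) (w k \<bullet> (g \<odot> ?Aft)) \<xi> = app x (d k a) (\<sigma> k \<bullet> ?Efs) \<xi>" by (rule sym)
    qed (use * Aft Efs in simp_all)
    then have "vinv (\<sigma> k) \<bullet> w k \<bullet> (g \<odot> ?Aft) = ?Efs" using Efs by simp
    then show "app (fob A k) (fob (fob E p) k) (\<tau> k \<bullet> g) ?Aft =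
      app (fob (fob E p) j) (fob (fob E p) k) (fhom (fob E p) j k \<bullet> f) (app (fob A j) (fob (fob E p) j) (\<tau> j \<bullet> g) t)"
      using t_app[OF jk(2) *(3) Aft] t_app[OF jk(1) *(3,5)] by (simp add: d_def)
  qed (use d_def in \<open>auto intro: algebra_vfun\<close>)
  define inv where "inv = lift (tcat T) A (fob E p) ?h \<tau>"
  have inv: "vdom V inv = ?h" "vcod V inv = vhom (Alg T) A (fob E p)"
    using lift_simps[OF _ _ _ wedge] by (simp_all add: inv_def)
  have inv_app: "comp_at T A (fob E p) j (inv \<bullet> g) t = vinv (\<sigma> j) \<bullet> w j \<bullet> (g \<odot> t)"
    if "j \<in> \<J>" "g \<in> El ?h" "t \<in> El (fob A j)" for j g t
    using that lift_simps[OF _ _ _ wedge] t_app[OF that] by (simp add: inv_def d_def)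
  let ?S = "self_power_map x (fob ?H a) (fob ?H p) (fhom ?H p a \<cdot> \<kappa>)"
  have k: "fhom ?H p a \<cdot> \<kappa> \<in> hom x (ih (fob ?H p) (fob ?H a))" by simp
  have S: "vdom V ?S = vhom (Alg T) A (fob E p)" "vcod V ?S = ?h"
    using vdom_self_power_map[OF k] vcod_self_power_map[OF k] by simp_all
  have S_app: "app x (vhom (Alg T) A (fob E a)) (?S \<bullet> \<beta>) \<xi> = cmp (Alg T) A (fob E p) (fob E a) (fhom E p a \<bullet> \<kappa> \<bullet> \<xi>) \<beta>"
    if "\<beta> \<in> El (vhom (Alg T) A (fob E p))" "\<xi> \<in> El x" for \<beta> \<xi>
    using app_self_power_map[OF k, of \<beta> \<xi>] that by simp
  have "is_iso ?S"
  proof (rule is_iso_actI[of "vhom (Alg T) A (fob E p)" inv _ ?h])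
    fix \<beta> assume \<beta>: "\<beta> \<in> El (vhom (Alg T) A (fob E p))"
    then have S\<beta>: "?S \<bullet> \<beta> \<in> El ?h" using S by (intro act_El) simp_all
    show "inv \<bullet> ?S \<bullet> \<beta> = \<beta>"
    proof (rule Alg_ext[of T A "fob E p"])
      fix j t assume jt: "j \<in> \<J>" "t \<in> El (fob A j)"
      let ?b = "comp_at T A (fob E p) j \<beta> t"
      have b: "?b \<in> El (d j p)" using jt \<beta> by (simp add: d_def)
      have "w j \<bullet> ((?S \<bullet> \<beta>) \<odot> t) = \<sigma> j \<bullet> ?b"
      proof (rule ih_ext[of _ x "d j a"])
        fix \<xi> assume \<xi>: "\<xi> \<in> El x"
        have "app x (d j a) (w j \<bullet> ((?S \<bullet> \<beta>) \<odot> t)) \<xi> =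
          comp_at T A (fob E a) j (cmp (Alg T) A (fob E p) (fob E a) (fhom E p a \<bullet> \<kappa> \<bullet> \<xi>) \<beta>) t"
          using jt S\<beta> \<xi> \<beta> by (simp only: w_app S_app)
        also have "\<dots> = app x (d j a) (\<sigma> j \<bullet> ?b) \<xi>"
          using jt \<xi> \<beta> b by (subst s_app) (simp_all add: d_def)
        finally show "app x (d j a) (w j \<bullet> ((?S \<bullet> \<beta>) \<odot> t)) \<xi> = app x (d j a) (\<sigma> j \<bullet> ?b) \<xi>" .
      qed (use jt S\<beta> b in simp_all)
      then show "comp_at T A (fob E p) j (inv \<bullet> ?S \<bullet> \<beta>) t = ?b"
        using jt S\<beta> b inv_app[OF jt(1) S\<beta> jt(2)] by simp
    qed (use S\<beta> \<beta> inv in simp_all)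
  next
    fix g assume g: "g \<in> El ?h"
    then have ig: "inv \<bullet> g \<in> El (vhom (Alg T) A (fob E p))" using inv by simp
    show "?S \<bullet> inv \<bullet> g = g"
    proof (rule ih_ext[of _ x "vhom (Alg T) A (fob E a)"])
      fix \<xi> assume \<xi>: "\<xi> \<in> El x"
      show "app x (vhom (Alg T) A (fob E a)) (?S \<bullet> inv \<bullet> g) \<xi> = app x (vhom (Alg T) A (fob E a)) g \<xi>"
        unfolding S_app[OF ig \<xi>]
      proof (rule Alg_ext[of T A "fob E a"])
        fix j t assume jt: "j \<in> \<J>" "t \<in> El (fob A j)"
        let ?s = "vinv (\<sigma> j) \<bullet> w j \<bullet> (g \<odot> t)"
        have se: "?s \<in> El (d j p)" using jt g by simp
        have "comp_at T A (fob E a) j (cmp (Alg T) A (fob E p) (fob E a) (fhom E p a \<bullet> \<kappa> \<bullet> \<xi>) (inv \<bullet> g)) t =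
          app (d j p) (d j a) (fhom (fob E' j) p a \<bullet> \<kappa> \<bullet> \<xi>) ?s"
          using jt g ig \<xi> by (simp add: inv_app d_def)
        also have "\<dots> = app x (d j a) (\<sigma> j \<bullet> ?s) \<xi>" using jt se \<xi> by simp
        also have "\<dots> = comp_at T A (fob E a) j (app x (vhom (Alg T) A (fob E a)) g \<xi>) t"
          using jt g \<xi> by simp
        finally show "comp_at T A (fob E a) j (cmp (Alg T) A (fob E p) (fob E a) (fhom E p a \<bullet> \<kappa> \<bullet> \<xi>) (inv \<bullet> g)) t =
          comp_at T A (fob E a) j (app x (vhom (Alg T) A (fob E a)) g \<xi>) t" .
      qed (use g ig \<xi> in simp_all)
    qed (use g ig S in \<open>simp_all del: vdom_self_power_map vcod_self_power_map\<close>)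
  qed (use S inv in simp_all)
  then show "is_power vself x (fob ?H a) (fob ?H p) (fhom ?H p a \<cdot> \<kappa>)"
    using k by (simp add: is_power_vself)
qed

lemma is_algebra_dual_alg: "is_algebra U (dual_alg T U E A)"
  using is_vfun_dual_alg dual_alg_preserves_powers by (simp add: is_algebra_def)

end

end

context
  fixes T U E E'
  assumes TU: "transposes T U E E'"
begin

text \<open>Precomposition is the covariant representable functor of the opposite category.\<close>

lemma rep_vop_typing:
  assumes A: "is_algebra T A" and A': "is_algebra T A'" and k: "k \<in> \<J>"
  shows "vdom V (fhom (rep (vop (Alg T)) (fob E k)) A A') = vhom (Alg T) A' A"
    "vcod V (fhom (rep (vop (Alg T)) (fob E k)) A A') = ih (vhom (Alg T) A (fob E k)) (vhom (Alg T) A' (fob E k))"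
    and "g \<in> El (vhom (Alg T) A' A) \<Longrightarrow> \<beta> \<in> El (vhom (Alg T) A (fob E k)) \<Longrightarrow>
      app (vhom (Alg T) A (fob E k)) (vhom (Alg T) A' (fob E k)) (fhom (rep (vop (Alg T)) (fob E k)) A A' \<bullet> g) \<beta> =
      cmp (Alg T) A' A (fob E k) \<beta> g"
  using app_rep[of "vop (Alg T)" "fob E k" A A' g \<beta>] vdom_rep[of "vop (Alg T)" "fob E k" A A']
    vcod_rep[of "vop (Alg T)" "fob E k" A A'] assms
  by (simp_all add: transposes_simps[OF TU])

text \<open>The wedge condition is associativity of composition: precomposition with
  \<open>g\<close> commutes with postcomposition by the values of \<open>E\<close>.\<close>

lemma hom_wedge_dual_fun:
  assumes A: "is_algebra T A" and A': "is_algebra T A'"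
  shows "hom_wedge (tcat U) (dual_alg T U E A) (dual_alg T U E A') (vhom (Alg T) A' A)
    (\<lambda>k. fhom (rep (vop (Alg T)) (fob E k)) A A')"
proof (rule hom_wedgeI)
  note [simp] = transposes_simps[OF TU] A A' fob_dual_alg[OF TU] app_dual_alg[OF TU] rep_vop_typing
  fix k k' g f \<beta>
  assume "k \<in> obs (tcat U)" "k' \<in> obs (tcat U)" "g \<in> El (vhom (Alg T) A' A)"
    "f \<in> El (vhom (tcat U) k k')" "\<beta> \<in> El (fob (dual_alg T U E A) k)"
  then show "app (fob (dual_alg T U E A) k') (fob (dual_alg T U E A') k')
      (fhom (rep (vop (Alg T)) (fob E k')) A A' \<bullet> g)
      (app (fob (dual_alg T U E A) k) (fob (dual_alg T U E A) k') (fhom (dual_alg T U E A) k k' \<bullet> f) \<beta>) =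
    app (fob (dual_alg T U E A') k) (fob (dual_alg T U E A') k') (fhom (dual_alg T U E A') k k' \<bullet> f)
      (app (fob (dual_alg T U E A) k) (fob (dual_alg T U E A') k)
        (fhom (rep (vop (Alg T)) (fob E k)) A A' \<bullet> g) \<beta>)"
    by simp
qed (use A A' in \<open>simp_all add: transposes_simps[OF TU] fob_dual_alg[OF TU] rep_vop_typing is_vfun_dual_alg[OF TU]\<close>)

lemma fob_dual_fun: "is_algebra T A \<Longrightarrow> fob (dual_fun T U E) A = dual_alg T U E A"
  by (simp add: dual_fun_def)

lemma
  assumes A: "is_algebra T A" and A': "is_algebra T A'"
  shows vdom_dual_fun: "vdom V (fhom (dual_fun T U E) A A') = vhom (Alg T) A' A"
    and vcod_dual_fun: "vcod V (fhom (dual_fun T U E) A A') =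
      vhom (Alg U) (dual_alg T U E A) (dual_alg T U E A')"
    and app_dual_fun: "k \<in> \<J> \<Longrightarrow> g \<in> El (vhom (Alg T) A' A) \<Longrightarrow> \<beta> \<in> El (vhom (Alg T) A (fob E k)) \<Longrightarrow>
      app (vhom (Alg T) A (fob E k)) (vhom (Alg T) A' (fob E k))
        (proj (tcat U) (dual_alg T U E A) (dual_alg T U E A') k \<bullet> fhom (dual_fun T U E) A A' \<bullet> g) \<beta> =
      cmp (Alg T) A' A (fob E k) \<beta> g"
  using lift_simps[OF transposes_theory(2)[OF TU] is_algebra_dual_alg[OF TU A]
      is_algebra_dual_alg[OF TU A'] hom_wedge_dual_fun[OF A A']] A A'
  by (simp_all add: dual_fun_def rep_vop_typing)

lemma is_vfun_dual_fun: "is_vfun (vop (Alg T)) (Alg U) (dual_fun T U E)"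
proof (rule is_vfunI)
  note [simp] = transposes_simps[OF TU] fob_dual_fun vdom_dual_fun vcod_dual_fun
    is_algebra_dual_alg[OF TU]
  show "is_vcat (vop (Alg T))" "is_vcat (Alg U)" by simp_all
  show "fob (dual_fun T U E) \<in> obs (vop (Alg T)) \<rightarrow>\<^sub>E obs (Alg U)"
    by (auto simp: dual_fun_def)
  have "fhom (dual_fun T U E) A = undefined" if "\<not> is_algebra T A" for A
    using that by (simp add: dual_fun_def)
  moreover have "fhom (dual_fun T U E) A B = undefined" if "is_algebra T A" "\<not> is_algebra T B" for A B
    using that by (simp add: dual_fun_def)
  ultimately show "fhom (dual_fun T U E) \<in> (\<Pi>\<^sub>E A\<in>obs (vop (Alg T)). \<Pi>\<^sub>E B\<in>obs (vop (Alg T)).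
      hom (vhom (vop (Alg T)) A B) (vhom (Alg U) (fob (dual_fun T U E) A) (fob (dual_fun T U E) B)))"
    by (auto simp: PiE_iff extensional_def)
next
  note [simp] = transposes_simps[OF TU] fob_dual_fun vdom_dual_fun vcod_dual_fun
    is_algebra_dual_alg[OF TU]
  fix A assume "A \<in> obs (vop (Alg T))"
  then have A [simp]: "is_algebra T A" by simp
  let ?H = "dual_alg T U E A"
  have "fhom (dual_fun T U E) A A \<bullet> ide (Alg T) A = ide (Alg U) ?H"
  proof (rule Alg_ext[of U ?H ?H])
    fix k \<beta> assume *: "k \<in> \<J>" "\<beta> \<in> El (fob ?H k)"
    then show "comp_at U ?H ?H k (fhom (dual_fun T U E) A A \<bullet> ide (Alg T) A) \<beta> = comp_at U ?H ?H k (ide (Alg U) ?H) \<beta>"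
      using comp_at_ide[of U ?H k \<beta>] app_dual_fun[OF A A, of k "ide (Alg T) A" \<beta>]
      by (simp add: fob_dual_alg[OF TU A])
  qed simp_all
  then show "fhom (dual_fun T U E) A A \<bullet> ide (vop (Alg T)) A = ide (Alg U) (fob (dual_fun T U E) A)"
    by simp
next
  note [simp] = transposes_simps[OF TU] fob_dual_fun vdom_dual_fun vcod_dual_fun
    is_algebra_dual_alg[OF TU]
  fix A B C f g
  assume "A \<in> obs (vop (Alg T))" "B \<in> obs (vop (Alg T))" "C \<in> obs (vop (Alg T))"
    "f \<in> El (vhom (vop (Alg T)) A B)" "g \<in> El (vhom (vop (Alg T)) B C)"
  then have A [simp]: "is_algebra T A" and B [simp]: "is_algebra T B" and C [simp]: "is_algebra T C"
    and f: "f \<in> El (vhom (Alg T) B A)" and g: "g \<in> El (vhom (Alg T) C B)" by simp_all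
  let ?A = "dual_alg T U E A" and ?B = "dual_alg T U E B" and ?C = "dual_alg T U E C"
  have e: "fhom (dual_fun T U E) A B \<bullet> f \<in> El (vhom (Alg U) ?A ?B)"
    "fhom (dual_fun T U E) B C \<bullet> g \<in> El (vhom (Alg U) ?B ?C)"
    using f g by simp_all
  have "fhom (dual_fun T U E) A C \<bullet> cmp (Alg T) C B A f g =
    cmp (Alg U) ?A ?B ?C (fhom (dual_fun T U E) B C \<bullet> g) (fhom (dual_fun T U E) A B \<bullet> f)" (is "?l = ?r")
  proof (rule Alg_ext[of U ?A ?C])
    fix k \<beta> assume k: "k \<in> \<J>" and b: "\<beta> \<in> El (fob ?A k)"
    then have \<beta>: "\<beta> \<in> El (vhom (Alg T) A (fob E k))" by (simp add: fob_dual_alg[OF TU A])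
    have fg: "cmp (Alg T) C B A f g \<in> El (vhom (Alg T) C A)" using f g by simp
    have \<beta>f: "cmp (Alg T) B A (fob E k) \<beta> f \<in> El (vhom (Alg T) B (fob E k))" using \<beta> f k by simp
    have "comp_at U ?A ?C k ?l \<beta> = cmp (Alg T) C A (fob E k) \<beta> (cmp (Alg T) C B A f g)"
      using app_dual_fun[OF A C k fg \<beta>] k by (simp add: fob_dual_alg[OF TU])
    also have "\<dots> = cmp (Alg T) C B (fob E k) (cmp (Alg T) B A (fob E k) \<beta> f) g"
      using f g \<beta> k by simp
    also have "\<dots> = comp_at U ?B ?C k (fhom (dual_fun T U E) B C \<bullet> g) (comp_at U ?A ?B k (fhom (dual_fun T U E) A B \<bullet> f) \<beta>)"
      using app_dual_fun[OF A B k f \<beta>] app_dual_fun[OF B C k g \<beta>f] k by (simp add: fob_dual_alg[OF TU])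
    also have "\<dots> = comp_at U ?A ?C k ?r \<beta>"
      using k b by (intro comp_at_cmp[OF _ _ _ _ k e(2,1) b, symmetric]) simp_all
    finally show "comp_at U ?A ?C k ?l \<beta> = comp_at U ?A ?C k ?r \<beta>" .
  qed (use f g in simp_all)
  then show "fhom (dual_fun T U E) A C \<bullet> cmp (vop (Alg T)) A B C g f =
    cmp (Alg U) (fob (dual_fun T U E) A) (fob (dual_fun T U E) B) (fob (dual_fun T U E) C)
      (fhom (dual_fun T U E) B C \<bullet> g) (fhom (dual_fun T U E) A B \<bullet> f)"
    using f g by simp
qed

end

section \<open>The dualization isomorphism\<close>

text \<open>Element form of the defining property of \<open>dual_iso\<close>, stated for arbitrary
  transposes so that it can be used with the two theories exchanged. The link to
  \<open>dual_iso\<close> is \<open>can_iff_dualization\<close>.\<close>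

definition is_dualization :: "('o, 'm) theory_data \<Rightarrow> ('o, 'm) theory_data \<Rightarrow>
    ('o, ('o, 'm) alg, 'm) vfun \<Rightarrow> ('o, ('o, 'm) alg, 'm) vfun \<Rightarrow>
    ('o, 'm) alg \<Rightarrow> ('o, 'm) alg \<Rightarrow> 'm \<Rightarrow> bool" where
  "is_dualization T U E E' A B h \<longleftrightarrow>
     h \<in> hom (vhom (Alg T) A (dual_alg U T E' B)) (vhom (Alg U) B (dual_alg T U E A)) \<and>
     (\<forall>j\<in>\<J>. \<forall>k\<in>\<J>. \<forall>\<alpha>\<in>El (vhom (Alg T) A (dual_alg U T E' B)). \<forall>t\<in>El (fob A j). \<forall>y\<in>El (fob B k).
        comp_at T A (fob E k) j (comp_at U B (dual_alg T U E A) k (h \<bullet> \<alpha>) y) t =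
        comp_at U B (fob E' j) k (comp_at T A (dual_alg U T E' B) j \<alpha> t) y)"

context
  fixes T U E E' A B
  assumes TU: "transposes T U E E'" and A: "is_algebra T A" and B: "is_algebra U B"
begin

text \<open>\<open>Alg_ext\<close> twice: a homomorphism into a dual algebra has components in
  hom-objects of algebras, which have components themselves.\<close>

lemma dual_alg_double_ext:
  assumes "\<alpha> \<in> El (vhom (Alg U) B (dual_alg T U E A))" "\<beta> \<in> El (vhom (Alg U) B (dual_alg T U E A))"
    and "\<And>j k t y. j \<in> \<J> \<Longrightarrow> k \<in> \<J> \<Longrightarrow> t \<in> El (fob A j) \<Longrightarrow> y \<in> El (fob B k) \<Longrightarrow>
      comp_at T A (fob E k) j (comp_at U B (dual_alg T U E A) k \<alpha> y) t =
      comp_at T A (fob E k) j (comp_at U B (dual_alg T U E A) k \<beta> y) t"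
  shows "\<alpha> = \<beta>"
proof (rule Alg_ext[of U B "dual_alg T U E A"])
  note [simp] = transposes_simps[OF TU] A B is_algebra_dual_alg[OF TU]
  fix k y assume ky: "k \<in> \<J>" "y \<in> El (fob B k)"
  have e: "comp_at U B (dual_alg T U E A) k \<gamma> y \<in> El (vhom (Alg T) A (fob E k))"
    if "\<gamma> \<in> El (vhom (Alg U) B (dual_alg T U E A))" for \<gamma>
    using that ky by (simp add: fob_dual_alg[OF TU A])
  show "comp_at U B (dual_alg T U E A) k \<alpha> y = comp_at U B (dual_alg T U E A) k \<beta> y"
    by (rule Alg_ext[of T A "fob E k"]) (use assms ky e in simp_all)
qed (use assms A B in \<open>simp_all add: transposes_simps[OF TU] is_algebra_dual_alg[OF TU]\<close>)

lemma is_dualization_unique: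
  assumes "is_dualization T U E E' A B h" "is_dualization T U E E' A B h'"
  shows "h = h'"
proof (rule act_eqI)
  fix \<alpha> assume \<alpha>: "\<alpha> \<in> El (vhom (Alg T) A (dual_alg U T E' B))"
  show "h \<bullet> \<alpha> = h' \<bullet> \<alpha>"
    by (rule dual_alg_double_ext) (use assms \<alpha> in \<open>simp_all add: is_dualization_def\<close>)
qed (use assms in \<open>simp_all add: is_dualization_def\<close>)

lemma ex_is_dualization: "\<exists>h. is_dualization T U E E' A B h"
proof -
  note UT = transposes_sym[OF TU]
  let ?H = "dual_alg T U E A" and ?K = "dual_alg U T E' B"
  let ?e = "vhom (Alg T) A ?K"
  have t: "is_theory T" "is_theory U" by (rule transposes_theory[OF TU])+
  have al: "is_algebra T ?K" "is_algebra U ?H"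
    "\<And>k. k \<in> \<J> \<Longrightarrow> is_algebra T (fob E k)" "\<And>j. j \<in> \<J> \<Longrightarrow> is_algebra U (fob E' j)"
    using is_algebra_dual_alg[OF UT B] is_algebra_dual_alg[OF TU A] transposes_algebra[OF TU] by auto
  note [simp] = t A B al is_vcat_Alg[OF t(1)] is_vcat_Alg[OF t(2)]
  define d where "d = (\<lambda>j k. fob (fob E k) j)"
  have d: "fob (fob E k) j = d j k" "fob (fob E' j) k = d j k" "fob ?H k = vhom (Alg T) A (fob E k)"
    "fob ?K j = vhom (Alg U) B (fob E' j)" if "j \<in> \<J>" "k \<in> \<J>" for j k
    using that fob_transpose[OF TU] fob_dual_alg[OF TU A] fob_dual_alg[OF UT B] by (simp_all add: d_def)
  have dH: "fob ?H k = vhom (Alg T) A (fob E k)" "fob ?K k = vhom (Alg U) B (fob E' k)" if "k \<in> \<J>" for k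
    using d[OF that that] by simp_all
  \<comment> \<open>\<open>r k j\<close> sends \<open>(\<alpha>, y)\<close> to
    \<open>t \<mapsto> (\<alpha>_j t)_k y\<close>. It is lifted over \<open>j\<close> to
    \<open>R k\<close>, transposed to \<open>s k\<close>, and then lifted over \<open>k\<close> to
    \<open>h\<close>.\<close>
  define r where "r = (\<lambda>k j. transp (?e \<otimes> fob B k) (fob A j) (d j k)
    (untransp (fob B k) (d j k) (proj (tcat U) B (fob E' j) k) \<cdot>
     (untransp (fob A j) (fob ?K j) (proj (tcat T) A ?K j) \<boxtimes> idt (fob B k)) \<cdot> exch ?e (fob B k) (fob A j)))"
  have r: "vdom V (r k j) = ?e \<otimes> fob B k" "vcod V (r k j) = ih (fob A j) (d j k)" if "j \<in> \<J>" "k \<in> \<J>" for j k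
    using that by (simp_all add: r_def d)
  have r_app: "app (fob A j) (d j k) (r k j \<bullet> (\<alpha> \<odot> y)) t = comp_at U B (fob E' j) k (comp_at T A ?K j \<alpha> t) y"
    if "j \<in> \<J>" "k \<in> \<J>" "\<alpha> \<in> El ?e" "y \<in> El (fob B k)" "t \<in> El (fob A j)" for j k \<alpha> y t
    using that by (simp add: r_def d)
  \<comment> \<open>Naturality in \<open>j\<close>: \<open>\<alpha>\<close> carries the action of
    \<open>f\<close> on \<open>A\<close> to postcomposition with
    \<open>fhom E' j j' \<bullet> f\<close>, and the component of the latter at \<open>k\<close> is
    the action of \<open>f\<close> on \<open>fob E k\<close>.\<close>
  have nat1: "comp_at U B (fob E' j') k (comp_at T A ?K j' \<alpha> (app (fob A j) (fob A j') (fhom A j j' \<bullet> f) t)) y =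
      app (d j k) (d j' k) (fhom (fob E k) j j' \<bullet> f) (comp_at U B (fob E' j) k (comp_at T A ?K j \<alpha> t) y)"
    if *: "j \<in> \<J>" "j' \<in> \<J>" "k \<in> \<J>" "\<alpha> \<in> El ?e" "y \<in> El (fob B k)" "t \<in> El (fob A j)" "f \<in> El (vhom (tcat T) j j')"
    for j j' k \<alpha> y t f
  proof -
    have c: "comp_at T A ?K j \<alpha> t \<in> El (vhom (Alg U) B (fob E' j))" using * by (simp add: dH)
    have "comp_at T A ?K j' \<alpha> (app (fob A j) (fob A j') (fhom A j j' \<bullet> f) t) =
        app (fob ?K j) (fob ?K j') (fhom ?K j j' \<bullet> f) (comp_at T A ?K j \<alpha> t)"
      by (rule comp_at_nat) (use * in simp_all)
    also have "\<dots> = cmp (Alg U) B (fob E' j) (fob E' j') (fhom E' j j' \<bullet> f) (comp_at T A ?K j \<alpha> t)"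
      using app_dual_alg[OF UT B _ _ _ c, of j' f] * by (simp add: dH)
    finally show ?thesis
      using comp_at_transpose_cmp[OF UT B _ _ _ _ c, of j' k f y] * d[of j k] d[of j' k] by simp
  qed
  \<comment> \<open>\<open>nat1\<close> with the values of \<open>?K\<close> and of the transposes
    rewritten by \<open>d\<close>, the form in which the simplifier meets it.\<close>
  have nat1': "app (fob B k) (d j' k) (proj (tcat U) B (fob E' j') k \<bullet>
        app (fob A j') (vhom (Alg U) B (fob E' j')) (proj (tcat T) A ?K j' \<bullet> \<alpha>)
          (app (fob A j) (fob A j') (fhom A j j' \<bullet> f) t)) y =
      app (d j k) (d j' k) (fhom (fob E k) j j' \<bullet> f)
        (app (fob B k) (d j k) (proj (tcat U) B (fob E' j) k \<bullet>
          app (fob A j) (vhom (Alg U) B (fob E' j)) (proj (tcat T) A ?K j \<bullet> \<alpha>) t) y)"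
    if *: "j \<in> \<J>" "j' \<in> \<J>" "k \<in> \<J>" "\<alpha> \<in> El ?e" "y \<in> El (fob B k)" "t \<in> El (fob A j)" "f \<in> El (vhom (tcat T) j j')"
    for j j' k \<alpha> y t f
    using nat1[OF *] * by (simp add: d)
  have w1: "hom_wedge (tcat T) A (fob E k) (?e \<otimes> fob B k) (r k)" if k: "k \<in> \<J>" for k
    \<comment> \<open>The domain is a tensor product, so the wedge condition is tested on
      \<open>(\<alpha> \<odot> y) \<odot> f\<close> and not through
      \<open>hom_wedgeI\<close>.\<close>
    unfolding hom_wedge_def
  proof (intro conjI ballI)
    fix j j' assume j: "j \<in> obs (tcat T)" "j' \<in> obs (tcat T)"
    note ty = vdom_fhom[OF algebra_vfun[OF A]] vcod_fhom[OF algebra_vfun[OF A]]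
      vdom_fhom[OF algebra_vfun[OF al(3)[OF k]]] vcod_fhom[OF algebra_vfun[OF al(3)[OF k]]]
    show "vcmp vself (fob A j) (fob A j') (fob (fob E k) j') \<cdot> (r k j' \<boxtimes> fhom A j j') =
       vcmp vself (fob A j) (fob (fob E k) j) (fob (fob E k) j') \<cdot> (fhom (fob E k) j j' \<boxtimes> r k j) \<cdot> sy (?e \<otimes> fob B k) (vhom (tcat T) j j')"
    proof (rule act_eqI_pair_left[of ?e "fob B k" "vhom (tcat T) j j'"])
      fix \<alpha> y f assume e: "\<alpha> \<in> El ?e" "y \<in> El (fob B k)" "f \<in> El (vhom (tcat T) j j')"
      show "(vcmp vself (fob A j) (fob A j') (fob (fob E k) j') \<cdot> (r k j' \<boxtimes> fhom A j j')) \<bullet> ((\<alpha> \<odot> y) \<odot> f) =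
         (vcmp vself (fob A j) (fob (fob E k) j) (fob (fob E k) j') \<cdot> (fhom (fob E k) j j' \<boxtimes> r k j) \<cdot> sy (?e \<otimes> fob B k) (vhom (tcat T) j j')) \<bullet> ((\<alpha> \<odot> y) \<odot> f)"
        by (rule ih_ext[of _ "fob A j" "fob (fob E k) j'"])
          (use e j k in \<open>simp_all add: r r_app d ty nat1'\<close>)
    qed (use j k in \<open>simp_all add: r d ty\<close>)
  qed (use k in \<open>simp_all add: r d\<close>)
  define R where "R = (\<lambda>k. lift (tcat T) A (fob E k) (?e \<otimes> fob B k) (r k))"
  have R: "vdom V (R k) = ?e \<otimes> fob B k" "vcod V (R k) = vhom (Alg T) A (fob E k)" if "k \<in> \<J>" for k
    using lift_simps[OF _ _ _ w1[OF that]] that by (simp_all add: R_def)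
  have R_app: "comp_at T A (fob E k) j (R k \<bullet> (\<alpha> \<odot> y)) t = comp_at U B (fob E' j) k (comp_at T A ?K j \<alpha> t) y"
    if "j \<in> \<J>" "k \<in> \<J>" "\<alpha> \<in> El ?e" "y \<in> El (fob B k)" "t \<in> El (fob A j)" for j k \<alpha> y t
    using lift_simps(3)[OF _ _ _ w1[OF that(2)]] that r_app[OF that] by (simp add: R_def d)
  define s where "s = (\<lambda>k. transp ?e (fob B k) (vhom (Alg T) A (fob E k)) (R k))"
  have s: "vdom V (s k) = ?e" "vcod V (s k) = ih (fob B k) (vhom (Alg T) A (fob E k))" if "k \<in> \<J>" for k
    using that R by (simp_all add: s_def)
  have s_app: "app (fob B k) (vhom (Alg T) A (fob E k)) (s k \<bullet> \<alpha>) y = R k \<bullet> (\<alpha> \<odot> y)"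
    if "k \<in> \<J>" "\<alpha> \<in> El ?e" "y \<in> El (fob B k)" for k \<alpha> y
    using that R by (simp add: s_def)
  have w2: "hom_wedge (tcat U) B ?H ?e s"
  proof (rule hom_wedgeI)
    fix k k' \<alpha> g y
    assume "k \<in> obs (tcat U)" "k' \<in> obs (tcat U)" and \<alpha>: "\<alpha> \<in> El ?e" and g: "g \<in> El (vhom (tcat U) k k')"
      and y: "y \<in> El (fob B k)"
    then have k: "k \<in> \<J>" "k' \<in> \<J>" by simp_all
    let ?gy = "app (fob B k) (fob B k') (fhom B k k' \<bullet> g) y"
    have gy: "?gy \<in> El (fob B k')"
      using k g y vdom_fhom[OF algebra_vfun[OF B]] vcod_fhom[OF algebra_vfun[OF B]] by simp
    have Ra: "R k \<bullet> (\<alpha> \<odot> y) \<in> El (vhom (Alg T) A (fob E k))" using R k \<alpha> y by simp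
    \<comment> \<open>Naturality in \<open>k\<close>: on components it is naturality in
      \<open>k\<close> of the homomorphism \<open>\<alpha>_j t\<close> of
      \<open>U\<close>-algebras.\<close>
    have "R k' \<bullet> (\<alpha> \<odot> ?gy) = cmp (Alg T) A (fob E k) (fob E k') (fhom E k k' \<bullet> g) (R k \<bullet> (\<alpha> \<odot> y))"
    proof (rule Alg_ext[of T A "fob E k'"])
      fix j t assume j: "j \<in> \<J>" and t: "t \<in> El (fob A j)"
      have c: "comp_at T A ?K j \<alpha> t \<in> El (vhom (Alg U) B (fob E' j))" using j t \<alpha> by (simp add: dH)
      have "comp_at T A (fob E k') j (R k' \<bullet> (\<alpha> \<odot> ?gy)) t = comp_at U B (fob E' j) k' (comp_at T A ?K j \<alpha> t) ?gy"
        by (rule R_app) (use j k \<alpha> t gy in simp_all)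
      also have "\<dots> = app (fob (fob E' j) k) (fob (fob E' j) k') (fhom (fob E' j) k k' \<bullet> g)
          (comp_at U B (fob E' j) k (comp_at T A ?K j \<alpha> t) y)"
        by (rule comp_at_nat) (use j k c g y in simp_all)
      also have "comp_at U B (fob E' j) k (comp_at T A ?K j \<alpha> t) y = comp_at T A (fob E k) j (R k \<bullet> (\<alpha> \<odot> y)) t"
        by (rule R_app[symmetric]) (use j k \<alpha> t y in simp_all)
      also have "app (fob (fob E' j) k) (fob (fob E' j) k') (fhom (fob E' j) k k' \<bullet> g) \<dots> =
          comp_at T A (fob E k') j (cmp (Alg T) A (fob E k) (fob E k') (fhom E k k' \<bullet> g) (R k \<bullet> (\<alpha> \<odot> y))) t"
        using comp_at_transpose_cmp[OF TU A k j g Ra t] d[OF j k(1)] d[OF j k(2)] by simp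
      finally show "comp_at T A (fob E k') j (R k' \<bullet> (\<alpha> \<odot> ?gy)) t =
        comp_at T A (fob E k') j (cmp (Alg T) A (fob E k) (fob E k') (fhom E k k' \<bullet> g) (R k \<bullet> (\<alpha> \<odot> y))) t" .
    qed (use k R \<alpha> y gy g Ra fhom_transpose_typing[OF TU] in simp_all)
    then show "app (fob B k') (fob ?H k') (s k' \<bullet> \<alpha>) ?gy =
      app (fob ?H k) (fob ?H k') (fhom ?H k k' \<bullet> g) (app (fob B k) (fob ?H k) (s k \<bullet> \<alpha>) y)"
      using k \<alpha> y gy g app_dual_alg[OF TU A k g Ra] by (simp add: dH s_app)
  qed (use s in \<open>auto intro: algebra_vfun simp: dH\<close>)
  define h where "h = lift (tcat U) B ?H ?e s"
  have h: "vdom V h = ?e" "vcod V h = vhom (Alg U) B ?H"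
    using lift_simps[OF _ _ _ w2] by (simp_all add: h_def)
  have "comp_at T A (fob E k) j (comp_at U B ?H k (h \<bullet> \<alpha>) y) t = comp_at U B (fob E' j) k (comp_at T A ?K j \<alpha> t) y"
    if "j \<in> \<J>" "k \<in> \<J>" "\<alpha> \<in> El ?e" "t \<in> El (fob A j)" "y \<in> El (fob B k)" for j k \<alpha> t y
    using lift_simps(3)[OF _ _ _ w2] that s_app R_app by (simp add: h_def dH)
  then show ?thesis using h by (auto simp: is_dualization_def)
qed

end

text \<open>The inverse is the dualization with the two theories exchanged: each of the two laws
  reads the other backwards, so both composites fix all double components.\<close>

lemma is_iso_dualization:
  assumes TU: "transposes T U E E'" and A: "is_algebra T A" and B: "is_algebra U B"
    and h: "is_dualization T U E E' A B h"
  shows "is_iso h"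
proof -
  note UT = transposes_sym[OF TU]
  obtain h' where h': "is_dualization U T E' E B A h'"
    using ex_is_dualization[OF UT B A] by blast
  have ty: "vdom V h = vhom (Alg T) A (dual_alg U T E' B)" "vcod V h = vhom (Alg U) B (dual_alg T U E A)"
    "vdom V h' = vhom (Alg U) B (dual_alg T U E A)" "vcod V h' = vhom (Alg T) A (dual_alg U T E' B)"
    using h h' by (simp_all add: is_dualization_def)
  have l: "comp_at T A (fob E k) j (comp_at U B (dual_alg T U E A) k (h \<bullet> \<alpha>) y) t =
        comp_at U B (fob E' j) k (comp_at T A (dual_alg U T E' B) j \<alpha> t) y"
    if "j \<in> \<J>" "k \<in> \<J>" "\<alpha> \<in> El (vhom (Alg T) A (dual_alg U T E' B))" "t \<in> El (fob A j)" "y \<in> El (fob B k)" for j k \<alpha> t y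
    using h that unfolding is_dualization_def by blast
  have l': "comp_at U B (fob E' j) k (comp_at T A (dual_alg U T E' B) j (h' \<bullet> \<alpha>) t) y =
        comp_at T A (fob E k) j (comp_at U B (dual_alg T U E A) k \<alpha> y) t"
    if "j \<in> \<J>" "k \<in> \<J>" "\<alpha> \<in> El (vhom (Alg U) B (dual_alg T U E A))" "t \<in> El (fob A j)" "y \<in> El (fob B k)" for j k \<alpha> t y
    using h' that unfolding is_dualization_def by blast
  show ?thesis
  proof (rule is_iso_actI[OF _ _ ty])
    fix \<alpha> assume \<alpha>: "\<alpha> \<in> El (vhom (Alg T) A (dual_alg U T E' B))"
    show "h' \<bullet> h \<bullet> \<alpha> = \<alpha>"
      by (rule dual_alg_double_ext[OF UT B A]) (use \<alpha> ty in \<open>simp_all add: l l'\<close>)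
  next
    fix \<beta> assume \<beta>: "\<beta> \<in> El (vhom (Alg U) B (dual_alg T U E A))"
    show "h \<bullet> h' \<bullet> \<beta> = \<beta>"
      by (rule dual_alg_double_ext[OF TU A B]) (use \<beta> ty in \<open>simp_all add: l l'\<close>)
  qed
qed

text \<open>Currying, stated for two families \<open>L\<close> and \<open>R\<close> of algebras with
  an interchange law, so that it yields both \<open>curry_right\<close> and
  \<open>curry_left\<close>. The interchange law \<open>nat\<close> is the wedge condition for the
  lift, and functoriality in \<open>k\<close> is that of the algebras \<open>L j\<close>.\<close>

lemma transpose_vfun:
  assumes T: "is_theory T" and U: "is_theory U"
    and L: "\<And>j. j \<in> \<J> \<Longrightarrow> is_algebra U (L j)" and R: "\<And>k. k \<in> \<J> \<Longrightarrow> is_algebra T (R k)"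
    and LR: "\<And>j k. j \<in> \<J> \<Longrightarrow> k \<in> \<J> \<Longrightarrow> fob (L j) k = fob (R k) j"
    and nat: "\<And>j j' k k' f g t. j \<in> \<J> \<Longrightarrow> j' \<in> \<J> \<Longrightarrow> k \<in> \<J> \<Longrightarrow> k' \<in> \<J> \<Longrightarrow>
      f \<in> El (vhom (tcat T) j j') \<Longrightarrow> g \<in> El (vhom (tcat U) k k') \<Longrightarrow> t \<in> El (fob (R k) j) \<Longrightarrow>
      app (fob (R k) j') (fob (R k') j') (fhom (L j') k k' \<bullet> g) (app (fob (R k) j) (fob (R k) j') (fhom (R k) j j' \<bullet> f) t) =
      app (fob (R k') j) (fob (R k') j') (fhom (R k') j j' \<bullet> f) (app (fob (R k) j) (fob (R k') j) (fhom (L j) k k' \<bullet> g) t)"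
    and E: "E = \<lparr>fob = (\<lambda>k\<in>\<J>. R k),
     fhom = (\<lambda>k\<in>\<J>. \<lambda>k'\<in>\<J>. lift (tcat T) (R k) (R k') (vhom (tcat U) k k') (\<lambda>j. fhom (L j) k k'))\<rparr>"
  shows "is_vfun (tcat U) (Alg T) E"
    and "\<And>j k k'. j \<in> \<J> \<Longrightarrow> k \<in> \<J> \<Longrightarrow> k' \<in> \<J> \<Longrightarrow> proj (tcat T) (R k) (R k') j \<cdot> fhom E k k' = fhom (L j) k k'"
proof -
  note [simp] = T U L R is_vcat_Alg[OF T]
  have Lf: "vdom V (fhom (L j) k k') = vhom (tcat U) k k'" "vcod V (fhom (L j) k k') = ih (fob (R k) j) (fob (R k') j)"
    if "j \<in> \<J>" "k \<in> \<J>" "k' \<in> \<J>" for j k k'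
    using vdom_fhom[OF algebra_vfun[OF L[OF that(1)]], of k k'] vcod_fhom[OF algebra_vfun[OF L[OF that(1)]], of k k'] that
    by (simp_all add: LR)
  have w: "hom_wedge (tcat T) (R k) (R k') (vhom (tcat U) k k') (\<lambda>j. fhom (L j) k k')" if "k \<in> \<J>" "k' \<in> \<J>" for k k'
    by (rule hom_wedgeI) (use that in \<open>simp_all add: Lf nat algebra_vfun\<close>)
  have obE: "fob E k = R k" if "k \<in> \<J>" for k using that by (simp add: E)
  have hE: "fhom E k k' = lift (tcat T) (R k) (R k') (vhom (tcat U) k k') (\<lambda>j. fhom (L j) k k')" if "k \<in> \<J>" "k' \<in> \<J>" for k k'
    using that by (simp add: E)
  have E1: "vdom V (fhom E k k') = vhom (tcat U) k k'" "vcod V (fhom E k k') = vhom (Alg T) (R k) (R k')" if "k \<in> \<J>" "k' \<in> \<J>" for k k'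
    using lift_simps(1,2)[OF T R R w, of k k'] that by (simp_all add: hE)
  have E2: "proj (tcat T) (R k) (R k') j \<bullet> fhom E k k' \<bullet> f = fhom (L j) k k' \<bullet> f"
    if "j \<in> \<J>" "k \<in> \<J>" "k' \<in> \<J>" "f \<in> El (vhom (tcat U) k k')" for j k k' f
    using lift_simps(3)[OF T R R w, of k k'] that by (simp_all add: hE)
  show "proj (tcat T) (R k) (R k') j \<cdot> fhom E k k' = fhom (L j) k k'" if "j \<in> \<J>" "k \<in> \<J>" "k' \<in> \<J>" for j k k'
    using lift_typing[OF T R R w, of k k'] that by (simp add: hE)
  show "is_vfun (tcat U) (Alg T) E"
  proof (rule is_vfunI)
    show "fob E \<in> obs (tcat U) \<rightarrow>\<^sub>E obs (Alg T)" by (auto simp: E)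
    have "fhom E k = undefined" if "k \<notin> \<J>" for k using that by (simp add: E)
    moreover have "fhom E k k' = undefined" if "k \<in> \<J>" "k' \<notin> \<J>" for k k' using that by (simp add: E)
    ultimately show "fhom E \<in> (\<Pi>\<^sub>E a\<in>obs (tcat U). \<Pi>\<^sub>E b\<in>obs (tcat U). hom (vhom (tcat U) a b) (vhom (Alg T) (fob E a) (fob E b)))"
      by (auto simp: PiE_iff extensional_def E1 obE)
    fix k assume "k \<in> obs (tcat U)"
    then have k [simp]: "k \<in> \<J>" by simp
    have "fhom E k k \<bullet> ide (tcat U) k = ide (Alg T) (R k)"
    proof (rule Alg_ext[of T "R k" "R k"])
      fix j t assume j: "j \<in> \<J>" "t \<in> El (fob (R k) j)"
      then show "comp_at T (R k) (R k) j (fhom E k k \<bullet> ide (tcat U) k) t = comp_at T (R k) (R k) j (ide (Alg T) (R k)) t"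
        using fhom_ide[OF algebra_vfun[OF L[OF j(1)]], of k] LR[OF j(1) k] comp_at_ide[OF T R[OF k] j]
        by (simp add: E2)
    qed (use E1 in simp_all)
    then show "fhom E k k \<bullet> ide (tcat U) k = ide (Alg T) (fob E k)" by (simp add: obE)
  next
    fix a b c f g assume "a \<in> obs (tcat U)" "b \<in> obs (tcat U)" "c \<in> obs (tcat U)"
      and f: "f \<in> El (vhom (tcat U) a b)" and g: "g \<in> El (vhom (tcat U) b c)"
    then have o [simp]: "a \<in> \<J>" "b \<in> \<J>" "c \<in> \<J>" by simp_all
    have e: "fhom E a b \<bullet> f \<in> El (vhom (Alg T) (R a) (R b))" "fhom E b c \<bullet> g \<in> El (vhom (Alg T) (R b) (R c))"
      using f g by (simp_all add: E1)
    have "fhom E a c \<bullet> cmp (tcat U) a b c g f = cmp (Alg T) (R a) (R b) (R c) (fhom E b c \<bullet> g) (fhom E a b \<bullet> f)"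
    proof (rule Alg_ext[of T "R a" "R c"])
      fix j t assume j: "j \<in> \<J>" "t \<in> El (fob (R a) j)"
      have "comp_at T (R a) (R c) j (fhom E a c \<bullet> cmp (tcat U) a b c g f) t =
        app (fob (R a) j) (fob (R c) j) (fhom (L j) a c \<bullet> cmp (tcat U) a b c g f) t"
        using j f g by (simp add: E2)
      also have "\<dots> = app (fob (R b) j) (fob (R c) j) (fhom (L j) b c \<bullet> g) (app (fob (R a) j) (fob (R b) j) (fhom (L j) a b \<bullet> f) t)"
        using j f g fhom_cmp[OF algebra_vfun[OF L[OF j(1)]], of a b c f g] by (simp add: LR Lf)
      also have "\<dots> = comp_at T (R a) (R c) j (cmp (Alg T) (R a) (R b) (R c) (fhom E b c \<bullet> g) (fhom E a b \<bullet> f)) t"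
        using comp_at_cmp[OF T R[OF o(1)] R[OF o(2)] R[OF o(3)] j(1) e(2,1) j(2)] j f g by (simp add: E2)
      finally show "comp_at T (R a) (R c) j (fhom E a c \<bullet> cmp (tcat U) a b c g f) t =
        comp_at T (R a) (R c) j (cmp (Alg T) (R a) (R b) (R c) (fhom E b c \<bullet> g) (fhom E a b \<bullet> f)) t" .
    qed (use E1 e f g in simp_all)
    then show "fhom E a c \<bullet> cmp (tcat U) a b c g f =
      cmp (Alg T) (fob E a) (fob E b) (fob E c) (fhom E b c \<bullet> g) (fhom E a b \<bullet> f)" by (simp add: obE)
  qed simp_all
qed

section \<open>The transposes of a bifold algebra and its dualization isomorphism\<close>

context
  fixes X
  assumes X: "is_bifold X"
begin

lemma bifold_theory: "is_theory (lth X)" "is_theory (rth X)"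
  and bifold_vfun: "is_vfun (vtimes (tcat (lth X)) (tcat (rth X))) vself (bif X)"
  using X by (simp_all only: is_bifold_def)

lemmas bif_simps = bifun_simps[OF theory_vcat[OF bifold_theory(1)] theory_vcat[OF bifold_theory(2)]
    is_vcat_vself bifold_vfun, unfolded theory_obs[OF bifold_theory(1)] theory_obs[OF bifold_theory(2)] vself_simps]

lemmas fix_simps =
  fob_fix_left[OF theory_vcat[OF bifold_theory(1)] theory_vcat[OF bifold_theory(2)] is_vcat_vself bifold_vfun,
    unfolded theory_obs[OF bifold_theory(1)] theory_obs[OF bifold_theory(2)]]
  fob_fix_right[OF theory_vcat[OF bifold_theory(1)] theory_vcat[OF bifold_theory(2)] is_vcat_vself bifold_vfun,
    unfolded theory_obs[OF bifold_theory(1)] theory_obs[OF bifold_theory(2)]]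
  fhom_fix_left[OF theory_vcat[OF bifold_theory(1)] theory_vcat[OF bifold_theory(2)] is_vcat_vself bifold_vfun,
    unfolded theory_obs[OF bifold_theory(1)] theory_obs[OF bifold_theory(2)]]
  fhom_fix_right[OF theory_vcat[OF bifold_theory(1)] theory_vcat[OF bifold_theory(2)] is_vcat_vself bifold_vfun,
    unfolded theory_obs[OF bifold_theory(1)] theory_obs[OF bifold_theory(2)]]

lemma at_algebra:
  "k \<in> \<J> \<Longrightarrow> is_algebra (lth X) (at_right X k)"
  "j \<in> \<J> \<Longrightarrow> is_algebra (rth X) (at_left X j)"
proof -
  note t = theory_vcat[OF bifold_theory(1)] theory_vcat[OF bifold_theory(2)] is_vcat_vself
  have p: "\<forall>j\<in>\<J>. preserves_powers \<J> (tcat (rth X)) vself (at_left X j)"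
    "\<forall>k\<in>\<J>. preserves_powers \<J> (tcat (lth X)) vself (at_right X k)"
    using X[unfolded is_bifold_def] by - (elim conjE, assumption)+
  show "is_algebra (lth X) (at_right X k)" if "k \<in> \<J>"
    using is_vfun_fix_right[OF t bifold_vfun, of k] p that theory_obs[OF bifold_theory(2)] by (simp add: is_algebra_def)
  show "is_algebra (rth X) (at_left X j)" if "j \<in> \<J>"
    using is_vfun_fix_left[OF t bifold_vfun, of j] p that theory_obs[OF bifold_theory(1)] by (simp add: is_algebra_def)
qed

text \<open>Both composites are the action of \<open>bif X\<close> on the pairing
  \<open>f \<odot> g\<close>, by functoriality and the identity laws in each variable.\<close>

lemma at_interchange:
  assumes jk: "j \<in> \<J>" "j' \<in> \<J>" "k \<in> \<J>" "k' \<in> \<J>"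
    and f: "f \<in> El (vhom (tcat (lth X)) j j')" and g: "g \<in> El (vhom (tcat (rth X)) k k')"
    and t: "t \<in> El (fob (bif X) (j, k))"
  shows "app (fob (bif X) (j', k)) (fob (bif X) (j', k')) (fhom (at_left X j') k k' \<bullet> g)
      (app (fob (bif X) (j, k)) (fob (bif X) (j', k)) (fhom (at_right X k) j j' \<bullet> f) t) =
    app (fob (bif X) (j, k')) (fob (bif X) (j', k')) (fhom (at_right X k') j j' \<bullet> f)
      (app (fob (bif X) (j, k)) (fob (bif X) (j, k')) (fhom (at_left X j) k k' \<bullet> g) t)"
proof -
  let ?T = "tcat (lth X)" and ?U = "tcat (rth X)" and ?D = "bif X"
  note [simp] = bifold_theory theory_obs bif_simps(2,3) fix_simps
  \<comment> \<open>Nested application is folded into composition in \<open>vself\<close>, the form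
    to which \<open>bif_simps(5)\<close> applies.\<close>
  have c: "app b c h (app a b h' t) = app a c (cmp vself a b c h h') t"
    if "h \<in> El (ih b c)" "h' \<in> El (ih a b)" "t \<in> El a" for a b c h h' t
    using that by simp
  have "app (fob ?D (j', k)) (fob ?D (j', k')) (fhom ?D (j', k) (j', k') \<bullet> (ide ?T j' \<odot> g))
      (app (fob ?D (j, k)) (fob ?D (j', k)) (fhom ?D (j, k) (j', k) \<bullet> (f \<odot> ide ?U k)) t) =
    app (fob ?D (j, k)) (fob ?D (j', k')) (fhom ?D (j, k) (j', k') \<bullet> (f \<odot> g)) t"
    using assms by (subst c) (simp_all add: bif_simps(5)[of j j' j' k k k' f "ide ?U k" "ide ?T j'" g] del: app_vcmp_vself)
  moreover have "app (fob ?D (j, k')) (fob ?D (j', k')) (fhom ?D (j, k') (j', k') \<bullet> (f \<odot> ide ?U k'))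
      (app (fob ?D (j, k)) (fob ?D (j, k')) (fhom ?D (j, k) (j, k') \<bullet> (ide ?T j \<odot> g)) t) =
    app (fob ?D (j, k)) (fob ?D (j', k')) (fhom ?D (j, k) (j', k') \<bullet> (f \<odot> g)) t"
    using assms by (subst c) (simp_all add: bif_simps(5)[of j j j' k k' k' "ide ?T j" g f "ide ?U k'"] del: app_vcmp_vself)
  ultimately show ?thesis using assms by simp
qed

lemma fob_curry: "k \<in> \<J> \<Longrightarrow> fob (curry_right X) k = at_right X k" "j \<in> \<J> \<Longrightarrow> fob (curry_left X) j = at_left X j"
  by (simp_all add: curry_right_def curry_left_def)

lemma transposes_curry: "transposes (lth X) (rth X) (curry_right X) (curry_left X)"
proof -
  note t = bifold_theory
  have r1: "is_vfun (tcat (rth X)) (Alg (lth X)) (curry_right X)"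
    by (rule transpose_vfun(1)[where T = "lth X" and U = "rth X" and L = "\<lambda>i. at_left X i" and R = "\<lambda>i. at_right X i"])
      (simp_all add: t at_algebra fix_simps(1,2) at_interchange curry_right_def)
  have r2: "proj (tcat (lth X)) (at_right X k) (at_right X k') j \<cdot> fhom (curry_right X) k k' = fhom (at_left X j) k k'"
    if "j \<in> \<J>" "k \<in> \<J>" "k' \<in> \<J>" for j k k'
    by (rule transpose_vfun(2)[where T = "lth X" and U = "rth X" and L = "\<lambda>i. at_left X i" and R = "\<lambda>i. at_right X i"])
      (use that in \<open>simp_all add: t at_algebra fix_simps(1,2) at_interchange curry_right_def\<close>)
  have l1: "is_vfun (tcat (lth X)) (Alg (rth X)) (curry_left X)"
    by (rule transpose_vfun(1)[where T = "rth X" and U = "lth X" and L = "\<lambda>i. at_right X i" and R = "\<lambda>i. at_left X i"])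
      (simp_all add: t at_algebra fix_simps(1,2) at_interchange curry_left_def)
  have l2: "proj (tcat (rth X)) (at_left X k) (at_left X k') j \<cdot> fhom (curry_left X) k k' = fhom (at_right X j) k k'"
    if "j \<in> \<J>" "k \<in> \<J>" "k' \<in> \<J>" for j k k'
    by (rule transpose_vfun(2)[where T = "rth X" and U = "lth X" and L = "\<lambda>i. at_right X i" and R = "\<lambda>i. at_left X i"])
      (use that in \<open>simp_all add: t at_algebra fix_simps(1,2) at_interchange curry_left_def\<close>)
  show ?thesis
    unfolding transposes_def
    using t r1 r2 l1 l2 by (auto simp: fix_simps(1,2) fob_curry)
qed

abbreviation "dual_left A \<equiv> dual_alg (lth X) (rth X) (curry_right X) A"
abbreviation "dual_right B \<equiv> dual_alg (rth X) (lth X) (curry_left X) B"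

lemma fob_Hom: "is_algebra (lth X) A \<Longrightarrow> fob (Hom_left X) A = dual_left A"
  "is_algebra (rth X) B \<Longrightarrow> fob (Hom_right X) B = dual_right B"
  by (simp_all add: Hom_left_def Hom_right_def fob_dual_fun[OF transposes_curry]
      fob_dual_fun[OF transposes_sym[OF transposes_curry]])

lemma is_vfun_Hom: "is_vfun (vop (Alg (lth X))) (Alg (rth X)) (Hom_left X)"
  "is_vfun (Alg (rth X)) (vop (Alg (lth X))) (Hom_right X)"
  using is_vfun_dual_fun[OF transposes_curry]
    is_vfun_fop'[OF is_vfun_dual_fun[OF transposes_sym[OF transposes_curry]]] bifold_theory
  by (simp_all add: Hom_left_def Hom_right_def is_vcat_Alg)

context
  fixes A B
  assumes A: "is_algebra (lth X) A" and B: "is_algebra (rth X) B"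
begin

lemma can_typing:
  assumes j: "j \<in> \<J>" and k: "k \<in> \<J>"
  shows "can_left X B A j k \<in> hom (vhom (Alg (lth X)) A (dual_right B)) (ih (fob A j \<otimes> fob B k) (fob (bif X) (j, k)))"
    and "can_right X B A j k \<in> hom (vhom (Alg (rth X)) B (dual_left A)) (ih (fob A j \<otimes> fob B k) (fob (bif X) (j, k)))"
    and "\<alpha> \<in> El (vhom (Alg (lth X)) A (dual_right B)) \<Longrightarrow> t \<in> El (fob A j) \<Longrightarrow> y \<in> El (fob B k) \<Longrightarrow>
      app (fob A j \<otimes> fob B k) (fob (bif X) (j, k)) (can_left X B A j k \<bullet> \<alpha>) (t \<odot> y) =
      comp_at (rth X) B (fob (curry_left X) j) k (comp_at (lth X) A (dual_right B) j \<alpha> t) y"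
    and "\<beta> \<in> El (vhom (Alg (rth X)) B (dual_left A)) \<Longrightarrow> t \<in> El (fob A j) \<Longrightarrow> y \<in> El (fob B k) \<Longrightarrow>
      app (fob A j \<otimes> fob B k) (fob (bif X) (j, k)) (can_right X B A j k \<bullet> \<beta>) (t \<odot> y) =
      comp_at (lth X) A (fob (curry_right X) k) j (comp_at (rth X) B (dual_left A) k \<beta> y) t"
proof -
  note [simp] = bifold_theory A B j k fob_curry fix_simps(1,2) at_algebra fob_Hom
    is_algebra_dual_alg[OF transposes_curry A] is_algebra_dual_alg[OF transposes_sym[OF transposes_curry] B]
    fob_dual_alg[OF transposes_curry A] fob_dual_alg[OF transposes_sym[OF transposes_curry] B]
  show "can_left X B A j k \<in> hom (vhom (Alg (lth X)) A (dual_right B)) (ih (fob A j \<otimes> fob B k) (fob (bif X) (j, k)))"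
    by (simp add: can_left_def Let_def)
  show "can_right X B A j k \<in> hom (vhom (Alg (rth X)) B (dual_left A)) (ih (fob A j \<otimes> fob B k) (fob (bif X) (j, k)))"
    by (simp add: can_right_def Let_def)
  show "app (fob A j \<otimes> fob B k) (fob (bif X) (j, k)) (can_left X B A j k \<bullet> \<alpha>) (t \<odot> y) =
      comp_at (rth X) B (fob (curry_left X) j) k (comp_at (lth X) A (dual_right B) j \<alpha> t) y"
    if "\<alpha> \<in> El (vhom (Alg (lth X)) A (dual_right B))" "t \<in> El (fob A j)" "y \<in> El (fob B k)"
    using that by (simp add: can_left_def Let_def)
  show "app (fob A j \<otimes> fob B k) (fob (bif X) (j, k)) (can_right X B A j k \<bullet> \<beta>) (t \<odot> y) =
      comp_at (lth X) A (fob (curry_right X) k) j (comp_at (rth X) B (dual_left A) k \<beta> y) t"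
    if "\<beta> \<in> El (vhom (Alg (rth X)) B (dual_left A))" "t \<in> El (fob A j)" "y \<in> El (fob B k)"
    using that by (simp add: can_right_def Let_def)
qed

text \<open>An arrow into \<open>[Aj \<otimes> Bk, D(j,k)]\<close> is determined by its values on
  pairings \<open>t \<odot> y\<close>, and there the canonical arrows give the two sides of the law.
  So the description in \<open>dual_iso\<close> picks out the dualization.\<close>

lemma can_iff_dualization:
  "h \<in> hom (vhom (Alg (lth X)) A (fob (Hom_right X) B)) (vhom (Alg (rth X)) B (fob (Hom_left X) A)) \<and>
     (\<forall>j\<in>\<J>. \<forall>k\<in>\<J>. can_right X B A j k \<cdot> h = can_left X B A j k) \<longleftrightarrow>
   is_dualization (lth X) (rth X) (curry_right X) (curry_left X) A B h"
proof (intro iffI conjI ballI)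
  note [simp] = can_typing
  assume "h \<in> hom (vhom (Alg (lth X)) A (fob (Hom_right X) B)) (vhom (Alg (rth X)) B (fob (Hom_left X) A)) \<and>
     (\<forall>j\<in>\<J>. \<forall>k\<in>\<J>. can_right X B A j k \<cdot> h = can_left X B A j k)"
  then have h: "vdom V h = vhom (Alg (lth X)) A (dual_right B)" "vcod V h = vhom (Alg (rth X)) B (dual_left A)"
    and c: "\<And>j k. j \<in> \<J> \<Longrightarrow> k \<in> \<J> \<Longrightarrow> can_right X B A j k \<cdot> h = can_left X B A j k"
    using A B by (auto simp: fob_Hom)
  show "is_dualization (lth X) (rth X) (curry_right X) (curry_left X) A B h"
    unfolding is_dualization_def
  proof (intro conjI ballI)
    fix j k \<alpha> t y
    assume *: "j \<in> \<J>" "k \<in> \<J>" "\<alpha> \<in> El (vhom (Alg (lth X)) A (dual_right B))" "t \<in> El (fob A j)" "y \<in> El (fob B k)"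
    have "app (fob A j \<otimes> fob B k) (fob (bif X) (j, k)) ((can_right X B A j k \<cdot> h) \<bullet> \<alpha>) (t \<odot> y) =
      app (fob A j \<otimes> fob B k) (fob (bif X) (j, k)) (can_left X B A j k \<bullet> \<alpha>) (t \<odot> y)"
      using * by (simp only: c)
    moreover have "(can_right X B A j k \<cdot> h) \<bullet> \<alpha> = can_right X B A j k \<bullet> h \<bullet> \<alpha>"
      using * h can_typing(2)[of j k] by simp
    ultimately show "comp_at (lth X) A (fob (curry_right X) k) j (comp_at (rth X) B (dual_left A) k (h \<bullet> \<alpha>) y) t =
        comp_at (rth X) B (fob (curry_left X) j) k (comp_at (lth X) A (dual_right B) j \<alpha> t) y"
      using * h can_typing(3,4)[of j k] by simp
  qed (use h in simp)
next
  assume h: "is_dualization (lth X) (rth X) (curry_right X) (curry_left X) A B h"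
  then have ty: "h \<in> hom (vhom (Alg (lth X)) A (dual_right B)) (vhom (Alg (rth X)) B (dual_left A))"
    by (simp only: is_dualization_def)
  then show "h \<in> hom (vhom (Alg (lth X)) A (fob (Hom_right X) B)) (vhom (Alg (rth X)) B (fob (Hom_left X) A))"
    using A B by (simp add: fob_Hom)
  fix j k assume jk: "j \<in> \<J>" "k \<in> \<J>"
  note c = can_typing[OF jk]
  show "can_right X B A j k \<cdot> h = can_left X B A j k"
  proof (rule act_ih_pair_eqI[of "vhom (Alg (lth X)) A (dual_right B)" "fob A j" "fob B k" "fob (bif X) (j, k)"])
    fix \<alpha> t y assume *: "\<alpha> \<in> El (vhom (Alg (lth X)) A (dual_right B))" "t \<in> El (fob A j)" "y \<in> El (fob B k)"
    have "comp_at (lth X) A (fob (curry_right X) k) j (comp_at (rth X) B (dual_left A) k (h \<bullet> \<alpha>) y) t =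
        comp_at (rth X) B (fob (curry_left X) j) k (comp_at (lth X) A (dual_right B) j \<alpha> t) y"
      using h * jk unfolding is_dualization_def by blast
    then show "app (fob A j \<otimes> fob B k) (fob (bif X) (j, k)) ((can_right X B A j k \<cdot> h) \<bullet> \<alpha>) (t \<odot> y) =
      app (fob A j \<otimes> fob B k) (fob (bif X) (j, k)) (can_left X B A j k \<bullet> \<alpha>) (t \<odot> y)"
      using * ty c by simp
  qed (use c ty in simp_all)
qed

lemma is_dualization_dual_iso:
  "is_dualization (lth X) (rth X) (curry_right X) (curry_left X) A B (dual_iso X B A)"
proof -
  have "\<exists>!h. is_dualization (lth X) (rth X) (curry_right X) (curry_left X) A B h"
    using ex_is_dualization[OF transposes_curry A B] is_dualization_unique[OF transposes_curry A B] by blast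
  from theI'[OF this]
  have "is_dualization (lth X) (rth X) (curry_right X) (curry_left X) A B
    (THE h. is_dualization (lth X) (rth X) (curry_right X) (curry_left X) A B h)" .
  moreover have "dual_iso X B A = (THE h. h \<in> hom (vhom (Alg (lth X)) A (fob (Hom_right X) B))
      (vhom (Alg (rth X)) B (fob (Hom_left X) A)) \<and>
     (\<forall>j\<in>\<J>. \<forall>k\<in>\<J>. can_right X B A j k \<cdot> h = can_left X B A j k))"
    using A B by (simp add: dual_iso_def)
  ultimately show ?thesis by (simp only: can_iff_dualization)
qed

end

end

section \<open>The dualization adjunction\<close>

lemma comp_at_dual_fun:
  assumes TU: "transposes T U E E'" and A: "is_algebra T A" and A': "is_algebra T A'" and k: "k \<in> \<J>"
    and g: "g \<in> El (vhom (Alg T) A' A)" and \<beta>: "\<beta> \<in> El (vhom (Alg T) A (fob E k))"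
  shows "comp_at U (dual_alg T U E A) (dual_alg T U E A') k (fhom (dual_fun T U E) A A' \<bullet> g) \<beta> =
    cmp (Alg T) A' A (fob E k) \<beta> g"
  using app_dual_fun[OF TU A A' k g \<beta>] k by (simp add: fob_dual_alg[OF TU A] fob_dual_alg[OF TU A'])

context
  fixes X
  assumes X: "is_bifold X"
begin

lemma dual_iso_law:
  assumes "is_algebra (lth X) A" "is_algebra (rth X) B" "j \<in> \<J>" "k \<in> \<J>"
    and "\<alpha> \<in> El (vhom (Alg (lth X)) A (dual_right X B))" "t \<in> El (fob A j)" "y \<in> El (fob B k)"
  shows "comp_at (lth X) A (fob (curry_right X) k) j (comp_at (rth X) B (dual_left X A) k (dual_iso X B A \<bullet> \<alpha>) y) t =
    comp_at (rth X) B (fob (curry_left X) j) k (comp_at (lth X) A (dual_right X B) j \<alpha> t) y"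
  using is_dualization_dual_iso[OF X assms(1,2)] assms unfolding is_dualization_def by blast

lemma dual_iso_typing:
  assumes "is_algebra (lth X) A" "is_algebra (rth X) B"
  shows "vdom V (dual_iso X B A) = vhom (Alg (lth X)) A (dual_right X B)"
    "vcod V (dual_iso X B A) = vhom (Alg (rth X)) B (dual_left X A)"
  using is_dualization_dual_iso[OF X assms] by (simp_all add: is_dualization_def)

text \<open>Both naturality conditions are tested on double components. There
  \<open>dual_iso\<close> merely exchanges the order of the arguments \<open>t\<close> and
  \<open>y\<close>, so it is compatible with whatever acts on one of them.\<close>

lemma is_vadj_dualization:
  "is_vadj (Alg (rth X)) (vop (Alg (lth X))) (Hom_right X) (Hom_left X) (dual_iso X)"
proof -
  let ?T = "lth X" and ?U = "rth X" and ?E = "curry_right X" and ?E' = "curry_left X"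
  let ?L = "dual_left X" and ?R = "dual_right X"
  note TU = transposes_curry[OF X] and UT = transposes_sym[OF transposes_curry[OF X]]
  note al = is_algebra_dual_alg[OF TU] is_algebra_dual_alg[OF UT] transposes_algebra[OF TU]
  note t = bifold_theory[OF X]
  note [simp] = t al is_vcat_Alg[OF t(1)] is_vcat_Alg[OF t(2)] fob_Hom[OF X] dual_iso_typing
  note f = is_vfun_Hom[OF X]
  have "fhom (Hom_left X) = fhom (dual_fun ?T ?U ?E)" by (simp add: Hom_left_def)
  note G = this vdom_dual_fun[OF TU] vcod_dual_fun[OF TU]
  have "fhom (Hom_right X) B B' = fhom (dual_fun ?U ?T ?E') B' B" if "is_algebra ?U B" "is_algebra ?U B'" for B B'
    using that by (simp add: Hom_right_def)
  note F = this vdom_dual_fun[OF UT] vcod_dual_fun[OF UT]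
  show ?thesis
    unfolding is_vadj_def
  proof (intro conjI ballI)
    show "is_vfun (Alg ?U) (vop (Alg ?T)) (Hom_right X)" "is_vfun (vop (Alg ?T)) (Alg ?U) (Hom_left X)"
      by (rule f)+
    have "dual_iso X B = undefined" if "\<not> is_algebra ?U B" for B using that by (simp add: dual_iso_def)
    moreover have "dual_iso X B A = undefined" if "is_algebra ?U B" "\<not> is_algebra ?T A" for A B
      using that by (simp add: dual_iso_def)
    ultimately show "dual_iso X \<in> (\<Pi>\<^sub>E b\<in>obs (Alg ?U). \<Pi>\<^sub>E c\<in>obs (vop (Alg ?T)).
        hom (vhom (vop (Alg ?T)) (fob (Hom_right X) b) c) (vhom (Alg ?U) b (fob (Hom_left X) c)))"
      by (auto simp: PiE_iff extensional_def)
    show "is_iso (dual_iso X B A)" if "B \<in> obs (Alg ?U)" "A \<in> obs (vop (Alg ?T))" for A B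
      using is_iso_dualization[OF TU _ _ is_dualization_dual_iso[OF X]] that by simp
  next
    fix B A A' assume "B \<in> obs (Alg ?U)" "A \<in> obs (vop (Alg ?T))" "A' \<in> obs (vop (Alg ?T))"
    then have B [simp]: "is_algebra ?U B" and A [simp]: "is_algebra ?T A" "is_algebra ?T A'" by simp_all
    have "dual_iso X B A' \<bullet> cmp (Alg ?T) A' A (?R B) \<alpha> g =
        cmp (Alg ?U) B (?L A) (?L A') (fhom (dual_fun ?T ?U ?E) A A' \<bullet> g) (dual_iso X B A \<bullet> \<alpha>)"
      if \<alpha>: "\<alpha> \<in> El (vhom (Alg ?T) A (?R B))" and g: "g \<in> El (vhom (Alg ?T) A' A)" for \<alpha> g
    proof (rule dual_alg_double_ext[OF TU A(2) B])
      have Gg: "fhom (dual_fun ?T ?U ?E) A A' \<bullet> g \<in> El (vhom (Alg ?U) (?L A) (?L A'))" using g G by simp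
      have \<theta>: "dual_iso X B A \<bullet> \<alpha> \<in> El (vhom (Alg ?U) B (?L A))" using \<alpha> by simp
      have \<alpha>g: "cmp (Alg ?T) A' A (?R B) \<alpha> g \<in> El (vhom (Alg ?T) A' (?R B))" using \<alpha> g by simp
      show "dual_iso X B A' \<bullet> cmp (Alg ?T) A' A (?R B) \<alpha> g \<in> El (vhom (Alg ?U) B (?L A'))" using \<alpha>g by simp
      show "cmp (Alg ?U) B (?L A) (?L A') (fhom (dual_fun ?T ?U ?E) A A' \<bullet> g) (dual_iso X B A \<bullet> \<alpha>)
         \<in> El (vhom (Alg ?U) B (?L A'))" using Gg \<theta> by simp
      fix j k t y assume j: "j \<in> \<J>" and k: "k \<in> \<J>" and t: "t \<in> El (fob A' j)" and y: "y \<in> El (fob B k)"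
      let ?\<beta> = "comp_at ?U B (?L A) k (dual_iso X B A \<bullet> \<alpha>) y"
      let ?gt = "comp_at ?T A' A j g t"
      have \<beta>: "?\<beta> \<in> El (vhom (Alg ?T) A (fob ?E k))" using \<theta> k y by (simp add: fob_dual_alg[OF TU A(1)])
      have gt: "?gt \<in> El (fob A j)" using g j t by simp
      \<comment> \<open>Both sides equal \<open>(\<alpha>_j (g_j t))_k y\<close>.\<close>
      have "comp_at ?T A' (fob ?E k) j (comp_at ?U B (?L A') k (dual_iso X B A' \<bullet> cmp (Alg ?T) A' A (?R B) \<alpha> g) y) t =
          comp_at ?U B (fob ?E' j) k (comp_at ?T A' (?R B) j (cmp (Alg ?T) A' A (?R B) \<alpha> g) t) y"
        by (rule dual_iso_law) (use j k t y \<alpha>g in simp_all)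
      also have "comp_at ?T A' (?R B) j (cmp (Alg ?T) A' A (?R B) \<alpha> g) t = comp_at ?T A (?R B) j \<alpha> ?gt"
        by (rule comp_at_cmp) (use j t \<alpha> g in simp_all)
      also have "comp_at ?U B (fob ?E' j) k \<dots> y = comp_at ?T A (fob ?E k) j ?\<beta> ?gt"
        by (rule dual_iso_law[symmetric]) (use j k gt y \<alpha> in simp_all)
      also have "\<dots> = comp_at ?T A' (fob ?E k) j (cmp (Alg ?T) A' A (fob ?E k) ?\<beta> g) t"
        by (rule comp_at_cmp[symmetric]) (use j k t \<beta> g in simp_all)
      also have "cmp (Alg ?T) A' A (fob ?E k) ?\<beta> g =
          comp_at ?U (?L A) (?L A') k (fhom (dual_fun ?T ?U ?E) A A' \<bullet> g) ?\<beta>"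
        by (rule comp_at_dual_fun[OF TU A k g \<beta>, symmetric])
      also have "\<dots> = comp_at ?U B (?L A') k
          (cmp (Alg ?U) B (?L A) (?L A') (fhom (dual_fun ?T ?U ?E) A A' \<bullet> g) (dual_iso X B A \<bullet> \<alpha>)) y"
        by (rule comp_at_cmp[symmetric]) (use k y Gg \<theta> in simp_all)
      finally show "comp_at ?T A' (fob ?E k) j (comp_at ?U B (?L A') k (dual_iso X B A' \<bullet> cmp (Alg ?T) A' A (?R B) \<alpha> g) y) t =
        comp_at ?T A' (fob ?E k) j (comp_at ?U B (?L A') k
          (cmp (Alg ?U) B (?L A) (?L A') (fhom (dual_fun ?T ?U ?E) A A' \<bullet> g) (dual_iso X B A \<bullet> \<alpha>)) y) t" .
    qed
    then show "dual_iso X B A' \<cdot> vcmp (vop (Alg ?T)) (fob (Hom_right X) B) A A' =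
       vcmp (Alg ?U) B (fob (Hom_left X) A) (fob (Hom_left X) A') \<cdot> (fhom (Hom_left X) A A' \<boxtimes> dual_iso X B A)"
      by (intro act_eqI_pair[of "vhom (Alg ?T) A' A" "vhom (Alg ?T) A (?R B)"]) (simp_all add: G)
  next
    fix B B' A assume "B \<in> obs (Alg ?U)" "B' \<in> obs (Alg ?U)" "A \<in> obs (vop (Alg ?T))"
    then have B [simp]: "is_algebra ?U B" "is_algebra ?U B'" and A [simp]: "is_algebra ?T A" by simp_all
    have "dual_iso X B' A \<bullet> cmp (Alg ?T) A (?R B) (?R B') (fhom (dual_fun ?U ?T ?E') B B' \<bullet> f) \<alpha> =
        cmp (Alg ?U) B' B (?L A) (dual_iso X B A \<bullet> \<alpha>) f"
      if \<alpha>: "\<alpha> \<in> El (vhom (Alg ?T) A (?R B))" and f: "f \<in> El (vhom (Alg ?U) B' B)" for \<alpha> f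
    proof (rule dual_alg_double_ext[OF TU A B(2)])
      let ?Ff = "fhom (dual_fun ?U ?T ?E') B B' \<bullet> f"
      have Ff: "?Ff \<in> El (vhom (Alg ?T) (?R B) (?R B'))" using f F by simp
      have \<theta>: "dual_iso X B A \<bullet> \<alpha> \<in> El (vhom (Alg ?U) B (?L A))" using \<alpha> by simp
      have Ff\<alpha>: "cmp (Alg ?T) A (?R B) (?R B') ?Ff \<alpha> \<in> El (vhom (Alg ?T) A (?R B'))" using \<alpha> Ff by simp
      show "dual_iso X B' A \<bullet> cmp (Alg ?T) A (?R B) (?R B') ?Ff \<alpha> \<in> El (vhom (Alg ?U) B' (?L A))" using Ff\<alpha> by simp
      show "cmp (Alg ?U) B' B (?L A) (dual_iso X B A \<bullet> \<alpha>) f \<in> El (vhom (Alg ?U) B' (?L A))" using f \<theta> by simp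
      fix j k t y assume j: "j \<in> \<J>" and k: "k \<in> \<J>" and t: "t \<in> El (fob A j)" and y: "y \<in> El (fob B' k)"
      let ?\<gamma> = "comp_at ?T A (?R B) j \<alpha> t"
      let ?fy = "comp_at ?U B' B k f y"
      have \<gamma>: "?\<gamma> \<in> El (vhom (Alg ?U) B (fob ?E' j))" using \<alpha> j t by (simp add: fob_dual_alg[OF UT B(1)])
      have fy: "?fy \<in> El (fob B k)" using f k y by simp
      \<comment> \<open>Both sides equal \<open>(\<alpha>_j t)_k (f_k y)\<close>.\<close>
      have "comp_at ?T A (fob ?E k) j (comp_at ?U B' (?L A) k (dual_iso X B' A \<bullet> cmp (Alg ?T) A (?R B) (?R B') ?Ff \<alpha>) y) t =
          comp_at ?U B' (fob ?E' j) k (comp_at ?T A (?R B') j (cmp (Alg ?T) A (?R B) (?R B') ?Ff \<alpha>) t) y"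
        by (rule dual_iso_law) (use j k t y Ff\<alpha> in simp_all)
      also have "comp_at ?T A (?R B') j (cmp (Alg ?T) A (?R B) (?R B') ?Ff \<alpha>) t = comp_at ?T (?R B) (?R B') j ?Ff ?\<gamma>"
        by (rule comp_at_cmp) (use j t \<alpha> Ff in simp_all)
      also have "\<dots> = cmp (Alg ?U) B' B (fob ?E' j) ?\<gamma> f"
        by (rule comp_at_dual_fun[OF UT B j f \<gamma>])
      also have "comp_at ?U B' (fob ?E' j) k \<dots> y = comp_at ?U B (fob ?E' j) k ?\<gamma> ?fy"
        by (rule comp_at_cmp) (use j k y f \<gamma> in simp_all)
      also have "\<dots> = comp_at ?T A (fob ?E k) j (comp_at ?U B (?L A) k (dual_iso X B A \<bullet> \<alpha>) ?fy) t"
        by (rule dual_iso_law[symmetric]) (use j k t fy \<alpha> in simp_all)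
      also have "comp_at ?U B (?L A) k (dual_iso X B A \<bullet> \<alpha>) ?fy =
          comp_at ?U B' (?L A) k (cmp (Alg ?U) B' B (?L A) (dual_iso X B A \<bullet> \<alpha>) f) y"
        by (rule comp_at_cmp[symmetric]) (use k y f \<theta> in simp_all)
      finally show "comp_at ?T A (fob ?E k) j (comp_at ?U B' (?L A) k (dual_iso X B' A \<bullet> cmp (Alg ?T) A (?R B) (?R B') ?Ff \<alpha>) y) t =
        comp_at ?T A (fob ?E k) j (comp_at ?U B' (?L A) k (cmp (Alg ?U) B' B (?L A) (dual_iso X B A \<bullet> \<alpha>) f) y) t" .
    qed
    then show "dual_iso X B' A \<cdot> vcmp (vop (Alg ?T)) (fob (Hom_right X) B') (fob (Hom_right X) B) A \<cdot>
         (idt (vhom (vop (Alg ?T)) (fob (Hom_right X) B) A) \<boxtimes> fhom (Hom_right X) B' B) =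
       vcmp (Alg ?U) B' B (fob (Hom_left X) A) \<cdot> (dual_iso X B A \<boxtimes> idt (vhom (Alg ?U) B' B))"
      by (intro act_eqI_pair[of "vhom (Alg ?T) A (?R B)" "vhom (Alg ?U) B' B"]) (simp_all add: F)
  qed
qed

lemma is_dual_adj_Dualn: "is_dual_adj (Dualn_ob X)"
  using is_vadj_dualization algebraic_Alg bifold_theory[OF X]
  by (simp add: is_dual_adj_def Dualn_ob_def Alg_over_def)

end

section \<open>The category of bifold algebras\<close>

lemma is_vcat_bcat: "is_bifold X \<Longrightarrow> is_vcat (bcat X)"
  using bifold_theory[of X] by simp

lemma obs_bcat: "is_bifold X \<Longrightarrow> obs (bcat X) = \<J> \<times> \<J>"
  using bifold_theory[of X] by simp

context
  fixes m
  assumes m: "is_bifold_mor m"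
begin

lemma bifold_mor_bifold: "is_bifold (bsrc m)" "is_bifold (btgt m)"
  and bifold_mor_theory: "theory_mor (lth (btgt m)) (lth (bsrc m)) (bml m)"
    "theory_mor (rth (btgt m)) (rth (bsrc m)) (bmr m)"
  and vnat_bnat: "vnat (bcat (btgt m)) vself (brestr (btgt m) (bml m) (bmr m) (bif (bsrc m))) (bif (btgt m)) (bnat m)"
  using m by (simp_all only: is_bifold_mor_def)

lemma is_vfun_bpair: "is_vfun (bcat (btgt m)) (bcat (bsrc m)) (bpair (btgt m) (bml m) (bmr m))"
  unfolding bpair_def
  using is_vfun_ftimes[OF theory_morD(1)[OF bifold_mor_theory(1)] theory_morD(1)[OF bifold_mor_theory(2)]]
    bifold_theory[OF bifold_mor_bifold(1)] bifold_theory[OF bifold_mor_bifold(2)] by simp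

lemma is_vfun_brestr:
  assumes "is_vfun (bcat (bsrc m)) vself D"
  shows "is_vfun (bcat (btgt m)) vself (brestr (btgt m) (bml m) (bmr m) D)"
  unfolding brestr_def
  by (rule is_vfun_fcomp[OF is_vfun_bpair assms])
    (simp_all add: is_vcat_bcat bifold_mor_bifold del: is_vcat_vtimes)

end

lemma bpair_fid: "is_bifold X \<Longrightarrow> bpair X (fid (tcat (lth X))) (fid (tcat (rth X))) = fid (bcat X)"
  using bifold_theory[of X] by (simp add: bpair_def ftimes_fid)

lemma brestr_fid: "is_bifold X \<Longrightarrow> brestr X (fid (tcat (lth X))) (fid (tcat (rth X))) (bif X) = bif X"
  by (simp only: brestr_def bpair_fid fcomp_fid_right[OF bifold_vfun is_vcat_bcat is_vcat_vself])

lemma bifold_id_simps: "bsrc (bifold_id X) = X" "btgt (bifold_id X) = X"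
  "bml (bifold_id X) = fid (tcat (lth X))" "bmr (bifold_id X) = fid (tcat (rth X))"
  "bnat (bifold_id X) = nid (bcat X) vself (bif X)"
  by (simp_all add: bifold_id_def)

lemma is_bifold_mor_id:
  assumes X: "is_bifold X"
  shows "is_bifold_mor (bifold_id X)"
  unfolding is_bifold_mor_def bifold_id_simps brestr_fid[OF X]
  using X theory_mor_fid[OF bifold_theory(1)[OF X]] theory_mor_fid[OF bifold_theory(2)[OF X]]
    vnat_nid[OF bifold_vfun[OF X] is_vcat_bcat[OF X] is_vcat_vself] by simp

lemma bifold_comp_simps:
  "bsrc (bifold_comp n m) = bsrc m" "btgt (bifold_comp n m) = btgt n"
  "bml (bifold_comp n m) = fcomp (tcat (lth (btgt n))) (bml m) (bml n)"
  "bmr (bifold_comp n m) = fcomp (tcat (rth (btgt n))) (bmr m) (bmr n)"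
  by (simp_all add: bifold_comp_def)

context
  fixes m n
  assumes m: "is_bifold_mor m" and n: "is_bifold_mor n" and nm: "bsrc n = btgt m"
begin

lemma brestr_comp:
  assumes D: "is_vfun (bcat (bsrc m)) vself D"
  shows "brestr (btgt n) (fcomp (tcat (lth (btgt n))) (bml m) (bml n)) (fcomp (tcat (rth (btgt n))) (bmr m) (bmr n)) D =
    brestr (btgt n) (bml n) (bmr n) (brestr (btgt m) (bml m) (bmr m) D)"
proof -
  note b = bifold_mor_bifold[OF m] bifold_mor_bifold[OF n]
  note t = bifold_theory[OF b(1)] bifold_theory[OF b(2)] bifold_theory[OF b(4)]
  note mt = bifold_mor_theory[OF m] bifold_mor_theory[OF n, unfolded nm]
  have "bpair (btgt n) (fcomp (tcat (lth (btgt n))) (bml m) (bml n)) (fcomp (tcat (rth (btgt n))) (bmr m) (bmr n)) =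
    fcomp (bcat (btgt n)) (bpair (btgt m) (bml m) (bmr m)) (bpair (btgt n) (bml n) (bmr n))"
    unfolding bpair_def
    by (rule fcomp_ftimes[OF theory_morD(1)[OF mt(3)] theory_morD(1)[OF mt(1)]
          theory_morD(1)[OF mt(4)] theory_morD(1)[OF mt(2)]]) (simp_all add: t)
  moreover have "fcomp (bcat (btgt n)) (fcomp (bcat (btgt m)) D (bpair (btgt m) (bml m) (bmr m))) (bpair (btgt n) (bml n) (bmr n)) =
    fcomp (bcat (btgt n)) D (fcomp (bcat (btgt n)) (bpair (btgt m) (bml m) (bmr m)) (bpair (btgt n) (bml n) (bmr n)))"
    by (rule fcomp_assoc[OF is_vfun_bpair[OF n, unfolded nm] is_vfun_bpair[OF m] D])
      (simp_all add: t)
  ultimately show ?thesis by (simp add: brestr_def)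
qed

lemma vnat_bnat_comp:
  "vnat (bcat (btgt n)) vself
     (brestr (btgt n) (bml n) (bmr n) (brestr (btgt m) (bml m) (bmr m) (bif (bsrc m))))
     (brestr (btgt n) (bml n) (bmr n) (bif (btgt m)))
     (wright (bcat (btgt n)) (bnat m) (bpair (btgt n) (bml n) (bmr n)))"
  unfolding brestr_def[of "btgt n"]
  by (rule vnat_wright[OF vnat_bnat[OF m] is_vfun_bpair[OF n, unfolded nm]
      is_vfun_brestr[OF m bifold_vfun[OF bifold_mor_bifold(1)[OF m]]]
      bifold_vfun[OF bifold_mor_bifold(2)[OF m]]])
    (simp_all add: is_vcat_bcat bifold_mor_bifold[OF m] bifold_mor_bifold[OF n] del: is_vcat_vtimes)

lemma is_bifold_mor_comp: "is_bifold_mor (bifold_comp n m)"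
proof -
  note b = bifold_mor_bifold[OF m] bifold_mor_bifold[OF n]
  note t = bifold_theory[OF b(1)] bifold_theory[OF b(2)] bifold_theory[OF b(4)]
  note mt = bifold_mor_theory[OF m] bifold_mor_theory[OF n, unfolded nm]
  note f = is_vfun_brestr[OF m bifold_vfun[OF b(1)]] bifold_vfun[OF b(2)] bifold_vfun[OF b(4)]
  note r = is_vfun_brestr[OF n, unfolded nm]
  show ?thesis
    unfolding is_bifold_mor_def bifold_comp_simps brestr_comp[OF bifold_vfun[OF b(1)]]
  proof (intro conjI)
    show "theory_mor (lth (btgt n)) (lth (bsrc m)) (fcomp (tcat (lth (btgt n))) (bml m) (bml n))"
      by (rule theory_mor_fcomp[OF t(5,3,1) mt(3,1)])
    show "theory_mor (rth (btgt n)) (rth (bsrc m)) (fcomp (tcat (rth (btgt n))) (bmr m) (bmr n))"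
      by (rule theory_mor_fcomp[OF t(6,4,2) mt(4,2)])
    show "vnat (bcat (btgt n)) vself
      (brestr (btgt n) (bml n) (bmr n) (brestr (btgt m) (bml m) (bmr m) (bif (bsrc m))))
      (bif (btgt n)) (bnat (bifold_comp n m))"
      unfolding bifold_comp_def bifold_mor.simps
      by (rule vnat_ncomp[OF vnat_bnat_comp vnat_bnat[OF n, unfolded nm] r[OF f(1)] r[OF f(2)] f(3)
            is_vcat_bcat[OF b(4)] is_vcat_vself])
  qed (use b in simp_all)
qed

text \<open>Morphisms of theories fix objects, so the reindexed transformation has the same
  components as \<open>bnat m\<close>, and composition in \<open>BAlg\<close> becomes composition of
  components.\<close>

lemma bnat_comp:
  assumes j: "j \<in> \<J>" and k: "k \<in> \<J>"
  shows "bnat (bifold_comp n m) (j, k) \<bullet> one =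
    cmp vself (fob (bif (bsrc m)) (j, k)) (fob (bif (btgt m)) (j, k)) (fob (bif (btgt n)) (j, k))
      (bnat n (j, k) \<bullet> one) (bnat m (j, k) \<bullet> one)"
proof -
  note b = bifold_mor_bifold[OF m] bifold_mor_bifold[OF n]
  note t = bifold_theory[OF b(1)] bifold_theory[OF b(2)] bifold_theory[OF b(4)]
  note mt = bifold_mor_theory[OF m] bifold_mor_theory[OF n, unfolded nm]
  note f = is_vfun_brestr[OF m bifold_vfun[OF b(1)]] bifold_vfun[OF b(2)] bifold_vfun[OF b(4)]
  note r = is_vfun_brestr[OF n, unfolded nm]
  have o: "(j, k) \<in> obs (bcat (btgt n))" using j k by (simp only: obs_bcat[OF b(4)]) simp
  have p: "fob (bpair (btgt n) (bml n) (bmr n)) (j, k) = (j, k)"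
    "fob (bpair (btgt m) (bml m) (bmr m)) (j, k) = (j, k)"
    using j k t fob_theory_mor[OF t(5,3) mt(3)] fob_theory_mor[OF t(6,4) mt(4)]
      fob_theory_mor[OF t(3,1) mt(1)] fob_theory_mor[OF t(4,2) mt(2)]
    by (simp_all add: bpair_def)
  have q: "fob (brestr (btgt n) (bml n) (bmr n) D) (j, k) = fob D (j, k)"
    "fob (brestr (btgt m) (bml m) (bmr m) D) (j, k) = fob D (j, k)" for D
    using p j k t by (simp_all add: brestr_def)
  have w: "wright (bcat (btgt n)) (bnat m) (bpair (btgt n) (bml n) (bmr n)) (j, k) = bnat m (j, k)"
    using o by (simp only: wright_simps p)
  show ?thesis
    unfolding bifold_comp_def bifold_mor.simps
    using ncomp_one[OF vnat_bnat_comp vnat_bnat[OF n, unfolded nm] o refl r[OF f(1)] r[OF f(2)] f(3)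
            is_vcat_bcat[OF b(4)] is_vcat_vself]
    by (simp only: q w)
qed

end

lemma bnat_typing:
  assumes m: "is_bifold_mor m" and j: "j \<in> \<J>" and k: "k \<in> \<J>"
  shows "vdom V (bnat m (j, k)) = \<I>"
    "vcod V (bnat m (j, k)) = ih (fob (bif (bsrc m)) (j, k)) (fob (bif (btgt m)) (j, k))"
proof -
  note b = bifold_mor_bifold[OF m]
  note t = bifold_theory[OF b(1)] bifold_theory[OF b(2)]
  note mt = bifold_mor_theory[OF m]
  have o: "(j, k) \<in> obs (bcat (btgt m))" using j k by (simp only: obs_bcat[OF b(2)]) simp
  have "fob (brestr (btgt m) (bml m) (bmr m) D) (j, k) = fob D (j, k)" for D
    using j k t fob_theory_mor[OF t(3,1) mt(1)] fob_theory_mor[OF t(4,2) mt(2)]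
    by (simp add: bpair_def brestr_def)
  then show "vdom V (bnat m (j, k)) = \<I>"
    "vcod V (bnat m (j, k)) = ih (fob (bif (bsrc m)) (j, k)) (fob (bif (btgt m)) (j, k))"
    using vdom_vnat[OF vnat_bnat[OF m] o] vcod_vnat[OF vnat_bnat[OF m] o] by simp_all
qed

lemma bifold_mor_eqI:
  assumes f: "is_bifold_mor f" and g: "is_bifold_mor g" and "bsrc f = bsrc g" "btgt f = btgt g"
    "bml f = bml g" "bmr f = bmr g"
    and eq: "\<And>j k. j \<in> \<J> \<Longrightarrow> k \<in> \<J> \<Longrightarrow> bnat f (j, k) \<bullet> one = bnat g (j, k) \<bullet> one"
  shows "f = g"
proof (rule bifold_mor.equality)
  show "bnat f = bnat g"
  proof (rule vnat_eqI[OF vnat_bnat[OF f] vnat_bnat[OF g, folded assms(4)]])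
    fix p assume "p \<in> obs (bcat (btgt f))"
    then show "bnat f p \<bullet> one = bnat g p \<bullet> one"
      using eq by (cases p) (simp only: obs_bcat[OF bifold_mor_bifold(2)[OF f]] mem_Times_iff fst_conv snd_conv)
  qed
qed (use assms in simp_all)

text \<open>By \<open>bnat_comp\<close> the laws hold componentwise in the base. The theory parts
  compose contravariantly, so the law for an identity on one side uses that of \<open>fcomp\<close>
  on the other side.\<close>

lemma category_BAlg: "category BAlg"
proof
  fix f g h and a b c d :: "('o, 'm) bifold_data"
  show "f \<in> Arr BAlg \<Longrightarrow> Dom BAlg f \<in> Ob BAlg" "f \<in> Arr BAlg \<Longrightarrow> Cod BAlg f \<in> Ob BAlg"
    using bifold_mor_bifold[of f] by (simp_all add: BAlg_def)
  show "a \<in> Ob BAlg \<Longrightarrow> Idt BAlg a \<in> Homset BAlg a a"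
    by (simp add: BAlg_def Homset_def is_bifold_mor_id bifold_id_simps)
  show "f \<in> Homset BAlg a b \<Longrightarrow> g \<in> Homset BAlg b c \<Longrightarrow> Cmp BAlg g f \<in> Homset BAlg a c"
    by (auto simp: BAlg_def Homset_def is_bifold_mor_comp bifold_comp_simps)
  {
    assume "f \<in> Homset BAlg a b"
    then have f: "is_bifold_mor f" "bsrc f = a" "btgt f = b" by (simp_all add: BAlg_def Homset_def)
    note bi = bifold_mor_bifold[OF f(1), unfolded f]
    note t = bifold_theory[OF bi(1)] bifold_theory[OF bi(2)]
    note mt = bifold_mor_theory[OF f(1), unfolded f]
    have ia: "is_bifold_mor (bifold_id a)" "bsrc f = btgt (bifold_id a)" using is_bifold_mor_id[OF bi(1)] f by (simp_all add: bifold_id_simps)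
    have ib: "is_bifold_mor (bifold_id b)" "bsrc (bifold_id b) = btgt f" using is_bifold_mor_id[OF bi(2)] f by (simp_all add: bifold_id_simps)
    have idn: "nid (bcat X) vself (bif X) (j, k) \<bullet> one = ide vself (fob (bif X) (j, k))"
      if "is_bifold X" "j \<in> \<J>" "k \<in> \<J>" for X j k
      using that by (subst nid_simps) (simp_all only: obs_bcat mem_Times_iff fst_conv snd_conv)
    have "bifold_comp f (bifold_id a) = f"
    proof (rule bifold_mor_eqI[OF is_bifold_mor_comp[OF ia(1) f(1) ia(2)] f(1)])
      fix j k assume jk: "j \<in> \<J>" "k \<in> \<J>"
      show "bnat (bifold_comp f (bifold_id a)) (j, k) \<bullet> one = bnat f (j, k) \<bullet> one"
        unfolding bnat_comp[OF ia(1) f(1) ia(2) jk]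
        using bnat_typing[OF f(1) jk] by (simp add: bifold_id_simps idn[OF bi(1) jk] f)
    qed (simp_all add: bifold_comp_simps bifold_id_simps f fcomp_fid_left[OF theory_morD(1)[OF mt(1)]]
        fcomp_fid_left[OF theory_morD(1)[OF mt(2)]] t)
    then show "Cmp BAlg f (Idt BAlg a) = f" by (simp add: BAlg_def)
    have "bifold_comp (bifold_id b) f = f"
    proof (rule bifold_mor_eqI[OF is_bifold_mor_comp[OF f(1) ib] f(1)])
      fix j k assume jk: "j \<in> \<J>" "k \<in> \<J>"
      show "bnat (bifold_comp (bifold_id b) f) (j, k) \<bullet> one = bnat f (j, k) \<bullet> one"
        unfolding bnat_comp[OF f(1) ib jk]
        using bnat_typing[OF f(1) jk] by (simp add: bifold_id_simps idn[OF bi(2) jk] f)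
    qed (simp_all add: bifold_comp_simps bifold_id_simps f fcomp_fid_right[OF theory_morD(1)[OF mt(1)]]
        fcomp_fid_right[OF theory_morD(1)[OF mt(2)]] t)
    then show "Cmp BAlg (Idt BAlg b) f = f" by (simp add: BAlg_def)
  }
  assume "f \<in> Homset BAlg a b" "g \<in> Homset BAlg b c" "h \<in> Homset BAlg c d"
  then have f: "is_bifold_mor f" "bsrc f = a" "btgt f = b" and g: "is_bifold_mor g" "bsrc g = b" "btgt g = c"
    and h: "is_bifold_mor h" "bsrc h = c" "btgt h = d" by (simp_all add: BAlg_def Homset_def)
  note t = bifold_theory[OF bifold_mor_bifold(1)[OF f(1)], unfolded f] bifold_theory[OF bifold_mor_bifold(2)[OF f(1)], unfolded f]
    bifold_theory[OF bifold_mor_bifold(2)[OF g(1)], unfolded g] bifold_theory[OF bifold_mor_bifold(2)[OF h(1)], unfolded h]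
  have gf: "is_bifold_mor (bifold_comp g f)" "bsrc h = btgt (bifold_comp g f)"
    using is_bifold_mor_comp[OF f(1) g(1)] f g h by (simp_all add: bifold_comp_simps)
  have hg: "is_bifold_mor (bifold_comp h g)" "bsrc (bifold_comp h g) = btgt f"
    using is_bifold_mor_comp[OF g(1) h(1)] f g h by (simp_all add: bifold_comp_simps)
  have "bifold_comp (bifold_comp h g) f = bifold_comp h (bifold_comp g f)"
  proof (rule bifold_mor_eqI[OF is_bifold_mor_comp[OF f(1) hg] is_bifold_mor_comp[OF gf(1) h(1) gf(2)]])
    fix j k assume jk: "j \<in> \<J>" "k \<in> \<J>"
    note n = bnat_typing[OF f(1) jk] bnat_typing[OF g(1) jk] bnat_typing[OF h(1) jk]
    show "bnat (bifold_comp (bifold_comp h g) f) (j, k) \<bullet> one = bnat (bifold_comp h (bifold_comp g f)) (j, k) \<bullet> one"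
      unfolding bnat_comp[OF f(1) hg jk] bnat_comp[OF gf(1) h(1) gf(2) jk]
      using n by (simp add: bnat_comp f g h bifold_comp_simps jk)
  qed (simp_all add: bifold_comp_simps f g h t
      fcomp_assoc[OF theory_morD(1)[OF bifold_mor_theory(1)[OF h(1), unfolded h]]
        theory_morD(1)[OF bifold_mor_theory(1)[OF g(1), unfolded g]] theory_morD(1)[OF bifold_mor_theory(1)[OF f(1), unfolded f]]]
      fcomp_assoc[OF theory_morD(1)[OF bifold_mor_theory(2)[OF h(1), unfolded h]]
        theory_morD(1)[OF bifold_mor_theory(2)[OF g(1), unfolded g]] theory_morD(1)[OF bifold_mor_theory(2)[OF f(1), unfolded f]]])
  then show "Cmp BAlg (Cmp BAlg h g) f = Cmp BAlg h (Cmp BAlg g f)" by (simp add: BAlg_def)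
qed

text \<open>\<open>hom_wedgeI\<close> quantifies over all elements of \<open>x\<close>. For
  \<open>x = \<I>\<close> the components are computed at \<open>one\<close> alone, which suffices
  because arrows out of \<open>\<I> \<otimes> a\<close> are determined by the pairings
  \<open>one \<odot> f\<close>.\<close>

lemma hom_wedgeI_one:
  assumes T: "is_vcat T" and A: "is_vfun T vself A" and B: "is_vfun T vself B"
    and p: "\<And>j. j \<in> obs T \<Longrightarrow> \<pi> j \<in> hom \<I> (ih (fob A j) (fob B j))"
    and "\<And>j k f t. j \<in> obs T \<Longrightarrow> k \<in> obs T \<Longrightarrow> f \<in> El (vhom T j k) \<Longrightarrow> t \<in> El (fob A j) \<Longrightarrow>
      app (fob A k) (fob B k) (\<pi> k \<bullet> one) (app (fob A j) (fob A k) (fhom A j k \<bullet> f) t) =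
      app (fob B j) (fob B k) (fhom B j k \<bullet> f) (app (fob A j) (fob B j) (\<pi> j \<bullet> one) t)"
  shows "hom_wedge T A B \<I> \<pi>"
  unfolding hom_wedge_def
proof (intro conjI ballI)
  note [simp] = T vfun_simps[OF A] vfun_simps[OF B]
  have [simp]: "vdom V (\<pi> j) = \<I>" "vcod V (\<pi> j) = ih (fob A j) (fob B j)" if "j \<in> obs T" for j
    using p that by auto
  fix j k assume jk: "j \<in> obs T" "k \<in> obs T"
  show "vcmp vself (fob A j) (fob A k) (fob B k) \<cdot> (\<pi> k \<boxtimes> fhom A j k) =
       vcmp vself (fob A j) (fob B j) (fob B k) \<cdot> (fhom B j k \<boxtimes> \<pi> j) \<cdot> sy \<I> (vhom T j k)"
  proof (rule act_eqI_one_pair[of "vhom T j k"])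
    fix f assume f: "f \<in> El (vhom T j k)"
    show "(vcmp vself (fob A j) (fob A k) (fob B k) \<cdot> (\<pi> k \<boxtimes> fhom A j k)) \<bullet> (one \<odot> f) =
       (vcmp vself (fob A j) (fob B j) (fob B k) \<cdot> (fhom B j k \<boxtimes> \<pi> j) \<cdot> sy \<I> (vhom T j k)) \<bullet> (one \<odot> f)"
      by (rule ih_ext[of _ "fob A j" "fob B k"]) (use jk f assms(5) in simp_all)
  qed (use jk in simp_all)
qed (use p in auto)

section \<open>The comparison transformation\<close>

context
  fixes m
  assumes m: "is_bifold_mor m"
begin

abbreviation "T1 \<equiv> lth (bsrc m)"
abbreviation "T2 \<equiv> lth (btgt m)"
abbreviation "U1 \<equiv> rth (bsrc m)"
abbreviation "U2 \<equiv> rth (btgt m)"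
abbreviation "D1 \<equiv> bif (bsrc m)"
abbreviation "D2 \<equiv> bif (btgt m)"
abbreviation "pull_l A \<equiv> fcomp (tcat T2) A (bml m)"
abbreviation "pull_r B \<equiv> fcomp (tcat U2) B (bmr m)"
abbreviation "R1 \<equiv> at_right (bsrc m)"
abbreviation "R2 \<equiv> at_right (btgt m)"

lemmas mor_theory = bifold_theory[OF bifold_mor_bifold(1)[OF m]] bifold_theory[OF bifold_mor_bifold(2)[OF m]]
lemmas mor_src = bifold_mor_bifold(1)[OF m]
lemmas mor_tgt = bifold_mor_bifold(2)[OF m]
lemmas mor_l = bifold_mor_theory(1)[OF m]
lemmas mor_r = bifold_mor_theory(2)[OF m]
lemmas mor_transposes = transposes_curry[OF mor_src] transposes_curry[OF mor_tgt]
lemmas fob_mor = fob_theory_mor[OF mor_theory(3,1) mor_l] fob_theory_mor[OF mor_theory(4,2) mor_r]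

lemma mor_typing:
  "j \<in> \<J> \<Longrightarrow> j' \<in> \<J> \<Longrightarrow> vdom V (fhom (bml m) j j') = vhom (tcat T2) j j'"
  "j \<in> \<J> \<Longrightarrow> j' \<in> \<J> \<Longrightarrow> vcod V (fhom (bml m) j j') = vhom (tcat T1) j j'"
  "j \<in> \<J> \<Longrightarrow> fhom (bml m) j j \<bullet> ide (tcat T2) j = ide (tcat T1) j"
  "k \<in> \<J> \<Longrightarrow> k' \<in> \<J> \<Longrightarrow> vdom V (fhom (bmr m) k k') = vhom (tcat U2) k k'"
  "k \<in> \<J> \<Longrightarrow> k' \<in> \<J> \<Longrightarrow> vcod V (fhom (bmr m) k k') = vhom (tcat U1) k k'"
  "k \<in> \<J> \<Longrightarrow> fhom (bmr m) k k \<bullet> ide (tcat U2) k = ide (tcat U1) k"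
  using vfun_simps(2-4)[OF theory_morD(1)[OF mor_l]] vfun_simps(2-4)[OF theory_morD(1)[OF mor_r]]
  by (simp_all add: mor_theory fob_mor)

lemma restr_l_simps:
  "is_algebra T1 A \<Longrightarrow> fob (restr_l m) A = pull_l A"
  "is_algebra U1 B \<Longrightarrow> fob (restr_r m) B = pull_r B"
  by (simp_all add: restr_l_def restr_r_def fob_restr[OF mor_theory(3,1) mor_l] fob_restr[OF mor_theory(4,2) mor_r])

lemmas restr_algebra = is_algebra_fcomp[OF mor_theory(3,1) mor_l] is_algebra_fcomp[OF mor_theory(4,2) mor_r]

lemma fob_mor_fcomp:
  "j \<in> \<J> \<Longrightarrow> fob (pull_l A) j = fob A j"
  "k \<in> \<J> \<Longrightarrow> fob (pull_r B) k = fob B k"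
  by (simp_all add: mor_theory fob_mor)

lemma comp_at_restr_l:
  assumes "is_algebra T1 A" "is_algebra T1 B" "j \<in> \<J>" "\<alpha> \<in> El (vhom (Alg T1) A B)"
  shows "comp_at T2 (pull_l A) (pull_l B) j (fhom (restr_l m) A B \<bullet> \<alpha>) t =
    comp_at T1 A B j \<alpha> t"
  using proj_restr[OF mor_theory(3,1) mor_l assms] assms by (simp add: restr_l_def fob_mor_fcomp del: fcomp_simps)

lemma comp_at_restr_r:
  assumes "is_algebra U1 A" "is_algebra U1 B" "j \<in> \<J>" "\<alpha> \<in> El (vhom (Alg U1) A B)"
  shows "comp_at U2 (pull_r A) (pull_r B) j (fhom (restr_r m) A B \<bullet> \<alpha>) t =
    comp_at U1 A B j \<alpha> t"
  using proj_restr[OF mor_theory(4,2) mor_r assms] assms by (simp add: restr_r_def fob_mor_fcomp del: fcomp_simps)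

lemma restr_typing:
  "is_algebra T1 A \<Longrightarrow> is_algebra T1 B \<Longrightarrow> vdom V (fhom (restr_l m) A B) = vhom (Alg T1) A B"
  "is_algebra T1 A \<Longrightarrow> is_algebra T1 B \<Longrightarrow> vcod V (fhom (restr_l m) A B) =
    vhom (Alg T2) (pull_l A) (pull_l B)"
  "is_algebra U1 C \<Longrightarrow> is_algebra U1 D \<Longrightarrow> vdom V (fhom (restr_r m) C D) = vhom (Alg U1) C D"
  "is_algebra U1 C \<Longrightarrow> is_algebra U1 D \<Longrightarrow> vcod V (fhom (restr_r m) C D) =
    vhom (Alg U2) (pull_r C) (pull_r D)"
  by (simp_all add: restr_l_def restr_r_def vdom_restr[OF mor_theory(3,1) mor_l] vcod_restr[OF mor_theory(3,1) mor_l]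
      vdom_restr[OF mor_theory(4,2) mor_r] vcod_restr[OF mor_theory(4,2) mor_r])

lemma is_vfun_restr_lr: "is_vfun (Alg T1) (Alg T2) (restr_l m)" "is_vfun (Alg U1) (Alg U2) (restr_r m)"
  by (simp_all add: restr_l_def restr_r_def is_vfun_restr[OF mor_theory(3,1) mor_l] is_vfun_restr[OF mor_theory(4,2) mor_r])

text \<open>The naturality square of \<open>bnat m\<close> on pairings \<open>f \<odot> g\<close>.
  As morphisms of theories fix objects, \<open>bnat m (j, k)\<close> starts at
  \<open>D1 (j, k)\<close> itself. Putting an identity for \<open>f\<close> or \<open>g\<close>
  gives naturality in one variable.\<close>

lemma app_bnat_nat:
  assumes jk: "j \<in> \<J>" "j' \<in> \<J>" "k \<in> \<J>" "k' \<in> \<J>"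
    and f: "f \<in> El (vhom (tcat T2) j j')" and g: "g \<in> El (vhom (tcat U2) k k')"
    and t: "t \<in> El (fob D1 (j, k))"
  shows "app (fob D1 (j', k')) (fob D2 (j', k')) (bnat m (j', k') \<bullet> one)
      (app (fob D1 (j, k)) (fob D1 (j', k')) (fhom D1 (j, k) (j', k') \<bullet> ((fhom (bml m) j j' \<bullet> f) \<odot> (fhom (bmr m) k k' \<bullet> g))) t) =
    app (fob D2 (j, k)) (fob D2 (j', k')) (fhom D2 (j, k) (j', k') \<bullet> (f \<odot> g))
      (app (fob D1 (j, k)) (fob D2 (j, k)) (bnat m (j, k) \<bullet> one) t)"
proof -
  note [simp] = mor_theory mor_typing fob_mor bif_simps(2,3)[OF mor_src] bif_simps(2,3)[OF mor_tgt]
    bnat_typing[OF m]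
  let ?B = "brestr (btgt m) (bml m) (bmr m) D1"
  have B1: "fob ?B (j, k) = fob D1 (j, k)" if "j \<in> \<J>" "k \<in> \<J>" for j k
    using that by (simp add: brestr_def bpair_def)
  have B2: "fhom ?B (j, k) (j', k') \<bullet> (f \<odot> g) = fhom D1 (j, k) (j', k') \<bullet> ((fhom (bml m) j j' \<bullet> f) \<odot> (fhom (bmr m) k k' \<bullet> g))"
    using jk f g by (simp add: brestr_def bpair_def)
  have o: "(j, k) \<in> obs (bcat (btgt m))" "(j', k') \<in> obs (bcat (btgt m))" using jk by simp_all
  have fg: "f \<odot> g \<in> El (vhom (bcat (btgt m)) (j, k) (j', k'))" using jk f g by simp
  have "cmp vself (fob ?B (j, k)) (fob ?B (j', k')) (fob D2 (j', k')) (bnat m (j', k') \<bullet> one) (fhom ?B (j, k) (j', k') \<bullet> (f \<odot> g)) =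
    cmp vself (fob ?B (j, k)) (fob D2 (j, k)) (fob D2 (j', k')) (fhom D2 (j, k) (j', k') \<bullet> (f \<odot> g)) (bnat m (j, k) \<bullet> one)"
    by (rule vnat_cmp[OF vnat_bnat[OF m] o fg is_vcat_bcat[OF mor_tgt] is_vcat_vself
          is_vfun_brestr[OF m bifold_vfun[OF mor_src]] bifold_vfun[OF mor_tgt]])
  then have "app (fob D1 (j, k)) (fob D2 (j', k')) (cmp vself (fob D1 (j, k)) (fob D1 (j', k')) (fob D2 (j', k')) (bnat m (j', k') \<bullet> one)
      (fhom D1 (j, k) (j', k') \<bullet> ((fhom (bml m) j j' \<bullet> f) \<odot> (fhom (bmr m) k k' \<bullet> g)))) t =
    app (fob D1 (j, k)) (fob D2 (j', k')) (cmp vself (fob D1 (j, k)) (fob D2 (j, k)) (fob D2 (j', k')) (fhom D2 (j, k) (j', k') \<bullet> (f \<odot> g)) (bnat m (j, k) \<bullet> one)) t"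
    using jk by (simp only: B1 B2)
  then show ?thesis using jk f g t by simp
qed

lemma app_bnat_at_right:
  assumes "j \<in> \<J>" "j' \<in> \<J>" "k \<in> \<J>" "f \<in> El (vhom (tcat T2) j j')" "t \<in> El (fob D1 (j, k))"
  shows "app (fob D1 (j', k)) (fob D2 (j', k)) (bnat m (j', k) \<bullet> one)
      (app (fob D1 (j, k)) (fob D1 (j', k)) (fhom (R1 k) j j' \<bullet> fhom (bml m) j j' \<bullet> f) t) =
    app (fob D2 (j, k)) (fob D2 (j', k)) (fhom (R2 k) j j' \<bullet> f)
      (app (fob D1 (j, k)) (fob D2 (j, k)) (bnat m (j, k) \<bullet> one) t)"
  using app_bnat_nat[of j j' k k f "ide (tcat U2) k" t] assms
  by (simp add: fix_simps[OF mor_src] fix_simps[OF mor_tgt] mor_typing mor_theory)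

lemma app_bnat_at_left:
  assumes "j \<in> \<J>" "k \<in> \<J>" "k' \<in> \<J>" "g \<in> El (vhom (tcat U2) k k')" "t \<in> El (fob D1 (j, k))"
  shows "app (fob D1 (j, k')) (fob D2 (j, k')) (bnat m (j, k') \<bullet> one)
      (app (fob D1 (j, k)) (fob D1 (j, k')) (fhom (at_left (bsrc m) j) k k' \<bullet> fhom (bmr m) k k' \<bullet> g) t) =
    app (fob D2 (j, k)) (fob D2 (j, k')) (fhom (at_left (btgt m) j) k k' \<bullet> g)
      (app (fob D1 (j, k)) (fob D2 (j, k)) (bnat m (j, k) \<bullet> one) t)"
  using app_bnat_nat[of j j k k' "ide (tcat T2) j" g t] assms
  by (simp add: fix_simps[OF mor_src] fix_simps[OF mor_tgt] mor_typing mor_theory)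

lemma bnat_at_simps:
  assumes k: "k \<in> \<J>"
  shows "vdom V (bnat_at m k) = \<I>"
    "vcod V (bnat_at m k) = vhom (Alg T2) (pull_l (R1 k)) (R2 k)"
    "j \<in> \<J> \<Longrightarrow> comp_at T2 (pull_l (R1 k)) (R2 k) j (bnat_at m k \<bullet> one) t =
      app (fob D1 (j, k)) (fob D2 (j, k)) (bnat m (j, k) \<bullet> one) t"
proof -
  let ?P = "pull_l (R1 k)" and ?Q = "R2 k"
  note a = at_algebra(1)[OF mor_src k] at_algebra(1)[OF mor_tgt k]
  have P: "is_algebra T2 ?P" using restr_algebra(1)[OF a(1)] .
  have w: "hom_wedge (tcat T2) ?P ?Q \<I> (\<lambda>j. bnat m (j, k))"
  proof (rule hom_wedgeI_one)
    note [simp] = mor_theory fob_mor fix_simps(1,2)[OF mor_src] fix_simps(1,2)[OF mor_tgt] k mor_typing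
      vdom_fhom[OF algebra_vfun[OF a(1)]] vcod_fhom[OF algebra_vfun[OF a(1)]]
    show "is_vcat (tcat T2)" "is_vfun (tcat T2) vself ?P" "is_vfun (tcat T2) vself ?Q"
      using algebra_vfun[OF P] algebra_vfun[OF a(2)] by simp_all
    show "bnat m (j, k) \<in> hom \<I> (ih (fob ?P j) (fob ?Q j))" if "j \<in> obs (tcat T2)" for j
      using that bnat_typing[OF m, of j k] by simp
    fix j j' f t assume "j \<in> obs (tcat T2)" "j' \<in> obs (tcat T2)" "f \<in> El (vhom (tcat T2) j j')" "t \<in> El (fob ?P j)"
    then show "app (fob ?P j') (fob ?Q j') (bnat m (j', k) \<bullet> one) (app (fob ?P j) (fob ?P j') (fhom ?P j j' \<bullet> f) t) =
      app (fob ?Q j) (fob ?Q j') (fhom ?Q j j' \<bullet> f) (app (fob ?P j) (fob ?Q j) (bnat m (j, k) \<bullet> one) t)"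
      using app_bnat_at_right[of j j' k f t] by simp
  qed
  have e: "bnat_at m k = lift (tcat T2) ?P ?Q \<I> (\<lambda>j. bnat m (j, k))"
    using k a(1) by (simp add: bnat_at_def restr_l_simps fob_mor)
  note l = lift_simps[OF mor_theory(3) P a(2) w, folded e]
  show "vdom V (bnat_at m k) = \<I>" "vcod V (bnat_at m k) = vhom (Alg T2) ?P ?Q" by (rule l)+
  show "comp_at T2 ?P ?Q j (bnat_at m k \<bullet> one) t = app (fob D1 (j, k)) (fob D2 (j, k)) (bnat m (j, k) \<bullet> one) t" if "j \<in> \<J>"
    using that k l(3)[OF that one_El] by (simp add: fob_mor_fcomp fix_simps(1,2)[OF mor_src] fix_simps(1,2)[OF mor_tgt] mor_theory del: fcomp_simps)
qed

context
  fixes A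
  assumes A: "is_algebra T1 A"
begin

text \<open>Restriction along \<open>bml m\<close> leaves components unchanged, and
  \<open>bnat_at m k\<close> has the components of \<open>bnat m\<close>; so the composite just
  applies \<open>bnat m (j, k)\<close> after the component of \<open>\<beta>\<close> at
  \<open>j\<close>.\<close>

lemma phi_comp_simps:
  assumes k: "k \<in> \<J>"
  shows "vdom V (phi_comp m A k) = vhom (Alg T1) A (R1 k)"
    "vcod V (phi_comp m A k) = vhom (Alg T2) (pull_l A) (R2 k)"
    "j \<in> \<J> \<Longrightarrow> \<beta> \<in> El (vhom (Alg T1) A (R1 k)) \<Longrightarrow> t \<in> El (fob A j) \<Longrightarrow>
      comp_at T2 (pull_l A) (R2 k) j (phi_comp m A k \<bullet> \<beta>) t =
      app (fob D1 (j, k)) (fob D2 (j, k)) (bnat m (j, k) \<bullet> one) (comp_at T1 A (R1 k) j \<beta> t)"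
proof -
  let ?A = "pull_l A"
  let ?P = "pull_l (R1 k)" and ?Q = "R2 k"
  note a = at_algebra(1)[OF mor_src k] at_algebra(1)[OF mor_tgt k]
  have al: "is_algebra T2 ?A" "is_algebra T2 ?P" "is_algebra T2 ?Q"
    using restr_algebra(1) a A by auto
  have e: "phi_comp m A k = post (Alg T2) ?A ?P ?Q (bnat_at m k) \<cdot> fhom (restr_l m) A (R1 k)"
    using k a A by (simp add: phi_comp_def Let_def restr_l_simps fob_mor)
  note ty = restr_typing(1,2)[OF A a(1)] bnat_at_simps(1,2)[OF k]
  note [simp] = is_vcat_Alg[OF mor_theory(3)] al ty
  show "vdom V (phi_comp m A k) = vhom (Alg T1) A (R1 k)"
    "vcod V (phi_comp m A k) = vhom (Alg T2) ?A ?Q"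
    by (simp_all add: e post_def)
  assume j: "j \<in> \<J>" and \<beta>: "\<beta> \<in> El (vhom (Alg T1) A (R1 k))" and t: "t \<in> El (fob A j)"
  have r\<beta>: "fhom (restr_l m) A (R1 k) \<bullet> \<beta> \<in> El (vhom (Alg T2) ?A ?P)" using \<beta> by simp
  have "comp_at T2 ?A ?Q j (phi_comp m A k \<bullet> \<beta>) t =
    comp_at T2 ?A ?Q j (cmp (Alg T2) ?A ?P ?Q (bnat_at m k \<bullet> one) (fhom (restr_l m) A (R1 k) \<bullet> \<beta>)) t"
    using \<beta> by (simp add: e post_def del: fcomp_simps)
  also have "\<dots> = comp_at T2 ?P ?Q j (bnat_at m k \<bullet> one) (comp_at T2 ?A ?P j (fhom (restr_l m) A (R1 k) \<bullet> \<beta>) t)"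
    by (rule comp_at_cmp) (use mor_theory j r\<beta> t in \<open>simp_all add: fob_mor_fcomp(1) del: fcomp_simps\<close>)
  also have "\<dots> = app (fob D1 (j, k)) (fob D2 (j, k)) (bnat m (j, k) \<bullet> one) (comp_at T1 A (R1 k) j \<beta> t)"
    by (simp only: bnat_at_simps(3)[OF k j] comp_at_restr_l[OF A a(1) j \<beta>])
  finally show "comp_at T2 ?A ?Q j (phi_comp m A k \<bullet> \<beta>) t =
    app (fob D1 (j, k)) (fob D2 (j, k)) (bnat m (j, k) \<bullet> one) (comp_at T1 A (R1 k) j \<beta> t)" .
qed

lemma fob_phi_source: "k \<in> \<J> \<Longrightarrow> fob (pull_r (dual_left (bsrc m) A)) k = vhom (Alg T1) A (R1 k)"
  and fob_phi_target: "k \<in> \<J> \<Longrightarrow> fob (dual_left (btgt m) (pull_l A)) k =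
    vhom (Alg T2) (pull_l A) (R2 k)"
  by (simp_all add: mor_theory fob_mor fob_dual_alg[OF mor_transposes(1) A]
      fob_dual_alg[OF mor_transposes(2) restr_algebra(1)[OF A]] fob_curry[OF mor_src] fob_curry[OF mor_tgt])

lemma phi_algebras:
  "is_algebra U2 (pull_r (dual_left (bsrc m) A))"
  "is_algebra U2 (dual_left (btgt m) (pull_l A))"
  using restr_algebra(2)[OF is_algebra_dual_alg[OF mor_transposes(1) A]]
    is_algebra_dual_alg[OF mor_transposes(2) restr_algebra(1)[OF A]] by simp_all

text \<open>This makes the family \<open>phi_comp m A k\<close> a homomorphism of
  \<open>U2\<close>-algebras, as required for the lift in \<open>phi\<close>. On components it is
  naturality of \<open>bnat m\<close> in its right variable.\<close>

lemma phi_comp_nat: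
  assumes k: "k \<in> \<J>" and k': "k' \<in> \<J>" and g: "g \<in> El (vhom (tcat U2) k k')"
    and \<beta>: "\<beta> \<in> El (vhom (Alg T1) A (R1 k))"
  shows "phi_comp m A k' \<bullet> cmp (Alg T1) A (R1 k) (R1 k')
      (fhom (curry_right (bsrc m)) k k' \<bullet> fhom (bmr m) k k' \<bullet> g) \<beta> =
    cmp (Alg T2) (pull_l A) (R2 k) (R2 k')
      (fhom (curry_right (btgt m)) k k' \<bullet> g) (phi_comp m A k \<bullet> \<beta>)" (is "_ \<bullet> ?c = ?r")
proof (rule Alg_ext[OF mor_theory(3)])
  let ?A = "pull_l A"
  note E1 = fob_curry[OF mor_src] and E2 = fob_curry[OF mor_tgt]
  note tr = mor_transposes
  have al: "is_algebra T2 ?A" using restr_algebra(1) A by auto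
  note a = at_algebra(1)[OF mor_src k] at_algebra(1)[OF mor_src k'] at_algebra(1)[OF mor_tgt k] at_algebra(1)[OF mor_tgt k']
  have g': "fhom (bmr m) k k' \<bullet> g \<in> El (vhom (tcat U1) k k')" using g k k' by (simp add: mor_typing)
  have h: "fhom (curry_right (bsrc m)) k k' \<bullet> fhom (bmr m) k k' \<bullet> g \<in> El (vhom (Alg T1) (R1 k) (R1 k'))"
    using g' k k' fhom_transpose_typing[OF tr(1), of k k'] E1 by simp
  have h2: "fhom (curry_right (btgt m)) k k' \<bullet> g \<in> El (vhom (Alg T2) (R2 k) (R2 k'))"
    using g k k' fhom_transpose_typing[OF tr(2), of k k'] E2 by simp
  note [simp] = is_vcat_Alg[OF mor_theory(1)] is_vcat_Alg[OF mor_theory(3)] al A a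
  have c: "?c \<in> El (vhom (Alg T1) A (R1 k'))" using h \<beta> by simp
  have p: "phi_comp m A k \<bullet> \<beta> \<in> El (vhom (Alg T2) ?A (R2 k))"
    using \<beta> phi_comp_simps[OF k] by simp
  show "is_algebra T2 ?A" "is_algebra T2 (R2 k')" by simp_all
  show "phi_comp m A k' \<bullet> ?c \<in> El (vhom (Alg T2) ?A (R2 k'))" using c phi_comp_simps[OF k'] by simp
  show "?r \<in> El (vhom (Alg T2) ?A (R2 k'))" using h2 p by simp
  fix j t assume j: "j \<in> \<J>" and t': "t \<in> El (fob ?A j)"
  then have t: "t \<in> El (fob A j)" using j by (simp add: fob_mor_fcomp(1) del: fcomp_simps)
  let ?s = "comp_at T1 A (R1 k) j \<beta> t"
  note fb = fix_simps(1,2)[OF mor_src] fix_simps(1,2)[OF mor_tgt]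
  have s: "?s \<in> El (fob D1 (j, k))" using \<beta> j t k by (simp add: mor_theory fb)
  have c1: "comp_at T1 A (R1 k') j ?c t =
      app (fob D1 (j, k)) (fob D1 (j, k')) (fhom (at_left (bsrc m) j) k k' \<bullet> fhom (bmr m) k k' \<bullet> g) ?s"
    using comp_at_transpose_cmp[OF tr(1) A k k' j g', of \<beta> t] \<beta> t j k k' E1 by (simp add: fb)
  have c2: "comp_at T2 ?A (R2 k') j ?r t =
      app (fob D2 (j, k)) (fob D2 (j, k')) (fhom (at_left (btgt m) j) k k' \<bullet> g)
        (comp_at T2 ?A (R2 k) j (phi_comp m A k \<bullet> \<beta>) t)"
    using comp_at_transpose_cmp[OF tr(2) al k k' j g, of "phi_comp m A k \<bullet> \<beta>" t] p t' j k k' E2 by (simp add: fb)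
  show "comp_at T2 ?A (R2 k') j (phi_comp m A k' \<bullet> ?c) t = comp_at T2 ?A (R2 k') j ?r t"
    unfolding phi_comp_simps(3)[OF k' j c t] c1 c2 phi_comp_simps(3)[OF k j \<beta> t]
    by (rule app_bnat_at_left[OF j k k' g s])
qed

lemma phi_simps:
  shows "vdom V (phi m A) = \<I>"
    "vcod V (phi m A) = vhom (Alg U2) (pull_r (dual_left (bsrc m) A))
      (dual_left (btgt m) (pull_l A))"
    "k \<in> \<J> \<Longrightarrow> \<beta> \<in> El (vhom (Alg T1) A (R1 k)) \<Longrightarrow>
      comp_at U2 (pull_r (dual_left (bsrc m) A))
        (dual_left (btgt m) (pull_l A)) k (phi m A \<bullet> one) \<beta> = phi_comp m A k \<bullet> \<beta>"
proof -
  let ?A = "pull_l A"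
  let ?S = "pull_r (dual_left (bsrc m) A)" and ?R = "dual_left (btgt m) ?A"
  let ?n = "\<lambda>k. name (fob ?S k) (fob ?R k) (phi_comp m A k)"
  note al = phi_algebras restr_algebra(1)[OF A]
  note fb = fob_phi_source fob_phi_target
  have w: "hom_wedge (tcat U2) ?S ?R \<I> ?n"
  proof (rule hom_wedgeI_one)
    show "is_vcat (tcat U2)" "is_vfun (tcat U2) vself ?S" "is_vfun (tcat U2) vself ?R"
      using algebra_vfun al mor_theory by auto
    show "?n k \<in> hom \<I> (ih (fob ?S k) (fob ?R k))" if "k \<in> obs (tcat U2)" for k
      using that phi_comp_simps[of k] by (simp add: fb mor_theory del: fcomp_simps)
    fix k k' g \<beta>
    assume "k \<in> obs (tcat U2)" "k' \<in> obs (tcat U2)" and g: "g \<in> El (vhom (tcat U2) k k')" and "\<beta> \<in> El (fob ?S k)"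
    then have k: "k \<in> \<J>" and k': "k' \<in> \<J>" and \<beta>: "\<beta> \<in> El (vhom (Alg T1) A (R1 k))"
      by (simp_all add: fb mor_theory del: fcomp_simps)
    note a = at_algebra(1)[OF mor_src k] at_algebra(1)[OF mor_src k']
    have g': "fhom (bmr m) k k' \<bullet> g \<in> El (vhom (tcat U1) k k')" using g k k' by (simp add: mor_typing)
    have h: "fhom (curry_right (bsrc m)) k k' \<bullet> fhom (bmr m) k k' \<bullet> g \<in> El (vhom (Alg T1) (R1 k) (R1 k'))"
      using g' k k' fhom_transpose_typing[OF mor_transposes(1), of k k'] fob_curry[OF mor_src] by simp
    let ?c = "cmp (Alg T1) A (R1 k) (R1 k')
      (fhom (curry_right (bsrc m)) k k' \<bullet> fhom (bmr m) k k' \<bullet> g) \<beta>"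
    have c: "?c \<in> El (vhom (Alg T1) A (R1 k'))"
      using h \<beta> a A is_vcat_Alg[OF mor_theory(1)] by simp
    have p: "phi_comp m A k \<bullet> \<beta> \<in> El (vhom (Alg T2) ?A (R2 k))"
      using \<beta> phi_comp_simps[OF k] by simp
    have "fhom ?S k k' \<bullet> g = fhom (dual_left (bsrc m) A) k k' \<bullet> fhom (bmr m) k k' \<bullet> g"
      using k k' g by (simp add: mor_theory fob_mor mor_typing vdom_dual_alg[OF mor_transposes(1) A])
    then have S: "app (fob ?S k) (fob ?S k') (fhom ?S k k' \<bullet> g) \<beta> = ?c"
      using app_dual_alg[OF mor_transposes(1) A k k' g', of \<beta>] \<beta> k k' fob_curry[OF mor_src]
      by (simp add: fb del: fcomp_simps)
    have R: "app (fob ?R k) (fob ?R k') (fhom ?R k k' \<bullet> g) (phi_comp m A k \<bullet> \<beta>) =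
      cmp (Alg T2) ?A (R2 k) (R2 k') (fhom (curry_right (btgt m)) k k' \<bullet> g) (phi_comp m A k \<bullet> \<beta>)"
      using app_dual_alg[OF mor_transposes(2) al(3) k k' g, of "phi_comp m A k \<bullet> \<beta>"] p k k' fob_curry[OF mor_tgt]
      by (simp add: fb del: fcomp_simps)
    have n: "app (fob ?S k) (fob ?R k) (?n k \<bullet> one) \<gamma> = phi_comp m A k \<bullet> \<gamma>"
      if "k \<in> \<J>" "\<gamma> \<in> El (vhom (Alg T1) A (R1 k))" for k \<gamma>
      by (rule app_name) (use that phi_comp_simps[OF that(1)] in \<open>simp_all add: fb del: fcomp_simps\<close>)
    show "app (fob ?S k') (fob ?R k') (?n k' \<bullet> one) (app (fob ?S k) (fob ?S k') (fhom ?S k k' \<bullet> g) \<beta>) =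
      app (fob ?R k) (fob ?R k') (fhom ?R k k' \<bullet> g) (app (fob ?S k) (fob ?R k) (?n k \<bullet> one) \<beta>)"
      unfolding S n[OF k \<beta>] R n[OF k' c] by (rule phi_comp_nat[OF k k' g \<beta>])
  qed
  have e: "phi m A = lift (tcat U2) ?S ?R \<I> ?n"
    using A is_algebra_dual_alg[OF mor_transposes(1) A] al
    by (simp add: phi_def Let_def restr_l_simps fob_Hom[OF mor_src] fob_Hom[OF mor_tgt])
  note l = lift_simps[OF mor_theory(4) al(1,2) w, folded e]
  show "vdom V (phi m A) = \<I>" "vcod V (phi m A) = vhom (Alg U2) ?S ?R" by (rule l)+
  show "comp_at U2 ?S ?R k (phi m A \<bullet> one) \<beta> = phi_comp m A k \<bullet> \<beta>"
    if k: "k \<in> \<J>" and \<beta>: "\<beta> \<in> El (vhom (Alg T1) A (R1 k))"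
    unfolding l(3)[OF k one_El]
    by (rule app_name) (use \<beta> phi_comp_simps[OF k] in \<open>simp_all add: fb k del: fcomp_simps\<close>)
qed

text \<open>By \<open>dual_alg_double_ext\<close> these double components characterise
  \<open>phi m A\<close>; naturality and both functor laws are derived from this formula.\<close>

lemma phi_law:
  assumes "j \<in> \<J>" "k \<in> \<J>" "\<beta> \<in> El (vhom (Alg T1) A (R1 k))" "t \<in> El (fob A j)"
  shows "comp_at T2 (pull_l A) (R2 k) j
      (comp_at U2 (pull_r (dual_left (bsrc m) A))
        (dual_left (btgt m) (pull_l A)) k (phi m A \<bullet> one) \<beta>) t =
    app (fob D1 (j, k)) (fob D2 (j, k)) (bnat m (j, k) \<bullet> one) (comp_at T1 A (R1 k) j \<beta> t)"
  unfolding phi_simps(3)[OF assms(2,3)] by (rule phi_comp_simps(3)[OF assms(2,1,3,4)])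

end

end

lemma over_1cell_restr:
  assumes T: "is_theory T" and U: "is_theory U" and M: "theory_mor T U M"
  shows "over_1cell (Alg_over U) (Alg_over T) (restr T U M, nid (Alg U) vself (eval_unit U))"
  using is_vfun_restr[OF T U M] eval_unit_restr[OF T U M]
    vnat_iso_nid[OF is_vfun_eval_unit[OF U] is_vcat_Alg[OF U] is_vcat_vself]
  by (simp add: over_1cell_def Alg_over_def)

text \<open>For \<open>f : B \<rightarrow> A\<close> the double components of both sides are
  \<open>bnat m (j, k)\<close> applied to \<open>\<beta>_j (f_j t)\<close>: restriction and
  \<open>dual_fun\<close> merely compose with \<open>f\<close>, and \<open>phi_law\<close> adds the
  outer map.\<close>

lemma vnat_phi:
  assumes m: "is_bifold_mor m"
  shows "vnat (vop (Alg (lth (bsrc m)))) (Alg (rth (btgt m)))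
    (fcomp (vop (Alg (lth (bsrc m)))) (restr_r m) (Hom_left (bsrc m)))
    (fcomp (vop (Alg (lth (bsrc m)))) (Hom_left (btgt m)) (fop (Alg (lth (bsrc m))) (restr_l m)))
    (phi m)"
proof -
  let ?T1 = "lth (bsrc m)" and ?T2 = "lth (btgt m)" and ?U1 = "rth (bsrc m)" and ?U2 = "rth (btgt m)"
  let ?L1 = "dual_left (bsrc m)" and ?L2 = "dual_left (btgt m)"
  let ?E1 = "curry_right (bsrc m)" and ?E2 = "curry_right (btgt m)"
  note t = mor_theory[OF m] and tr = mor_transposes[OF m]
  note v = is_vcat_Alg[OF t(1)] is_vcat_Alg[OF t(2)] is_vcat_Alg[OF t(3)] is_vcat_Alg[OF t(4)]
  note H = is_vfun_Hom(1)[OF mor_src[OF m]] is_vfun_Hom(1)[OF mor_tgt[OF m]]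
  note rs = is_vfun_restr_lr[OF m]
  let ?m = "\<lambda>A. fcomp (tcat ?T2) A (bml m)"
  let ?S = "\<lambda>A. fcomp (tcat ?U2) (?L1 A) (bmr m)" and ?R = "\<lambda>A. ?L2 (?m A)"
  let ?F = "fcomp (vop (Alg ?T1)) (restr_r m) (Hom_left (bsrc m))"
  let ?G = "fcomp (vop (Alg ?T1)) (Hom_left (btgt m)) (fop (Alg ?T1) (restr_l m))"
  have F: "fob ?F A = ?S A" and G: "fob ?G A = ?R A" if "is_algebra ?T1 A" for A
    using that is_algebra_dual_alg[OF tr(1) that] restr_algebra(1)[OF m that]
    by (simp_all add: fob_Hom[OF mor_src[OF m]] fob_Hom[OF mor_tgt[OF m]] restr_l_simps[OF m])
  have Ff: "fhom ?F A B \<bullet> f = fhom (restr_r m) (?L1 A) (?L1 B) \<bullet> fhom (dual_fun ?T1 ?U1 ?E1) A B \<bullet> f"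
    and Gf: "fhom ?G A B \<bullet> f = fhom (dual_fun ?T2 ?U2 ?E2) (?m A) (?m B) \<bullet> fhom (restr_l m) B A \<bullet> f"
    if "is_algebra ?T1 A" "is_algebra ?T1 B" "f \<in> El (vhom (Alg ?T1) B A)" for A B f
    using that is_algebra_dual_alg[OF tr(1)] restr_algebra(1)[OF m]
    by (simp_all add: fob_dual_fun[OF tr(1)] fob_dual_fun[OF tr(2)] restr_l_simps[OF m]
      vdom_dual_fun[OF tr(1)] vcod_dual_fun[OF tr(1)] vdom_dual_fun[OF tr(2)] restr_typing[OF m]
      Hom_left_def)
  show ?thesis
  proof (rule vnatI)
    show "is_vcat (vop (Alg ?T1))" "is_vcat (Alg ?U2)" using v by simp_all
    show "is_vfun (vop (Alg ?T1)) (Alg ?U2) ?F" by (rule is_vfun_fcomp[OF H(1) rs(2)]) (use v in simp_all)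
    show "is_vfun (vop (Alg ?T1)) (Alg ?U2) ?G"
      by (rule is_vfun_fcomp[OF is_vfun_fop[OF rs(1) v(1,3)] H(2)]) (use v in simp_all)
    have "phi m A = undefined" if "\<not> is_algebra ?T1 A" for A using that by (simp add: phi_def)
    then show "phi m \<in> (\<Pi>\<^sub>E A\<in>obs (vop (Alg ?T1)). hom \<I> (vhom (Alg ?U2) (fob ?F A) (fob ?G A)))"
      by (auto simp: PiE_iff extensional_def F G phi_simps[OF m] simp del: fcomp_simps)
    fix A B f assume "A \<in> obs (vop (Alg ?T1))" "B \<in> obs (vop (Alg ?T1))" "f \<in> El (vhom (vop (Alg ?T1)) A B)"
    then have A: "is_algebra ?T1 A" and B: "is_algebra ?T1 B" and f: "f \<in> El (vhom (Alg ?T1) B A)" by simp_all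
    note al = is_algebra_dual_alg[OF tr(1) A] is_algebra_dual_alg[OF tr(1) B]
      restr_algebra(1)[OF m A] restr_algebra(1)[OF m B] phi_algebras[OF m A] phi_algebras[OF m B]
    let ?f1 = "fhom (dual_fun ?T1 ?U1 ?E1) A B \<bullet> f" and ?f2 = "fhom (restr_l m) B A \<bullet> f"
    let ?Ff = "fhom (restr_r m) (?L1 A) (?L1 B) \<bullet> ?f1" and ?Gf = "fhom (dual_fun ?T2 ?U2 ?E2) (?m A) (?m B) \<bullet> ?f2"
    let ?pA = "phi m A \<bullet> one" and ?pB = "phi m B \<bullet> one"
    have e: "?f1 \<in> El (vhom (Alg ?U1) (?L1 A) (?L1 B))" "?f2 \<in> El (vhom (Alg ?T2) (?m B) (?m A))"
      using f A B by (simp_all add: vdom_dual_fun[OF tr(1)] vcod_dual_fun[OF tr(1)] restr_typing[OF m])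
    have e': "?Ff \<in> El (vhom (Alg ?U2) (?S A) (?S B))" "?Gf \<in> El (vhom (Alg ?U2) (?R A) (?R B))"
      "?pA \<in> El (vhom (Alg ?U2) (?S A) (?R A))" "?pB \<in> El (vhom (Alg ?U2) (?S B) (?R B))"
      using e al by (simp_all add: vdom_dual_fun[OF tr(2)] vcod_dual_fun[OF tr(2)] restr_typing[OF m]
          phi_simps[OF m A] phi_simps[OF m B])
    note [simp] = t v al
    have "cmp (Alg ?U2) (?S A) (?S B) (?R B) ?pB ?Ff = cmp (Alg ?U2) (?S A) (?R A) (?R B) ?Gf ?pA"
    proof (rule dual_alg_double_ext[OF tr(2) al(4,5)])
      show "cmp (Alg ?U2) (?S A) (?S B) (?R B) ?pB ?Ff \<in> El (vhom (Alg ?U2) (?S A) (?R B))"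
        "cmp (Alg ?U2) (?S A) (?R A) (?R B) ?Gf ?pA \<in> El (vhom (Alg ?U2) (?S A) (?R B))"
        using e' by simp_all
      fix j k t \<beta> assume j: "j \<in> \<J>" and k: "k \<in> \<J>" and t': "t \<in> El (fob (?m B) j)" and \<beta>': "\<beta> \<in> El (fob (?S A) k)"
      have t: "t \<in> El (fob B j)" using t' j by (simp add: fob_mor_fcomp[OF m] del: fcomp_simps)
      have \<beta>: "\<beta> \<in> El (vhom (Alg ?T1) A (at_right (bsrc m) k))"
        using \<beta>' k by (simp add: fob_phi_source[OF m A] del: fcomp_simps)
      note c = fob_curry(1)[OF mor_src[OF m] k] fob_curry(1)[OF mor_tgt[OF m] k]
      note a = at_algebra(1)[OF mor_src[OF m] k] at_algebra(1)[OF mor_tgt[OF m] k]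
      let ?\<beta>f = "cmp (Alg ?T1) B A (at_right (bsrc m) k) \<beta> f" and ?ft = "comp_at ?T1 B A j f t"
      let ?\<beta>2 = "comp_at ?U2 (?S A) (?R A) k ?pA \<beta>"
      let ?b = "\<lambda>s. app (fob (bif (bsrc m)) (j, k)) (fob (bif (btgt m)) (j, k)) (bnat m (j, k) \<bullet> one) s"
      have \<beta>f: "?\<beta>f \<in> El (vhom (Alg ?T1) B (at_right (bsrc m) k))" using \<beta> f A B a by simp
      have ft: "?ft \<in> El (fob A j)" using f t j A B by simp
      have \<beta>2: "?\<beta>2 \<in> El (vhom (Alg ?T2) (?m A) (at_right (btgt m) k))"
        using phi_simps(3)[OF m A k \<beta>] \<beta> phi_comp_simps(1,2)[OF m A k] by simp
      have "comp_at ?U2 (?S A) (?S B) k ?Ff \<beta> = comp_at ?U1 (?L1 A) (?L1 B) k ?f1 \<beta>"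
        by (rule comp_at_restr_r[OF m al(1,2) k e(1)])
      also have "\<dots> = ?\<beta>f"
        using comp_at_dual_fun[OF tr(1) A B k f, of \<beta>] \<beta> by (simp add: c)
      finally have 1: "comp_at ?U2 (?S A) (?S B) k ?Ff \<beta> = ?\<beta>f" .
      have "comp_at ?U2 (?S A) (?R B) k (cmp (Alg ?U2) (?S A) (?S B) (?R B) ?pB ?Ff) \<beta> =
          comp_at ?U2 (?S B) (?R B) k ?pB (comp_at ?U2 (?S A) (?S B) k ?Ff \<beta>)"
        by (rule comp_at_cmp) (use k \<beta>' e' in \<open>simp_all del: fcomp_simps\<close>)
      then have 2: "comp_at ?U2 (?S A) (?R B) k (cmp (Alg ?U2) (?S A) (?S B) (?R B) ?pB ?Ff) \<beta> =
          comp_at ?U2 (?S B) (?R B) k ?pB ?\<beta>f" by (simp only: 1)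
      have l: "comp_at ?T2 (?m B) (at_right (btgt m) k) j
          (comp_at ?U2 (?S A) (?R B) k (cmp (Alg ?U2) (?S A) (?S B) (?R B) ?pB ?Ff) \<beta>) t = ?b (comp_at ?T1 B (at_right (bsrc m) k) j ?\<beta>f t)"
        unfolding 2 by (rule phi_law[OF m B j k \<beta>f t])
      also have "comp_at ?T1 B (at_right (bsrc m) k) j ?\<beta>f t = comp_at ?T1 A (at_right (bsrc m) k) j \<beta> ?ft"
        by (rule comp_at_cmp) (use j t \<beta> f A B a in simp_all)
      finally have lhs: "comp_at ?T2 (?m B) (at_right (btgt m) k) j
          (comp_at ?U2 (?S A) (?R B) k (cmp (Alg ?U2) (?S A) (?S B) (?R B) ?pB ?Ff) \<beta>) t =
          ?b (comp_at ?T1 A (at_right (bsrc m) k) j \<beta> ?ft)" .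
      have "comp_at ?U2 (?S A) (?R B) k (cmp (Alg ?U2) (?S A) (?R A) (?R B) ?Gf ?pA) \<beta> = comp_at ?U2 (?R A) (?R B) k ?Gf ?\<beta>2"
        by (rule comp_at_cmp) (use k \<beta>' e' in \<open>simp_all del: fcomp_simps\<close>)
      also have "\<dots> = cmp (Alg ?T2) (?m B) (?m A) (at_right (btgt m) k) ?\<beta>2 ?f2"
        using comp_at_dual_fun[OF tr(2) al(3,4) k e(2), of ?\<beta>2] \<beta>2 by (simp only: c)
      finally have 3: "comp_at ?U2 (?S A) (?R B) k (cmp (Alg ?U2) (?S A) (?R A) (?R B) ?Gf ?pA) \<beta> =
        cmp (Alg ?T2) (?m B) (?m A) (at_right (btgt m) k) ?\<beta>2 ?f2" .
      have "comp_at ?T2 (?m B) (at_right (btgt m) k) j (cmp (Alg ?T2) (?m B) (?m A) (at_right (btgt m) k) ?\<beta>2 ?f2) t =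
          comp_at ?T2 (?m A) (at_right (btgt m) k) j ?\<beta>2 (comp_at ?T2 (?m B) (?m A) j ?f2 t)"
        by (rule comp_at_cmp) (use j t' \<beta>2 e a in \<open>simp_all del: fcomp_simps\<close>)
      also have "comp_at ?T2 (?m B) (?m A) j ?f2 t = ?ft"
        by (rule comp_at_restr_l[OF m B A j f])
      also have "comp_at ?T2 (?m A) (at_right (btgt m) k) j ?\<beta>2 ?ft = ?b (comp_at ?T1 A (at_right (bsrc m) k) j \<beta> ?ft)"
        by (rule phi_law[OF m A j k \<beta> ft])
      finally show "comp_at ?T2 (?m B) (fob ?E2 k) j
          (comp_at ?U2 (?S A) (?R B) k (cmp (Alg ?U2) (?S A) (?S B) (?R B) ?pB ?Ff) \<beta>) t =
        comp_at ?T2 (?m B) (fob ?E2 k) j (comp_at ?U2 (?S A) (?R B) k (cmp (Alg ?U2) (?S A) (?R A) (?R B) ?Gf ?pA) \<beta>) t"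
        unfolding c 3 lhs by (rule sym)
    qed
    then show "cmp (Alg ?U2) (fob ?F A) (fob ?F B) (fob ?G B) ?pB (fhom ?F A B \<bullet> f) =
      cmp (Alg ?U2) (fob ?F A) (fob ?G A) (fob ?G B) (fhom ?G A B \<bullet> f) ?pA"
      unfolding F[OF A] F[OF B] G[OF A] G[OF B] Ff[OF A B f] Gf[OF A B f] .
  qed
qed

section \<open>Functoriality of dualization\<close>

lemma Dualn_simps:
  "csrc (Dualn_arr m) = Dualn_ob (bsrc m)" "ctgt (Dualn_arr m) = Dualn_ob (btgt m)"
  "cleft (Dualn_arr m) = (restr_l m, nid (Alg (lth (bsrc m))) vself (eval_unit (lth (bsrc m))))"
  "cright (Dualn_arr m) = (restr_r m, nid (Alg (rth (bsrc m))) vself (eval_unit (rth (bsrc m))))"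
  "cphi (Dualn_arr m) = phi m"
  "dleft (Dualn_ob X) = Alg_over (lth X)" "dright (Dualn_ob X) = Alg_over (rth X)"
  "ddelta (Dualn_ob X) = Hom_left X"
  "fst (Alg_over T) = Alg T" "snd (Alg_over T) = eval_unit T"
  by (simp_all add: Dualn_arr_def Dualn_ob_def Alg_over_def)

lemma is_dual_cell_Dualn:
  assumes m: "is_bifold_mor m"
  shows "is_dual_cell (Dualn_arr m)"
  using is_dual_adj_Dualn[OF mor_src[OF m]] is_dual_adj_Dualn[OF mor_tgt[OF m]] vnat_phi[OF m]
    over_1cell_restr[OF mor_theory(3,1)[OF m] mor_l[OF m]]
    over_1cell_restr[OF mor_theory(4,2)[OF m] mor_r[OF m]]
  by (simp add: is_dual_cell_def Dualn_simps restr_l_def restr_r_def)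

lemma Dualn_id:
  assumes X: "is_bifold X"
  shows "Dualn_arr (bifold_id X) = dual_id (Dualn_ob X)"
proof -
  note m = is_bifold_mor_id[OF X]
  note t = bifold_theory[OF X] and tr = transposes_curry[OF X]
  have r: "restr_l (bifold_id X) = fid (Alg (lth X))" "restr_r (bifold_id X) = fid (Alg (rth X))"
    by (simp_all add: restr_l_def restr_r_def bifold_id_simps restr_fid t)
  show ?thesis
  proof (rule dual_cell_eqI[OF is_dual_cell_Dualn[OF m] is_dual_cell_id[OF is_dual_adj_Dualn[OF X]]])
    fix A assume "A \<in> obs (fst (dleft (csrc (Dualn_arr (bifold_id X)))))"
    then have A: "is_algebra (lth X) A" by (simp add: Dualn_simps bifold_id_simps)
    let ?L = "dual_left X A"
    have L: "is_algebra (rth X) ?L" by (rule is_algebra_dual_alg[OF tr A])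
    \<comment> \<open>Restriction along identities fixes each algebra, so source and target of
      \<open>phi (bifold_id X) A\<close> are the same algebra \<open>?L\<close>.\<close>
    have fA: "fcomp (tcat (lth X)) A (fid (tcat (lth X))) = A"
      by (rule fcomp_fid_right[OF algebra_vfun[OF A]]) (simp_all add: t)
    have fL: "fcomp (tcat (rth X)) ?L (fid (tcat (rth X))) = ?L"
      by (rule fcomp_fid_right[OF algebra_vfun[OF L]]) (simp_all add: t)
    note s = bifold_id_simps fA fL
    have p: "phi (bifold_id X) A \<bullet> one \<in> El (vhom (Alg (rth X)) ?L ?L)"
      using phi_simps(1,2)[OF m, of A] A by (simp add: s)
    have i: "ide (Alg (rth X)) ?L \<in> El (vhom (Alg (rth X)) ?L ?L)"
      using L t by (simp add: is_vcat_Alg)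
    have "phi (bifold_id X) A \<bullet> one = ide (Alg (rth X)) ?L"
    proof (rule dual_alg_double_ext[OF tr A L p i])
      fix j k t \<beta> assume j: "j \<in> \<J>" and k: "k \<in> \<J>" and t': "t \<in> El (fob A j)" and \<beta>': "\<beta> \<in> El (fob ?L k)"
      have c: "fob (curry_right X) k = at_right X k" by (rule fob_curry(1)[OF X k])
      have \<beta>: "\<beta> \<in> El (vhom (Alg (lth X)) A (at_right X k))"
        using \<beta>' fob_dual_alg[OF tr A k] by (simp add: c)
      have n: "bnat (bifold_id X) (j, k) \<bullet> one = ide vself (fob (bif X) (j, k))"
        unfolding bifold_id_simps
        by (subst nid_simps) (simp_all only: obs_bcat[OF X] mem_Times_iff fst_conv snd_conv j k)
      have "comp_at (lth X) A (at_right X k) j (comp_at (rth X) ?L ?L k (phi (bifold_id X) A \<bullet> one) \<beta>) t =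
        app (fob (bif X) (j, k)) (fob (bif X) (j, k)) (bnat (bifold_id X) (j, k) \<bullet> one) (comp_at (lth X) A (at_right X k) j \<beta> t)"
        using phi_law[OF m _ j k, of A \<beta> t] A \<beta> t' by (simp only: s)
      also have "\<dots> = comp_at (lth X) A (at_right X k) j \<beta> t"
        unfolding n by (rule app_vid_vself)
          (use \<beta> t' j k t A at_algebra(1)[OF X k] fix_simps(2)[OF X, of j k] in simp)
      finally show "comp_at (lth X) A (fob (curry_right X) k) j (comp_at (rth X) ?L ?L k (phi (bifold_id X) A \<bullet> one) \<beta>) t =
        comp_at (lth X) A (fob (curry_right X) k) j (comp_at (rth X) ?L ?L k (ide (Alg (rth X)) ?L) \<beta>) t"
        unfolding c comp_at_ide[OF t(2) L k \<beta>'] .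
    qed
    then show "cphi (Dualn_arr (bifold_id X)) A \<bullet> one = cphi (dual_id (Dualn_ob X)) A \<bullet> one"
      using A by (simp add: Dualn_simps dual_id_simps fob_Hom[OF X])
  qed (simp_all add: Dualn_simps dual_id_simps bifold_id_simps r over_id_def)
qed

text \<open>The invertible parts are identities because evaluation at \<open>\<I>\<close> commutes
  strictly with restriction, and their composite is again an identity.\<close>

lemma over_comp_restr:
  assumes T: "is_theory T" and U: "is_theory U" and W: "is_theory W"
    and M: "theory_mor T U M" and N: "theory_mor U W N"
  shows "over_comp (Alg_over W) (Alg_over U) (Alg_over T)
      (restr T U M, nid (Alg U) vself (eval_unit U)) (restr U W N, nid (Alg W) vself (eval_unit W)) =
    (restr T W (fcomp (tcat T) N M), nid (Alg W) vself (eval_unit W))"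
proof -
  note o = is_over_Alg[OF W] is_over_Alg[OF U] is_over_Alg[OF T]
  note c = over_1cell_restr[OF U W N] over_1cell_restr[OF T U M]
  show ?thesis
  proof (rule over_1cell_eqI[OF over_1cell_comp[OF o c] over_1cell_restr[OF T W theory_mor_fcomp[OF T U W M N]]])
    show "fst (over_comp (Alg_over W) (Alg_over U) (Alg_over T)
        (restr T U M, nid (Alg U) vself (eval_unit U)) (restr U W N, nid (Alg W) vself (eval_unit W))) =
      fst (restr T W (fcomp (tcat T) N M), nid (Alg W) vself (eval_unit W))"
      by (simp add: over_comp_def Alg_over_def restr_fcomp[OF T U W M N])
    fix A assume A': "A \<in> obs (fst (Alg_over W))"
    then have A: "is_algebra W A" by (simp add: Alg_over_def)
    note al = is_algebra_fcomp[OF U W N A] is_algebra_fcomp[OF T U M is_algebra_fcomp[OF U W N A]]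
    show "snd (over_comp (Alg_over W) (Alg_over U) (Alg_over T)
        (restr T U M, nid (Alg U) vself (eval_unit U)) (restr U W N, nid (Alg W) vself (eval_unit W))) A \<bullet> one =
      snd (restr T W (fcomp (tcat T) N M), nid (Alg W) vself (eval_unit W)) A \<bullet> one"
      unfolding over_comp_one[OF o c A']
      using A al T U W unit_arity
      by (simp add: Alg_over_def fob_restr[OF U W N] fob_restr[OF T U M] eval_unit_simps
          fob_theory_mor[OF U W N] fob_theory_mor[OF T U M])
  qed
qed

text \<open>Both transformations send \<open>\<beta>\<close> to
  \<open>t \<mapsto> h (g (\<beta>_j t))\<close>, where \<open>g\<close> and \<open>h\<close> are
  the components of \<open>m\<close> and \<open>n\<close> at \<open>(j, k)\<close>. The restriction
  along \<open>bmr n\<close> that occurs in the pasting leaves components unchanged.\<close>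

lemma Dualn_comp:
  assumes m: "is_bifold_mor m" and n: "is_bifold_mor n" and nm: "bsrc n = btgt m"
  shows "Dualn_arr (bifold_comp n m) = dual_comp (Dualn_arr n) (Dualn_arr m)"
proof -
  note cm = is_dual_cell_Dualn[OF m] and cn = is_dual_cell_Dualn[OF n]
  have s: "csrc (Dualn_arr n) = ctgt (Dualn_arr m)" by (simp add: Dualn_simps nm)
  note nm' = is_bifold_mor_comp[OF m n nm]
  note t = mor_theory[OF m] mor_theory(3,4)[OF n]
  note ml = mor_l[OF n, unfolded nm] mor_l[OF m] and mr = mor_r[OF n, unfolded nm] mor_r[OF m]
  let ?T1 = "lth (bsrc m)" and ?T2 = "lth (btgt m)" and ?T3 = "lth (btgt n)"
  let ?U1 = "rth (bsrc m)" and ?U2 = "rth (btgt m)" and ?U3 = "rth (btgt n)"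
  show ?thesis
  proof (rule dual_cell_eqI[OF is_dual_cell_Dualn[OF nm'] is_dual_cell_comp[OF cm cn s]])
    show "cleft (Dualn_arr (bifold_comp n m)) = cleft (dual_comp (Dualn_arr n) (Dualn_arr m))"
      using over_comp_restr[OF t(5,3,1) ml]
      by (simp add: dual_comp_simps[OF cm cn s] Dualn_simps restr_l_def bifold_comp_simps nm)
    show "cright (Dualn_arr (bifold_comp n m)) = cright (dual_comp (Dualn_arr n) (Dualn_arr m))"
      using over_comp_restr[OF t(6,4,2) mr]
      by (simp add: dual_comp_simps[OF cm cn s] Dualn_simps restr_r_def bifold_comp_simps nm)
    fix A assume "A \<in> obs (fst (dleft (csrc (Dualn_arr (bifold_comp n m)))))"
    then have A: "is_algebra ?T1 A" by (simp add: Dualn_simps bifold_comp_simps)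
    then have A': "A \<in> obs (fst (dleft (csrc (Dualn_arr m))))" by (simp add: Dualn_simps)
    let ?A2 = "fcomp (tcat ?T2) A (bml m)"
    have A2: "is_algebra ?T2 ?A2" by (rule restr_algebra(1)[OF m A])
    let ?A3 = "fcomp (tcat ?T3) ?A2 (bml n)"
    have A3: "is_algebra ?T3 ?A3" by (rule restr_algebra(1)[OF n, unfolded nm, OF A2])
    let ?L1 = "dual_left (bsrc m) A" and ?L2 = "dual_left (btgt m) ?A2" and ?L3 = "dual_left (btgt n) ?A3"
    note tr = mor_transposes[OF m] mor_transposes(2)[OF n]
    note L = is_algebra_dual_alg[OF tr(1) A] is_algebra_dual_alg[OF tr(2) A2] is_algebra_dual_alg[OF tr(3) A3]
    let ?S2 = "fcomp (tcat ?U2) ?L1 (bmr m)"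
    have S2: "is_algebra ?U2 ?S2" by (rule restr_algebra(2)[OF m L(1)])
    let ?S3 = "fcomp (tcat ?U3) ?S2 (bmr n)" and ?S3' = "fcomp (tcat ?U3) ?L2 (bmr n)"
    have S3: "is_algebra ?U3 ?S3" "is_algebra ?U3 ?S3'"
      by (rule restr_algebra(2)[OF n, unfolded nm, OF S2], rule restr_algebra(2)[OF n, unfolded nm, OF L(2)])
    \<comment> \<open>Reassociation turns the source and target of \<open>phi\<close> for the
      composite into the algebras \<open>?S3\<close> and \<open>?L3\<close> that occur in the
      pasting.\<close>
    have a1: "fcomp (tcat ?T3) A (fcomp (tcat ?T3) (bml m) (bml n)) = ?A3"
      by (rule fcomp_assoc[OF theory_morD(1)[OF ml(1)] theory_morD(1)[OF ml(2)] algebra_vfun[OF A], symmetric])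
        (simp_all add: t)
    have a2: "fcomp (tcat ?U3) ?L1 (fcomp (tcat ?U3) (bmr m) (bmr n)) = ?S3"
      by (rule fcomp_assoc[OF theory_morD(1)[OF mr(1)] theory_morD(1)[OF mr(2)] algebra_vfun[OF L(1)], symmetric])
        (simp_all add: t)
    let ?pm = "phi m A \<bullet> one" and ?pn = "phi n ?A2 \<bullet> one" and ?pnm = "phi (bifold_comp n m) A \<bullet> one"
    let ?rpm = "fhom (restr_r n) ?S2 ?L2 \<bullet> ?pm"
    have pnm: "?pnm \<in> El (vhom (Alg ?U3) ?S3 ?L3)"
      using phi_simps(1,2)[OF nm', of A] A by (simp add: bifold_comp_simps a1 a2 del: fcomp_simps)
    have pm: "?pm \<in> El (vhom (Alg ?U2) ?S2 ?L2)" using phi_simps(1,2)[OF m A] by simp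
    have pn: "?pn \<in> El (vhom (Alg ?U3) ?S3' ?L3)"
      using phi_simps(1,2)[OF n, unfolded nm, OF A2] by simp
    have rpm: "?rpm \<in> El (vhom (Alg ?U3) ?S3 ?S3')"
      using pm restr_typing(3,4)[OF n, unfolded nm, OF S2 L(2)] by simp
    note v = is_vcat_Alg[OF t(6)]
    have "?pnm = cmp (Alg ?U3) ?S3 ?S3' ?L3 ?pn ?rpm"
    proof (rule dual_alg_double_ext[OF tr(3) A3 S3(1) pnm])
      show "cmp (Alg ?U3) ?S3 ?S3' ?L3 ?pn ?rpm \<in> El (vhom (Alg ?U3) ?S3 ?L3)"
        using v S3 L pn rpm by simp
      fix j k t \<beta> assume j: "j \<in> \<J>" and k: "k \<in> \<J>" and t': "t \<in> El (fob ?A3 j)" and \<beta>': "\<beta> \<in> El (fob ?S3 k)"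
      have t2: "t \<in> El (fob ?A2 j)" using t' j fob_mor_fcomp(1)[OF n, unfolded nm, OF j, of ?A2] by (simp only:)
      then have t1: "t \<in> El (fob A j)" using fob_mor_fcomp(1)[OF m j, of A] by (simp only:)
      have "\<beta> \<in> El (fob ?S2 k)" using \<beta>' fob_mor_fcomp(2)[OF n, unfolded nm, OF k, of ?S2] by (simp only:)
      then have \<beta>: "\<beta> \<in> El (vhom (Alg ?T1) A (at_right (bsrc m) k))"
        by (simp only: fob_phi_source[OF m A k])
      let ?\<beta>2 = "comp_at ?U2 ?S2 ?L2 k ?pm \<beta>"
      have \<beta>2: "?\<beta>2 \<in> El (vhom (Alg ?T2) ?A2 (at_right (btgt m) k))"
        using phi_simps(3)[OF m A k \<beta>] \<beta> phi_comp_simps(1,2)[OF m A k] by simp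
      let ?d1 = "fob (bif (bsrc m)) (j, k)" and ?d2 = "fob (bif (btgt m)) (j, k)" and ?d3 = "fob (bif (btgt n)) (j, k)"
      let ?s = "comp_at ?T1 A (at_right (bsrc m) k) j \<beta> t"
      have se: "?s \<in> El ?d1"
        using \<beta> t1 j k A t at_algebra(1)[OF mor_src[OF m] k] fix_simps(2)[OF mor_src[OF m], of j k] by simp
      note bt = bnat_typing[OF m j k] bnat_typing[OF n j k, unfolded nm]
      have c: "fob (curry_right (btgt n)) k = at_right (btgt n) k" by (rule fob_curry(1)[OF mor_tgt[OF n] k])
      have "comp_at ?T3 ?A3 (at_right (btgt n) k) j (comp_at ?U3 ?S3 ?L3 k ?pnm \<beta>) t =
        app ?d1 ?d3 (bnat (bifold_comp n m) (j, k) \<bullet> one) ?s"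
        using phi_law[OF nm' _ j k, of A \<beta> t] A \<beta> t1 by (simp only: bifold_comp_simps a1 a2)
      also have "\<dots> = app ?d2 ?d3 (bnat n (j, k) \<bullet> one) (app ?d1 ?d2 (bnat m (j, k) \<bullet> one) ?s)"
        unfolding bnat_comp[OF m n nm j k] using se bt by simp
      also have "app ?d1 ?d2 (bnat m (j, k) \<bullet> one) ?s = comp_at ?T2 ?A2 (at_right (btgt m) k) j ?\<beta>2 t"
        by (rule phi_law[OF m A j k \<beta> t1, symmetric])
      also have "app ?d2 ?d3 (bnat n (j, k) \<bullet> one) \<dots> =
          comp_at ?T3 ?A3 (at_right (btgt n) k) j (comp_at ?U3 ?S3' ?L3 k ?pn ?\<beta>2) t"
        by (rule phi_law[OF n, unfolded nm, OF A2 j k \<beta>2 t2, symmetric])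
      also have "?\<beta>2 = comp_at ?U3 ?S3 ?S3' k ?rpm \<beta>"
        by (rule comp_at_restr_r[OF n, unfolded nm, OF S2 L(2) k pm, symmetric])
      also have "comp_at ?U3 ?S3' ?L3 k ?pn \<dots> = comp_at ?U3 ?S3 ?L3 k (cmp (Alg ?U3) ?S3 ?S3' ?L3 ?pn ?rpm) \<beta>"
        by (rule comp_at_cmp[OF t(6) S3 L(3) k pn rpm \<beta>', symmetric])
      finally show "comp_at ?T3 ?A3 (fob (curry_right (btgt n)) k) j (comp_at ?U3 ?S3 ?L3 k ?pnm \<beta>) t =
        comp_at ?T3 ?A3 (fob (curry_right (btgt n)) k) j
          (comp_at ?U3 ?S3 ?L3 k (cmp (Alg ?U3) ?S3 ?S3' ?L3 ?pn ?rpm) \<beta>) t"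
        unfolding c .
    qed
    moreover have "fob (Hom_left (bsrc m)) A = ?L1" "fob (restr_l m) A = ?A2" "fob (restr_r m) ?L1 = ?S2"
      "fob (Hom_left (btgt m)) ?A2 = ?L2" "fob (restr_l n) ?A2 = ?A3" "fob (Hom_left (btgt n)) ?A3 = ?L3"
      "fob (restr_r n) ?S2 = ?S3" "fob (restr_r n) ?L2 = ?S3'"
      using fob_Hom(1)[OF mor_src[OF m] A] fob_Hom(1)[OF mor_tgt[OF m] A2] fob_Hom(1)[OF mor_tgt[OF n] A3]
        restr_l_simps(1)[OF m A] restr_l_simps(2)[OF m L(1)] restr_l_simps(1)[OF n, unfolded nm, OF A2]
        restr_l_simps(2)[OF n, unfolded nm, OF S2] restr_l_simps(2)[OF n, unfolded nm, OF L(2)]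
      by (simp_all only:)
    ultimately show "cphi (Dualn_arr (bifold_comp n m)) A \<bullet> one = cphi (dual_comp (Dualn_arr n) (Dualn_arr m)) A \<bullet> one"
      unfolding cphi_dual_comp[OF cm cn s A'] by (simp only: Dualn_simps fst_conv)
  qed (simp_all add: Dualn_simps bifold_comp_simps dual_comp_simps[OF cm cn s])
qed

lemma cat_functor_Dualn: "cat_functor BAlg ADA Dualn_ob Dualn_arr"
proof -
  interpret source: category BAlg by (rule category_BAlg)
  \<comment> \<open>\<open>ADA\<close> is polymorphic in the types of objects of the two categories;
    here both are the type of algebras.\<close>
  interpret target: category "ADA :: ((('o, 'm) alg, ('o, 'm) alg, 'o, 'm) dual_adj, (('o, 'm) alg, ('o, 'm) alg, 'o, 'm) dual_cell) cat"
    by (rule category_ADA)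
  show ?thesis
    by unfold_locales
      (auto simp: BAlg_def ADA_def Homset_def is_dual_adj_Dualn is_dual_cell_Dualn Dualn_simps
        Dualn_id Dualn_comp)
qed

end

theorem proposition7p2:
  fixes V :: "('o, 'm) smc_data" and \<J> :: "'o set"
  assumes "symmetric_monoidal_closed V"
    and "has_finite_limits (underlying V)"
    and "arity_system V \<J>"
    and "arity_system.amenable V \<J>"
  shows "cat_functor (arity_system.BAlg V \<J>) (arity_system.ADA V \<J>)
           (arity_system.Dualn_ob V \<J>) (arity_system.Dualn_arr V \<J>)"
proof -
  interpret amenable_arity_system V \<J>
    by (rule amenable_arity_system.intro[OF assms(3) amenable_arity_system_axioms.intro[OF assms(4)]])
  show ?thesis by (rule cat_functor_Dualn)
qed

end
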